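(* Let $\eta$ be a standard axiomatization of $\mathrm{HA}$. For all propositional strictly positive formulas $\varphi,\psi$: $\varphi\vdash_{\mathrm{RC}_1}\psi$ if and only if for every infinitary realization $\cdot^\circ$ we have $\mathrm{HA}\vdash \forall\theta\,(\Box_{\psi^{\circ\eta}}\theta \rightarrow \Box_{\varphi^{\circ\eta}}\theta)$. That is, $\mathrm{RL}(\mathrm{HA}) = \mathrm{RC}_1$.
   Context: Propositional strictly positive formulas: $\varphi ::= \top \mid p \mid (\varphi\wedge\varphi) \mid \Diamond\varphi$. $\mathrm{RC}_1$ derives sequents $\varphi\vdash\psi$ by: $\varphi\vdash\varphi$, $\varphi\vdash\top$; $\varphi\wedge\psi\vdash\varphi$, $\varphi\wedge\psi\vdash\psi$; from $\varphi\vdash\psi$ and $\varphi\vdash\chi$ infer $\varphi\vdash\psi\wedge\chi$; from $\varphi\vdash\psi$ and $\psi\vdash\chi$ infer $\varphi\vdash\chi$; from $\varphi\vdash\psi$ infer $\Diamond\varphi\vdash\Diamond\psi$; $\Diamond\Diamond\varphi\vdash\Diamond\varphi$. An infinitary realization $\cdot^\circ$ maps each propositional variable $p$ to an arithmetical formula $p^\circ(u)$ with free variable $u$, read as an axiomatization of a theory (the set of sentences whose Gödel numbers satisfy it). For such a formula $\alpha(u)$, $\Box_\alpha$ is the formalized provability predicate of the theory it axiomatizes and $\Diamond_\alpha\chi:=\neg\Box_\alpha\neg\chi$. Given a base axiomatization $\tau(u)$, define $\top^{\circ\tau} := \tau(u)$; $p^{\circ\tau} := p^\circ \vee \tau(u)$;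 $(\varphi\wedge\psi)^{\circ\tau} := \varphi^{\circ\tau}\vee\psi^{\circ\tau}$; $(\Diamond\varphi)^{\circ\tau} := \tau(u)\vee (u = \ulcorner \Diamond_{\varphi^{\circ\tau}}\top\urcorner)$. $\mathrm{RL}(\mathrm{HA})$ is the set of pairs $\langle\varphi,\psi\rangle$ satisfying the right-hand condition of the claim; $\theta$ ranges over Gödel numbers of sentences.
   Formalization: Infinitary realizations are restricted to Σ₁ formulas p°(u); for arbitrary arithmetical formulas ◇◇p ⊢ ◇p is not sound, e.g. for p° := (u = ⌜⊥⌝) ∧ Con(HA + Con HA). *)

theory Defs
  imports Main "HOL-Library.Nat_Bijection"
begin

section \<open>Strictly positive formulas and the calculus RC1\<close>

datatype spf =
    STop
  | SVar nat
  | SAnd spf spf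
  | SDia spf

inductive rc1 :: "spf \<Rightarrow> spf \<Rightarrow> bool"  (infix "\<turnstile>\<^sub>R\<^sub>C\<^sub>1" 50) where
  refl: "\<phi> \<turnstile>\<^sub>R\<^sub>C\<^sub>1 \<phi>"
| top: "\<phi> \<turnstile>\<^sub>R\<^sub>C\<^sub>1 STop"
| andE1: "SAnd \<phi> \<psi> \<turnstile>\<^sub>R\<^sub>C\<^sub>1 \<phi>"
| andE2: "SAnd \<phi> \<psi> \<turnstile>\<^sub>R\<^sub>C\<^sub>1 \<psi>"
| andI: "\<lbrakk>\<phi> \<turnstile>\<^sub>R\<^sub>C\<^sub>1 \<psi>; \<phi> \<turnstile>\<^sub>R\<^sub>C\<^sub>1 \<chi>\<rbrakk> \<Longrightarrow> \<phi> \<turnstile>\<^sub>R\<^sub>C\<^sub>1 SAnd \<psi> \<chi>"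
| trans: "\<lbrakk>\<phi> \<turnstile>\<^sub>R\<^sub>C\<^sub>1 \<psi>; \<psi> \<turnstile>\<^sub>R\<^sub>C\<^sub>1 \<chi>\<rbrakk> \<Longrightarrow> \<phi> \<turnstile>\<^sub>R\<^sub>C\<^sub>1 \<chi>"
| nec: "\<phi> \<turnstile>\<^sub>R\<^sub>C\<^sub>1 \<psi> \<Longrightarrow> SDia \<phi> \<turnstile>\<^sub>R\<^sub>C\<^sub>1 SDia \<psi>"
| four: "SDia (SDia \<phi>) \<turnstile>\<^sub>R\<^sub>C\<^sub>1 SDia \<phi>"


section \<open>The language of arithmetic\<close>

text \<open>De Bruijn indices throughout: \<open>Var n\<close> refers to the \<open>n\<close>-th enclosing quantifier, and indices
  beyond the enclosing quantifiers are the free variables.  A formula with one free variable \<open>u\<close>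
  is thus a formula whose only free index is \<open>0\<close>.\<close>

datatype tm = Var nat | Zero | Scc tm | Add tm tm | Mul tm tm

datatype fm =
    Eql tm tm  (infix "\<^bold>=" 60)
  | Fls
  | Conj fm fm  (infixr "\<^bold>\<and>" 55)
  | Disj fm fm  (infixr "\<^bold>\<or>" 50)
  | Impl fm fm  (infixr "\<^bold>\<longrightarrow>" 45)
  | Uni fm
  | Exi fm

abbreviation Neg :: "fm \<Rightarrow> fm" where "Neg A \<equiv> A \<^bold>\<longrightarrow> Fls"
abbreviation Tru :: fm where "Tru \<equiv> Fls \<^bold>\<longrightarrow> Fls"
abbreviation Iff :: "fm \<Rightarrow> fm \<Rightarrow> fm" where "Iff A B \<equiv> (A \<^bold>\<longrightarrow> B) \<^bold>\<and> (B \<^bold>\<longrightarrow> A)"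
abbreviation ExN :: "nat \<Rightarrow> fm \<Rightarrow> fm" where "ExN n A \<equiv> (Exi ^^ n) A"

definition disjs :: "fm list \<Rightarrow> fm" where
  "disjs As = foldr Disj As Fls"

primrec num :: "nat \<Rightarrow> tm" where
  "num 0 = Zero"
| "num (Suc n) = Scc (num n)"

primrec lift_tm :: "nat \<Rightarrow> tm \<Rightarrow> tm" where
  "lift_tm k (Var i) = Var (if i < k then i else Suc i)"
| "lift_tm k Zero = Zero"
| "lift_tm k (Scc s) = Scc (lift_tm k s)"
| "lift_tm k (Add s t) = Add (lift_tm k s) (lift_tm k t)"
| "lift_tm k (Mul s t) = Mul (lift_tm k s) (lift_tm k t)"

primrec lift_fm :: "nat \<Rightarrow> fm \<Rightarrow> fm" where
  "lift_fm k (s \<^bold>= t) = (lift_tm k s \<^bold>= lift_tm k t)"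
| "lift_fm k Fls = Fls"
| "lift_fm k (A \<^bold>\<and> B) = (lift_fm k A \<^bold>\<and> lift_fm k B)"
| "lift_fm k (A \<^bold>\<or> B) = (lift_fm k A \<^bold>\<or> lift_fm k B)"
| "lift_fm k (A \<^bold>\<longrightarrow> B) = (lift_fm k A \<^bold>\<longrightarrow> lift_fm k B)"
| "lift_fm k (Uni A) = Uni (lift_fm (Suc k) A)"
| "lift_fm k (Exi A) = Exi (lift_fm (Suc k) A)"

abbreviation shift :: "nat \<Rightarrow> tm \<Rightarrow> tm" where "shift n \<equiv> lift_tm 0 ^^ n"

text \<open>\<open>sub_fm k t A\<close> replaces the index \<open>k\<close> by \<open>t\<close> and removes it from the context.\<close>

primrec sub_tm :: "nat \<Rightarrow> tm \<Rightarrow> tm \<Rightarrow> tm" where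
  "sub_tm k t (Var i) = (if i < k then Var i else if i = k then t else Var (i - 1))"
| "sub_tm k t Zero = Zero"
| "sub_tm k t (Scc r) = Scc (sub_tm k t r)"
| "sub_tm k t (Add r s) = Add (sub_tm k t r) (sub_tm k t s)"
| "sub_tm k t (Mul r s) = Mul (sub_tm k t r) (sub_tm k t s)"

primrec sub_fm :: "nat \<Rightarrow> tm \<Rightarrow> fm \<Rightarrow> fm" where
  "sub_fm k t (r \<^bold>= s) = (sub_tm k t r \<^bold>= sub_tm k t s)"
| "sub_fm k t Fls = Fls"
| "sub_fm k t (A \<^bold>\<and> B) = (sub_fm k t A \<^bold>\<and> sub_fm k t B)"
| "sub_fm k t (A \<^bold>\<or> B) = (sub_fm k t A \<^bold>\<or> sub_fm k t B)"
| "sub_fm k t (A \<^bold>\<longrightarrow> B) = (sub_fm k t A \<^bold>\<longrightarrow> sub_fm k t B)"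
| "sub_fm k t (Uni A) = Uni (sub_fm (Suc k) (lift_tm 0 t) A)"
| "sub_fm k t (Exi A) = Exi (sub_fm (Suc k) (lift_tm 0 t) A)"

text \<open>\<open>closed_fm k A\<close>: all free indices of \<open>A\<close> are below \<open>k\<close>; sentences are the case \<open>k = 0\<close>.\<close>

primrec closed_tm :: "nat \<Rightarrow> tm \<Rightarrow> bool" where
  "closed_tm k (Var i) \<longleftrightarrow> i < k"
| "closed_tm k Zero \<longleftrightarrow> True"
| "closed_tm k (Scc s) \<longleftrightarrow> closed_tm k s"
| "closed_tm k (Add s t) \<longleftrightarrow> closed_tm k s \<and> closed_tm k t"
| "closed_tm k (Mul s t) \<longleftrightarrow> closed_tm k s \<and> closed_tm k t"

primrec closed_fm :: "nat \<Rightarrow> fm \<Rightarrow> bool" where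
  "closed_fm k (s \<^bold>= t) \<longleftrightarrow> closed_tm k s \<and> closed_tm k t"
| "closed_fm k Fls \<longleftrightarrow> True"
| "closed_fm k (A \<^bold>\<and> B) \<longleftrightarrow> closed_fm k A \<and> closed_fm k B"
| "closed_fm k (A \<^bold>\<or> B) \<longleftrightarrow> closed_fm k A \<and> closed_fm k B"
| "closed_fm k (A \<^bold>\<longrightarrow> B) \<longleftrightarrow> closed_fm k A \<and> closed_fm k B"
| "closed_fm k (Uni A) \<longleftrightarrow> closed_fm (Suc k) A"
| "closed_fm k (Exi A) \<longleftrightarrow> closed_fm (Suc k) A"

definition lt :: "tm \<Rightarrow> tm \<Rightarrow> fm"  (infix "\<^bold><" 60) where
  "s \<^bold>< t = Exi (Scc (Add (Var 0) (shift 1 s)) \<^bold>= shift 1 t)"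

definition le :: "tm \<Rightarrow> tm \<Rightarrow> fm"  (infix "\<^bold>\<le>" 60) where
  "s \<^bold>\<le> t = Exi (Add (Var 0) (shift 1 s) \<^bold>= shift 1 t)"

text \<open>The order is not a primitive symbol, so \<open>\<^bold><\<close> is admitted among the atoms of bounded formulas.\<close>

inductive delta0 :: "fm \<Rightarrow> bool" where
  "delta0 (s \<^bold>= t)"
| "delta0 (s \<^bold>< t)"
| "delta0 Fls"
| "\<lbrakk>delta0 A; delta0 B\<rbrakk> \<Longrightarrow> delta0 (A \<^bold>\<and> B)"
| "\<lbrakk>delta0 A; delta0 B\<rbrakk> \<Longrightarrow> delta0 (A \<^bold>\<or> B)"
| "\<lbrakk>delta0 A; delta0 B\<rbrakk> \<Longrightarrow> delta0 (A \<^bold>\<longrightarrow> B)"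
| "delta0 A \<Longrightarrow> delta0 (Uni (Var 0 \<^bold>< shift 1 t \<^bold>\<longrightarrow> A))"
| "delta0 A \<Longrightarrow> delta0 (Exi (Var 0 \<^bold>< shift 1 t \<^bold>\<and> A))"

inductive sigma1 :: "fm \<Rightarrow> bool" where
  "delta0 A \<Longrightarrow> sigma1 A"
| "sigma1 A \<Longrightarrow> sigma1 (Exi A)"


section \<open>Intuitionistic predicate logic with equality, and HA\<close>

inductive log_ax :: "fm \<Rightarrow> bool" where
  "log_ax (A \<^bold>\<longrightarrow> B \<^bold>\<longrightarrow> A)"
| "log_ax ((A \<^bold>\<longrightarrow> B \<^bold>\<longrightarrow> C) \<^bold>\<longrightarrow> (A \<^bold>\<longrightarrow> B) \<^bold>\<longrightarrow> A \<^bold>\<longrightarrow> C)"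
| "log_ax (A \<^bold>\<longrightarrow> B \<^bold>\<longrightarrow> A \<^bold>\<and> B)"
| "log_ax (A \<^bold>\<and> B \<^bold>\<longrightarrow> A)"
| "log_ax (A \<^bold>\<and> B \<^bold>\<longrightarrow> B)"
| "log_ax (A \<^bold>\<longrightarrow> A \<^bold>\<or> B)"
| "log_ax (B \<^bold>\<longrightarrow> A \<^bold>\<or> B)"
| "log_ax ((A \<^bold>\<longrightarrow> C) \<^bold>\<longrightarrow> (B \<^bold>\<longrightarrow> C) \<^bold>\<longrightarrow> A \<^bold>\<or> B \<^bold>\<longrightarrow> C)"
| "log_ax (Fls \<^bold>\<longrightarrow> A)"
| "log_ax (Uni A \<^bold>\<longrightarrow> sub_fm 0 t A)"
| "log_ax (sub_fm 0 t A \<^bold>\<longrightarrow> Exi A)"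
| "log_ax (Uni (lift_fm 0 A \<^bold>\<longrightarrow> B) \<^bold>\<longrightarrow> A \<^bold>\<longrightarrow> Uni B)"
| "log_ax (Uni (B \<^bold>\<longrightarrow> lift_fm 0 A) \<^bold>\<longrightarrow> Exi B \<^bold>\<longrightarrow> A)"
| "log_ax (t \<^bold>= t)"
| "log_ax (s \<^bold>= t \<^bold>\<longrightarrow> sub_fm 0 s A \<^bold>\<longrightarrow> sub_fm 0 t A)"

inductive prv :: "fm set \<Rightarrow> fm \<Rightarrow> bool"  (infix "\<^bold>\<turnstile>" 40) for T :: "fm set" where
  logic: "log_ax A \<Longrightarrow> T \<^bold>\<turnstile> A"
| axiom: "A \<in> T \<Longrightarrow> T \<^bold>\<turnstile> A"
| mp: "\<lbrakk>T \<^bold>\<turnstile> A; T \<^bold>\<turnstile> A \<^bold>\<longrightarrow> B\<rbrakk> \<Longrightarrow> T \<^bold>\<turnstile> B"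
| gen: "T \<^bold>\<turnstile> A \<Longrightarrow> T \<^bold>\<turnstile> Uni A"

definition basic_axioms :: "fm list" where
  "basic_axioms =
    [Uni (Neg (Scc (Var 0) \<^bold>= Zero)),
     Uni (Uni (Scc (Var 1) \<^bold>= Scc (Var 0) \<^bold>\<longrightarrow> Var 1 \<^bold>= Var 0)),
     Uni (Add (Var 0) Zero \<^bold>= Var 0),
     Uni (Uni (Add (Var 1) (Scc (Var 0)) \<^bold>= Scc (Add (Var 1) (Var 0)))),
     Uni (Mul (Var 0) Zero \<^bold>= Zero),
     Uni (Uni (Mul (Var 1) (Scc (Var 0)) \<^bold>= Add (Mul (Var 1) (Var 0)) (Var 1)))]"

text \<open>In the induction step \<open>A\<close> stays under the quantifier: lifting at \<open>1\<close> makes room for the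
  new index, and substituting \<open>Scc (Var 0)\<close> for \<open>0\<close> leaves the parameters of \<open>A\<close> unchanged.\<close>

definition ind_ax :: "fm \<Rightarrow> fm" where
  "ind_ax A =
    (sub_fm 0 Zero A \<^bold>\<and> Uni (A \<^bold>\<longrightarrow> sub_fm 0 (Scc (Var 0)) (lift_fm 1 A)) \<^bold>\<longrightarrow> Uni A)"

definition HA :: "fm set" where
  "HA = set basic_axioms \<union> {B. closed_fm 0 B \<and> (\<exists>n A. B = (Uni ^^ n) (ind_ax A))}"


section \<open>Goedel numbering\<close>

primrec code_tm :: "tm \<Rightarrow> nat" where
  "code_tm (Var i) = prod_encode (0, i)"
| "code_tm Zero = prod_encode (1, 0)"
| "code_tm (Scc s) = prod_encode (2, code_tm s)"
| "code_tm (Add s t) = prod_encode (3, prod_encode (code_tm s, code_tm t))"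
| "code_tm (Mul s t) = prod_encode (4, prod_encode (code_tm s, code_tm t))"

primrec code :: "fm \<Rightarrow> nat"  ("\<ulcorner>_\<urcorner>") where
  "\<ulcorner>s \<^bold>= t\<urcorner> = prod_encode (5, prod_encode (code_tm s, code_tm t))"
| "\<ulcorner>Fls\<urcorner> = prod_encode (6, 0)"
| "\<ulcorner>A \<^bold>\<and> B\<urcorner> = prod_encode (7, prod_encode (\<ulcorner>A\<urcorner>, \<ulcorner>B\<urcorner>))"
| "\<ulcorner>A \<^bold>\<or> B\<urcorner> = prod_encode (8, prod_encode (\<ulcorner>A\<urcorner>, \<ulcorner>B\<urcorner>))"
| "\<ulcorner>A \<^bold>\<longrightarrow> B\<urcorner> = prod_encode (9, prod_encode (\<ulcorner>A\<urcorner>, \<ulcorner>B\<urcorner>))"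
| "\<ulcorner>Uni A\<urcorner> = prod_encode (10, \<ulcorner>A\<urcorner>)"
| "\<ulcorner>Exi A\<urcorner> = prod_encode (11, \<ulcorner>A\<urcorner>)"


section \<open>Arithmetization of syntax\<close>

text \<open>\<open>z\<close> is the pair of \<open>x\<close> and \<open>y\<close>: \<open>2 * prod_encode (x, y) = (x + y) * (x + y + 1) + 2 * x\<close>.\<close>

definition pairing :: "tm \<Rightarrow> tm \<Rightarrow> tm \<Rightarrow> fm" where
  "pairing x y z = (Add z z \<^bold>= Add (Mul (Add x y) (Scc (Add x y))) (Add x x))"

text \<open>Patterns denote numbers built by pairing from the values of object terms; \<open>matches n p y\<close>
  says that \<open>y\<close> is the value of \<open>p\<close>, where the terms in \<open>p\<close> live \<open>n\<close> quantifiers further out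
  than \<open>y\<close>.\<close>

datatype pat = At tm | Pr pat pat  (infixr "\<triangleright>" 65)

primrec matches :: "nat \<Rightarrow> pat \<Rightarrow> tm \<Rightarrow> fm" where
  "matches n (At s) y = (y \<^bold>= shift n s)"
| "matches n (p \<triangleright> q) y = ExN 2 (pairing (Var 1) (Var 0) (shift 2 y) \<^bold>\<and>
     matches (n + 2) p (Var 1) \<^bold>\<and> matches (n + 2) q (Var 0))"

abbreviation V :: "nat \<Rightarrow> pat" where "V i \<equiv> At (Var i)"
abbreviation tag1 :: "nat \<Rightarrow> pat \<Rightarrow> pat" where "tag1 g p \<equiv> At (num g) \<triangleright> p"
abbreviation tag2 :: "nat \<Rightarrow> pat \<Rightarrow> pat \<Rightarrow> pat" where "tag2 g p q \<equiv> At (num g) \<triangleright> p \<triangleright> q"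

abbreviation pVar :: "tm \<Rightarrow> pat" where "pVar i \<equiv> tag1 0 (At i)"
abbreviation pZero :: pat where "pZero \<equiv> tag1 1 (At Zero)"
abbreviation pScc :: "pat \<Rightarrow> pat" where "pScc \<equiv> tag1 2"
abbreviation pEql :: "pat \<Rightarrow> pat \<Rightarrow> pat" where "pEql \<equiv> tag2 5"
abbreviation pFls :: pat where "pFls \<equiv> tag1 6 (At Zero)"
abbreviation pConj :: "pat \<Rightarrow> pat \<Rightarrow> pat" where "pConj \<equiv> tag2 7"
abbreviation pDisj :: "pat \<Rightarrow> pat \<Rightarrow> pat" where "pDisj \<equiv> tag2 8"
abbreviation pImpl :: "pat \<Rightarrow> pat \<Rightarrow> pat" where "pImpl \<equiv> tag2 9"
abbreviation pUni :: "pat \<Rightarrow> pat" where "pUni \<equiv> tag1 10"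
abbreviation pExi :: "pat \<Rightarrow> pat" where "pExi \<equiv> tag1 11"

text \<open>Goedel's beta function: \<open>y\<close> is the remainder of \<open>c\<close> modulo \<open>1 + (i + 1) * d\<close>.\<close>

definition beta :: "tm \<Rightarrow> tm \<Rightarrow> tm \<Rightarrow> tm \<Rightarrow> fm" where
  "beta c d i y =
    (Exi (shift 1 c \<^bold>= Add (Mul (Var 0) (Scc (Mul (Scc (shift 1 i)) (shift 1 d)))) (shift 1 y)) \<^bold>\<and>
     y \<^bold>< Scc (Mul (Scc i) d))"

text \<open>\<open>Deriv S p\<close>: there is a sequence, coded by \<open>c\<close> and \<open>d\<close> via beta, with last index \<open>n\<close> and
  last entry \<open>p\<close>, all of whose entries \<open>y\<close>, at index \<open>i\<close>, satisfy \<open>S\<close>.  In \<open>S\<close> the free indices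
  \<open>0, 1, 2, 3, 4\<close> stand for \<open>y, i, n, d, c\<close>.  Inside \<open>S\<close>, below \<open>m\<close> further quantifiers,
  \<open>Cur m p\<close> says that \<open>y\<close> is \<open>p\<close>, and \<open>Prev m p\<close> that \<open>p\<close> is an entry at an index smaller than \<open>i\<close>.\<close>

definition Cur :: "nat \<Rightarrow> pat \<Rightarrow> fm" where
  "Cur m p = matches 0 p (Var m)"

definition Prev :: "nat \<Rightarrow> pat \<Rightarrow> fm" where
  "Prev m p = ExN 2 (Var 1 \<^bold>< Var (m + 3) \<^bold>\<and>
     beta (Var (m + 6)) (Var (m + 5)) (Var 1) (Var 0) \<^bold>\<and> matches 2 p (Var 0))"

definition Deriv :: "fm \<Rightarrow> pat \<Rightarrow> fm" where
  "Deriv S p = ExN 3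
    (Exi (beta (Var 3) (Var 2) (Var 1) (Var 0) \<^bold>\<and> matches 4 p (Var 0)) \<^bold>\<and>
     Uni (Var 0 \<^bold>\<le> Var 1 \<^bold>\<longrightarrow> Exi (beta (Var 4) (Var 3) (Var 1) (Var 0) \<^bold>\<and> S)))"

text \<open>\<open>TmF k x\<close> and \<open>FmF k x\<close>: \<open>x\<close> is the code of a term (formula) with free indices below \<open>k\<close>.\<close>

definition tm_step :: fm where
  "tm_step = disjs (
    [ExN 2 (Cur 2 (V 0 \<triangleright> pVar (Var 1)) \<^bold>\<and> Var 1 \<^bold>< Var 0),
     ExN 1 (Cur 1 (V 0 \<triangleright> pZero)),
     ExN 2 (Cur 2 (V 0 \<triangleright> pScc (V 1)) \<^bold>\<and> Prev 2 (V 0 \<triangleright> V 1))] @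
    map (\<lambda>g. ExN 3 (Cur 3 (V 0 \<triangleright> tag2 g (V 1) (V 2)) \<^bold>\<and>
               Prev 3 (V 0 \<triangleright> V 1) \<^bold>\<and> Prev 3 (V 0 \<triangleright> V 2))) [3, 4])"

definition TmF :: "tm \<Rightarrow> tm \<Rightarrow> fm" where
  "TmF k x = Deriv tm_step (At k \<triangleright> At x)"

definition fm_step :: fm where
  "fm_step = disjs (
    [ExN 3 (Cur 3 (V 0 \<triangleright> pEql (V 1) (V 2)) \<^bold>\<and> TmF (Var 0) (Var 1) \<^bold>\<and> TmF (Var 0) (Var 2)),
     ExN 1 (Cur 1 (V 0 \<triangleright> pFls))] @
    map (\<lambda>g. ExN 3 (Cur 3 (V 0 \<triangleright> tag2 g (V 1) (V 2)) \<^bold>\<and>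
               Prev 3 (V 0 \<triangleright> V 1) \<^bold>\<and> Prev 3 (V 0 \<triangleright> V 2))) [7, 8, 9] @
    map (\<lambda>g. ExN 2 (Cur 2 (V 0 \<triangleright> tag1 g (V 1)) \<^bold>\<and> Prev 2 (At (Scc (Var 0)) \<triangleright> V 1))) [10, 11])"

definition FmF :: "tm \<Rightarrow> tm \<Rightarrow> fm" where
  "FmF k x = Deriv fm_step (At k \<triangleright> At x)"

definition IsTm :: "tm \<Rightarrow> fm" where "IsTm x = Exi (TmF (Var 0) (shift 1 x))"
definition IsFm :: "tm \<Rightarrow> fm" where "IsFm x = Exi (FmF (Var 0) (shift 1 x))"
definition IsSent :: "tm \<Rightarrow> fm" where "IsSent x = FmF Zero x"

text \<open>\<open>LiftF k x y\<close> and \<open>SubF k t x y\<close> are the graphs of lifting and substitution, on codes of terms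
  and formulas alike.\<close>

definition lift_step :: fm where
  "lift_step = disjs (
    [ExN 2 (Cur 2 (V 0 \<triangleright> pVar (Var 1) \<triangleright> pVar (Var 1)) \<^bold>\<and> Var 1 \<^bold>< Var 0),
     ExN 2 (Cur 2 (V 0 \<triangleright> pVar (Var 1) \<triangleright> pVar (Scc (Var 1))) \<^bold>\<and> Var 0 \<^bold>\<le> Var 1),
     ExN 1 (Cur 1 (V 0 \<triangleright> pZero \<triangleright> pZero)),
     ExN 1 (Cur 1 (V 0 \<triangleright> pFls \<triangleright> pFls)),
     ExN 3 (Cur 3 (V 0 \<triangleright> pScc (V 1) \<triangleright> pScc (V 2)) \<^bold>\<and> Prev 3 (V 0 \<triangleright> V 1 \<triangleright> V 2))] @
    map (\<lambda>g. ExN 5 (Cur 5 (V 0 \<triangleright> tag2 g (V 1) (V 2) \<triangleright> tag2 g (V 3) (V 4)) \<^bold>\<and>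
               Prev 5 (V 0 \<triangleright> V 1 \<triangleright> V 3) \<^bold>\<and> Prev 5 (V 0 \<triangleright> V 2 \<triangleright> V 4))) [3, 4, 5, 7, 8, 9] @
    map (\<lambda>g. ExN 3 (Cur 3 (V 0 \<triangleright> tag1 g (V 1) \<triangleright> tag1 g (V 2)) \<^bold>\<and>
               Prev 3 (At (Scc (Var 0)) \<triangleright> V 1 \<triangleright> V 2))) [10, 11])"

definition LiftF :: "tm \<Rightarrow> tm \<Rightarrow> tm \<Rightarrow> fm" where
  "LiftF k x y = Deriv lift_step (At k \<triangleright> At x \<triangleright> At y)"

definition sub_step :: fm where
  "sub_step = disjs (
    [ExN 3 (Cur 3 (V 0 \<triangleright> V 1 \<triangleright> pVar (Var 2) \<triangleright> pVar (Var 2)) \<^bold>\<and> Var 2 \<^bold>< Var 0),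
     ExN 2 (Cur 2 (V 0 \<triangleright> V 1 \<triangleright> pVar (Var 0) \<triangleright> V 1)),
     ExN 3 (Cur 3 (V 0 \<triangleright> V 1 \<triangleright> pVar (Scc (Var 2)) \<triangleright> pVar (Var 2)) \<^bold>\<and> Var 0 \<^bold>\<le> Var 2),
     ExN 2 (Cur 2 (V 0 \<triangleright> V 1 \<triangleright> pZero \<triangleright> pZero)),
     ExN 2 (Cur 2 (V 0 \<triangleright> V 1 \<triangleright> pFls \<triangleright> pFls)),
     ExN 4 (Cur 4 (V 0 \<triangleright> V 1 \<triangleright> pScc (V 2) \<triangleright> pScc (V 3)) \<^bold>\<and> Prev 4 (V 0 \<triangleright> V 1 \<triangleright> V 2 \<triangleright> V 3))] @
    map (\<lambda>g. ExN 6 (Cur 6 (V 0 \<triangleright> V 1 \<triangleright> tag2 g (V 2) (V 3) \<triangleright> tag2 g (V 4) (V 5)) \<^bold>\<and>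
               Prev 6 (V 0 \<triangleright> V 1 \<triangleright> V 2 \<triangleright> V 4) \<^bold>\<and> Prev 6 (V 0 \<triangleright> V 1 \<triangleright> V 3 \<triangleright> V 5))) [3, 4, 5, 7, 8, 9] @
    map (\<lambda>g. ExN 5 (Cur 5 (V 0 \<triangleright> V 1 \<triangleright> tag1 g (V 2) \<triangleright> tag1 g (V 3)) \<^bold>\<and>
               LiftF Zero (Var 1) (Var 4) \<^bold>\<and>
               Prev 5 (At (Scc (Var 0)) \<triangleright> V 4 \<triangleright> V 2 \<triangleright> V 3))) [10, 11])"

definition SubF :: "tm \<Rightarrow> tm \<Rightarrow> tm \<Rightarrow> tm \<Rightarrow> fm" where
  "SubF k t x y = Deriv sub_step (At k \<triangleright> At t \<triangleright> At x \<triangleright> At y)"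

text \<open>\<open>ClosureF x y\<close>: \<open>y\<close> results from \<open>x\<close> by prefixing universal quantifiers.\<close>

definition closure_step :: fm where
  "closure_step = disjs
    [ExN 1 (Cur 1 (V 0 \<triangleright> V 0)),
     ExN 2 (Cur 2 (V 0 \<triangleright> pUni (V 1)) \<^bold>\<and> Prev 2 (V 0 \<triangleright> V 1))]"

definition ClosureF :: "tm \<Rightarrow> tm \<Rightarrow> fm" where
  "ClosureF x y = Deriv closure_step (At x \<triangleright> At y)"

text \<open>The free index \<open>0\<close> of \<open>LogAxF\<close> and \<open>HaAxF\<close> is the code of the axiom; \<open>LogAxF\<close> mirrors
  \<open>log_ax\<close> and \<open>HaAxF\<close> mirrors \<open>HA\<close>.\<close>

definition LogAxF :: fm where
  "LogAxF = disjs
    [ExN 3 (IsFm (Var 0) \<^bold>\<and> IsFm (Var 1) \<^bold>\<and> IsFm (Var 2) \<^bold>\<and> disjs (map (Cur 3)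
       [pImpl (V 0) (pImpl (V 1) (V 0)),
        pImpl (pImpl (V 0) (pImpl (V 1) (V 2))) (pImpl (pImpl (V 0) (V 1)) (pImpl (V 0) (V 2))),
        pImpl (V 0) (pImpl (V 1) (pConj (V 0) (V 1))),
        pImpl (pConj (V 0) (V 1)) (V 0),
        pImpl (pConj (V 0) (V 1)) (V 1),
        pImpl (V 0) (pDisj (V 0) (V 1)),
        pImpl (V 1) (pDisj (V 0) (V 1)),
        pImpl (pImpl (V 0) (V 2)) (pImpl (pImpl (V 1) (V 2)) (pImpl (pDisj (V 0) (V 1)) (V 2))),
        pImpl pFls (V 0)])),
     ExN 3 (IsFm (Var 0) \<^bold>\<and> IsTm (Var 1) \<^bold>\<and> SubF Zero (Var 1) (Var 0) (Var 2) \<^bold>\<and> disjs (map (Cur 3)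
       [pImpl (pUni (V 0)) (V 2),
        pImpl (V 2) (pExi (V 0))])),
     ExN 3 (IsFm (Var 0) \<^bold>\<and> IsFm (Var 1) \<^bold>\<and> LiftF Zero (Var 0) (Var 2) \<^bold>\<and> disjs (map (Cur 3)
       [pImpl (pUni (pImpl (V 2) (V 1))) (pImpl (V 0) (pUni (V 1))),
        pImpl (pUni (pImpl (V 1) (V 2))) (pImpl (pExi (V 1)) (V 0))])),
     ExN 1 (IsTm (Var 0) \<^bold>\<and> Cur 1 (pEql (V 0) (V 0))),
     ExN 5 (IsFm (Var 0) \<^bold>\<and> IsTm (Var 1) \<^bold>\<and> IsTm (Var 2) \<^bold>\<and>
       SubF Zero (Var 1) (Var 0) (Var 3) \<^bold>\<and> SubF Zero (Var 2) (Var 0) (Var 4) \<^bold>\<and>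
       Cur 5 (pImpl (pEql (V 1) (V 2)) (pImpl (V 3) (V 4))))]"

definition HaAxF :: fm where
  "HaAxF = (disjs (map (\<lambda>A. Var 0 \<^bold>= num \<ulcorner>A\<urcorner>) basic_axioms) \<^bold>\<or>
    IsSent (Var 0) \<^bold>\<and>
    ExN 5 (IsFm (Var 0) \<^bold>\<and>
      SubF Zero (num (code_tm Zero)) (Var 0) (Var 1) \<^bold>\<and>
      LiftF (num 1) (Var 0) (Var 2) \<^bold>\<and>
      SubF Zero (num (code_tm (Scc (Var 0)))) (Var 2) (Var 3) \<^bold>\<and>
      matches 0 (pImpl (pConj (V 1) (pUni (pImpl (V 0) (V 3)))) (pUni (V 0))) (Var 4) \<^bold>\<and>
      ClosureF (Var 4) (Var 5)))"


section \<open>Formalized provability and infinitary realizations\<close>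

text \<open>\<open>\<alpha>\<close> has at most the free index \<open>0\<close>, which in a step formula is the current entry; hence \<open>\<alpha>\<close>
  itself expresses that the current entry satisfies \<open>\<alpha>\<close>.\<close>

definition prov_step :: "fm \<Rightarrow> fm" where
  "prov_step \<alpha> = disjs
    [LogAxF,
     IsSent (Var 0) \<^bold>\<and> \<alpha>,
     ExN 2 (Cur 2 (V 0) \<^bold>\<and> Prev 2 (V 1) \<^bold>\<and> Prev 2 (pImpl (V 1) (V 0))),
     ExN 1 (Cur 1 (pUni (V 0)) \<^bold>\<and> Prev 1 (V 0))]"

definition Box :: "fm \<Rightarrow> tm \<Rightarrow> fm" where
  "Box \<alpha> x = Deriv (prov_step \<alpha>) (At x)"

definition Dia :: "fm \<Rightarrow> fm \<Rightarrow> fm" where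
  "Dia \<alpha> \<chi> = Neg (Box \<alpha> (num \<ulcorner>Neg \<chi>\<urcorner>))"

definition standard_axiomatization_HA :: "fm \<Rightarrow> bool" where
  "standard_axiomatization_HA \<eta> \<longleftrightarrow> closed_fm 1 \<eta> \<and> HA \<^bold>\<turnstile> Uni (Iff \<eta> HaAxF)"

text \<open>Realizations are c.e. axiomatizations, that is, they take values in \<open>\<Sigma>\<^sub>1\<close> formulas.  Without
  this, the axiom \<open>four\<close> of \<open>rc1\<close> is not sound: let \<open>\<pi>\<close> be the \<open>\<Pi>\<^sub>1\<close> sentence
  \<open>Con (HA + Con HA)\<close> and realize \<open>p\<close> by \<open>u = \<ulcorner>Fls\<urcorner> \<^bold>\<and> \<pi>\<close>.\<close>

definition infinitary_realization :: "(nat \<Rightarrow> fm) \<Rightarrow> bool" where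
  "infinitary_realization r \<longleftrightarrow> (\<forall>p. sigma1 (r p) \<and> closed_fm 1 (r p))"

primrec realize :: "(nat \<Rightarrow> fm) \<Rightarrow> fm \<Rightarrow> spf \<Rightarrow> fm" where
  "realize r \<tau> STop = \<tau>"
| "realize r \<tau> (SVar p) = (r p \<^bold>\<or> \<tau>)"
| "realize r \<tau> (SAnd \<phi> \<psi>) = (realize r \<tau> \<phi> \<^bold>\<or> realize r \<tau> \<psi>)"
| "realize r \<tau> (SDia \<phi>) = (\<tau> \<^bold>\<or> (Var 0 \<^bold>= num \<ulcorner>Dia (realize r \<tau> \<phi>) Tru\<urcorner>))"

definition RL_HA :: "fm \<Rightarrow> (spf \<times> spf) set" where
  "RL_HA \<eta> = {(\<phi>, \<psi>). \<forall>r. infinitary_realization r \<longrightarrow>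
     HA \<^bold>\<turnstile> Uni (IsSent (Var 0) \<^bold>\<longrightarrow> Box (realize r \<eta> \<psi>) (Var 0) \<^bold>\<longrightarrow> Box (realize r \<eta> \<phi>) (Var 0))}"

end

theory Submission
  imports Defs "HOL-Library.Countable"
begin

text \<open>An implication between \<open>\<Sigma>\<close>-formulas is provable in HA as soon as it holds in all models of Peano
  arithmetic: if HA does not prove \<open>A \<^bold>\<longrightarrow> B\<close>, then, by Friedman's translation with respect to \<open>B\<close>, the
  classical theory with the axioms of HA and \<open>A\<close> does not prove \<open>B\<close>, and a Henkin construction
  yields a model.  So the realization of a sequent, and the instances of \<open>\<Sigma>\<^sub>1\<close>-completeness behind the
  axiom \<open>four\<close>, may be verified in models, where proofs are nonstandard finite sequences given by
  the beta function.

  For completeness, unravel \<open>\<phi>\<close> to the finite tree of paths in its canonical Kripke model, and let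
  a process enter the root and then climb the tree, moving to a child \<open>x\<close> (first to the root) when a
  proof turns up that it does not stop at \<open>x\<close>; a Rosser comparison of proofs decides between
  siblings.  Its self-reference is obtained by diagonalization.  Let \<open>p\<close> be realized by the sentence
  that the process stops at a node whose world satisfies \<open>p\<close>.  By induction on \<open>\<chi>\<close>, the sentence
  that the process stops at \<open>x\<close> decides in HA the realization of \<open>\<chi>\<close>, and does so in accordance
  with the truth of \<open>\<chi>\<close> at \<open>x\<close>.  If the realization of \<open>\<phi> \<turnstile>\<^sub>R\<^sub>C\<^sub>1 \<psi>\<close> is provable but \<open>\<psi>\<close> fails at the
  root, then HA proves that the process does not stop there.  So the process really enters the
  root, and as entering a node requires a proof that it does not stop at it, it climbs forever.\<close>

section \<open>Simultaneous substitution\<close>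

text \<open>The construction is Solovay's, and two obstacles give it this shape. Solovay's argument
  distinguishes cases by where the process stops, which HA cannot do. So only two kinds of facts are
  used: implications between \<Sigma>-formulas, for which models may be consulted although these are
  classical, and negative or conditional statements derived from them in HA itself. That the process
  enters a node is a \<Sigma>-sentence, that it stops there is not; hence what is transferred speaks
  of entering. The second obstacle is that transfer yields single implications. A rule such as
  necessitation needs its premise proved in HA, not merely true in a model, so soundness transfers
  the conclusion of each rule before the next rule is applied. Nodes are paths because a path
  carries its history: entering it means winning at every node on the way, with no coded run of the
  process. The comparison among siblings is stated with a bounded version of provability, so that
  both having and lacking a proof up to a bound are bounded formulas and entering stays
  \<Sigma>.\<close>

primrec tsubst :: "(nat \<Rightarrow> tm) \<Rightarrow> tm \<Rightarrow> tm" where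
  "tsubst \<sigma> (Var i) = \<sigma> i"
| "tsubst \<sigma> Zero = Zero"
| "tsubst \<sigma> (Scc s) = Scc (tsubst \<sigma> s)"
| "tsubst \<sigma> (Add s t) = Add (tsubst \<sigma> s) (tsubst \<sigma> t)"
| "tsubst \<sigma> (Mul s t) = Mul (tsubst \<sigma> s) (tsubst \<sigma> t)"

definition up :: "(nat \<Rightarrow> tm) \<Rightarrow> nat \<Rightarrow> tm" where
  "up \<sigma> = case_nat (Var 0) (\<lambda>i. lift_tm 0 (\<sigma> i))"

primrec fsubst :: "(nat \<Rightarrow> tm) \<Rightarrow> fm \<Rightarrow> fm" where
  "fsubst \<sigma> (s \<^bold>= t) = (tsubst \<sigma> s \<^bold>= tsubst \<sigma> t)"
| "fsubst \<sigma> Fls = Fls"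
| "fsubst \<sigma> (A \<^bold>\<and> B) = (fsubst \<sigma> A \<^bold>\<and> fsubst \<sigma> B)"
| "fsubst \<sigma> (A \<^bold>\<or> B) = (fsubst \<sigma> A \<^bold>\<or> fsubst \<sigma> B)"
| "fsubst \<sigma> (A \<^bold>\<longrightarrow> B) = (fsubst \<sigma> A \<^bold>\<longrightarrow> fsubst \<sigma> B)"
| "fsubst \<sigma> (Uni A) = Uni (fsubst (up \<sigma>) A)"
| "fsubst \<sigma> (Exi A) = Exi (fsubst (up \<sigma>) A)"

lemma up_simps [simp]: "up \<sigma> 0 = Var 0" "up \<sigma> (Suc i) = lift_tm 0 (\<sigma> i)"
  by (simp_all add: up_def)

lemma tsubst_Var [simp]: "tsubst Var t = t"
  by (induction t) auto

lemma up_Var [simp]: "up Var = Var"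
  by (rule ext) (simp add: up_def split: nat.split)

lemma fsubst_Var [simp]: "fsubst Var A = A"
  by (induction A) auto

lemma lift_tm_tsubst: "lift_tm k t = tsubst (\<lambda>i. Var (if i < k then i else Suc i)) t"
  by (induction t) auto

text \<open>Lifting and substitution at an index are both instances of parallel substitution. Their
  commutation laws thereby reduce to equations between functions on indices, without a separate
  induction on formulas for each law.\<close>

lemma lift_fm_fsubst: "lift_fm k A = fsubst (\<lambda>i. Var (if i < k then i else Suc i)) A"
proof (induction A arbitrary: k)
  have *: "up (\<lambda>i. Var (if i < k then i else Suc i)) = (\<lambda>i. Var (if i < Suc k then i else Suc i))" for k
    by (rule ext) (auto simp: up_def split: nat.split)
  { case (Uni A) then show ?case unfolding fsubst.simps * by simp }
  { case (Exi A) then show ?case unfolding fsubst.simps * by simp }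
qed (auto simp: lift_tm_tsubst)

lemma sub_tm_tsubst:
  "sub_tm k u t = tsubst (\<lambda>i. if i < k then Var i else if i = k then u else Var (i - 1)) t"
  by (induction t) auto

lemma sub_fm_fsubst:
  "sub_fm k u A = fsubst (\<lambda>i. if i < k then Var i else if i = k then u else Var (i - 1)) A"
proof (induction A arbitrary: k u)
  have *: "up (\<lambda>i. if i < k then Var i else if i = k then u else Var (i - 1)) =
     (\<lambda>i. if i < Suc k then Var i else if i = Suc k then lift_tm 0 u else Var (i - 1))" for k u
    by (rule ext) (auto simp: up_def split: nat.split)
  { case (Uni A) then show ?case unfolding fsubst.simps * by simp }
  { case (Exi A) then show ?case unfolding fsubst.simps * by simp }
qed (auto simp: sub_tm_tsubst)

lemma tsubst_tsubst: "tsubst \<sigma> (tsubst \<tau> t) = tsubst (\<lambda>i. tsubst \<sigma> (\<tau> i)) t"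
  by (induction t) auto

lemma tsubst_lift0: "tsubst \<sigma> (lift_tm 0 t) = tsubst (\<lambda>i. \<sigma> (Suc i)) t"
  by (simp add: lift_tm_tsubst tsubst_tsubst)

lemma lift0_tsubst: "lift_tm 0 (tsubst \<sigma> t) = tsubst (\<lambda>i. lift_tm 0 (\<sigma> i)) t"
  by (induction t) auto

lemma fsubst_fsubst: "fsubst \<sigma> (fsubst \<tau> A) = fsubst (\<lambda>i. tsubst \<sigma> (\<tau> i)) A"
proof (induction A arbitrary: \<sigma> \<tau>)
  have *: "(\<lambda>i. tsubst (up \<sigma>) (up \<tau> i)) = up (\<lambda>i. tsubst \<sigma> (\<tau> i))" for \<sigma> \<tau>
    by (rule ext) (auto simp: up_def tsubst_lift0 lift0_tsubst split: nat.split)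
  { case (Uni A) then show ?case by (simp add: *) }
  { case (Exi A) then show ?case by (simp add: *) }
qed (auto simp: tsubst_tsubst)

lemma lift_fm_0: "lift_fm 0 A = fsubst (\<lambda>i. Var (Suc i)) A"
  by (simp add: lift_fm_fsubst)

lemma lift_tm_0: "lift_tm 0 t = tsubst (\<lambda>i. Var (Suc i)) t"
  by (simp add: lift_tm_tsubst)

lemma sub_fm_0: "sub_fm 0 u A = fsubst (case_nat u Var) A"
proof -
  have "(\<lambda>i. if i < 0 then Var i else if i = 0 then u else Var (i - 1)) = case_nat u Var"
    by (rule ext) (auto split: nat.split)
  then show ?thesis by (simp add: sub_fm_fsubst)
qed

lemma sub_tm_0: "sub_tm 0 u t = tsubst (case_nat u Var) t"
proof -
  have "(\<lambda>i. if i < 0 then Var i else if i = 0 then u else Var (i - 1)) = case_nat u Var"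
    by (rule ext) (auto split: nat.split)
  then show ?thesis by (simp add: sub_tm_tsubst)
qed

lemma sub_tm_lift_tm [simp]: "sub_tm 0 u (lift_tm 0 t) = t"
  by (simp add: sub_tm_0 tsubst_lift0)

lemma fsubst_up_lift_fm [simp]: "fsubst (up \<sigma>) (lift_fm 0 A) = lift_fm 0 (fsubst \<sigma> A)"
  by (simp add: lift_fm_0 fsubst_fsubst lift_tm_0)

lemma fsubst_sub_fm: "fsubst \<sigma> (sub_fm 0 u A) = sub_fm 0 (tsubst \<sigma> u) (fsubst (up \<sigma>) A)"
proof -
  have "(\<lambda>i. tsubst \<sigma> (case i of 0 \<Rightarrow> u | Suc i \<Rightarrow> Var i)) =
    (\<lambda>i. tsubst (case_nat (tsubst \<sigma> u) Var) (up \<sigma> i))"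
    by (rule ext) (auto simp: tsubst_lift0 split: nat.split)
  then show ?thesis by (simp add: sub_fm_0 fsubst_fsubst)
qed

text \<open>Instantiating the bound index after substituting under the binder is again one parallel
  substitution. The term model reads its quantifiers in this form.\<close>

lemma sub_fm_fsubst_up: "sub_fm 0 u (fsubst (up \<sigma>) A) = fsubst (case_nat u \<sigma>) A"
proof -
  have "(\<lambda>i. tsubst (case_nat u Var) (up \<sigma> i)) = case_nat u \<sigma>"
    by (rule ext) (auto simp: tsubst_lift0 split: nat.split)
  then show ?thesis by (simp add: sub_fm_0 fsubst_fsubst)
qed

lemma tsubst_closed: "closed_tm k t \<Longrightarrow> (\<And>i. i < k \<Longrightarrow> \<sigma> i = \<tau> i) \<Longrightarrow> tsubst \<sigma> t = tsubst \<tau> t"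
  by (induction t) auto

lemma fsubst_closed: "closed_fm k A \<Longrightarrow> (\<And>i. i < k \<Longrightarrow> \<sigma> i = \<tau> i) \<Longrightarrow> fsubst \<sigma> A = fsubst \<tau> A"
proof (induction A arbitrary: k \<sigma> \<tau>)
  case (Eql s t) then show ?case using tsubst_closed[of k _ \<sigma> \<tau>] by simp
next
  case (Conj A B)
  from Conj.IH(1)[of k \<sigma> \<tau>] Conj.IH(2)[of k \<sigma> \<tau>] Conj.prems show ?case by simp
next
  case (Disj A B)
  from Disj.IH(1)[of k \<sigma> \<tau>] Disj.IH(2)[of k \<sigma> \<tau>] Disj.prems show ?case by simp
next
  case (Impl A B)
  from Impl.IH(1)[of k \<sigma> \<tau>] Impl.IH(2)[of k \<sigma> \<tau>] Impl.prems show ?case by simp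
next
  case (Uni A)
  have "fsubst (up \<sigma>) A = fsubst (up \<tau>) A"
    by (rule Uni.IH[of "Suc k"]) (use Uni.prems in \<open>auto simp: up_def split: nat.split\<close>)
  then show ?case by simp
next
  case (Exi A)
  have "fsubst (up \<sigma>) A = fsubst (up \<tau>) A"
    by (rule Exi.IH[of "Suc k"]) (use Exi.prems in \<open>auto simp: up_def split: nat.split\<close>)
  then show ?case by simp
qed simp

lemma fsubst_sentence: "closed_fm 0 A \<Longrightarrow> fsubst \<sigma> A = A"
  using fsubst_closed[of 0 A \<sigma> Var] by simp

lemma lift_fm_sentence: "closed_fm 0 A \<Longrightarrow> lift_fm k A = A"
  by (simp add: lift_fm_fsubst fsubst_sentence)

lemma closed_tm_mono: "closed_tm k t \<Longrightarrow> k \<le> l \<Longrightarrow> closed_tm l t"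
  by (induction t) auto

lemma closed_fm_mono: "closed_fm k A \<Longrightarrow> k \<le> l \<Longrightarrow> closed_fm l A"
proof (induction A arbitrary: k l)
  case (Uni A) then show ?case using Uni.IH[of "Suc k" "Suc l"] by simp
next
  case (Exi A) then show ?case using Exi.IH[of "Suc k" "Suc l"] by simp
next
  case (Conj A B) then show ?case using Conj.IH[of k l] by simp
next
  case (Disj A B) then show ?case using Disj.IH[of k l] by simp
next
  case (Impl A B) then show ?case using Impl.IH[of k l] by simp
qed (auto intro: closed_tm_mono)

lemma closed_tm_ex: "\<exists>k. closed_tm k t"
proof (induction t)
  case (Add s t) then show ?case by (metis closed_tm_mono closed_tm.simps(4) nat_le_linear)
next
  case (Mul s t) then show ?case by (metis closed_tm_mono closed_tm.simps(5) nat_le_linear)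
qed auto

lemma closed_fm_ex: "\<exists>k. closed_fm k A"
proof (induction A)
  case (Eql s t) then show ?case by (metis closed_tm_ex closed_tm_mono closed_fm.simps(1) nat_le_linear)
next
  case (Conj s t) then show ?case by (metis closed_fm_mono closed_fm.simps(3) nat_le_linear)
next
  case (Disj s t) then show ?case by (metis closed_fm_mono closed_fm.simps(4) nat_le_linear)
next
  case (Impl s t) then show ?case by (metis closed_fm_mono closed_fm.simps(5) nat_le_linear)
next
  case (Uni A) then show ?case by (metis closed_fm_mono closed_fm.simps(6) le_SucI order_refl)
next
  case (Exi A) then show ?case by (metis closed_fm_mono closed_fm.simps(7) le_SucI order_refl)
qed auto

section \<open>Natural deduction\<close>

lemma HA_closed: "A \<in> HA \<Longrightarrow> closed_fm 0 A"
  by (auto simp: HA_def basic_axioms_def)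

lemma log_ax_fsubst: "log_ax A \<Longrightarrow> log_ax (fsubst \<sigma> A)"
  by (induction rule: log_ax.induct) (auto simp: fsubst_sub_fm intro: log_ax.intros)

text \<open>Derivability is closed under substitution because \<open>log_ax\<close> is and the
  axioms of HA are sentences. This replaces the renaming of variables when an open theorem is used
  under other quantifiers.\<close>

lemma HA_fsubst: "HA \<^bold>\<turnstile> A \<Longrightarrow> HA \<^bold>\<turnstile> fsubst \<sigma> A"
proof (induction arbitrary: \<sigma> rule: prv.induct)
  case (logic A) then show ?case by (intro prv.logic log_ax_fsubst)
next
  case (axiom A) then show ?case by (simp add: HA_closed fsubst_sentence prv.axiom)
next
  case (mp A B) from prv.mp[OF mp.IH(1)[of \<sigma>]] mp.IH(2)[of \<sigma>] show ?case by simp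
next
  case (gen A) then show ?case by (simp add: prv.gen)
qed

lemma HA_inst: "HA \<^bold>\<turnstile> Uni A \<Longrightarrow> HA \<^bold>\<turnstile> sub_fm 0 t A"
  by (rule prv.mp[OF _ prv.logic[OF log_ax.intros(10)]])

text \<open>The head of the context is the innermost antecedent, so that moving it into the context
  is definitional.\<close>

definition nd :: "fm list \<Rightarrow> fm \<Rightarrow> bool"  (infix "\<tturnstile>" 40) where
  "\<Gamma> \<tturnstile> A \<longleftrightarrow> HA \<^bold>\<turnstile> fold Impl \<Gamma> A"

lemma nd_Nil: "[] \<tturnstile> A \<longleftrightarrow> HA \<^bold>\<turnstile> A"
  by (simp add: nd_def)

lemma nd_Cons: "A # \<Gamma> \<tturnstile> B \<longleftrightarrow> \<Gamma> \<tturnstile> A \<^bold>\<longrightarrow> B"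
  by (simp add: nd_def)

lemma nd_impI: "A # \<Gamma> \<tturnstile> B \<Longrightarrow> \<Gamma> \<tturnstile> A \<^bold>\<longrightarrow> B"
  by (simp add: nd_def)

lemma nd_thm: "HA \<^bold>\<turnstile> A \<Longrightarrow> \<Gamma> \<tturnstile> A"
proof (induction \<Gamma> arbitrary: A)
  case Nil then show ?case by (simp add: nd_def)
next
  case (Cons B \<Gamma>)
  have "HA \<^bold>\<turnstile> B \<^bold>\<longrightarrow> A" by (rule prv.mp[OF Cons.prems prv.logic[OF log_ax.intros(1)]])
  then show ?case using Cons.IH nd_Cons by blast
qed

lemmas nd_ax = nd_thm[OF prv.logic]

lemma nd_mp: "\<Gamma> \<tturnstile> A \<^bold>\<longrightarrow> B \<Longrightarrow> \<Gamma> \<tturnstile> A \<Longrightarrow> \<Gamma> \<tturnstile> B"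
proof (induction \<Gamma> arbitrary: A B)
  case Nil then show ?case by (auto simp: nd_def intro: prv.mp)
next
  case (Cons C \<Gamma>)
  have "\<Gamma> \<tturnstile> (C \<^bold>\<longrightarrow> A) \<^bold>\<longrightarrow> C \<^bold>\<longrightarrow> B"
    by (rule Cons.IH[OF nd_ax[OF log_ax.intros(2)]]) (use Cons.prems in \<open>simp add: nd_Cons\<close>)
  from Cons.IH[OF this] Cons.prems(2) show ?case by (simp add: nd_Cons)
qed

lemma nd_weaken1: "\<Gamma> \<tturnstile> A \<Longrightarrow> B # \<Gamma> \<tturnstile> A"
  using nd_mp[OF nd_ax[OF log_ax.intros(1)]] nd_Cons by blast

lemma nd_self: "A # \<Gamma> \<tturnstile> A"
proof -
  have "\<Gamma> \<tturnstile> A \<^bold>\<longrightarrow> (A \<^bold>\<longrightarrow> A)" and *: "\<Gamma> \<tturnstile> A \<^bold>\<longrightarrow> ((A \<^bold>\<longrightarrow> A) \<^bold>\<longrightarrow> A)"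
    by (rule nd_ax[OF log_ax.intros(1)])+
  then have "\<Gamma> \<tturnstile> A \<^bold>\<longrightarrow> A"
    using nd_mp[OF nd_mp[OF nd_ax[OF log_ax.intros(2)] *]] by blast
  then show ?thesis by (simp add: nd_Cons)
qed

lemma nd_asm: "A \<in> set \<Gamma> \<Longrightarrow> \<Gamma> \<tturnstile> A"
  by (induction \<Gamma>) (auto intro: nd_self nd_weaken1)

lemma nd_cut_list: "\<Gamma> \<tturnstile> A \<Longrightarrow> (\<And>B. B \<in> set \<Gamma> \<Longrightarrow> \<Delta> \<tturnstile> B) \<Longrightarrow> \<Delta> \<tturnstile> A"
proof (induction \<Gamma> arbitrary: A)
  case Nil then show ?case by (simp add: nd_Nil nd_thm)
next
  case (Cons B \<Gamma>)
  have "\<Delta> \<tturnstile> B \<^bold>\<longrightarrow> A" by (rule Cons.IH) (use Cons.prems in \<open>auto simp: nd_Cons\<close>)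
  then show ?case by (rule nd_mp) (use Cons.prems in auto)
qed

lemma nd_weaken: "\<Gamma> \<tturnstile> A \<Longrightarrow> set \<Gamma> \<subseteq> set \<Delta> \<Longrightarrow> \<Delta> \<tturnstile> A"
  by (rule nd_cut_list) (auto intro: nd_asm)

lemma nd_cut: "\<Gamma> \<tturnstile> A \<Longrightarrow> A # \<Gamma> \<tturnstile> B \<Longrightarrow> \<Gamma> \<tturnstile> B"
  by (metis nd_impI nd_mp)

lemma nd_conjI: "\<Gamma> \<tturnstile> A \<Longrightarrow> \<Gamma> \<tturnstile> B \<Longrightarrow> \<Gamma> \<tturnstile> A \<^bold>\<and> B"
  using nd_mp[OF nd_mp[OF nd_ax[OF log_ax.intros(3)]]] .

lemma nd_conj1: "\<Gamma> \<tturnstile> A \<^bold>\<and> B \<Longrightarrow> \<Gamma> \<tturnstile> A"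
  using nd_mp[OF nd_ax[OF log_ax.intros(4)]] .

lemma nd_conj2: "\<Gamma> \<tturnstile> A \<^bold>\<and> B \<Longrightarrow> \<Gamma> \<tturnstile> B"
  using nd_mp[OF nd_ax[OF log_ax.intros(5)]] .

lemma nd_disj1: "\<Gamma> \<tturnstile> A \<Longrightarrow> \<Gamma> \<tturnstile> A \<^bold>\<or> B"
  using nd_mp[OF nd_ax[OF log_ax.intros(6)]] .

lemma nd_disj2: "\<Gamma> \<tturnstile> B \<Longrightarrow> \<Gamma> \<tturnstile> A \<^bold>\<or> B"
  using nd_mp[OF nd_ax[OF log_ax.intros(7)]] .

lemma nd_disjE: "\<Gamma> \<tturnstile> A \<^bold>\<or> B \<Longrightarrow> A # \<Gamma> \<tturnstile> C \<Longrightarrow> B # \<Gamma> \<tturnstile> C \<Longrightarrow> \<Gamma> \<tturnstile> C"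
  using nd_mp[OF nd_mp[OF nd_mp[OF nd_ax[OF log_ax.intros(8)]]]] nd_Cons by blast

lemma nd_FlsE: "\<Gamma> \<tturnstile> Fls \<Longrightarrow> \<Gamma> \<tturnstile> A"
  using nd_mp[OF nd_ax[OF log_ax.intros(9)]] .

lemma nd_Tru: "\<Gamma> \<tturnstile> Tru"
  by (intro nd_impI nd_self)

lemma nd_allE: "\<Gamma> \<tturnstile> Uni A \<Longrightarrow> \<Gamma> \<tturnstile> sub_fm 0 t A"
  using nd_mp[OF nd_ax[OF log_ax.intros(10)]] .

lemma nd_exI: "\<Gamma> \<tturnstile> sub_fm 0 t A \<Longrightarrow> \<Gamma> \<tturnstile> Exi A"
  using nd_mp[OF nd_ax[OF log_ax.intros(11)]] .

text \<open>Lifting the context is the eigenvariable condition. The hypotheses are moved out of the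
  quantifier one by one, by the axiom for \<open>Uni\<close> with a lifted antecedent.\<close>

lemma nd_allI: "map (lift_fm 0) \<Gamma> \<tturnstile> A \<Longrightarrow> \<Gamma> \<tturnstile> Uni A"
proof (induction \<Gamma> arbitrary: A)
  case Nil then show ?case by (simp add: nd_Nil prv.gen)
next
  case (Cons B \<Gamma>)
  have "\<Gamma> \<tturnstile> Uni (lift_fm 0 B \<^bold>\<longrightarrow> A)" by (rule Cons.IH) (use Cons.prems in \<open>simp add: nd_Cons\<close>)
  from nd_mp[OF nd_ax[OF log_ax.intros(12)] this] show ?case by (simp add: nd_Cons)
qed

lemma nd_exE: "\<Gamma> \<tturnstile> Exi B \<Longrightarrow> B # map (lift_fm 0) \<Gamma> \<tturnstile> lift_fm 0 A \<Longrightarrow> \<Gamma> \<tturnstile> A"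
  using nd_mp[OF nd_mp[OF nd_ax[OF log_ax.intros(13)]]] nd_allI nd_Cons by blast

lemma nd_refl: "\<Gamma> \<tturnstile> t \<^bold>= t"
  by (rule nd_ax[OF log_ax.intros(14)])

lemma nd_subst: "\<Gamma> \<tturnstile> s \<^bold>= t \<Longrightarrow> \<Gamma> \<tturnstile> sub_fm 0 s A \<Longrightarrow> \<Gamma> \<tturnstile> sub_fm 0 t A"
  using nd_mp[OF nd_mp[OF nd_ax[OF log_ax.intros(15)]]] .

text \<open>Equality has only reflexivity and replacement as axioms. The formula passed to
  \<open>nd_subst\<close> marks with index 0 the occurrence to be replaced; everything else is
  lifted past it.\<close>

lemma nd_sym: "\<Gamma> \<tturnstile> s \<^bold>= t \<Longrightarrow> \<Gamma> \<tturnstile> t \<^bold>= s"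
  using nd_subst[of \<Gamma> s t "Var 0 \<^bold>= lift_tm 0 s"] nd_refl[of \<Gamma> s] by simp

lemma nd_trans: "\<Gamma> \<tturnstile> s \<^bold>= t \<Longrightarrow> \<Gamma> \<tturnstile> t \<^bold>= u \<Longrightarrow> \<Gamma> \<tturnstile> s \<^bold>= u"
  using nd_subst[of \<Gamma> t u "lift_tm 0 s \<^bold>= Var 0"] by simp

lemma nd_Scc_cong: "\<Gamma> \<tturnstile> s \<^bold>= t \<Longrightarrow> \<Gamma> \<tturnstile> Scc s \<^bold>= Scc t"
  using nd_subst[of \<Gamma> s t "Scc (lift_tm 0 s) \<^bold>= Scc (Var 0)"] nd_refl[of \<Gamma> "Scc s"] by simp

lemma nd_Add_cong: "\<Gamma> \<tturnstile> s \<^bold>= t \<Longrightarrow> \<Gamma> \<tturnstile> s' \<^bold>= t' \<Longrightarrow> \<Gamma> \<tturnstile> Add s s' \<^bold>= Add t t'"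
  using nd_subst[of \<Gamma> s t "Add (lift_tm 0 s) (lift_tm 0 s') \<^bold>= Add (Var 0) (lift_tm 0 s')"]
    nd_subst[of \<Gamma> s' t' "Add (lift_tm 0 s) (lift_tm 0 s') \<^bold>= Add (lift_tm 0 t) (Var 0)"]
    nd_refl[of \<Gamma> "Add s s'"] by simp

lemma nd_Mul_cong: "\<Gamma> \<tturnstile> s \<^bold>= t \<Longrightarrow> \<Gamma> \<tturnstile> s' \<^bold>= t' \<Longrightarrow> \<Gamma> \<tturnstile> Mul s s' \<^bold>= Mul t t'"
  using nd_subst[of \<Gamma> s t "Mul (lift_tm 0 s) (lift_tm 0 s') \<^bold>= Mul (Var 0) (lift_tm 0 s')"]
    nd_subst[of \<Gamma> s' t' "Mul (lift_tm 0 s) (lift_tm 0 s') \<^bold>= Mul (lift_tm 0 t) (Var 0)"]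
    nd_refl[of \<Gamma> "Mul s s'"] by simp

text \<open>The induction axioms are closed; the open instances follow by instantiating a closure.\<close>

lemma HA_closure: "HA \<^bold>\<turnstile> (Uni ^^ n) A \<Longrightarrow> HA \<^bold>\<turnstile> A"
proof (induction n arbitrary: A)
  case (Suc n)
  from Suc.prems have "HA \<^bold>\<turnstile> (Uni ^^ n) (Uni A)" by (simp only: funpow_Suc_right o_apply)
  from HA_inst[OF HA_fsubst[OF Suc.IH[OF this], of "\<lambda>i. Var (Suc i)", simplified], of "Var 0"]
  have "HA \<^bold>\<turnstile> fsubst (case_nat (Var 0) (\<lambda>i. Var (Suc i))) A" by (simp add: sub_fm_fsubst_up)
  moreover have "case_nat (Var 0) (\<lambda>i. Var (Suc i)) = Var" by (rule ext) (simp split: nat.split)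
  ultimately show ?case by simp
qed simp

lemma closed_fm_closure: "closed_fm (k + n) A \<Longrightarrow> closed_fm k ((Uni ^^ n) A)"
  by (induction n arbitrary: k) (auto simp: add.commute)

lemma HA_ind_ax: "HA \<^bold>\<turnstile> ind_ax A"
proof -
  obtain n where "closed_fm n (ind_ax A)" using closed_fm_ex by blast
  then have "(Uni ^^ n) (ind_ax A) \<in> HA" using closed_fm_closure[of 0 n] by (auto simp: HA_def)
  then show ?thesis by (blast intro: HA_closure prv.axiom)
qed

lemma nd_induct_all:
  assumes "\<Gamma> \<tturnstile> sub_fm 0 Zero A"
    and "A # map (lift_fm 0) \<Gamma> \<tturnstile> sub_fm 0 (Scc (Var 0)) (lift_fm 1 A)"
  shows "\<Gamma> \<tturnstile> Uni A"
  using nd_mp[OF nd_thm[OF HA_ind_ax[of A, unfolded ind_ax_def]]] nd_conjI assms nd_allI nd_Cons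
  by blast

lemma nd_induct:
  assumes "\<Gamma> \<tturnstile> sub_fm 0 Zero A"
    and "A # map (lift_fm 0) \<Gamma> \<tturnstile> sub_fm 0 (Scc (Var 0)) (lift_fm 1 A)"
  shows "\<Gamma> \<tturnstile> sub_fm 0 t A"
  by (rule nd_allE[OF nd_induct_all[OF assms]])

section \<open>The basic axioms as rules\<close>

lemma HA_basic: "A \<in> set basic_axioms \<Longrightarrow> HA \<^bold>\<turnstile> A"
  by (rule prv.axiom) (simp add: HA_def)

lemma nd_Scc_Zero: "\<Gamma> \<tturnstile> Scc t \<^bold>= Zero \<Longrightarrow> \<Gamma> \<tturnstile> A"
proof -
  have "HA \<^bold>\<turnstile> Uni (Neg (Scc (Var 0) \<^bold>= Zero))" by (rule HA_basic) (simp add: basic_axioms_def)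
  from nd_allE[OF nd_thm[OF this], of \<Gamma> t] have "\<Gamma> \<tturnstile> Neg (Scc t \<^bold>= Zero)" by simp
  then show "\<Gamma> \<tturnstile> Scc t \<^bold>= Zero \<Longrightarrow> \<Gamma> \<tturnstile> A" using nd_mp nd_FlsE by blast
qed

lemma nd_Scc_inj: "\<Gamma> \<tturnstile> Scc s \<^bold>= Scc t \<Longrightarrow> \<Gamma> \<tturnstile> s \<^bold>= t"
proof -
  have "HA \<^bold>\<turnstile> Uni (Uni (Scc (Var 1) \<^bold>= Scc (Var 0) \<^bold>\<longrightarrow> Var 1 \<^bold>= Var 0))"
    by (rule HA_basic) (simp add: basic_axioms_def)
  from nd_allE[OF nd_allE[OF nd_thm[OF this], of \<Gamma> s, simplified], of t]
  show "\<Gamma> \<tturnstile> Scc s \<^bold>= Scc t \<Longrightarrow> \<Gamma> \<tturnstile> s \<^bold>= t" using nd_mp by simp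
qed

lemma nd_Add_Zero: "\<Gamma> \<tturnstile> Add t Zero \<^bold>= t"
proof -
  have "HA \<^bold>\<turnstile> Uni (Add (Var 0) Zero \<^bold>= Var 0)" by (rule HA_basic) (simp add: basic_axioms_def)
  from nd_allE[OF nd_thm[OF this], of \<Gamma> t] show ?thesis by simp
qed

lemma nd_Add_Scc: "\<Gamma> \<tturnstile> Add s (Scc t) \<^bold>= Scc (Add s t)"
proof -
  have "HA \<^bold>\<turnstile> Uni (Uni (Add (Var 1) (Scc (Var 0)) \<^bold>= Scc (Add (Var 1) (Var 0))))"
    by (rule HA_basic) (simp add: basic_axioms_def)
  from nd_allE[OF nd_allE[OF nd_thm[OF this], of \<Gamma> s, simplified], of t] show ?thesis by simp
qed

lemma nd_Mul_Zero: "\<Gamma> \<tturnstile> Mul t Zero \<^bold>= Zero"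
proof -
  have "HA \<^bold>\<turnstile> Uni (Mul (Var 0) Zero \<^bold>= Zero)" by (rule HA_basic) (simp add: basic_axioms_def)
  from nd_allE[OF nd_thm[OF this], of \<Gamma> t] show ?thesis by simp
qed

lemma nd_Mul_Scc: "\<Gamma> \<tturnstile> Mul s (Scc t) \<^bold>= Add (Mul s t) s"
proof -
  have "HA \<^bold>\<turnstile> Uni (Uni (Mul (Var 1) (Scc (Var 0)) \<^bold>= Add (Mul (Var 1) (Var 0)) (Var 1)))"
    by (rule HA_basic) (simp add: basic_axioms_def)
  from nd_allE[OF nd_allE[OF nd_thm[OF this], of \<Gamma> s, simplified], of t] show ?thesis by simp
qed

section \<open>Decidability of bounded formulas in HA\<close>

lemma sub_tm_Suc_lift [simp]: "sub_tm (Suc k) (lift_tm 0 u) (lift_tm 0 t) = lift_tm 0 (sub_tm k u t)"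
  by (induction t) auto

lemma lift_tm_Suc_lift [simp]: "lift_tm (Suc k) (lift_tm 0 t) = lift_tm 0 (lift_tm k t)"
  by (induction t) auto

lemma sub_tm_lift_tm' [simp]: "sub_tm k u (lift_tm k t) = t"
  by (induction t) auto

lemma sub_fm_lift_fm [simp]: "sub_fm k u (lift_fm k A) = A"
  by (induction A arbitrary: k u) auto

lemma sub_fm_Var0_lift1 [simp]: "sub_fm 0 (Var 0) (lift_fm (Suc 0) A) = A"
proof -
  have "(\<lambda>i. tsubst (case_nat (Var 0) Var) (Var (if i < Suc 0 then i else Suc i))) = Var"
    by (rule ext) auto
  then show ?thesis unfolding sub_fm_0 lift_fm_fsubst fsubst_fsubst by simp
qed

lemma lift_fm_Suc_lift [simp]: "lift_fm (Suc k) (lift_fm 0 A) = lift_fm 0 (lift_fm k A)"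
  unfolding lift_fm_fsubst fsubst_fsubst
  by (rule arg_cong[where f = "\<lambda>\<sigma>. fsubst \<sigma> A"]) auto

lemma lift_fm_lift_same [simp]: "lift_fm (Suc k) (lift_fm k A) = lift_fm k (lift_fm k A)"
  unfolding lift_fm_fsubst fsubst_fsubst
  by (rule arg_cong[where f = "\<lambda>\<sigma>. fsubst \<sigma> A"]) auto

lemma sub_fm_Suc_lift [simp]: "sub_fm (Suc k) (lift_tm 0 u) (lift_fm 0 A) = lift_fm 0 (sub_fm k u A)"
  unfolding lift_fm_fsubst sub_fm_fsubst fsubst_fsubst
  by (rule arg_cong[where f = "\<lambda>\<sigma>. fsubst \<sigma> A"]) (auto simp: lift_tm_tsubst)

lemma sub_lt [simp]: "sub_fm k u (s \<^bold>< t) = (sub_tm k u s \<^bold>< sub_tm k u t)"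
  by (simp add: lt_def)

lemma lift_lt [simp]: "lift_fm k (s \<^bold>< t) = (lift_tm k s \<^bold>< lift_tm k t)"
  by (simp add: lt_def)

lemma lift_le [simp]: "lift_fm k (s \<^bold>\<le> t) = (lift_tm k s \<^bold>\<le> lift_tm k t)"
  by (simp add: le_def)

section \<open>Addition and order in HA\<close>

lemma nd_Zero_Add: "\<Gamma> \<tturnstile> Add Zero t \<^bold>= t"
proof -
  have "\<Gamma> \<tturnstile> sub_fm 0 t (Add Zero (Var 0) \<^bold>= Var 0)"
  proof (rule nd_induct)
    show "\<Gamma> \<tturnstile> sub_fm 0 Zero (Add Zero (Var 0) \<^bold>= Var 0)" using nd_Add_Zero by simp
    let ?G = "(Add Zero (Var 0) \<^bold>= Var 0) # map (lift_fm 0) \<Gamma>"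
    have "?G \<tturnstile> Add Zero (Scc (Var 0)) \<^bold>= Scc (Var 0)"
      by (rule nd_trans[OF nd_Add_Scc nd_Scc_cong[OF nd_self]])
    then show "?G \<tturnstile> sub_fm 0 (Scc (Var 0)) (lift_fm 1 (Add Zero (Var 0) \<^bold>= Var 0))" by simp
  qed
  then show ?thesis by simp
qed

lemma nd_Scc_Add: "\<Gamma> \<tturnstile> Add (Scc s) t \<^bold>= Scc (Add s t)"
proof -
  let ?A = "Add (Scc (lift_tm 0 s)) (Var 0) \<^bold>= Scc (Add (lift_tm 0 s) (Var 0))"
  have "\<Gamma> \<tturnstile> sub_fm 0 t ?A"
  proof (rule nd_induct)
    have "\<Gamma> \<tturnstile> Add (Scc s) Zero \<^bold>= Scc (Add s Zero)"
      by (rule nd_trans[OF nd_Add_Zero nd_Scc_cong[OF nd_sym[OF nd_Add_Zero]]])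
    then show "\<Gamma> \<tturnstile> sub_fm 0 Zero ?A" by simp
    let ?G = "?A # map (lift_fm 0) \<Gamma>" and ?s = "lift_tm 0 s"
    have "?G \<tturnstile> Add (Scc ?s) (Scc (Var 0)) \<^bold>= Scc (Add ?s (Scc (Var 0)))"
      by (rule nd_trans[OF nd_Add_Scc nd_trans[OF nd_Scc_cong[OF nd_self]
            nd_Scc_cong[OF nd_sym[OF nd_Add_Scc]]]])
    then show "?G \<tturnstile> sub_fm 0 (Scc (Var 0)) (lift_fm 1 ?A)" by simp
  qed
  then show ?thesis by simp
qed

lemma nd_Add_assoc: "\<Gamma> \<tturnstile> Add s (Add u t) \<^bold>= Add (Add s u) t"
proof -
  let ?A = "Add (lift_tm 0 s) (Add (lift_tm 0 u) (Var 0)) \<^bold>= Add (Add (lift_tm 0 s) (lift_tm 0 u)) (Var 0)"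
  have "\<Gamma> \<tturnstile> sub_fm 0 t ?A"
  proof (rule nd_induct)
    have "\<Gamma> \<tturnstile> Add s (Add u Zero) \<^bold>= Add (Add s u) Zero"
      by (rule nd_trans[OF nd_Add_cong[OF nd_refl nd_Add_Zero] nd_sym[OF nd_Add_Zero]])
    then show "\<Gamma> \<tturnstile> sub_fm 0 Zero ?A" by simp
    let ?G = "?A # map (lift_fm 0) \<Gamma>" and ?s = "lift_tm 0 s" and ?u = "lift_tm 0 u"
    have "?G \<tturnstile> Add ?s (Add ?u (Scc (Var 0))) \<^bold>= Add (Add ?s ?u) (Scc (Var 0))"
      by (rule nd_trans[OF nd_Add_cong[OF nd_refl nd_Add_Scc] nd_trans[OF nd_Add_Scc
            nd_trans[OF nd_Scc_cong[OF nd_self] nd_sym[OF nd_Add_Scc]]]])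
    then show "?G \<tturnstile> sub_fm 0 (Scc (Var 0)) (lift_fm 1 ?A)" by simp
  qed
  then show ?thesis by simp
qed

lemma nd_nat_cases:
  assumes "(t \<^bold>= Zero) # \<Gamma> \<tturnstile> C"
    and "(lift_tm 0 t \<^bold>= Scc (Var 0)) # map (lift_fm 0) \<Gamma> \<tturnstile> lift_fm 0 C"
  shows "\<Gamma> \<tturnstile> C"
proof -
  let ?A = "Var 0 \<^bold>= Zero \<^bold>\<or> Exi (Var 1 \<^bold>= Scc (Var 0))"
  have "\<Gamma> \<tturnstile> sub_fm 0 t ?A"
  proof (rule nd_induct)
    show "\<Gamma> \<tturnstile> sub_fm 0 Zero ?A" by simp (intro nd_disj1 nd_refl)
    let ?G = "?A # map (lift_fm 0) \<Gamma>"
    have "?G \<tturnstile> Exi (Scc (Var 1) \<^bold>= Scc (Var 0))"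
      by (rule nd_exI[of _ "Var 0"]) (simp add: nd_refl)
    then show "?G \<tturnstile> sub_fm 0 (Scc (Var 0)) (lift_fm 1 ?A)" by (simp add: nd_disj2)
  qed
  then have *: "\<Gamma> \<tturnstile> t \<^bold>= Zero \<^bold>\<or> Exi (lift_tm 0 t \<^bold>= Scc (Var 0))" by simp
  show ?thesis
  proof (rule nd_disjE[OF * assms(1)])
    show "Exi (lift_tm 0 t \<^bold>= Scc (Var 0)) # \<Gamma> \<tturnstile> C"
      by (rule nd_exE[OF nd_self]) (rule nd_weaken[OF assms(2)], auto)
  qed
qed

text \<open>The induction is on \<open>s\<close>, with the other side universally quantified inside
  the formula, since the successor case calls the hypothesis at the predecessor of that
  side.\<close>

lemma nd_eq_dec: "\<Gamma> \<tturnstile> s \<^bold>= t \<^bold>\<or> Neg (s \<^bold>= t)"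
proof -
  let ?A = "Uni (Var 1 \<^bold>= Var 0 \<^bold>\<or> Neg (Var 1 \<^bold>= Var 0))"
  have "\<Gamma> \<tturnstile> sub_fm 0 s ?A"
  proof (rule nd_induct)
    have "\<Gamma> \<tturnstile> Uni (Zero \<^bold>= Var 0 \<^bold>\<or> Neg (Zero \<^bold>= Var 0))"
    proof (rule nd_allI, rule nd_nat_cases[of "Var 0"])
      show "(Var 0 \<^bold>= Zero) # map (lift_fm 0) \<Gamma> \<tturnstile> Zero \<^bold>= Var 0 \<^bold>\<or> Neg (Zero \<^bold>= Var 0)"
        by (intro nd_disj1 nd_sym[OF nd_self])
      show "(lift_tm 0 (Var 0) \<^bold>= Scc (Var 0)) # map (lift_fm 0) (map (lift_fm 0) \<Gamma>)
          \<tturnstile> lift_fm 0 (Zero \<^bold>= Var 0 \<^bold>\<or> Neg (Zero \<^bold>= Var 0))" (is "?G \<tturnstile> _")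
      proof -
        have "(Zero \<^bold>= Var 1) # ?G \<tturnstile> Scc (Var 0) \<^bold>= Zero"
          by (rule nd_sym, rule nd_trans[of _ _ "Var 1"]; rule nd_asm; simp)
        then show ?thesis by (simp add: nd_disj2 nd_impI nd_Scc_Zero)
      qed
    qed
    then show "\<Gamma> \<tturnstile> sub_fm 0 Zero ?A" by simp
    let ?G = "map (lift_fm 0) (?A # map (lift_fm 0) \<Gamma>)"
    let ?C = "Scc (Var 1) \<^bold>= Var 0 \<^bold>\<or> Neg (Scc (Var 1) \<^bold>= Var 0)"
    have "?A # map (lift_fm 0) \<Gamma> \<tturnstile> Uni ?C"
    proof (rule nd_allI, rule nd_nat_cases[of "Var 0"])
      have "(Scc (Var 1) \<^bold>= Var 0) # (Var 0 \<^bold>= Zero) # ?G \<tturnstile> Scc (Var 1) \<^bold>= Zero"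
        by (rule nd_trans[of _ _ "Var 0"]; rule nd_asm; simp)
      then show "(Var 0 \<^bold>= Zero) # ?G \<tturnstile> ?C" by (intro nd_disj2 nd_impI) (rule nd_Scc_Zero)
      let ?H = "(lift_tm 0 (Var 0) \<^bold>= Scc (Var 0)) # map (lift_fm 0) ?G"
      have "?H \<tturnstile> Uni (Var 3 \<^bold>= Var 0 \<^bold>\<or> Neg (Var 3 \<^bold>= Var 0))"
        by (rule nd_asm) (simp add: numeral_eq_Suc)
      from nd_allE[OF this, of "Var 0"]
      have h: "?H \<tturnstile> Var 2 \<^bold>= Var 0 \<^bold>\<or> Neg (Var 2 \<^bold>= Var 0)" by simp
      have "?H \<tturnstile> Scc (Var 2) \<^bold>= Var 1 \<^bold>\<or> Neg (Scc (Var 2) \<^bold>= Var 1)"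
      proof (rule nd_disjE[OF h])
        let ?K = "(Var 2 \<^bold>= Var 0) # ?H"
        have "?K \<tturnstile> Scc (Var 0) \<^bold>= Var 1" by (rule nd_sym, rule nd_asm) simp
        then have "?K \<tturnstile> Scc (Var 2) \<^bold>= Var 1" by (rule nd_trans[OF nd_Scc_cong[OF nd_self]])
        then show "?K \<tturnstile> Scc (Var 2) \<^bold>= Var 1 \<^bold>\<or> Neg (Scc (Var 2) \<^bold>= Var 1)" by (rule nd_disj1)
      next
        let ?K = "(Scc (Var 2) \<^bold>= Var 1) # Neg (Var 2 \<^bold>= Var 0) # ?H"
        have "?K \<tturnstile> Scc (Var 2) \<^bold>= Scc (Var 0)"
          by (rule nd_trans[of _ _ "Var 1"]; rule nd_asm; simp)
        then have "?K \<tturnstile> Fls" by (rule nd_mp[OF nd_asm nd_Scc_inj, rotated]) auto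
        then show "Neg (Var 2 \<^bold>= Var 0) # ?H \<tturnstile> Scc (Var 2) \<^bold>= Var 1 \<^bold>\<or> Neg (Scc (Var 2) \<^bold>= Var 1)"
          by (intro nd_disj2 nd_impI)
      qed
      then show "?H \<tturnstile> lift_fm 0 ?C" by (simp add: numeral_eq_Suc)
    qed
    then show "?A # map (lift_fm 0) \<Gamma> \<tturnstile> sub_fm 0 (Scc (Var 0)) (lift_fm 1 ?A)" by simp
  qed
  from nd_allE[OF this[simplified], of t] show ?thesis by simp
qed

lemma nd_ltI: "\<Gamma> \<tturnstile> Scc (Add u s) \<^bold>= t \<Longrightarrow> \<Gamma> \<tturnstile> s \<^bold>< t"
  unfolding lt_def by (rule nd_exI[of _ u]) simp

lemma nd_ltE:
  assumes "\<Gamma> \<tturnstile> s \<^bold>< t" "(Scc (Add (Var 0) (lift_tm 0 s)) \<^bold>= lift_tm 0 t) # map (lift_fm 0) \<Gamma> \<tturnstile> lift_fm 0 C"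
  shows "\<Gamma> \<tturnstile> C"
  by (rule nd_exE[OF assms(1)[unfolded lt_def, simplified] assms(2)])

lemma nd_lt_Zero: "\<Gamma> \<tturnstile> s \<^bold>< Zero \<Longrightarrow> \<Gamma> \<tturnstile> C"
  by (erule nd_ltE, rule nd_Scc_Zero[of _ "Add (Var 0) (lift_tm 0 s)"], rule nd_asm) simp

lemma nd_lt_SccI: "\<Gamma> \<tturnstile> s \<^bold>< t \<Longrightarrow> \<Gamma> \<tturnstile> s \<^bold>< Scc t"
proof (erule nd_ltE)
  let ?G = "(Scc (Add (Var 0) (lift_tm 0 s)) \<^bold>= lift_tm 0 t) # map (lift_fm 0) \<Gamma>"
  have "?G \<tturnstile> Scc (Add (Scc (Var 0)) (lift_tm 0 s)) \<^bold>= Scc (lift_tm 0 t)"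
    by (rule nd_trans[OF nd_Scc_cong[OF nd_Scc_Add] nd_Scc_cong[OF nd_self]])
  then show "?G \<tturnstile> lift_fm 0 (s \<^bold>< Scc t)" by (simp add: nd_ltI)
qed

lemma nd_lt_Scc_eqI: "\<Gamma> \<tturnstile> s \<^bold>= t \<Longrightarrow> \<Gamma> \<tturnstile> s \<^bold>< Scc t"
  by (rule nd_ltI[of _ Zero], rule nd_Scc_cong, rule nd_trans[OF nd_Zero_Add])

lemma nd_lt_SccE: "\<Gamma> \<tturnstile> s \<^bold>< Scc t \<Longrightarrow> \<Gamma> \<tturnstile> s \<^bold>< t \<^bold>\<or> s \<^bold>= t"
proof (erule nd_ltE, simp, rule nd_nat_cases[of "Var 0"])
  let ?s = "lift_tm 0 s" and ?t = "lift_tm 0 t"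
  let ?G = "(Scc (Add (Var 0) ?s) \<^bold>= Scc ?t) # map (lift_fm 0) \<Gamma>"
  let ?C = "?s \<^bold>< ?t \<^bold>\<or> ?s \<^bold>= ?t"
  let ?H = "(Var 0 \<^bold>= Zero) # ?G"
  have e: "?H \<tturnstile> Add (Var 0) ?s \<^bold>= ?t" by (rule nd_Scc_inj, rule nd_asm) simp
  have "?H \<tturnstile> Add (Var 0) ?s \<^bold>= ?s" by (rule nd_trans[OF nd_Add_cong[OF nd_self nd_refl] nd_Zero_Add])
  from nd_trans[OF nd_sym[OF this] e] show "?H \<tturnstile> ?C" by (rule nd_disj2)
  let ?K = "(lift_tm 0 (Var 0) \<^bold>= Scc (Var 0)) # map (lift_fm 0) ?G"
  let ?ss = "lift_tm 0 ?s" and ?tt = "lift_tm 0 ?t"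
  have e: "?K \<tturnstile> Add (Var 1) ?ss \<^bold>= ?tt" by (rule nd_Scc_inj, rule nd_asm) simp
  have "?K \<tturnstile> Add (Var 1) ?ss \<^bold>= Scc (Add (Var 0) ?ss)"
    by (rule nd_trans[OF nd_Add_cong[OF nd_asm nd_refl] nd_Scc_Add]) simp
  from nd_ltI[OF nd_trans[OF nd_sym[OF this] e]] show "?K \<tturnstile> lift_fm 0 ?C"
    by (simp add: nd_disj1)
qed

lemma nd_le_lt: "\<Gamma> \<tturnstile> s \<^bold>\<le> t \<Longrightarrow> \<Gamma> \<tturnstile> s \<^bold>< Scc t"
  unfolding le_def
proof (erule nd_exE)
  let ?G = "(Add (Var 0) (shift 1 s) \<^bold>= shift 1 t) # map (lift_fm 0) \<Gamma>"
  have "?G \<tturnstile> Scc (Add (Var 0) (shift 1 s)) \<^bold>= Scc (shift 1 t)" by (rule nd_Scc_cong[OF nd_self])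
  then show "?G \<tturnstile> lift_fm 0 (s \<^bold>< Scc t)" by (simp add: nd_ltI)
qed

lemma nd_lt_le: "\<Gamma> \<tturnstile> s \<^bold>< Scc t \<Longrightarrow> \<Gamma> \<tturnstile> s \<^bold>\<le> t"
proof (erule nd_ltE)
  let ?G = "(Scc (Add (Var 0) (lift_tm 0 s)) \<^bold>= lift_tm 0 (Scc t)) # map (lift_fm 0) \<Gamma>"
  have "?G \<tturnstile> Add (Var 0) (lift_tm 0 s) \<^bold>= lift_tm 0 t" by (rule nd_Scc_inj, rule nd_asm) simp
  then show "?G \<tturnstile> lift_fm 0 (s \<^bold>\<le> t)" unfolding le_def by (simp, intro nd_exI[of _ "Var 0"]) simp
qed

lemma nd_lt_irrefl: "\<Gamma> \<tturnstile> Scc (Add s t) \<^bold>= t \<Longrightarrow> \<Gamma> \<tturnstile> C"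
proof -
  let ?A = "Neg (Scc (Add (lift_tm 0 s) (Var 0)) \<^bold>= Var 0)"
  have "\<Gamma> \<tturnstile> sub_fm 0 t ?A"
  proof (rule nd_induct)
    have "\<Gamma> \<tturnstile> Neg (Scc (Add s Zero) \<^bold>= Zero)" by (rule nd_impI, rule nd_Scc_Zero, rule nd_self)
    then show "\<Gamma> \<tturnstile> sub_fm 0 Zero ?A" by simp
    let ?s = "lift_tm 0 s"
    let ?G = "(Scc (Add ?s (Scc (Var 0))) \<^bold>= Scc (Var 0)) # ?A # map (lift_fm 0) \<Gamma>"
    have "?G \<tturnstile> Scc (Add ?s (Var 0)) \<^bold>= Var 0"
      by (rule nd_trans[OF nd_sym[OF nd_Add_Scc]], rule nd_Scc_inj, rule nd_self)
    then have "?G \<tturnstile> Fls" by (rule nd_mp[OF nd_asm, rotated]) auto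
    then show "?A # map (lift_fm 0) \<Gamma> \<tturnstile> sub_fm 0 (Scc (Var 0)) (lift_fm 1 ?A)"
      by (simp add: nd_impI)
  qed
  then have n: "\<Gamma> \<tturnstile> Neg (Scc (Add s t) \<^bold>= t)" by simp
  show "\<Gamma> \<tturnstile> Scc (Add s t) \<^bold>= t \<Longrightarrow> \<Gamma> \<tturnstile> C" by (rule nd_FlsE[OF nd_mp[OF n]])
qed

lemma nd_le_not_lt: "\<Gamma> \<tturnstile> Add u t \<^bold>= s \<Longrightarrow> \<Gamma> \<tturnstile> Neg (s \<^bold>< t)"
proof (rule nd_impI, rule nd_ltE[OF nd_self])
  assume a: "\<Gamma> \<tturnstile> Add u t \<^bold>= s"
  let ?s = "lift_tm 0 s" and ?t = "lift_tm 0 t" and ?u = "lift_tm 0 u"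
  let ?G = "(Scc (Add (Var 0) ?s) \<^bold>= ?t) # map (lift_fm 0) ((s \<^bold>< t) # \<Gamma>)"
  \<comment> \<open>The equation is only known to follow from the context, so it is carried under
    the new witness by lifting its whole derivation.\<close>
  from a have "HA \<^bold>\<turnstile> fold Impl \<Gamma> (Add u t \<^bold>= s)" by (simp add: nd_def)
  from HA_fsubst[OF this, of "\<lambda>i. Var (Suc i)"]
  have "HA \<^bold>\<turnstile> lift_fm 0 (fold Impl \<Gamma> (Add u t \<^bold>= s))" by (simp only: lift_fm_0)
  moreover have "lift_fm 0 (fold Impl \<Gamma> X) = fold Impl (map (lift_fm 0) \<Gamma>) (lift_fm 0 X)" for X
    by (induction \<Gamma> arbitrary: X) auto
  ultimately have "map (lift_fm 0) \<Gamma> \<tturnstile> Add ?u ?t \<^bold>= ?s" by (simp add: nd_def)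
  then have e: "?G \<tturnstile> Add ?u ?t \<^bold>= ?s" by (rule nd_weaken) auto
  have "?G \<tturnstile> Scc (Add (Add (Var 0) ?u) ?t) \<^bold>= Scc (Add (Var 0) ?s)"
    by (rule nd_Scc_cong[OF nd_trans[OF nd_sym[OF nd_Add_assoc] nd_Add_cong[OF nd_refl e]]])
  from nd_trans[OF this nd_self] show "?G \<tturnstile> lift_fm 0 Fls" by (rule nd_lt_irrefl)
qed

text \<open>A number below the successor is below the old bound or equal to it. This one step serves
  the inductions on a bound in HA, under the translation, and for proofs inside a model.\<close>

lemma nd_bounded_step:
  assumes "\<Gamma> \<tturnstile> Uni (Var 0 \<^bold>< Var 1 \<^bold>\<longrightarrow> lift_fm 1 A)" "\<Gamma> \<tturnstile> A"
  shows "\<Gamma> \<tturnstile> Uni (Var 0 \<^bold>< Scc (Var 1) \<^bold>\<longrightarrow> lift_fm 1 A)"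
proof (rule nd_cut[OF assms(1)], rule nd_cut[OF nd_weaken1[OF assms(2)]], intro nd_allI nd_impI)
  let ?U = "Uni (Var 0 \<^bold>< Var 1 \<^bold>\<longrightarrow> lift_fm 1 A)"
  let ?K = "(Var 0 \<^bold>< Scc (Var 1)) # map (lift_fm 0) (A # ?U # \<Gamma>)"
  have "?K \<tturnstile> Var 0 \<^bold>< Var 1 \<^bold>\<or> Var 0 \<^bold>= Var 1" by (rule nd_lt_SccE, rule nd_asm) simp
  then show "?K \<tturnstile> lift_fm 1 A"
  proof (rule nd_disjE)
    let ?L = "(Var 0 \<^bold>< Var 1) # ?K"
    have "?L \<tturnstile> lift_fm 0 ?U" by (rule nd_asm) simp
    from nd_allE[OF this[simplified], of "Var 0"]
    have "?L \<tturnstile> Var 0 \<^bold>< Var 1 \<^bold>\<longrightarrow> sub_fm 0 (Var 0) (lift_fm 1 (lift_fm 1 A))" by simp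
    from nd_mp[OF this nd_self] show "?L \<tturnstile> lift_fm 1 A" by simp
  next
    let ?L = "(Var 0 \<^bold>= Var 1) # ?K"
    have "?L \<tturnstile> Var 1 \<^bold>= Var 0" by (rule nd_sym[OF nd_self])
    moreover have "?L \<tturnstile> lift_fm 0 A" by (rule nd_asm) simp
    moreover have "lift_fm 0 A = sub_fm 0 (Var 1) (lift_fm 1 (lift_fm 1 A))"
      unfolding lift_fm_fsubst sub_fm_fsubst fsubst_fsubst
      by (rule arg_cong[where f = "\<lambda>\<sigma>. fsubst \<sigma> A"]) auto
    ultimately show "?L \<tturnstile> lift_fm 1 A"
      using nd_subst[of ?L "Var 1" "Var 0" "lift_fm 1 (lift_fm 1 A)"] by simp
  qed
qed

text \<open>With \<open>Neg A\<close> for \<open>B\<close> this decides a bounded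
  \<open>Uni\<close>, with the negation in the place of \<open>A\<close> a bounded
  \<open>Exi\<close>; one induction on the bound serves both.\<close>

lemma nd_bounded_cases:
  assumes AB: "HA \<^bold>\<turnstile> A \<^bold>\<or> B"
  shows "\<Gamma> \<tturnstile> Uni (Var 0 \<^bold>< lift_tm 0 t \<^bold>\<longrightarrow> A) \<^bold>\<or> Exi (Var 0 \<^bold>< lift_tm 0 t \<^bold>\<and> B)"
proof -
  let ?U = "\<lambda>w. Uni (Var 0 \<^bold>< lift_tm 0 w \<^bold>\<longrightarrow> lift_fm 1 A)"
  let ?E = "\<lambda>w. Exi (Var 0 \<^bold>< lift_tm 0 w \<^bold>\<and> lift_fm 1 B)"
  let ?D = "?U (Var 0) \<^bold>\<or> ?E (Var 0)"
  have "\<Gamma> \<tturnstile> sub_fm 0 t ?D"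
  proof (rule nd_induct)
    have "\<Gamma> \<tturnstile> Uni (Var 0 \<^bold>< Zero \<^bold>\<longrightarrow> A)"
      by (intro nd_allI nd_impI) (rule nd_lt_Zero[OF nd_self])
    then show "\<Gamma> \<tturnstile> sub_fm 0 Zero ?D" by (simp add: nd_disj1)
    let ?G = "?D # map (lift_fm 0) \<Gamma>"
    have "?G \<tturnstile> ?U (Scc (Var 0)) \<^bold>\<or> ?E (Scc (Var 0))"
    proof (rule nd_disjE[OF nd_self])
      let ?H = "?U (Var 0) # ?G"
      have "?H \<tturnstile> A \<^bold>\<or> B" by (rule nd_thm[OF AB])
      then show "?H \<tturnstile> ?U (Scc (Var 0)) \<^bold>\<or> ?E (Scc (Var 0))"
      proof (rule nd_disjE)
        have "A # ?H \<tturnstile> ?U (Scc (Var 0))"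
          using nd_bounded_step[of "A # ?H" A] nd_self nd_asm[of "?U (Var 0)" "A # ?H"] by simp
        then show "A # ?H \<tturnstile> ?U (Scc (Var 0)) \<^bold>\<or> ?E (Scc (Var 0))" by (rule nd_disj1)
      next
        have "B # ?H \<tturnstile> Var 0 \<^bold>< Scc (Var 0) \<^bold>\<and> B"
          by (rule nd_conjI[OF nd_lt_Scc_eqI[OF nd_refl] nd_self])
        then show "B # ?H \<tturnstile> ?U (Scc (Var 0)) \<^bold>\<or> ?E (Scc (Var 0))"
          by (intro nd_disj2 nd_exI[of _ "Var 0"]) simp
      qed
    next
      have "?E (Var 0) # ?G \<tturnstile> ?E (Scc (Var 0))"
      proof (rule nd_exE[OF nd_self])
        let ?H = "(Var 0 \<^bold>< lift_tm 0 (Var 0) \<^bold>\<and> lift_fm 1 B) # map (lift_fm 0) (?E (Var 0) # ?G)"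
        have "?H \<tturnstile> Var 0 \<^bold>< Scc (Var 1) \<^bold>\<and> lift_fm 1 B"
          using nd_conjI[OF nd_lt_SccI[OF nd_conj1[OF nd_self]] nd_conj2[OF nd_self]] by simp
        then show "?H \<tturnstile> lift_fm 0 (?E (Scc (Var 0)))"
          by (simp, intro nd_exI[of _ "Var 0"]) simp
      qed
      then show "?E (Var 0) # ?G \<tturnstile> ?U (Scc (Var 0)) \<^bold>\<or> ?E (Scc (Var 0))" by (rule nd_disj2)
    qed
    then show "?G \<tturnstile> sub_fm 0 (Scc (Var 0)) (lift_fm 1 ?D)" by simp
  qed
  then show ?thesis by simp
qed

text \<open>This is what admits implications among bounded formulas under the translation: they are
  compared with their translations by deciding the antecedent.\<close>

lemma delta0_dec: "delta0 A \<Longrightarrow> HA \<^bold>\<turnstile> A \<^bold>\<or> Neg A"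
proof (induction rule: delta0.induct)
  case (1 s t)
  show ?case using nd_eq_dec[of "[]"] by (simp add: nd_Nil)
next
  case (2 s t)
  \<comment> \<open>The quantifier hidden in the atom has no bound of its own, so the atom is
    decided by a search below \<open>t\<close> for a number equal to \<open>s\<close>.\<close>
  let ?E = "Exi (Var 0 \<^bold>< lift_tm 0 t \<^bold>\<and> lift_tm 0 s \<^bold>= Var 0)"
  have "[] \<tturnstile> Uni (Var 0 \<^bold>< lift_tm 0 t \<^bold>\<longrightarrow> Neg (lift_tm 0 s \<^bold>= Var 0)) \<^bold>\<or> ?E"
  proof (rule nd_bounded_cases)
    show "HA \<^bold>\<turnstile> Neg (lift_tm 0 s \<^bold>= Var 0) \<^bold>\<or> lift_tm 0 s \<^bold>= Var 0"
      unfolding nd_Nil[symmetric]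
      by (rule nd_disjE[OF nd_eq_dec[of _ "lift_tm 0 s" "Var 0"]])
        (auto intro: nd_self nd_disj1 nd_disj2)
  qed
  then have "[] \<tturnstile> s \<^bold>< t \<^bold>\<or> Neg (s \<^bold>< t)"
  proof (rule nd_disjE)
    let ?U = "Uni (Var 0 \<^bold>< lift_tm 0 t \<^bold>\<longrightarrow> Neg (lift_tm 0 s \<^bold>= Var 0))"
    have "[s \<^bold>< t, ?U] \<tturnstile> ?U" by (rule nd_asm) simp
    from nd_allE[OF this, of s] have "[s \<^bold>< t, ?U] \<tturnstile> s \<^bold>< t \<^bold>\<longrightarrow> Neg (s \<^bold>= s)" by simp
    from nd_mp[OF nd_mp[OF this nd_self] nd_refl] have "[s \<^bold>< t, ?U] \<tturnstile> Fls" .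
    then show "[?U] \<tturnstile> s \<^bold>< t \<^bold>\<or> Neg (s \<^bold>< t)" by (intro nd_disj2 nd_impI)
    have "[?E] \<tturnstile> s \<^bold>< t"
    proof (rule nd_exE[OF nd_self])
      let ?G = "(Var 0 \<^bold>< lift_tm 0 t \<^bold>\<and> lift_tm 0 s \<^bold>= Var 0) # map (lift_fm 0) [?E]"
      have 1: "?G \<tturnstile> Var 0 \<^bold>< lift_tm 0 t" and 2: "?G \<tturnstile> Var 0 \<^bold>= lift_tm 0 s"
        using nd_conj1[OF nd_self] nd_sym[OF nd_conj2[OF nd_self]] by blast+
      show "?G \<tturnstile> lift_fm 0 (s \<^bold>< t)"
        using nd_subst[OF 2, of "Var 0 \<^bold>< lift_tm 0 (lift_tm 0 t)"] 1 by simp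
    qed
    then show "[?E] \<tturnstile> s \<^bold>< t \<^bold>\<or> Neg (s \<^bold>< t)" by (rule nd_disj1)
  qed
  then show ?case by (simp add: nd_Nil)
next
  case 3
  show ?case unfolding nd_Nil[symmetric] by (intro nd_disj2 nd_Tru)
next
  case (4 A B)
  have "[] \<tturnstile> (A \<^bold>\<and> B) \<^bold>\<or> Neg (A \<^bold>\<and> B)"
  proof (rule nd_disjE[OF nd_thm[OF 4(3)]])
    show "[A] \<tturnstile> (A \<^bold>\<and> B) \<^bold>\<or> Neg (A \<^bold>\<and> B)"
    proof (rule nd_disjE[OF nd_thm[OF 4(4)]])
      show "[B, A] \<tturnstile> (A \<^bold>\<and> B) \<^bold>\<or> Neg (A \<^bold>\<and> B)" by (intro nd_disj1 nd_conjI nd_asm) auto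
      show "[Neg B, A] \<tturnstile> (A \<^bold>\<and> B) \<^bold>\<or> Neg (A \<^bold>\<and> B)"
        by (intro nd_disj2 nd_impI, rule nd_mp[of _ B], rule nd_asm, simp, rule nd_conj2[OF nd_self])
    qed
    show "[Neg A] \<tturnstile> (A \<^bold>\<and> B) \<^bold>\<or> Neg (A \<^bold>\<and> B)"
      by (intro nd_disj2 nd_impI, rule nd_mp[of _ A], rule nd_asm, simp, rule nd_conj1[OF nd_self])
  qed
  then show ?case by (simp add: nd_Nil)
next
  case (5 A B)
  have "[] \<tturnstile> (A \<^bold>\<or> B) \<^bold>\<or> Neg (A \<^bold>\<or> B)"
  proof (rule nd_disjE[OF nd_thm[OF 5(3)]])
    show "[A] \<tturnstile> (A \<^bold>\<or> B) \<^bold>\<or> Neg (A \<^bold>\<or> B)" by (intro nd_disj1 nd_self)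
    show "[Neg A] \<tturnstile> (A \<^bold>\<or> B) \<^bold>\<or> Neg (A \<^bold>\<or> B)"
    proof (rule nd_disjE[OF nd_thm[OF 5(4)]])
      show "[B, Neg A] \<tturnstile> (A \<^bold>\<or> B) \<^bold>\<or> Neg (A \<^bold>\<or> B)" by (rule nd_disj1, rule nd_disj2, rule nd_self)
      show "[Neg B, Neg A] \<tturnstile> (A \<^bold>\<or> B) \<^bold>\<or> Neg (A \<^bold>\<or> B)"
      proof (rule nd_disj2, rule nd_impI, rule nd_disjE[OF nd_self])
        show "A # [A \<^bold>\<or> B, Neg B, Neg A] \<tturnstile> Fls" by (rule nd_mp[of _ A]; rule nd_asm; simp)
        show "B # [A \<^bold>\<or> B, Neg B, Neg A] \<tturnstile> Fls" by (rule nd_mp[of _ B]; rule nd_asm; simp)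
      qed
    qed
  qed
  then show ?case by (simp add: nd_Nil)
next
  case (6 A B)
  have "[] \<tturnstile> (A \<^bold>\<longrightarrow> B) \<^bold>\<or> Neg (A \<^bold>\<longrightarrow> B)"
  proof (rule nd_disjE[OF nd_thm[OF 6(3)]])
    show "[A] \<tturnstile> (A \<^bold>\<longrightarrow> B) \<^bold>\<or> Neg (A \<^bold>\<longrightarrow> B)"
    proof (rule nd_disjE[OF nd_thm[OF 6(4)]])
      show "[B, A] \<tturnstile> (A \<^bold>\<longrightarrow> B) \<^bold>\<or> Neg (A \<^bold>\<longrightarrow> B)" by (intro nd_disj1 nd_impI nd_asm) auto
      have "[A \<^bold>\<longrightarrow> B, Neg B, A] \<tturnstile> B" by (rule nd_mp[of _ A]; rule nd_asm; simp)
      then have "[A \<^bold>\<longrightarrow> B, Neg B, A] \<tturnstile> Fls" by (rule nd_mp[rotated]) (rule nd_asm, simp)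
      then show "[Neg B, A] \<tturnstile> (A \<^bold>\<longrightarrow> B) \<^bold>\<or> Neg (A \<^bold>\<longrightarrow> B)" by (intro nd_disj2 nd_impI)
    qed
    have "[A, Neg A] \<tturnstile> Fls" by (rule nd_mp[of _ A]; rule nd_asm; simp)
    then show "[Neg A] \<tturnstile> (A \<^bold>\<longrightarrow> B) \<^bold>\<or> Neg (A \<^bold>\<longrightarrow> B)" by (rule nd_disj1[OF nd_impI[OF nd_FlsE]])
  qed
  then show ?case by (simp add: nd_Nil)
next
  case (7 A t)
  let ?U = "Uni (Var 0 \<^bold>< lift_tm 0 t \<^bold>\<longrightarrow> A)" and ?E = "Exi (Var 0 \<^bold>< lift_tm 0 t \<^bold>\<and> Neg A)"
  have "[] \<tturnstile> ?U \<^bold>\<or> ?E" by (rule nd_bounded_cases[OF 7(2)])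
  then have "[] \<tturnstile> ?U \<^bold>\<or> Neg ?U"
  proof (rule nd_disjE)
    show "[?U] \<tturnstile> ?U \<^bold>\<or> Neg ?U" by (rule nd_disj1, rule nd_self)
    have "[?U, ?E] \<tturnstile> Fls"
    proof (rule nd_exE[OF nd_asm, of "Var 0 \<^bold>< lift_tm 0 t \<^bold>\<and> Neg A"])
      let ?G = "(Var 0 \<^bold>< lift_tm 0 t \<^bold>\<and> Neg A) # map (lift_fm 0) [?U, ?E]"
      have "?G \<tturnstile> lift_fm 0 ?U" by (rule nd_asm) simp
      from nd_allE[OF this[simplified], of "Var 0"]
      have "?G \<tturnstile> Var 0 \<^bold>< lift_tm 0 t \<^bold>\<longrightarrow> A" by simp
      from nd_mp[OF nd_conj2[OF nd_self] nd_mp[OF this nd_conj1[OF nd_self]]]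
      show "?G \<tturnstile> lift_fm 0 Fls" by simp
    qed simp
    then show "[?E] \<tturnstile> ?U \<^bold>\<or> Neg ?U" by (intro nd_disj2 nd_impI)
  qed
  then show ?case by (simp add: nd_Nil)
next
  case (8 A t)
  let ?U = "Uni (Var 0 \<^bold>< lift_tm 0 t \<^bold>\<longrightarrow> Neg A)" and ?E = "Exi (Var 0 \<^bold>< lift_tm 0 t \<^bold>\<and> A)"
  have "[] \<tturnstile> ?U \<^bold>\<or> ?E"
  proof (rule nd_bounded_cases)
    show "HA \<^bold>\<turnstile> Neg A \<^bold>\<or> A" unfolding nd_Nil[symmetric]
      by (rule nd_disjE[OF nd_thm[OF 8(2)]]) (auto intro: nd_self nd_disj1 nd_disj2)
  qed
  then have "[] \<tturnstile> ?E \<^bold>\<or> Neg ?E"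
  proof (rule nd_disjE)
    show "[?E] \<tturnstile> ?E \<^bold>\<or> Neg ?E" by (rule nd_disj1, rule nd_self)
    have "[?E, ?U] \<tturnstile> Fls"
    proof (rule nd_exE[OF nd_self])
      let ?G = "(Var 0 \<^bold>< lift_tm 0 t \<^bold>\<and> A) # map (lift_fm 0) [?E, ?U]"
      have "?G \<tturnstile> lift_fm 0 ?U" by (rule nd_asm) simp
      from nd_allE[OF this[simplified], of "Var 0"]
      have "?G \<tturnstile> Var 0 \<^bold>< lift_tm 0 t \<^bold>\<longrightarrow> Neg A" by simp
      from nd_mp[OF nd_mp[OF this nd_conj1[OF nd_self]] nd_conj2[OF nd_self]]
      show "?G \<tturnstile> lift_fm 0 Fls" by simp
    qed
    then show "[?U] \<tturnstile> ?E \<^bold>\<or> Neg ?E" by (intro nd_disj2 nd_impI)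
  qed
  then show ?case by (simp add: nd_Nil)
qed

section \<open>The Friedman translation\<close>

abbreviation nn :: "fm \<Rightarrow> fm \<Rightarrow> fm" where "nn F A \<equiv> (A \<^bold>\<longrightarrow> F) \<^bold>\<longrightarrow> F"

text \<open>The Goedel-Gentzen translation with falsity replaced by \<open>F\<close>, so that all
  double negations are relative to \<open>F\<close>. Lifting \<open>F\<close> under a quantifier
  takes the place of the proviso that its variables are not captured.\<close>

primrec tr :: "fm \<Rightarrow> fm \<Rightarrow> fm" where
  "tr F (s \<^bold>= t) = nn F (s \<^bold>= t)"
| "tr F Fls = F"
| "tr F (A \<^bold>\<and> B) = (tr F A \<^bold>\<and> tr F B)"
| "tr F (A \<^bold>\<or> B) = nn F (tr F A \<^bold>\<or> tr F B)"
| "tr F (A \<^bold>\<longrightarrow> B) = (tr F A \<^bold>\<longrightarrow> tr F B)"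
| "tr F (Uni A) = Uni (tr (lift_fm 0 F) A)"
| "tr F (Exi A) = nn F (Exi (tr (lift_fm 0 F) A))"

lemma fsubst_tr: "fsubst \<sigma> (tr F A) = tr (fsubst \<sigma> F) (fsubst \<sigma> A)"
  by (induction A arbitrary: \<sigma> F) auto

lemma lift_tr: "lift_fm k (tr F A) = tr (lift_fm k F) (lift_fm k A)"
  by (simp add: lift_fm_fsubst fsubst_tr)

lemma sub_tr: "sub_fm k t (tr F A) = tr (sub_fm k t F) (sub_fm k t A)"
  by (simp add: sub_fm_fsubst fsubst_tr)

lemma nnI: "\<Gamma> \<tturnstile> A \<Longrightarrow> \<Gamma> \<tturnstile> nn F A"
  by (rule nd_impI, rule nd_mp[OF nd_self], rule nd_weaken1)

lemma nn_bind: "\<Gamma> \<tturnstile> nn F A \<Longrightarrow> A # \<Gamma> \<tturnstile> nn F B \<Longrightarrow> \<Gamma> \<tturnstile> nn F B"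
proof (rule nd_impI)
  assume a: "\<Gamma> \<tturnstile> nn F A" and b: "A # \<Gamma> \<tturnstile> nn F B"
  have "A # (B \<^bold>\<longrightarrow> F) # \<Gamma> \<tturnstile> F"
    by (rule nd_mp[OF nd_weaken[OF b]], force, rule nd_asm, simp)
  then show "(B \<^bold>\<longrightarrow> F) # \<Gamma> \<tturnstile> F"
    by (rule nd_mp[OF nd_weaken1[OF a] nd_impI])
qed

lemma nn_mp: "\<Gamma> \<tturnstile> nn F A \<Longrightarrow> A # \<Gamma> \<tturnstile> F \<Longrightarrow> \<Gamma> \<tturnstile> F"
  by (rule nd_mp[OF _ nd_impI])

lemma nn_F: "\<Gamma> \<tturnstile> F \<Longrightarrow> \<Gamma> \<tturnstile> nn F A"
  by (rule nd_impI, rule nd_weaken1)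

lemma nd_all_self: "\<Gamma> \<tturnstile> lift_fm 0 (Uni A) \<Longrightarrow> \<Gamma> \<tturnstile> A"
  using nd_allE[of \<Gamma> "lift_fm 1 A" "Var 0"] by simp

lemma nd_ex_self: "\<Gamma> \<tturnstile> A \<Longrightarrow> \<Gamma> \<tturnstile> lift_fm 0 (Exi A)"
  using nd_exI[of \<Gamma> "Var 0" "lift_fm 1 A"] by simp

text \<open>Atoms, disjunctions and existential formulas are stable because of the double negation
  put in front of them; the other connectives inherit stability. It provides classical reasoning
  after translation.\<close>

lemma tr_stable: "\<Gamma> \<tturnstile> nn F (tr F A) \<Longrightarrow> \<Gamma> \<tturnstile> tr F A"
proof (induction A arbitrary: \<Gamma> F)
  case (Eql s t) then show ?case by simp (rule nn_bind[OF _ nd_self])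
next
  case Fls then show ?case by simp (rule nn_mp[OF _ nd_self])
next
  case (Conj A B)
  have "\<Gamma> \<tturnstile> nn F (tr F A)" "\<Gamma> \<tturnstile> nn F (tr F B)"
    by (rule nn_bind[OF Conj.prems], rule nnI, simp, rule nd_conj1[OF nd_self])
      (rule nn_bind[OF Conj.prems], rule nnI, simp, rule nd_conj2[OF nd_self])
  then show ?case using Conj.IH by (simp add: nd_conjI)
next
  case (Disj A B) then show ?case by simp (rule nn_bind[OF _ nd_self])
next
  case (Impl A B)
  have "tr F A # \<Gamma> \<tturnstile> nn F (tr F B)"
  proof (rule nn_bind[OF nd_weaken1[OF Impl.prems]], rule nnI)
    show "tr F (A \<^bold>\<longrightarrow> B) # tr F A # \<Gamma> \<tturnstile> tr F B" by (rule nd_mp[of _ "tr F A"]; rule nd_asm; simp)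
  qed
  then show ?case using Impl.IH(2) nd_impI by simp
next
  case (Uni A)
  let ?X = "nn F (Uni (tr (lift_fm 0 F) A))"
  have "?X # \<Gamma> \<tturnstile> Uni (tr (lift_fm 0 F) A)"
  proof (rule nd_allI, rule Uni.IH)
    let ?G = "map (lift_fm 0) (?X # \<Gamma>)"
    have "?G \<tturnstile> lift_fm 0 ?X" by (rule nd_asm) simp
    then have "?G \<tturnstile> nn (lift_fm 0 F) (lift_fm 0 (Uni (tr (lift_fm 0 F) A)))" by simp
    then show "?G \<tturnstile> nn (lift_fm 0 F) (tr (lift_fm 0 F) A)"
      by (rule nn_bind) (rule nnI, rule nd_all_self, rule nd_self)
  qed
  from nd_cut[OF _ this] Uni.prems show ?case by simp
next
  case (Exi A) then show ?case by simp (rule nn_bind[OF _ nd_self])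
qed

lemma tr_stable_bind: "\<Gamma> \<tturnstile> nn F B \<Longrightarrow> B # \<Gamma> \<tturnstile> tr F A \<Longrightarrow> \<Gamma> \<tturnstile> tr F A"
  by (rule tr_stable) (rule nn_bind, assumption, rule nnI)

lemma sub_fm_lift_lift [simp]: "sub_fm (Suc 0) u (lift_fm 0 (lift_fm 0 A)) = lift_fm 0 A"
  unfolding lift_fm_fsubst sub_fm_fsubst fsubst_fsubst
  by (rule arg_cong[where f = "\<lambda>\<sigma>. fsubst \<sigma> A"]) auto

lemma nd_bounded_nn:
  "\<Gamma> \<tturnstile> Uni (Var 0 \<^bold>< lift_tm 0 t \<^bold>\<longrightarrow> nn (lift_fm 0 F) B) \<^bold>\<longrightarrow> nn F (Uni (Var 0 \<^bold>< lift_tm 0 t \<^bold>\<longrightarrow> B))"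
proof -
  let ?F = "lift_fm 0 F"
  let ?L = "\<lambda>w. Uni (Var 0 \<^bold>< lift_tm 0 w \<^bold>\<longrightarrow> nn (lift_fm 0 ?F) (lift_fm 1 B))"
  let ?R = "\<lambda>w. Uni (Var 0 \<^bold>< lift_tm 0 w \<^bold>\<longrightarrow> lift_fm 1 B)"
  let ?D = "?L (Var 0) \<^bold>\<longrightarrow> nn ?F (?R (Var 0))"
  have "\<Gamma> \<tturnstile> sub_fm 0 t ?D"
  proof (rule nd_induct)
    let ?Z = "Uni (Var 0 \<^bold>< Zero \<^bold>\<longrightarrow> nn ?F B)"
    have "?Z # \<Gamma> \<tturnstile> Uni (Var 0 \<^bold>< Zero \<^bold>\<longrightarrow> B)"
      by (intro nd_allI nd_impI) (rule nd_lt_Zero[OF nd_self])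
    then have "\<Gamma> \<tturnstile> ?Z \<^bold>\<longrightarrow> nn F (Uni (Var 0 \<^bold>< Zero \<^bold>\<longrightarrow> B))" by (intro nd_impI[of ?Z] nnI)
    then show "\<Gamma> \<tturnstile> sub_fm 0 Zero ?D" by simp
    let ?G = "?L (Scc (Var 0)) # ?D # map (lift_fm 0) \<Gamma>"
    have "?G \<tturnstile> nn ?F (?R (Scc (Var 0)))"
    proof (rule nn_bind)
      show "?G \<tturnstile> nn ?F (?R (Var 0))"
      proof (rule nd_mp[OF nd_asm[of ?D]], simp, rule nd_allI, rule nd_impI)
        let ?H = "(Var 0 \<^bold>< lift_tm 0 (Var 0)) # map (lift_fm 0) ?G"
        have 1: "?H \<tturnstile> Var 0 \<^bold>< lift_tm 0 (Scc (Var 0)) \<^bold>\<longrightarrow> nn (lift_fm 0 ?F) (lift_fm 1 B)"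
          by (rule nd_all_self, rule nd_asm) simp
        have "?H \<tturnstile> Var 0 \<^bold>< lift_tm 0 (Scc (Var 0))" using nd_lt_SccI[OF nd_self] by simp
        from nd_mp[OF 1 this] show "?H \<tturnstile> nn (lift_fm 0 ?F) (lift_fm 1 B)" .
      qed
      let ?H = "?R (Var 0) # ?G"
      have "?H \<tturnstile> ?L (Scc (Var 0))" by (rule nd_asm) simp
      from nd_allE[OF this, of "Var 0"] have "?H \<tturnstile> Var 0 \<^bold>< Scc (Var 0) \<^bold>\<longrightarrow> nn ?F B" by simp
      from nd_mp[OF this nd_lt_Scc_eqI[OF nd_refl]] have "?H \<tturnstile> nn ?F B" .
      then show "?H \<tturnstile> nn ?F (?R (Scc (Var 0)))"
      proof (rule nn_bind, intro nnI)
        have "B # ?H \<tturnstile> Uni (Var 0 \<^bold>< Scc (Var 1) \<^bold>\<longrightarrow> lift_fm 1 B)"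
          by (rule nd_bounded_step) (rule nd_asm, simp, rule nd_self)
        then show "B # ?H \<tturnstile> ?R (Scc (Var 0))" by simp
      qed
    qed
    then show "?D # map (lift_fm 0) \<Gamma> \<tturnstile> sub_fm 0 (Scc (Var 0)) (lift_fm 1 ?D)"
      by (simp add: nd_impI)
  qed
  then show ?thesis by simp
qed

text \<open>Agreement with the translation for every \<open>F\<close>, exact in one direction and up
  to a double negation relative to \<open>F\<close> in the other. When the conclusion itself is
  chosen as \<open>F\<close>, that double negation disappears; this is how a \<Sigma>-conclusion is
  recovered.\<close>

definition good :: "fm \<Rightarrow> bool" where
  "good A \<longleftrightarrow> (\<forall>\<Gamma> F. (\<Gamma> \<tturnstile> A \<longrightarrow> \<Gamma> \<tturnstile> tr F A) \<and> (\<Gamma> \<tturnstile> tr F A \<longrightarrow> \<Gamma> \<tturnstile> nn F A))"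

lemma goodD: "good A \<Longrightarrow> \<Gamma> \<tturnstile> A \<Longrightarrow> \<Gamma> \<tturnstile> tr F A" "good A \<Longrightarrow> \<Gamma> \<tturnstile> tr F A \<Longrightarrow> \<Gamma> \<tturnstile> nn F A"
  by (auto simp: good_def)

lemma goodI:
  assumes "\<And>\<Gamma> F. A # \<Gamma> \<tturnstile> tr F A" "\<And>\<Gamma> F. tr F A # \<Gamma> \<tturnstile> nn F A"
  shows "good A"
  unfolding good_def using nd_cut[OF _ assms(1)] nd_cut[OF _ assms(2)] by simp

lemma good_Eql: "good (s \<^bold>= t)"
  by (rule goodI) (simp_all add: nnI nd_self)

lemma good_Fls: "good Fls"
  by (rule goodI) (simp_all add: nd_FlsE nd_self nn_F)

lemma good_Conj: assumes "good A" "good B" shows "good (A \<^bold>\<and> B)"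
proof (rule goodI)
  fix \<Gamma> F
  show "(A \<^bold>\<and> B) # \<Gamma> \<tturnstile> tr F (A \<^bold>\<and> B)"
    using goodD(1)[OF assms(1) nd_conj1[OF nd_self]] goodD(1)[OF assms(2) nd_conj2[OF nd_self]]
    by (simp add: nd_conjI)
  let ?G = "tr F (A \<^bold>\<and> B) # \<Gamma>"
  have "?G \<tturnstile> nn F A" by (rule goodD(2)[OF assms(1)], rule nd_conj1[of _ _ "tr F B"], rule nd_asm) simp
  then show "?G \<tturnstile> nn F (A \<^bold>\<and> B)"
  proof (rule nn_bind)
    have "A # ?G \<tturnstile> nn F B"
      by (rule goodD(2)[OF assms(2)], rule nd_conj2[of _ "tr F A"], rule nd_asm) simp
    then show "A # ?G \<tturnstile> nn F (A \<^bold>\<and> B)"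
      by (rule nn_bind) (intro nnI nd_conjI nd_asm; simp)
  qed
qed

lemma good_Disj: assumes "good A" "good B" shows "good (A \<^bold>\<or> B)"
proof (rule goodI)
  fix \<Gamma> F
  show "(A \<^bold>\<or> B) # \<Gamma> \<tturnstile> tr F (A \<^bold>\<or> B)"
    by (simp, rule nnI, rule nd_disjE[OF nd_self])
      (rule nd_disj1[OF goodD(1)[OF assms(1) nd_self]], rule nd_disj2[OF goodD(1)[OF assms(2) nd_self]])
  show "tr F (A \<^bold>\<or> B) # \<Gamma> \<tturnstile> nn F (A \<^bold>\<or> B)"
  proof (simp, rule nn_bind[OF nd_self], rule nd_disjE[OF nd_self])
    fix \<Delta>
    show "tr F A # \<Delta> \<tturnstile> nn F (A \<^bold>\<or> B)"
      by (rule nn_bind[OF goodD(2)[OF assms(1) nd_self] nnI], rule nd_disj1, rule nd_self)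
    show "tr F B # \<Delta> \<tturnstile> nn F (A \<^bold>\<or> B)"
      by (rule nn_bind[OF goodD(2)[OF assms(2) nd_self] nnI], rule nd_disj2, rule nd_self)
  qed
qed

lemma good_Exi: assumes "good A" shows "good (Exi A)"
proof (rule goodI)
  fix \<Gamma> F
  show "Exi A # \<Gamma> \<tturnstile> tr F (Exi A)"
    by (simp, rule nnI, rule nd_exE[OF nd_self], rule nd_ex_self, rule goodD(1)[OF assms nd_self])
  show "tr F (Exi A) # \<Gamma> \<tturnstile> nn F (Exi A)"
  proof (simp, rule nn_bind[OF nd_self], rule nd_exE[OF nd_self])
    fix \<Delta>
    have "tr (lift_fm 0 F) A # \<Delta> \<tturnstile> nn (lift_fm 0 F) (lift_fm 0 (Exi A))"
      by (rule nn_bind[OF goodD(2)[OF assms nd_self] nnI], rule nd_ex_self, rule nd_self)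
    then show "tr (lift_fm 0 F) A # \<Delta> \<tturnstile> lift_fm 0 (nn F (Exi A))" by simp
  qed
qed

lemma good_Impl_tr:
  assumes "good A" "good B" "\<Gamma> \<tturnstile> A \<^bold>\<longrightarrow> B"
  shows "\<Gamma> \<tturnstile> tr F A \<^bold>\<longrightarrow> tr F B"
proof (rule nd_impI, rule tr_stable_bind[OF goodD(2)[OF assms(1) nd_self]], rule goodD(1)[OF assms(2)])
  show "A # tr F A # \<Gamma> \<tturnstile> B"
    by (rule nd_mp[OF nd_weaken[OF assms(3)] nd_self]) auto
qed

text \<open>The hard direction leads from the translated implication back to the implication behind
  a single double negation. With \<open>A\<close> decided, either \<open>B\<close> is obtained or
  the implication holds for lack of \<open>A\<close>.\<close>

lemma good_Impl:
  assumes "good A" "good B" "HA \<^bold>\<turnstile> A \<^bold>\<or> Neg A"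
  shows "good (A \<^bold>\<longrightarrow> B)"
proof (rule goodI)
  fix \<Gamma> F
  show "(A \<^bold>\<longrightarrow> B) # \<Gamma> \<tturnstile> tr F (A \<^bold>\<longrightarrow> B)"
    using good_Impl_tr[OF assms(1,2) nd_self] by simp
  let ?G = "tr F (A \<^bold>\<longrightarrow> B) # \<Gamma>"
  show "?G \<tturnstile> nn F (A \<^bold>\<longrightarrow> B)"
  proof (rule nd_disjE[OF nd_thm[OF assms(3)]])
    have "A # ?G \<tturnstile> tr F B"
      by (rule nd_mp[OF nd_asm goodD(1)[OF assms(1) nd_self, where F = F]]) simp
    then show "A # ?G \<tturnstile> nn F (A \<^bold>\<longrightarrow> B)"
      by (rule nn_bind[OF goodD(2)[OF assms(2)]]) (intro nnI nd_impI nd_asm, simp)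
    show "Neg A # ?G \<tturnstile> nn F (A \<^bold>\<longrightarrow> B)"
      by (rule nnI, rule nd_impI, rule nd_FlsE, rule nd_mp[of _ A]; rule nd_asm; simp)
  qed
qed

lemma good_lt: "good (s \<^bold>< t)"
  unfolding lt_def by (intro good_Exi good_Eql)

lemma good_Uni_lt:
  assumes "good A" shows "good (Uni (Var 0 \<^bold>< lift_tm 0 t \<^bold>\<longrightarrow> A))"
proof (rule goodI)
  fix \<Gamma> F
  let ?v = "Var 0 \<^bold>< lift_tm 0 t" and ?F = "lift_fm 0 F"
  have "Uni (?v \<^bold>\<longrightarrow> A) # \<Gamma> \<tturnstile> Uni (tr ?F ?v \<^bold>\<longrightarrow> tr ?F A)"
    by (rule nd_allI, rule good_Impl_tr[OF good_lt assms], rule nd_all_self, rule nd_asm) simp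
  then show "Uni (?v \<^bold>\<longrightarrow> A) # \<Gamma> \<tturnstile> tr F (Uni (?v \<^bold>\<longrightarrow> A))" by simp
  let ?T = "Uni (tr ?F ?v \<^bold>\<longrightarrow> tr ?F A)"
  have "?T # \<Gamma> \<tturnstile> Uni (?v \<^bold>\<longrightarrow> nn ?F A)"
  proof (intro nd_allI nd_impI[of ?v])
    let ?G = "?v # map (lift_fm 0) (?T # \<Gamma>)"
    have "?G \<tturnstile> tr ?F ?v \<^bold>\<longrightarrow> tr ?F A" by (rule nd_all_self, rule nd_asm) simp
    from goodD(2)[OF assms nd_mp[OF this goodD(1)[OF good_lt nd_self]]]
    show "?G \<tturnstile> nn ?F A" .
  qed
  from nd_mp[OF nd_bounded_nn this] show "tr F (Uni (?v \<^bold>\<longrightarrow> A)) # \<Gamma> \<tturnstile> nn F (Uni (?v \<^bold>\<longrightarrow> A))"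
    by simp
qed

text \<open>The arithmetized syntax bounds by \<le>, the induction on bounds by <; the bound
  \<open>Scc t\<close> mediates between them.\<close>

lemma good_Uni_le:
  assumes "good A" shows "good (Uni (Var 0 \<^bold>\<le> lift_tm 0 t \<^bold>\<longrightarrow> A))"
proof (rule goodI)
  fix \<Gamma> F
  let ?v = "Var 0 \<^bold>\<le> lift_tm 0 t" and ?F = "lift_fm 0 F"
  have le: "good ?v" unfolding le_def by (intro good_Exi good_Eql)
  have "Uni (?v \<^bold>\<longrightarrow> A) # \<Gamma> \<tturnstile> Uni (tr ?F ?v \<^bold>\<longrightarrow> tr ?F A)"
    by (rule nd_allI, rule good_Impl_tr[OF le assms], rule nd_all_self, rule nd_asm) simp
  then show "Uni (?v \<^bold>\<longrightarrow> A) # \<Gamma> \<tturnstile> tr F (Uni (?v \<^bold>\<longrightarrow> A))" by simp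
  let ?T = "Uni (tr ?F ?v \<^bold>\<longrightarrow> tr ?F A)" and ?w = "Var 0 \<^bold>< lift_tm 0 (Scc t)"
  have "?T # \<Gamma> \<tturnstile> Uni (?w \<^bold>\<longrightarrow> nn ?F A)"
  proof (intro nd_allI nd_impI[of ?w])
    let ?G = "?w # map (lift_fm 0) (?T # \<Gamma>)"
    have "?G \<tturnstile> tr ?F ?v \<^bold>\<longrightarrow> tr ?F A" by (rule nd_all_self, rule nd_asm) simp
    moreover have "?G \<tturnstile> ?v" by (rule nd_lt_le, rule nd_asm) simp
    ultimately show "?G \<tturnstile> nn ?F A" using goodD(2)[OF assms nd_mp] goodD(1)[OF le] by blast
  qed
  from nd_mp[OF nd_bounded_nn this] have "?T # \<Gamma> \<tturnstile> nn F (Uni (?w \<^bold>\<longrightarrow> A))" .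
  then have "?T # \<Gamma> \<tturnstile> nn F (Uni (?v \<^bold>\<longrightarrow> A))"
  proof (rule nn_bind, intro nnI nd_allI nd_impI[of ?v])
    let ?G = "?v # map (lift_fm 0) (Uni (?w \<^bold>\<longrightarrow> A) # ?T # \<Gamma>)"
    have "?G \<tturnstile> ?w \<^bold>\<longrightarrow> A" by (rule nd_all_self, rule nd_asm) simp
    moreover have "?G \<tturnstile> ?w" using nd_le_lt[OF nd_self] by simp
    ultimately show "?G \<tturnstile> A" by (rule nd_mp)
  qed
  then show "tr F (Uni (?v \<^bold>\<longrightarrow> A)) # \<Gamma> \<tturnstile> nn F (Uni (?v \<^bold>\<longrightarrow> A))" by simp
qed

lemma good_delta0: "delta0 A \<Longrightarrow> good A"
proof (induction rule: delta0.induct)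
  case (7 A t) then show ?case using good_Uni_lt by simp
qed (auto intro: good_Eql good_lt good_Fls good_Conj good_Disj good_Impl good_Exi delta0_dec)

text \<open>Wider than prenex formulas: arithmetized provability mixes existential quantifiers with
  universal ones bounded by \<le>, as in \<open>Deriv\<close>, and falls into this class as it
  stands.\<close>

inductive Sig :: "fm \<Rightarrow> bool" where
  Sig_delta0: "delta0 A \<Longrightarrow> Sig A"
| Sig_Conj: "Sig A \<Longrightarrow> Sig B \<Longrightarrow> Sig (A \<^bold>\<and> B)"
| Sig_Disj: "Sig A \<Longrightarrow> Sig B \<Longrightarrow> Sig (A \<^bold>\<or> B)"
| Sig_Exi: "Sig A \<Longrightarrow> Sig (Exi A)"
| Sig_Uni: "Sig A \<Longrightarrow> Sig (Uni (Var 0 \<^bold>\<le> lift_tm 0 t \<^bold>\<longrightarrow> A))"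

lemma good_Sig: "Sig A \<Longrightarrow> good A"
  by (induction rule: Sig.induct)
    (auto intro: good_delta0 good_Conj good_Disj good_Exi good_Uni_le)

section \<open>Henkin sets\<close>

instance tm :: countable by countable_datatype
instance fm :: countable by countable_datatype

text \<open>The formulas may be open. Free indices act as Henkin constants; a finite context uses
  only finitely many of them, so fresh ones are always at hand.\<close>

definition henkin :: "fm set \<Rightarrow> bool" where
  "henkin \<Delta> \<longleftrightarrow> Fls \<notin> \<Delta> \<and> HA \<subseteq> \<Delta> \<and>
    (\<forall>A B. (A \<^bold>\<and> B) \<in> \<Delta> \<longleftrightarrow> A \<in> \<Delta> \<and> B \<in> \<Delta>) \<and>
    (\<forall>A B. (A \<^bold>\<or> B) \<in> \<Delta> \<longleftrightarrow> A \<in> \<Delta> \<or> B \<in> \<Delta>) \<and>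
    (\<forall>A B. (A \<^bold>\<longrightarrow> B) \<in> \<Delta> \<longleftrightarrow> (A \<in> \<Delta> \<longrightarrow> B \<in> \<Delta>)) \<and>
    (\<forall>A. Uni A \<in> \<Delta> \<longleftrightarrow> (\<forall>t. sub_fm 0 t A \<in> \<Delta>)) \<and>
    (\<forall>A. Exi A \<in> \<Delta> \<longleftrightarrow> (\<exists>t. sub_fm 0 t A \<in> \<Delta>)) \<and>
    (\<forall>t. (t \<^bold>= t) \<in> \<Delta>) \<and>
    (\<forall>s t A. (s \<^bold>= t) \<in> \<Delta> \<longrightarrow> sub_fm 0 s A \<in> \<Delta> \<longrightarrow> sub_fm 0 t A \<in> \<Delta>)"

lemma nd_fsubst: "\<Gamma> \<tturnstile> A \<Longrightarrow> map (fsubst \<sigma>) \<Gamma> \<tturnstile> fsubst \<sigma> A"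
proof -
  have "fsubst \<sigma> (fold Impl \<Gamma> A) = fold Impl (map (fsubst \<sigma>) \<Gamma>) (fsubst \<sigma> A)"
    by (induction \<Gamma> arbitrary: A) auto
  then show "\<Gamma> \<tturnstile> A \<Longrightarrow> ?thesis" using HA_fsubst[of "fold Impl \<Gamma> A" \<sigma>] by (simp add: nd_def)
qed

lemma closed_list_ex: "\<exists>m. \<forall>A \<in> set \<Gamma>. closed_fm m A"
proof (induction \<Gamma>)
  case (Cons B \<Gamma>)
  then obtain m where m: "\<forall>A \<in> set \<Gamma>. closed_fm m A" by blast
  obtain k where "closed_fm k B" using closed_fm_ex by blast
  then have "\<forall>A \<in> set (B # \<Gamma>). closed_fm (max m k) A"
    using m by (auto intro: closed_fm_mono)
  then show ?case by blast
qed simp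

text \<open>Renaming the fresh variable \<open>Var m\<close> to \<open>Var 0\<close> and lifting everything else turns a
  derivation from a generic instance into one under a quantifier.\<close>

lemma nd_exE_fresh:
  assumes "closed_fm m F" "closed_fm m A" "\<And>B. B \<in> set \<Gamma> \<Longrightarrow> closed_fm m B"
    and "tr F (sub_fm 0 (Var m) A) # map (tr F) \<Gamma> \<tturnstile> F"
  shows "tr (lift_fm 0 F) A # map (lift_fm 0) (map (tr F) \<Gamma>) \<tturnstile> lift_fm 0 F"
proof -
  define \<sigma> where "\<sigma> = (\<lambda>i. if i = m then Var 0 else Var (Suc i))"
  have lift: "fsubst \<sigma> B = lift_fm 0 B" if "closed_fm m B" for B
    unfolding lift_fm_0 by (rule fsubst_closed[OF that]) (simp add: \<sigma>_def)
  have "fsubst \<sigma> (sub_fm 0 (Var m) A) = fsubst Var A"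
    unfolding sub_fm_0 fsubst_fsubst
    by (rule fsubst_closed[OF assms(2)]) (auto simp: \<sigma>_def split: nat.split)
  then have "fsubst \<sigma> (tr F (sub_fm 0 (Var m) A)) = tr (lift_fm 0 F) A"
    by (simp add: fsubst_tr lift assms(1))
  moreover have "map (fsubst \<sigma>) (map (tr F) \<Gamma>) = map (lift_fm 0) (map (tr F) \<Gamma>)"
    by (simp add: fsubst_tr lift_tr lift assms(1,3))
  ultimately show ?thesis
    using nd_fsubst[OF assms(4), of \<sigma>] lift[OF assms(1)] by (simp only: list.map)
qed

text \<open>Consistency of a context means that its translation does not derive \<open>F\<close>. If
  adding \<open>X\<close> destroys it, adding \<open>Neg X\<close> cannot, since the translation of
  \<open>Neg X\<close> is an implication into \<open>F\<close>.\<close>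

lemma henkin_step:
  assumes "\<not> map (tr F) \<Gamma> \<tturnstile> F"
  shows "\<exists>\<Gamma>'. set \<Gamma> \<subseteq> set \<Gamma>' \<and> \<not> map (tr F) \<Gamma>' \<tturnstile> F \<and> (X \<in> set \<Gamma>' \<or> Neg X \<in> set \<Gamma>') \<and>
    (\<forall>A. X = Exi A \<longrightarrow> X \<in> set \<Gamma>' \<longrightarrow> (\<exists>t. sub_fm 0 t A \<in> set \<Gamma>'))"
proof (cases "map (tr F) (X # \<Gamma>) \<tturnstile> F")
  case True
  have X: "X \<notin> set \<Gamma>"
  proof
    assume "X \<in> set \<Gamma>"
    then have "map (tr F) \<Gamma> \<tturnstile> F" by (intro nd_weaken[OF True]) auto
    then show False using assms by simp
  qed
  have "\<not> map (tr F) (Neg X # \<Gamma>) \<tturnstile> F"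
  proof
    assume "map (tr F) (Neg X # \<Gamma>) \<tturnstile> F"
    then have "map (tr F) \<Gamma> \<tturnstile> F" using nd_cut[of "map (tr F) \<Gamma>" "tr F X \<^bold>\<longrightarrow> F"] nd_impI True by simp
    then show False using assms by simp
  qed
  \<comment> \<open>As \<open>X\<close> is not in \<Gamma> either, the witness condition is vacuous
    in this branch.\<close>
  moreover have "X \<noteq> Neg X" by (metis add.right_neutral add_Suc_right fm.size(12) less_add_Suc1 less_irrefl)
  ultimately show ?thesis using X by (intro exI[of _ "Neg X # \<Gamma>"]) auto
next
  case False
  show ?thesis
  proof (cases "\<exists>A. X = Exi A")
    case True
    then obtain A where X: "X = Exi A" by blast
    \<comment> \<open>Index \<open>m\<close> lies above all free indices in sight and serves as the
      fresh witness.\<close>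
    obtain m where m: "\<forall>B \<in> set (F # A # X # \<Gamma>). closed_fm m B" using closed_list_ex by blast
    have "\<not> map (tr F) (sub_fm 0 (Var m) A # X # \<Gamma>) \<tturnstile> F"
    proof
      assume "map (tr F) (sub_fm 0 (Var m) A # X # \<Gamma>) \<tturnstile> F"
      then have h: "tr (lift_fm 0 F) A # map (lift_fm 0) (map (tr F) (X # \<Gamma>)) \<tturnstile> lift_fm 0 F"
        by (intro nd_exE_fresh[of m]) (use m in auto)
      have "map (tr F) (X # \<Gamma>) \<tturnstile> F"
      proof (rule nn_mp)
        let ?E = "Exi (tr (lift_fm 0 F) A)"
        show "map (tr F) (X # \<Gamma>) \<tturnstile> nn F ?E" by (rule nd_asm) (simp add: X)
        show "?E # map (tr F) (X # \<Gamma>) \<tturnstile> F"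
          by (rule nd_exE[OF nd_self]) (rule nd_weaken[OF h], auto)
      qed
      then show False using False by simp
    qed
    then show ?thesis using X by (intro exI[of _ "sub_fm 0 (Var m) A # X # \<Gamma>"]) auto
  next
    case f: False
    then show ?thesis using False by (intro exI[of _ "X # \<Gamma>"]) auto
  qed
qed

text \<open>The translation of an induction axiom is the induction axiom of the translated formula,
  for any \<open>F\<close>. The other axioms are equations or implications from an equation and
  survive the double negation.\<close>

lemma HA_tr: "A \<in> HA \<Longrightarrow> [] \<tturnstile> tr F A"
proof -
  have ind: "[] \<tturnstile> tr F (ind_ax A)" for F A
  proof -
    have "tr F (ind_ax A) = ind_ax (tr (lift_fm 0 F) A)"
      by (simp add: ind_ax_def sub_tr lift_tr)
    then show ?thesis using HA_ind_ax by (simp add: nd_Nil)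
  qed
  have clos: "[] \<tturnstile> tr F ((Uni ^^ n) (ind_ax A))" for F n A
    by (induction n arbitrary: F) (auto simp: ind intro: nd_allI)
  have nneq: "\<Gamma> \<tturnstile> nn F (s \<^bold>= t) \<Longrightarrow> (\<And>\<Delta>. \<Delta> \<tturnstile> s \<^bold>= t \<Longrightarrow> \<Delta> \<tturnstile> u \<^bold>= v) \<Longrightarrow> \<Gamma> \<tturnstile> nn F (u \<^bold>= v)"
    for \<Gamma> F s t u v by (rule nn_bind, assumption, rule nnI) (simp add: nd_self)
  have basic: "[] \<tturnstile> tr F A" if "A \<in> set basic_axioms" for F A
  proof -
    have "[] \<tturnstile> tr F (Uni (Neg (Scc (Var 0) \<^bold>= Zero)))"
      by (simp, rule nd_allI, rule nd_impI, rule nn_mp[OF nd_self], rule nd_Scc_Zero[OF nd_self])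
    moreover have "[] \<tturnstile> tr F (Uni (Uni (Scc (Var 1) \<^bold>= Scc (Var 0) \<^bold>\<longrightarrow> Var 1 \<^bold>= Var 0)))"
      by (simp, rule nd_allI, rule nd_allI, rule nd_impI, rule nneq[OF nd_self], rule nd_Scc_inj)
    moreover have "[] \<tturnstile> tr F (Uni (Add (Var 0) Zero \<^bold>= Var 0))"
      by (simp, rule nd_allI, rule nnI, rule nd_Add_Zero)
    moreover have "[] \<tturnstile> tr F (Uni (Uni (Add (Var 1) (Scc (Var 0)) \<^bold>= Scc (Add (Var 1) (Var 0)))))"
      by (simp, rule nd_allI, rule nd_allI, rule nnI, rule nd_Add_Scc)
    moreover have "[] \<tturnstile> tr F (Uni (Mul (Var 0) Zero \<^bold>= Zero))"
      by (simp, rule nd_allI, rule nnI, rule nd_Mul_Zero)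
    moreover have "[] \<tturnstile> tr F (Uni (Uni (Mul (Var 1) (Scc (Var 0)) \<^bold>= Add (Mul (Var 1) (Var 0)) (Var 1))))"
      by (simp, rule nd_allI, rule nd_allI, rule nnI, rule nd_Mul_Scc)
    ultimately show ?thesis using that unfolding basic_axioms_def by auto
  qed
  show "A \<in> HA \<Longrightarrow> ?thesis" using basic clos by (auto simp: HA_def)
qed

theorem henkin_exists:
  assumes "Sig A" "Sig B" "\<not> HA \<^bold>\<turnstile> A \<^bold>\<longrightarrow> B"
  shows "\<exists>\<Delta>. henkin \<Delta> \<and> A \<in> \<Delta> \<and> B \<notin> \<Delta>"
proof -
  define con where "con = (\<lambda>\<Gamma>. \<not> map (tr B) \<Gamma> \<tturnstile> B)"
  \<comment> \<open>\<open>A\<close> proves its own translation, so a derivation of \<open>B\<close>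
    from the translation would be one from \<open>A\<close>.\<close>
  have con0: "con [A]"
  proof (unfold con_def, rule notI)
    assume "map (tr B) [A] \<tturnstile> B"
    then have "[tr B A] \<tturnstile> B" by simp
    moreover have "[A] \<tturnstile> tr B A" by (rule goodD(1)[OF good_Sig[OF assms(1)] nd_self])
    ultimately have "[A] \<tturnstile> B" using nd_cut[OF _ nd_weaken[of "[tr B A]" B "[tr B A, A]"]] by simp
    then have "HA \<^bold>\<turnstile> A \<^bold>\<longrightarrow> B" by (simp add: nd_Cons nd_Nil)
    then show False using assms(3) by simp
  qed
  \<comment> \<open>Stage \<open>n\<close> decides the formula with number \<open>n\<close> and
    supplies a witness if this is an existential formula that was accepted.\<close>
  define Q where "Q = (\<lambda>n \<Gamma> \<Gamma>'. set \<Gamma> \<subseteq> set \<Gamma>' \<and> ((from_nat n :: fm) \<in> set \<Gamma>' \<or> Neg (from_nat n) \<in> set \<Gamma>') \<and>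
      (\<forall>C. from_nat n = Exi C \<longrightarrow> from_nat n \<in> set \<Gamma>' \<longrightarrow> (\<exists>t. sub_fm 0 t C \<in> set \<Gamma>')))"
  have "\<exists>f. \<forall>n. (con (f n) \<and> (n = 0 \<longrightarrow> A \<in> set (f n))) \<and> Q n (f n) (f (Suc n))"
  proof (rule dependent_nat_choice[of "\<lambda>n \<Gamma>. con \<Gamma> \<and> (n = 0 \<longrightarrow> A \<in> set \<Gamma>)" Q])
    show "\<exists>\<Gamma>. con \<Gamma> \<and> ((0 :: nat) = 0 \<longrightarrow> A \<in> set \<Gamma>)" using con0 by (intro exI[of _ "[A]"]) simp
    fix \<Gamma> and n :: nat assume "con \<Gamma> \<and> (n = 0 \<longrightarrow> A \<in> set \<Gamma>)"
    then show "\<exists>\<Gamma>'. (con \<Gamma>' \<and> (Suc n = 0 \<longrightarrow> A \<in> set \<Gamma>')) \<and> Q n \<Gamma> \<Gamma>'"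
      using henkin_step[of B \<Gamma> "from_nat n"] unfolding con_def Q_def by blast
  qed
  then obtain f where f0: "\<forall>n. (con (f n) \<and> (n = 0 \<longrightarrow> A \<in> set (f n))) \<and> Q n (f n) (f (Suc n))" ..
  have f: "con (f n)" "A \<in> set (f 0)" "set (f n) \<subseteq> set (f (Suc n))"
    "(from_nat n :: fm) \<in> set (f (Suc n)) \<or> Neg (from_nat n) \<in> set (f (Suc n))"
    "from_nat n = Exi C \<Longrightarrow> from_nat n \<in> set (f (Suc n)) \<Longrightarrow> \<exists>t. sub_fm 0 t C \<in> set (f (Suc n))" for n C
    using f0[rule_format, of n] f0[rule_format, of 0] unfolding Q_def by simp_all
  define \<Delta> where "\<Delta> = (\<Union>n. set (f n))"
  have mono: "set (f m) \<subseteq> set (f n)" if "m \<le> n" for m n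
    by (rule lift_Suc_mono_le[of "\<lambda>n. set (f n)", OF f(3) that])
  have fin: "\<exists>n. set \<Gamma> \<subseteq> set (f n)" if "set \<Gamma> \<subseteq> \<Delta>" for \<Gamma>
    using that
  proof (induction \<Gamma>)
    case (Cons C \<Gamma>)
    then obtain n k where "set \<Gamma> \<subseteq> set (f n)" "C \<in> set (f k)" by (auto simp: \<Delta>_def)
    then have "set (C # \<Gamma>) \<subseteq> set (f (max n k))"
      using mono[of n "max n k"] mono[of k "max n k"] by auto
    then show ?case by blast
  qed simp
  have cons: "\<not> map (tr B) \<Gamma> \<tturnstile> B" if G: "set \<Gamma> \<subseteq> \<Delta>" for \<Gamma>
  proof
    assume a: "map (tr B) \<Gamma> \<tturnstile> B"
    obtain n where "set \<Gamma> \<subseteq> set (f n)" using fin[OF G] by blast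
    then have "map (tr B) (f n) \<tturnstile> B" by (intro nd_weaken[OF a]) auto
    then show False using f(1)[of n] by (simp add: con_def)
  qed
  have max: "C \<in> \<Delta> \<or> Neg C \<in> \<Delta>" for C
    using f(4)[of "to_nat C"] unfolding \<Delta>_def from_nat_to_nat by blast
  have ded: "C \<in> \<Delta>" if "set \<Gamma> \<subseteq> \<Delta>" "map (tr B) \<Gamma> \<tturnstile> tr B C" for \<Gamma> C
  proof (rule ccontr)
    assume "C \<notin> \<Delta>"
    then have "set (Neg C # \<Gamma>) \<subseteq> \<Delta>" using max that(1) by auto
    from cons[OF this] show False
      using nd_mp[OF nd_self nd_weaken1[OF that(2)], of B] by simp
  qed
  have neg: "Neg C \<in> \<Delta> \<longleftrightarrow> C \<notin> \<Delta>" for C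
  proof
    assume n: "Neg C \<in> \<Delta>"
    show "C \<notin> \<Delta>"
    proof
      assume "C \<in> \<Delta>"
      then have "set [Neg C, C] \<subseteq> \<Delta>" using n by simp
      moreover have "map (tr B) [Neg C, C] \<tturnstile> B"
        by (simp, rule nd_mp[OF nd_self], rule nd_asm, simp)
      ultimately show False using cons by blast
    qed
  qed (use max in blast)
  have "map (tr B) [Fls] \<tturnstile> B" by (simp, rule nd_self)
  then have fls: "Fls \<notin> \<Delta>" using cons[of "[Fls]"] by auto
  have conj: "(C \<^bold>\<and> D) \<in> \<Delta> \<longleftrightarrow> C \<in> \<Delta> \<and> D \<in> \<Delta>" for C D
  proof
    assume cd: "(C \<^bold>\<and> D) \<in> \<Delta>"
    have "map (tr B) [C \<^bold>\<and> D] \<tturnstile> tr B C" "map (tr B) [C \<^bold>\<and> D] \<tturnstile> tr B D"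
      by (simp, rule nd_conj1[OF nd_self]) (simp, rule nd_conj2[OF nd_self])
    then show "C \<in> \<Delta> \<and> D \<in> \<Delta>" using ded[of "[C \<^bold>\<and> D]" C] ded[of "[C \<^bold>\<and> D]" D] cd by simp
  next
    assume cd: "C \<in> \<Delta> \<and> D \<in> \<Delta>"
    have "map (tr B) [C, D] \<tturnstile> tr B (C \<^bold>\<and> D)"
      by (simp, rule nd_conjI[OF nd_self nd_weaken1[OF nd_self]])
    then show "(C \<^bold>\<and> D) \<in> \<Delta>" using ded[of "[C, D]"] cd by simp
  qed
  have disj: "(C \<^bold>\<or> D) \<in> \<Delta> \<longleftrightarrow> C \<in> \<Delta> \<or> D \<in> \<Delta>" for C D
  proof
    assume cd: "(C \<^bold>\<or> D) \<in> \<Delta>"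
    show "C \<in> \<Delta> \<or> D \<in> \<Delta>"
    proof (rule ccontr)
      assume "\<not> (C \<in> \<Delta> \<or> D \<in> \<Delta>)"
      then have s: "set [C \<^bold>\<or> D, Neg C, Neg D] \<subseteq> \<Delta>" using cd neg by auto
      have "[tr B (C \<^bold>\<or> D), tr B C \<^bold>\<longrightarrow> B, tr B D \<^bold>\<longrightarrow> B] \<tturnstile> B" (is "?G \<tturnstile> B")
      proof (rule nn_mp)
        show "?G \<tturnstile> nn B (tr B C \<^bold>\<or> tr B D)" using nd_self by simp
        show "(tr B C \<^bold>\<or> tr B D) # ?G \<tturnstile> B"
          by (rule nd_disjE[OF nd_self]) ((rule nd_mp[OF nd_asm nd_self], simp)+)
      qed
      then show False using cons[OF s] by simp
    qed
  next
    assume "C \<in> \<Delta> \<or> D \<in> \<Delta>"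
    moreover have "map (tr B) [C] \<tturnstile> tr B (C \<^bold>\<or> D)" "map (tr B) [D] \<tturnstile> tr B (C \<^bold>\<or> D)"
      by (simp, rule nnI[OF nd_disj1[OF nd_self]]) (simp, rule nnI[OF nd_disj2[OF nd_self]])
    ultimately show "(C \<^bold>\<or> D) \<in> \<Delta>"
      by (elim disjE) (rule ded[of "[C]"], simp, assumption, rule ded[of "[D]"], simp, assumption)
  qed
  have impl: "(C \<^bold>\<longrightarrow> D) \<in> \<Delta> \<longleftrightarrow> (C \<in> \<Delta> \<longrightarrow> D \<in> \<Delta>)" for C D
  proof
    assume cd: "(C \<^bold>\<longrightarrow> D) \<in> \<Delta>"
    have "map (tr B) [C \<^bold>\<longrightarrow> D, C] \<tturnstile> tr B D"
      by (simp, rule nd_mp[OF nd_self], rule nd_asm, simp)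
    then show "C \<in> \<Delta> \<longrightarrow> D \<in> \<Delta>" using ded[of "[C \<^bold>\<longrightarrow> D, C]" D] cd by simp
  next
    assume cd: "C \<in> \<Delta> \<longrightarrow> D \<in> \<Delta>"
    show "(C \<^bold>\<longrightarrow> D) \<in> \<Delta>"
    proof (cases "D \<in> \<Delta>")
      case True
      moreover have "map (tr B) [D] \<tturnstile> tr B (C \<^bold>\<longrightarrow> D)"
        by (simp, rule nd_impI, rule nd_asm, simp)
      ultimately show ?thesis using ded[of "[D]" "C \<^bold>\<longrightarrow> D"] by simp
    next
      case False
      then have "Neg C \<in> \<Delta>" using cd neg by simp
      moreover have "map (tr B) [Neg C] \<tturnstile> tr B (C \<^bold>\<longrightarrow> D)"
      \<comment> \<open>Both hypotheses together give \<open>B\<close>, from which any translated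
        formula follows by stability.\<close>
      proof (simp, rule nd_impI, rule tr_stable, rule nn_F)
        show "[tr B C, tr B C \<^bold>\<longrightarrow> B] \<tturnstile> B" by (rule nd_mp[OF nd_asm nd_self]) simp
      qed
      ultimately show ?thesis using ded[of "[Neg C]" "C \<^bold>\<longrightarrow> D"] by simp
    qed
  qed
  have exi: "Exi C \<in> \<Delta> \<longleftrightarrow> (\<exists>t. sub_fm 0 t C \<in> \<Delta>)" for C
  proof
    assume e: "Exi C \<in> \<Delta>"
    have "Exi C \<in> set (f (Suc (to_nat (Exi C))))"
    proof (rule ccontr)
      assume "Exi C \<notin> set (f (Suc (to_nat (Exi C))))"
      then have "Neg (Exi C) \<in> \<Delta>" using f(4)[of "to_nat (Exi C)"] by (auto simp: \<Delta>_def)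
      then show False using e neg by simp
    qed
    then show "\<exists>t. sub_fm 0 t C \<in> \<Delta>" using f(5)[of "to_nat (Exi C)" C] by (auto simp: \<Delta>_def)
  next
    assume "\<exists>t. sub_fm 0 t C \<in> \<Delta>"
    then obtain t where t: "sub_fm 0 t C \<in> \<Delta>" by blast
    have "[tr B (sub_fm 0 t C)] \<tturnstile> Exi (tr (lift_fm 0 B) C)"
      by (rule nd_exI[of _ t]) (simp add: sub_tr nd_self)
    from nnI[OF this] show "Exi C \<in> \<Delta>" using ded[of "[sub_fm 0 t C]" "Exi C"] t by simp
  qed
  have uni: "Uni C \<in> \<Delta> \<longleftrightarrow> (\<forall>t. sub_fm 0 t C \<in> \<Delta>)" for C
  proof
    assume u: "Uni C \<in> \<Delta>"
    show "\<forall>t. sub_fm 0 t C \<in> \<Delta>"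
    proof
      fix t
      have "[tr B (Uni C)] \<tturnstile> sub_fm 0 t (tr (lift_fm 0 B) C)"
        by (rule nd_allE) (simp add: nd_self)
      then show "sub_fm 0 t C \<in> \<Delta>" using ded[of "[Uni C]" "sub_fm 0 t C"] u by (simp add: sub_tr)
    qed
  next
    assume a: "\<forall>t. sub_fm 0 t C \<in> \<Delta>"
    show "Uni C \<in> \<Delta>"
    proof (rule ccontr)
      assume "Uni C \<notin> \<Delta>"
      then have n: "Neg (Uni C) \<in> \<Delta>" using neg by simp
      let ?T = "tr (lift_fm 0 B) C" and ?F = "lift_fm 0 B"
      \<comment> \<open>The classical passage from a refuted universal statement to a
        counterexample: stability of \<open>?T\<close> turns the absence of counterexamples into
        \<open>Uni ?T\<close>.\<close>
      let ?N = "Exi (?T \<^bold>\<longrightarrow> ?F)"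
      have "(?N \<^bold>\<longrightarrow> B) # [Uni ?T \<^bold>\<longrightarrow> B] \<tturnstile> B" (is "?G \<tturnstile> B")
      proof (rule nd_mp[of _ "Uni ?T"])
        show "?G \<tturnstile> Uni ?T \<^bold>\<longrightarrow> B" by (rule nd_asm) simp
        show "?G \<tturnstile> Uni ?T"
        proof (rule nd_allI, rule tr_stable, rule nd_impI)
          let ?H = "(?T \<^bold>\<longrightarrow> ?F) # map (lift_fm 0) ?G"
          have "?H \<tturnstile> lift_fm 0 ?N \<^bold>\<longrightarrow> ?F" by (rule nd_asm) simp
          then show "?H \<tturnstile> ?F" by (rule nd_mp) (rule nd_ex_self, rule nd_self)
        qed
      qed
      then have "map (tr B) [Neg (Uni C)] \<tturnstile> tr B (Exi (Neg C))" by (simp add: nd_impI)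
      then have "Exi (Neg C) \<in> \<Delta>" using ded[of "[Neg (Uni C)]" "Exi (Neg C)"] n by simp
      then obtain t where "Neg (sub_fm 0 t C) \<in> \<Delta>" using exi by auto
      then show False using neg a by simp
    qed
  qed
  have refl: "(t \<^bold>= t) \<in> \<Delta>" for t
    using ded[of "[]" "t \<^bold>= t"] nnI[OF nd_refl] by simp
  have subst: "sub_fm 0 t C \<in> \<Delta>" if "(s \<^bold>= t) \<in> \<Delta>" "sub_fm 0 s C \<in> \<Delta>" for s t C
  proof -
    let ?G = "map (tr B) [s \<^bold>= t, sub_fm 0 s C]"
    have "?G \<tturnstile> nn B (s \<^bold>= t)" using nd_self by simp
    then have "?G \<tturnstile> tr B (sub_fm 0 t C)"
    proof (rule tr_stable_bind)
      have "(s \<^bold>= t) # ?G \<tturnstile> sub_fm 0 s (tr (lift_fm 0 B) C)" by (rule nd_asm) (simp add: sub_tr)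
      from nd_subst[OF nd_self this] show "(s \<^bold>= t) # ?G \<tturnstile> tr B (sub_fm 0 t C)" by (simp add: sub_tr)
    qed
    then show ?thesis using ded[of "[s \<^bold>= t, sub_fm 0 s C]"] that by simp
  qed
  have ha: "HA \<subseteq> \<Delta>" by (rule subsetI, rule ded[of "[]"]) (simp_all add: HA_tr)
  have "A \<in> \<Delta>" using f(2) by (auto simp: \<Delta>_def)
  \<comment> \<open>The translation of \<open>B\<close> relative to \<open>B\<close> itself gives
    \<open>nn B B\<close>, and this gives \<open>B\<close>.\<close>
  moreover have "B \<notin> \<Delta>"
  proof
    assume "B \<in> \<Delta>"
    moreover have "map (tr B) [B] \<tturnstile> B"
      using nn_mp[OF goodD(2)[OF good_Sig[OF assms(2)] nd_self] nd_self] by simp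
    ultimately show False using cons[of "[B]"] by simp
  qed
  moreover have "henkin \<Delta>"
    unfolding henkin_def using fls ha conj disj impl uni exi refl subst by simp
  ultimately show ?thesis by blast
qed

section \<open>Models of Peano arithmetic\<close>

definition scons :: "'a \<Rightarrow> (nat \<Rightarrow> 'a) \<Rightarrow> nat \<Rightarrow> 'a"  (infixr "##" 65) where
  "x ## e = case_nat x e"

lemma scons_simps [simp]: "(x ## e) 0 = x" "(x ## e) (Suc i) = e i"
  "(x ## e) (numeral k) = e (pred_numeral k)"
  by (simp_all add: scons_def numeral_eq_Suc)

class pa_ops = zero + one + plus + times + minus + ord

primrec val :: "(nat \<Rightarrow> 'a::pa_ops) \<Rightarrow> tm \<Rightarrow> 'a" where
  "val e (Var i) = e i"
| "val e Zero = 0"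
| "val e (Scc t) = val e t + 1"
| "val e (Add s t) = val e s + val e t"
| "val e (Mul s t) = val e s * val e t"

primrec sat :: "(nat \<Rightarrow> 'a::pa_ops) \<Rightarrow> fm \<Rightarrow> bool" where
  "sat e (s \<^bold>= t) \<longleftrightarrow> val e s = val e t"
| "sat e Fls \<longleftrightarrow> False"
| "sat e (A \<^bold>\<and> B) \<longleftrightarrow> sat e A \<and> sat e B"
| "sat e (A \<^bold>\<or> B) \<longleftrightarrow> sat e A \<or> sat e B"
| "sat e (A \<^bold>\<longrightarrow> B) \<longleftrightarrow> (sat e A \<longrightarrow> sat e B)"
| "sat e (Uni A) \<longleftrightarrow> (\<forall>x. sat (x ## e) A)"
| "sat e (Exi A) \<longleftrightarrow> (\<exists>x. sat (x ## e) A)"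

lemma val_tsubst: "val e (tsubst \<sigma> t) = val (\<lambda>i. val e (\<sigma> i)) t"
  by (induction t) auto

lemma val_lift [simp]: "val (x ## e) (lift_tm 0 t) = val e t"
  by (simp add: lift_tm_0 val_tsubst)

lemma sat_fsubst: "sat e (fsubst \<sigma> A) = sat (\<lambda>i. val e (\<sigma> i)) A"
proof (induction A arbitrary: e \<sigma>)
  have *: "(\<lambda>i. val (x ## e) (up \<sigma> i)) = x ## (\<lambda>i. val e (\<sigma> i))" for x :: 'a and e \<sigma>
    by (rule ext) (auto simp: up_def scons_def lift_tm_0 val_tsubst split: nat.split)
  { case (Uni A) then show ?case by (simp add: *) }
  { case (Exi A) then show ?case by (simp add: *) }
qed (auto simp: val_tsubst)

lemma sat_lift [simp]: "sat (x ## e) (lift_fm 0 A) = sat e A"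
  by (simp add: lift_fm_0 sat_fsubst)

lemma sat_sub [simp]: "sat e (sub_fm 0 t A) = sat (val e t ## e) A"
proof -
  have "(\<lambda>i. val e (case_nat t Var i)) = val e t ## e"
    by (rule ext) (simp add: scons_def split: nat.split)
  then show ?thesis by (simp add: sub_fm_0 sat_fsubst)
qed

lemma val_closed: "closed_tm k t \<Longrightarrow> (\<And>i. i < k \<Longrightarrow> e i = f i) \<Longrightarrow> val e t = val f t"
  by (induction t) auto

lemma sat_closed: "closed_fm k A \<Longrightarrow> (\<And>i. i < k \<Longrightarrow> e i = f i) \<Longrightarrow> sat e A = sat f A"
proof (induction A arbitrary: k e f)
  case (Eql s t) then show ?case using val_closed[of k _ e f] by simp
next
  case (Conj A B)
  from Conj.IH(1)[of k e f] Conj.IH(2)[of k e f] Conj.prems show ?case by simp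
next
  case (Disj A B)
  from Disj.IH(1)[of k e f] Disj.IH(2)[of k e f] Disj.prems show ?case by simp
next
  case (Impl A B)
  from Impl.IH(1)[of k e f] Impl.IH(2)[of k e f] Impl.prems show ?case by simp
next
  case (Uni A)
  have "sat (x ## e) A = sat (x ## f) A" for x
    by (rule Uni.IH[of "Suc k"]) (use Uni.prems in \<open>auto simp: scons_def split: nat.split\<close>)
  then show ?case by simp
next
  case (Exi A)
  have "sat (x ## e) A = sat (x ## f) A" for x
    by (rule Exi.IH[of "Suc k"]) (use Exi.prems in \<open>auto simp: scons_def split: nat.split\<close>)
  then show ?case by simp
qed simp

text \<open>Order and truncated subtraction are definable; they are included so that the library classes
  for ordered semirings apply.\<close>

class pa = pa_ops +
  assumes pa_Suc_ne: "x + 1 \<noteq> 0"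
    and pa_Suc_inj: "x + 1 = y + 1 \<Longrightarrow> x = y"
    and pa_one: "0 + 1 = 1"
    and pa_add_0: "x + 0 = x"
    and pa_add_Suc: "x + (y + 1) = x + y + 1"
    and pa_mult_0: "x * 0 = 0"
    and pa_mult_Suc: "x * (y + 1) = x * y + x"
    and pa_less: "x < y \<longleftrightarrow> (\<exists>z. z + x + 1 = y)"
    and pa_le: "x \<le> y \<longleftrightarrow> (\<exists>z. z + x = y)"
    and pa_minus: "x - y = (if y \<le> x then THE z. z + y = x else 0)"
    and pa_induct: "sat (0 ## e) A \<Longrightarrow> (\<And>x. sat (x ## e) A \<Longrightarrow> sat ((x + 1) ## e) A) \<Longrightarrow> sat (x ## e) A"

section \<open>Semiring and order laws in an arbitrary model\<close>

lemma pa_0_add: "0 + x = (x :: 'a :: pa)"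
  using pa_induct[of "\<lambda>_. 0" "Add Zero (Var 0) \<^bold>= Var 0" x]
  by (simp add: pa_add_0 pa_add_Suc)

text \<open>Like the laws that follow, an instance of \<open>pa_induct\<close>: index 0 is the
  induction variable, the further indices hold parameters, and the environment supplies their
  values.\<close>

lemma pa_Suc_add: "(y + 1) + x = y + x + (1 :: 'a :: pa)"
  using pa_induct[of "\<lambda>_. y" "Add (Scc (Var 1)) (Var 0) \<^bold>= Scc (Add (Var 1) (Var 0))" x]
  by (simp add: pa_add_0 pa_add_Suc)

lemma pa_add_comm: "x + y = y + (x :: 'a :: pa)"
  using pa_induct[of "\<lambda>_. x" "Add (Var 1) (Var 0) \<^bold>= Add (Var 0) (Var 1)" y]
  by (simp add: pa_add_0 pa_0_add pa_add_Suc pa_Suc_add)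

lemma pa_add_assoc: "x + y + z = x + (y + (z :: 'a :: pa))"
  using pa_induct[of "x ## (\<lambda>_. y)" "Add (Add (Var 1) (Var 2)) (Var 0) \<^bold>= Add (Var 1) (Add (Var 2) (Var 0))" z]
  by (simp add: pa_add_0 pa_add_Suc)

lemma pa_add_cancel: "x + z = y + z \<Longrightarrow> x = (y :: 'a :: pa)"
  using pa_induct[of "x ## (\<lambda>_. y)" "Add (Var 1) (Var 0) \<^bold>= Add (Var 2) (Var 0) \<^bold>\<longrightarrow> Var 1 \<^bold>= Var 2" z]
  by (simp add: pa_add_0 pa_add_Suc) (metis pa_Suc_inj)

lemma pa_0_mult: "0 * x = (0 :: 'a :: pa)"
  using pa_induct[of "\<lambda>_. 0" "Mul Zero (Var 0) \<^bold>= Zero" x]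
  by (simp add: pa_add_0 pa_mult_0 pa_mult_Suc)

lemma pa_Suc_mult: "(y + 1) * x = y * x + (x :: 'a :: pa)"
  using pa_induct[of "\<lambda>_. y" "Mul (Scc (Var 1)) (Var 0) \<^bold>= Add (Mul (Var 1) (Var 0)) (Var 0)" x]
  by (simp add: pa_add_0 pa_mult_0 pa_mult_Suc pa_add_Suc) (metis pa_add_assoc pa_add_comm)

lemma pa_mult_comm: "x * y = y * (x :: 'a :: pa)"
  using pa_induct[of "\<lambda>_. x" "Mul (Var 1) (Var 0) \<^bold>= Mul (Var 0) (Var 1)" y]
  by (simp add: pa_mult_0 pa_0_mult pa_mult_Suc pa_Suc_mult)

lemma pa_distrib: "(x + y) * z = x * z + y * (z :: 'a :: pa)"
  using pa_induct[of "x ## (\<lambda>_. y)" "Mul (Add (Var 1) (Var 2)) (Var 0) \<^bold>= Add (Mul (Var 1) (Var 0)) (Mul (Var 2) (Var 0))" z]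
  by (simp add: pa_mult_0 pa_mult_Suc pa_add_0) (metis pa_add_assoc pa_add_comm)

lemma pa_mult_assoc: "x * y * z = x * (y * (z :: 'a :: pa))"
  using pa_induct[of "x ## (\<lambda>_. y)" "Mul (Mul (Var 1) (Var 2)) (Var 0) \<^bold>= Mul (Var 1) (Mul (Var 2) (Var 0))" z]
  by (simp add: pa_mult_0 pa_mult_Suc) (metis pa_distrib pa_mult_comm)

lemma pa_cases: obtains "x = (0 :: 'a :: pa)" | y where "x = y + 1"
  using pa_induct[of "\<lambda>_. 0" "Var 0 \<^bold>= Zero \<^bold>\<or> Exi (Var 1 \<^bold>= Scc (Var 0))" x] by auto

lemma pa_add_0_iff: "x + y = 0 \<Longrightarrow> y = (0 :: 'a :: pa)"
  by (metis pa_cases pa_add_Suc pa_Suc_ne)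

lemma pa_linear: "x \<le> y \<or> y \<le> (x :: 'a :: pa)"
proof -
  have "(\<exists>z. z + x = y) \<or> (\<exists>z. z + y = x)"
  proof -
    have step: "(\<exists>z. z + x = w + 1) \<or> (\<exists>z. z + (w + 1) = x)"
      if "(\<exists>z. z + x = w) \<or> (\<exists>z. z + w = x)" for w
      using that
    proof
      assume "\<exists>z. z + x = w"
      then show ?thesis by (metis pa_Suc_add)
    next
      assume "\<exists>z. z + w = x"
      then obtain z where z: "z + w = x" by blast
      show ?thesis by (cases z rule: pa_cases) (use z in \<open>metis pa_0_add pa_Suc_add pa_add_comm pa_add_assoc\<close>)+
    qed
    show ?thesis
      using pa_induct[of "\<lambda>_. x" "Exi (Add (Var 0) (Var 2) \<^bold>= Var 1) \<^bold>\<or> Exi (Add (Var 0) (Var 1) \<^bold>= Var 2)" y] step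
      by (auto simp: pa_add_0)
  qed
  then show ?thesis by (simp add: pa_le)
qed

instance pa \<subseteq> linordered_semidom
proof
  fix a b c d :: 'a
  show "a + b + c = a + (b + c)" by (rule pa_add_assoc)
  show "a + b = b + a" by (rule pa_add_comm)
  show "0 + a = a" by (rule pa_0_add)
  show "a * b * c = a * (b * c)" by (rule pa_mult_assoc)
  show "a * b = b * a" by (rule pa_mult_comm)
  show "1 * a = a" by (metis pa_one pa_Suc_mult pa_0_mult pa_0_add)
  show "(a + b) * c = a * c + b * c" by (rule pa_distrib)
  show "a * (b + c) = a * b + a * c" by (metis pa_distrib pa_mult_comm)
  show "0 * a = 0" by (rule pa_0_mult)
  show "a * 0 = 0" by (rule pa_mult_0)
  show "(0::'a) \<noteq> 1" by (metis pa_one pa_Suc_ne)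
  have minus: "a - b = c" if "c + b = a" for a b c :: 'a
    using that unfolding pa_minus pa_le by (auto intro: pa_add_cancel)
  have minus0: "a - b = 0" if "\<not> b \<le> a" for a b :: 'a using that by (simp add: pa_minus)
  show ab: "a + b - a = b" for a b :: 'a by (rule minus) (rule pa_add_comm)
  have antisym: "a = b" if "a \<le> b" "b \<le> a" for a b :: 'a
    using that unfolding pa_le by (metis pa_0_add pa_add_cancel pa_add_assoc pa_add_0_iff)
  have trans: "a \<le> c" if "a \<le> b" "b \<le> c" for a b c :: 'a
    using that unfolding pa_le by (metis pa_add_assoc)
  have addle: "a \<le> b + a" for a b :: 'a unfolding pa_le by blast
  show "a - b - c = a - (b + c)"
  proof (cases "b \<le> a")
    case True
    then obtain z where z: "z + b = a" by (auto simp: pa_le)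
    then have 1: "a - b = z" by (rule minus)
    show ?thesis
    proof (cases "c \<le> z")
      case True
      then obtain w where w: "w + c = z" by (auto simp: pa_le)
      then show ?thesis using 1 minus[OF w] minus[of w "b + c" a] z
        by (metis pa_add_assoc pa_add_comm)
    next
      case False
      have "\<not> b + c \<le> a"
      proof
        assume "b + c \<le> a"
        then obtain w where "w + (b + c) = a" by (auto simp: pa_le)
        then have "w + c = z" using z by (metis pa_add_assoc pa_add_comm pa_add_cancel)
        then show False using False by (auto simp: pa_le)
      qed
      then show ?thesis using 1 minus0 False by simp
    qed
  next
    case False
    have "\<not> b + c \<le> a" using False trans[of b "b + c" a] addle[of b c] by (auto simp: pa_add_comm)
    moreover have "0 - c = 0"
      by (metis minus minus0 pa_0_add pa_add_0_iff pa_le)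
    ultimately show ?thesis using minus0 False by simp
  qed
  show "a \<le> a" unfolding pa_le by (metis pa_0_add)
  show "a \<le> b \<Longrightarrow> b \<le> c \<Longrightarrow> a \<le> c" by (rule trans)
  show "a \<le> b \<Longrightarrow> b \<le> a \<Longrightarrow> a = b" by (rule antisym)
  show "a \<le> b \<or> b \<le> a" by (rule pa_linear)
  show less: "a < b \<longleftrightarrow> a \<le> b \<and> \<not> b \<le> a" for a b :: 'a
  proof
    assume "a < b"
    then obtain z where z: "z + a + 1 = b" by (auto simp: pa_less)
    have "a \<le> b" using z unfolding pa_le by (metis pa_Suc_add)
    moreover have "a \<noteq> b"
    proof
      assume "a = b"
      then have "z + 1 + a = 0 + a" using z by (simp add: pa_Suc_add pa_0_add)
      then show False using pa_add_cancel pa_Suc_ne by blast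
    qed
    ultimately show "a \<le> b \<and> \<not> b \<le> a" using antisym by blast
  next
    assume *: "a \<le> b \<and> \<not> b \<le> a"
    then obtain z where z: "z + a = b" by (auto simp: pa_le)
    show "a < b"
    proof (cases z rule: pa_cases)
      case 1 then show ?thesis using * z by (metis pa_0_add pa_le)
    next
      case (2 y) then show ?thesis using z by (auto simp: pa_less pa_Suc_add)
    qed
  qed
  show add_mono: "a \<le> b \<Longrightarrow> c + a \<le> c + b" unfolding pa_le by (metis pa_add_assoc pa_add_comm)
  show "b \<le> a \<Longrightarrow> a - b + b = a" using minus by (auto simp: pa_le)
  show "0 < (1::'a)" unfolding pa_less by (metis pa_0_add pa_one)
  have prod0: "a * b \<noteq> 0" if "a \<noteq> 0" "b \<noteq> 0" for a b :: 'a
    using that by (metis pa_cases pa_mult_Suc pa_add_Suc pa_Suc_ne)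
  show "a \<noteq> 0 \<Longrightarrow> b \<noteq> 0 \<Longrightarrow> a * b \<noteq> 0" by (rule prod0)
  show "a < b \<Longrightarrow> 0 < c \<Longrightarrow> c * a < c * b"
  proof -
    assume ab: "a < b" and c: "0 < c"
    then obtain z w where z: "z + a + 1 = b" and w: "w + 0 + 1 = c" by (auto simp: pa_less)
    have "c * b = c * z + c * a + c" using z by (metis pa_distrib pa_mult_comm pa_mult_Suc)
    also have "\<dots> = (c * z + w) + c * a + 1" using w
      by (metis pa_add_0 pa_add_Suc pa_add_assoc pa_add_comm)
    finally show "c * a < c * b" by (auto simp: pa_less)
  qed
  show "a * (b - c) = a * b - a * c"
  proof (cases "c \<le> b")
    case True
    then obtain z where z: "z + c = b" by (auto simp: pa_le)
    have "a * z + a * c = a * b" using z by (metis pa_distrib pa_mult_comm)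
    from minus[OF this] minus[OF z] show ?thesis by simp
  next
    case False
    show ?thesis
    proof (cases "a = 0")
      case True then show ?thesis using minus[of 0 0 0] by (simp add: pa_0_mult pa_add_0)
    next
      case a: False
      have "b \<le> c" "b \<noteq> c" using False pa_linear[of b c] pa_linear[of c c] by auto
      then obtain z where z: "z + b = c" by (auto simp: pa_le)
      have "z \<noteq> 0" using z \<open>b \<noteq> c\<close> by (auto simp: pa_0_add)
      have 1: "a * z + a * b = a * c" using z by (metis pa_distrib pa_mult_comm)
      have "\<not> a * c \<le> a * b"
      proof
        assume "a * c \<le> a * b"
        then have "a * z + a * b = 0 + a * b" using 1 antisym[of "a * b" "a * c"] addle[of "a * b" "a * z"]
          by (simp add: pa_0_add)
        then have "a * z = 0" by (rule pa_add_cancel)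
        then show False using prod0 a \<open>z \<noteq> 0\<close> by blast
      qed
      then show ?thesis using minus0 False by (simp add: pa_mult_0)
    qed
  qed
qed

instance pa \<subseteq> canonically_ordered_monoid_add
  by standard (auto simp: pa_le add.commute)

instance nat :: pa_ops ..

text \<open>The standard model. In it coded proofs are actual proofs, on which the end of the
  completeness argument relies.\<close>

instance nat :: pa
proof
  fix x y :: nat and e :: "nat \<Rightarrow> nat" and A
  show "(x < y) = (\<exists>z. z + x + 1 = y)" by (auto simp: less_iff_Suc_add add.commute)
  show "(x \<le> y) = (\<exists>z. z + x = y)" by (auto simp: le_iff_add add.commute)
  show "x - y = (if y \<le> x then THE z. z + y = x else 0)"
    by (auto intro!: the_equality[symmetric])
  assume "sat (0 ## e) A" "\<And>x. sat (x ## e) A \<Longrightarrow> sat ((x + 1) ## e) A"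
  then show "sat (x ## e) A" by (induction x) auto
qed auto

lemma pa_less_Suc [simp]: "x < y + 1 \<longleftrightarrow> x \<le> (y :: 'a :: pa)"
  unfolding pa_less[of x "y + 1"] pa_le[of x y] by simp

lemma pa_Suc_le [simp]: "x + 1 \<le> y \<longleftrightarrow> x < (y :: 'a :: pa)"
  unfolding pa_less[of x y] pa_le[of "x + 1" y] by (simp add: add.assoc)

lemma val_shift [simp]: "val e ((lift_tm 0 ^^ n) t) = val (\<lambda>i. e (i + n)) t"
proof (induction n arbitrary: t)
  case (Suc n)
  show ?case by (simp only: funpow_Suc_right o_apply Suc) (simp add: lift_tm_0 val_tsubst)
qed simp

lemma sat_lt [simp]: "sat e (s \<^bold>< t) \<longleftrightarrow> val e s < (val e t :: 'a :: pa)"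
  by (simp add: lt_def pa_less)

lemma sat_le [simp]: "sat e (s \<^bold>\<le> t) \<longleftrightarrow> val e s \<le> (val e t :: 'a :: pa)"
  by (simp add: le_def pa_le)

lemma sat_lift_1 [simp]: "sat (x ## y ## e) (lift_fm (Suc 0) A) = sat (x ## e) A"
  unfolding lift_fm_fsubst sat_fsubst
  by (rule arg_cong[where f = "\<lambda>e. sat e A"]) (auto simp: scons_def split: nat.split)

lemma sat_lift_2 [simp]: "sat (x ## y ## z ## e) (lift_fm (Suc (Suc 0)) A) = sat (x ## y ## e) A"
  unfolding lift_fm_fsubst sat_fsubst
  by (rule arg_cong[where f = "\<lambda>e. sat e A"]) (auto simp: scons_def split: nat.split)

lemma val_num [simp]: "val e (num n) = (of_nat n :: 'a :: pa)"
  by (induction n) (auto simp: add.commute)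

text \<open>Definability with parameters. No induction of the metatheory reaches nonstandard
  elements, so every induction in a model first exhibits a formula for its predicate.\<close>

definition dfb :: "('a :: pa \<Rightarrow> bool) \<Rightarrow> bool" where
  "dfb P \<longleftrightarrow> (\<exists>A e. \<forall>x. P x = sat (x ## e) A)"

lemma dfbI: "(\<And>x. P x = sat (x ## e) A) \<Longrightarrow> dfb P"
  unfolding dfb_def by blast

lemma dfb_induct [consumes 1, case_names 0 Suc]:
  "dfb P \<Longrightarrow> P 0 \<Longrightarrow> (\<And>x. P x \<Longrightarrow> P (x + 1)) \<Longrightarrow> P x"
  unfolding dfb_def using pa_induct by metis

lemma dfb_below: "dfb P \<Longrightarrow> dfb (\<lambda>x. \<forall>y<x. P y)"
proof -
  assume "dfb P"
  then obtain A e where "\<And>x. P x = sat (x ## e) A" unfolding dfb_def by blast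
  then show ?thesis by (intro dfbI[of _ e "Uni (Var 0 \<^bold>< Var 1 \<^bold>\<longrightarrow> lift_fm 1 A)"]) simp
qed

lemma dfb_strong: "dfb P \<Longrightarrow> (\<And>x. (\<And>y. y < x \<Longrightarrow> P y) \<Longrightarrow> P x) \<Longrightarrow> P x"
proof -
  assume P: "dfb P" and step: "\<And>x. (\<And>y. y < x \<Longrightarrow> P y) \<Longrightarrow> P x"
  have "\<forall>y<x. P y" for x
    by (induction x rule: dfb_induct[OF dfb_below[OF P]]) (auto simp: le_less step)
  then show "P x" using step by blast
qed

lemma dfb_least: "dfb P \<Longrightarrow> P x \<Longrightarrow> \<exists>m. P m \<and> (\<forall>y<m. \<not> P y)"
proof (rule ccontr)
  assume P: "dfb P" "P x" and n: "\<nexists>m. P m \<and> (\<forall>y<m. \<not> P y)"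
  obtain A e where A: "\<And>x. P x = sat (x ## e) A" using P unfolding dfb_def by blast
  have "dfb (\<lambda>x. \<not> P x)" by (rule dfbI[of _ e "Neg A"]) (simp add: A)
  then have "\<not> P x" by (rule dfb_strong) (use n in blast)
  then show False using P by simp
qed

section \<open>Pairing and Goedel's beta function in models\<close>

lemma pa_double_inj: "x + x = y + y \<Longrightarrow> x = (y :: 'a :: pa)"
  by (metis add_strict_mono linorder_neqE order_less_irrefl)

text \<open>Division by two is not in the language. That a product of consecutive numbers is even is
  shown by induction, so that Cantor's pairing becomes a function on every model.\<close>

lemma pa_ex_half: "\<exists>z. z + z = s * (s + 1) + (x + (x :: 'a :: pa))"
proof -
  have "\<exists>z. z + z = s * (s + 1)"
  proof (rule dfb_induct[of "\<lambda>s. \<exists>z. z + z = s * (s + 1)"])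
    show "dfb (\<lambda>s :: 'a. \<exists>z. z + z = s * (s + 1))"
      by (rule dfbI[of _ "\<lambda>_. 0" "Exi (Add (Var 0) (Var 0) \<^bold>= Mul (Var 1) (Scc (Var 1)))"]) simp
    fix s :: 'a assume "\<exists>z. z + z = s * (s + 1)"
    then obtain z where z: "z + z = s * (s + 1)" by blast
    have "(z + (s + 1)) + (z + (s + 1)) = (z + z) + ((s + 1) + (s + 1))" by (simp add: ac_simps)
    then have "(z + (s + 1)) + (z + (s + 1)) = (s + 1) * (s + 1 + 1)"
      unfolding z by (simp add: algebra_simps)
    then show "\<exists>z. z + z = (s + 1) * (s + 1 + 1)" by blast
  qed (auto intro: exI[of _ 0])
  then obtain z where z: "z + z = s * (s + 1)" by blast
  have "(z + x) + (z + x) = (z + z) + (x + x)" by (simp add: ac_simps)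
  then have "(z + x) + (z + x) = s * (s + 1) + (x + x)" unfolding z .
  then show ?thesis by blast
qed

definition pr :: "'a :: pa \<Rightarrow> 'a \<Rightarrow> 'a" where
  "pr x y = (THE z. z + z = (x + y) * (x + y + 1) + (x + x))"

lemma pr_iff: "z = pr x y \<longleftrightarrow> z + z = (x + y) * (x + y + 1) + (x + x)"
proof -
  obtain w where w: "w + w = (x + y) * (x + y + 1) + (x + x)" using pa_ex_half by blast
  have "pr x y = w" unfolding pr_def by (rule the_equality[where a = w], rule w, rule pa_double_inj) (simp add: w)
  then show ?thesis using w pa_double_inj[of z w] by auto
qed

lemma pr_inj [simp]: "pr x y = pr u v \<longleftrightarrow> x = u \<and> y = v"
proof
  assume "pr x y = pr u v"
  then have e: "(x + y) * (x + y + 1) + (x + x) = (u + v) * (u + v + 1) + (u + u)"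
    using pr_iff by metis
  \<comment> \<open>The two sums must agree: the larger sum has a triangular part that exceeds the
    triangular part of the smaller one even with twice the first component added.\<close>
  have less: False if e: "(x + y) * (x + y + 1) + (x + x) = (u + v) * (u + v + 1) + (u + u)"
    and l: "x + y < u + v" for x y u v :: 'a
  proof -
    have "x + y + 1 \<le> u + v" using l by (simp only: pa_Suc_le)
    then have "(x + y + 1) * (x + y + 1 + 1) \<le> (u + v) * (u + v + 1)"
      by (intro mult_mono) auto
    moreover have "(x + y + 1) * (x + y + 1 + 1) = (x + y) * (x + y + 1) + (x + x) + (y + y) + 1 + 1"
      by (simp add: algebra_simps)
    ultimately have "(u + v) * (u + v + 1) + (u + u) + (y + y) + 1 + 1 \<le> (u + v) * (u + v + 1)"
      using e by simp
    then have "(u + v) * (u + v + 1) + (u + u + (y + y) + 1) < (u + v) * (u + v + 1)"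
      by (simp only: add.assoc[symmetric] pa_Suc_le)
    then show False using not_less[of "(u + v) * (u + v + 1) + (u + u + (y + y) + 1)"] by (auto simp: le_iff_add)
  qed
  have s: "x + y = u + v" using less[OF e] less[OF e[symmetric]] by (metis linorder_neqE)
  then have "x + x = u + u" using e by simp
  then have "x = u" by (rule pa_double_inj)
  then show "x = u \<and> y = v" using s by simp
qed simp

lemma sat_pairing [simp]: "sat e (pairing x y z) \<longleftrightarrow> val e z = pr (val e x) (val e y)"
  by (simp add: pairing_def pr_iff)

lemma of_nat_prod_encode: "of_nat (prod_encode (x, y)) = pr (of_nat x) (of_nat y :: 'a :: pa)"
proof -
  obtain t where "(x + y) * Suc (x + y) = 2 * t" by (metis even_mult_iff even_Suc evenE)
  then have "prod_encode (x, y) + prod_encode (x, y) = (x + y) * (x + y + 1) + (x + x)"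
    by (simp add: prod_encode_def triangle_def)
  then have "(of_nat (prod_encode (x, y) + prod_encode (x, y)) :: 'a) = of_nat ((x + y) * (x + y + 1) + (x + x))"
    by simp
  then show ?thesis by (simp add: pr_iff algebra_simps)
qed

section \<open>The beta function and the Chinese remainder theorem\<close>

definition ent :: "'a :: pa \<Rightarrow> 'a \<Rightarrow> 'a \<Rightarrow> 'a \<Rightarrow> bool" where
  "ent c d i y \<longleftrightarrow> (\<exists>q. c = q * ((i + 1) * d + 1) + y) \<and> y < (i + 1) * d + 1"

lemma sat_beta [simp]: "sat e (beta c d i y) \<longleftrightarrow> ent (val e c) (val e d) (val e i) (val e y)"
  by (simp add: beta_def ent_def)

lemma pa_rem_unique:
  fixes y z :: "'a :: pa"
  assumes "q * m + y = p * m + z" "y < m" "z < m"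
  shows "y = z"
proof -
  have "\<not> q < p" if e: "q * m + y = p * m + z" and "y < m" for p q y z :: 'a
  proof
    assume "q < p"
    then have "q + 1 \<le> p" by simp
    then have "(q + 1) * m \<le> p * m" by (intro mult_right_mono) auto
    then have "q * m + m \<le> q * m + y" using e by (simp add: algebra_simps) (metis add_increasing zero_le)
    then show False using \<open>y < m\<close> by simp
  qed
  from this[OF assms(1,2)] this[OF assms(1)[symmetric] assms(3)] have "p = q" by simp
  then show ?thesis using assms(1) by simp
qed

lemma ent_unique: "ent c d i y \<Longrightarrow> ent c d i z \<Longrightarrow> y = z"
  unfolding ent_def using pa_rem_unique by metis

text \<open>Coprimality in a form without subtraction: \<open>a\<close> has an inverse modulo
  \<open>m\<close>. The inverse is what the Chinese remainder construction uses.\<close>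

definition inv_mod :: "'a :: pa \<Rightarrow> 'a \<Rightarrow> bool" where
  "inv_mod a m \<longleftrightarrow> (\<exists>u v. u * a = v * m + 1)"

lemma inv_mod_mult: "inv_mod a m \<Longrightarrow> inv_mod b m \<Longrightarrow> inv_mod (a * b) m"
proof -
  assume "inv_mod a m" "inv_mod b m"
  then obtain u v u' v' where "u * a = v * m + 1" "u' * b = v' * m + 1"
    unfolding inv_mod_def by blast
  then have "(u * u') * (a * b) = (v * m + 1) * (v' * m + 1)" by (metis mult.assoc mult.left_commute)
  also have "\<dots> = (v * m * v' + v + v') * m + 1" by (simp add: algebra_simps)
  finally show ?thesis unfolding inv_mod_def by blast
qed

lemma inv_mod_beta:
  fixes d :: "'a :: pa"
  assumes "i < j" "\<And>k. 0 < k \<Longrightarrow> k \<le> j \<Longrightarrow> \<exists>q. d = k * q" "0 < d"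
  shows "inv_mod ((i + 1) * d + 1) ((j + 1) * d + 1)"
proof -
  obtain r where r: "j = i + r" "0 < r" using \<open>i < j\<close>
    by (metis add.right_neutral le_iff_add less_imp_le not_less_iff_gr_or_eq pa_cases zero_less_iff_neq_zero)
  obtain q where q: "d = r * q" using assms(2)[of r] r by auto
  \<comment> \<open>Modulo the second modulus \<open>m\<close> the number \<open>(j + 1) * d\<close>
    is -1, so its square is 1. With \<open>(j + 1) * d = w + 1\<close> and \<open>m = w + 2\<close>
    this reads \<open>(w + 1) * (w + 1) = w * m + 1\<close>, free of negative numbers. The factor
    \<open>q\<close> below turns the difference \<open>r\<close> of the indices into
    \<open>d\<close>.\<close>
  have "(j + 1) * d \<noteq> 0" using \<open>0 < d\<close> by (simp add: pa_Suc_ne)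
  then obtain w where w: "(j + 1) * d = w + 1" using pa_cases by blast
  let ?a = "(i + 1) * d + 1" and ?m = "(j + 1) * d + 1"
  have 1: "(j + 1) * ?a = (i + 1) * ?m + r" using r by (simp add: algebra_simps)
  have "((j + 1) * d * q * (j + 1)) * ((j + 1) * ?a) =
      ((j + 1) * d * q * (j + 1) * (i + 1)) * ?m + ((j + 1) * d) * ((j + 1) * (r * q))"
    unfolding 1 by (simp add: algebra_simps)
  also have "((j + 1) * d) * ((j + 1) * (r * q)) = (w + 1) * (w + 1)" using q w by simp
  also have "\<dots> = w * ?m + 1" using w by (simp add: algebra_simps)
  finally have "((j + 1) * d * q * (j + 1) * (j + 1)) * ?a =
     ((j + 1) * d * q * (j + 1) * (i + 1) + w) * ?m + 1"
    by (simp add: algebra_simps)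
  then show ?thesis unfolding inv_mod_def by blast
qed

text \<open>Takes the place of a factorial, which would first have to be defined inside the
  model.\<close>

lemma pa_common_multiple: "\<exists>d :: 'a :: pa. 0 < d \<and> (\<forall>k. 0 < k \<longrightarrow> k \<le> m \<longrightarrow> (\<exists>q. d = k * q))"
proof (rule dfb_induct[of "\<lambda>m. \<exists>d. 0 < d \<and> (\<forall>k. 0 < k \<longrightarrow> k \<le> m \<longrightarrow> (\<exists>q. d = k * q))"])
  show "dfb (\<lambda>m :: 'a. \<exists>d. 0 < d \<and> (\<forall>k. 0 < k \<longrightarrow> k \<le> m \<longrightarrow> (\<exists>q. d = k * q)))"
    by (rule dfbI[of _ "\<lambda>_. 0" "Exi (Zero \<^bold>< Var 0 \<^bold>\<and> Uni (Zero \<^bold>< Var 0 \<^bold>\<longrightarrow> Var 0 \<^bold>\<le> Var 2 \<^bold>\<longrightarrow>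
      Exi (Var 2 \<^bold>= Mul (Var 1) (Var 0))))"]) simp
  show "\<exists>d :: 'a. 0 < d \<and> (\<forall>k. 0 < k \<longrightarrow> k \<le> 0 \<longrightarrow> (\<exists>q. d = k * q))"
    by (intro exI[of _ 1]) auto
  fix m :: 'a assume "\<exists>d. 0 < d \<and> (\<forall>k. 0 < k \<longrightarrow> k \<le> m \<longrightarrow> (\<exists>q. d = k * q))"
  then obtain d where d: "0 < d" "\<And>k. 0 < k \<Longrightarrow> k \<le> m \<Longrightarrow> \<exists>q. d = k * q" by blast
  have "\<exists>q. d * (m + 1) = k * q" if "0 < k" "k \<le> m + 1" for k
  proof (cases "k \<le> m")
    case True then show ?thesis using d(2)[OF that(1)] by (metis mult.assoc)
  next
    case False then have "k = m + 1" using that by (simp add: not_le order_antisym)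
    then show ?thesis by (metis mult.commute)
  qed
  moreover have "0 < d * (m + 1)" using d(1) by (simp add: add_nonneg_pos)
  ultimately show "\<exists>d. 0 < d \<and> (\<forall>k. 0 < k \<longrightarrow> k \<le> m + 1 \<longrightarrow> (\<exists>q. d = k * q))" by blast
qed

text \<open>The Chinese remainder theorem for the moduli of the beta function; \<open>L\<close> is the product of
  the moduli treated so far.\<close>

lemma beta_lemma:
  fixes n :: "'a :: pa"
  assumes G: "\<And>i. i \<le> n \<Longrightarrow> \<exists>!y. sat (y ## i ## e) G"
  shows "\<exists>c d. \<forall>i\<le>n. \<forall>y. ent c d i y \<longleftrightarrow> sat (y ## i ## e) G"
proof -
  \<comment> \<open>A common bound on the entries is collected by induction on the index; uniqueness
    in \<open>G\<close> leaves one value to be added at each index.\<close>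
  have "\<exists>b. \<forall>i<k. i \<le> n \<longrightarrow> (\<forall>y. sat (y ## i ## e) G \<longrightarrow> y < b)" for k
  proof (rule dfb_induct[of "\<lambda>k. \<exists>b. \<forall>i<k. i \<le> n \<longrightarrow> (\<forall>y. sat (y ## i ## e) G \<longrightarrow> y < b)"])
    show "dfb (\<lambda>k. \<exists>b. \<forall>i<k. i \<le> n \<longrightarrow> (\<forall>y. sat (y ## i ## e) G \<longrightarrow> y < b))"
      by (rule dfbI[of _ "n ## e" "Exi (Uni (Var 0 \<^bold>< Var 2 \<^bold>\<longrightarrow> Var 0 \<^bold>\<le> Var 3 \<^bold>\<longrightarrow>
        Uni (lift_fm 2 (lift_fm 2 (lift_fm 2 G)) \<^bold>\<longrightarrow> Var 0 \<^bold>< Var 2)))"])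
        (simp add: numeral_eq_Suc)
    fix k assume "\<exists>b. \<forall>i<k. i \<le> n \<longrightarrow> (\<forall>y. sat (y ## i ## e) G \<longrightarrow> y < b)"
    then obtain b where b: "\<And>i y. i < k \<Longrightarrow> i \<le> n \<Longrightarrow> sat (y ## i ## e) G \<Longrightarrow> y < b" by blast
    show "\<exists>b. \<forall>i<k + 1. i \<le> n \<longrightarrow> (\<forall>y. sat (y ## i ## e) G \<longrightarrow> y < b)"
    proof (cases "k \<le> n")
      case True
      then obtain z where z: "\<And>y. sat (y ## k ## e) G \<Longrightarrow> y = z" using G by blast
      have "y < max b (z + 1)" if "i < k + 1" "i \<le> n" "sat (y ## i ## e) G" for i y
      proof (cases "i = k")
        case True then show ?thesis using z that by (simp add: less_max_iff_disj)
      next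
        case False
        then have "i < k" using that(1) by (simp add: le_less)
        from b[OF this that(2,3)] show ?thesis by (simp add: less_max_iff_disj)
      qed
      then show ?thesis by blast
    next
      case False
      then have "i < k" if "i \<le> n" for i using that by (meson le_less_trans not_le)
      then show ?thesis using b by blast
    qed
  qed auto
  from this[of "n + 1"] obtain b where b: "\<And>i y. i \<le> n \<Longrightarrow> sat (y ## i ## e) G \<Longrightarrow> y < b" by auto
  \<comment> \<open>The part \<open>b\<close> makes every entry smaller than its modulus, the part
    \<open>n + 1\<close> makes every difference of indices a divisor of \<open>d\<close>.\<close>
  define m where "m = max b (n + 1)"
  obtain d where d: "0 < d" "\<And>k. 0 < k \<Longrightarrow> k \<le> m \<Longrightarrow> \<exists>q. d = k * q"
    using pa_common_multiple[of m] by blast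
  have "0 < m" unfolding m_def by (simp add: less_max_iff_disj add_nonneg_pos)
  then obtain q where q: "d = m * q" using d(2) by blast
  have "q \<noteq> 0" using q d(1) by auto
  then have "0 < q" by (simp add: zero_less_iff_neq_zero)
  then have "1 \<le> q" using pa_Suc_le[of 0 q] by simp
  then have "m \<le> d" using q mult_left_mono[of 1 q m] by simp
  have lt: "y < (i + 1) * d + 1" if "i \<le> n" "sat (y ## i ## e) G" for i y
  proof -
    have "y < m" using b[OF that] by (simp add: m_def less_max_iff_disj)
    also have "m \<le> d" by fact
    also have "d \<le> (i + 1) * d" by (simp add: algebra_simps)
    finally show ?thesis by (simp add: less_imp_le)
  qed
  have inv: "inv_mod ((i + 1) * d + 1) ((j + 1) * d + 1)" if "i < j" "j \<le> n" for i j
  proof (rule inv_mod_beta[OF that(1) _ d(1)])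
    fix k assume "0 < k" "k \<le> j"
    moreover have "k \<le> m" using \<open>k \<le> j\<close> \<open>j \<le> n\<close> unfolding m_def
      by (meson max.cobounded2 order_trans pa_less_Suc less_imp_le)
    ultimately show "\<exists>q. d = k * q" using d(2) by blast
  qed
  define M where "M = (\<lambda>k. k \<le> n + 1 \<longrightarrow> (\<exists>c L.
     (\<forall>i<k. \<forall>y. sat (y ## i ## e) G \<longrightarrow> (\<exists>q. c = q * ((i + 1) * d + 1) + y)) \<and>
     (\<forall>i<k. \<exists>q. L = q * ((i + 1) * d + 1)) \<and>
     (\<forall>j\<le>n. k \<le> j \<longrightarrow> inv_mod L ((j + 1) * d + 1))))"
  have "M k" for k
  proof (rule dfb_induct[of M])
    show "dfb M"
      unfolding M_def inv_mod_def
      by (rule dfbI[of _ "d ## n ## e" "Var 0 \<^bold>\<le> Scc (Var 2) \<^bold>\<longrightarrow> Exi (Exi (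
        Uni (Var 0 \<^bold>< Var 3 \<^bold>\<longrightarrow> Uni (lift_fm 2 (lift_fm 2 (lift_fm 2 (lift_fm 2 (lift_fm 2 G)))) \<^bold>\<longrightarrow>
          Exi (Var 4 \<^bold>= Add (Mul (Var 0) (Scc (Mul (Scc (Var 2)) (Var 6)))) (Var 1)))) \<^bold>\<and>
        Uni (Var 0 \<^bold>< Var 3 \<^bold>\<longrightarrow> Exi (Var 2 \<^bold>= Mul (Var 0) (Scc (Mul (Scc (Var 1)) (Var 5))))) \<^bold>\<and>
        Uni (Var 0 \<^bold>\<le> Var 5 \<^bold>\<longrightarrow> Var 3 \<^bold>\<le> Var 0 \<^bold>\<longrightarrow>
          Exi (Exi (Mul (Var 1) (Var 3) \<^bold>= Add (Mul (Var 0) (Scc (Mul (Scc (Var 2)) (Var 6)))) (Scc Zero))))))"])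
        (simp add: numeral_eq_Suc)
    have "inv_mod 1 ((j + 1) * d + 1)" for j
      unfolding inv_mod_def by (intro exI[of _ 1] exI[of _ 0]) simp
    then show "M 0" unfolding M_def by auto
    fix k assume "M k"
    show "M (k + 1)"
      unfolding M_def
    proof
      assume k: "k + 1 \<le> n + 1"
      then have kn: "k \<le> n" by simp
      then have "k \<le> n + 1" using k by (meson less_imp_le pa_Suc_le)
      with \<open>M k\<close> obtain c L where cL: "\<forall>i<k. \<forall>y. sat (y ## i ## e) G \<longrightarrow> (\<exists>q. c = q * ((i + 1) * d + 1) + y)"
        "\<forall>i<k. \<exists>q. L = q * ((i + 1) * d + 1)" "\<forall>j\<le>n. k \<le> j \<longrightarrow> inv_mod L ((j + 1) * d + 1)"
        unfolding M_def by blast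
      then have
        c: "\<And>i y. i < k \<Longrightarrow> sat (y ## i ## e) G \<Longrightarrow> \<exists>q. c = q * ((i + 1) * d + 1) + y" and
        L: "\<And>i. i < k \<Longrightarrow> \<exists>q. L = q * ((i + 1) * d + 1)"
           "\<And>j. j \<le> n \<Longrightarrow> k \<le> j \<Longrightarrow> inv_mod L ((j + 1) * d + 1)"
        by simp_all
      obtain y where y: "\<And>z. sat (z ## k ## e) G \<Longrightarrow> z = y" using G[OF kn] by blast
      let ?m = "(k + 1) * d + 1"
      obtain u v where uv: "u * L = v * ?m + 1" using L(2)[OF kn order_refl] unfolding inv_mod_def by blast
      \<comment> \<open>As \<open>(k + 1) * d\<close> is -1 modulo \<open>?m\<close>, the number
        \<open>?t\<close> is congruent to \<open>y - c\<close>. Since \<open>u * L\<close> is 1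
        modulo \<open>?m\<close> and 0 modulo the earlier moduli, \<open>?c\<close> takes the
        remainder \<open>y\<close> at \<open>k\<close> and leaves the earlier remainders
        alone.\<close>
      let ?t = "y + c * ((k + 1) * d)"
      let ?c = "c + u * L * ?t"
      have "?c = (v * ?t + c) * ?m + y" unfolding uv by (simp add: algebra_simps)
      then have ck: "\<exists>q. ?c = q * ?m + y" by blast
      have 1: "\<exists>q. ?c = q * ((i + 1) * d + 1) + z" if iz: "i < k + 1" "sat (z ## i ## e) G" for i z
      proof (cases "i = k")
        case True then show ?thesis using ck y iz(2) by auto
      next
        case False
        then have "i < k" using iz(1) by (simp add: le_less)
        then obtain q p where "c = q * ((i + 1) * d + 1) + z" "L = p * ((i + 1) * d + 1)"
          using c[OF \<open>i < k\<close> iz(2)] L(1)[OF \<open>i < k\<close>] by blast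
        then have "c + u * L * s = (q + u * p * s) * ((i + 1) * d + 1) + z" for s
          by (simp add: algebra_simps)
        then show ?thesis by blast
      qed
      have 2: "\<exists>q. L * ?m = q * ((i + 1) * d + 1)" if "i < k + 1" for i
      proof (cases "i = k")
        case True then show ?thesis by blast
      next
        case False
        then have "i < k" using that(1) by (simp add: le_less)
        then obtain p where "L = p * ((i + 1) * d + 1)" using L(1) by blast
        then have "L * ?m = (p * ?m) * ((i + 1) * d + 1)" by (metis mult.assoc mult.commute)
        then show ?thesis by blast
      qed
      have 3: "inv_mod (L * ?m) ((j + 1) * d + 1)" if "j \<le> n" "k + 1 \<le> j" for j
        by (rule inv_mod_mult[OF L(2) inv]) (use that in \<open>auto simp: less_imp_le\<close>)
      show "\<exists>c L. (\<forall>i<k + 1. \<forall>y. sat (y ## i ## e) G \<longrightarrow> (\<exists>q. c = q * ((i + 1) * d + 1) + y)) \<and>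
        (\<forall>i<k + 1. \<exists>q. L = q * ((i + 1) * d + 1)) \<and>
        (\<forall>j\<le>n. k + 1 \<le> j \<longrightarrow> inv_mod L ((j + 1) * d + 1))"
        by (rule exI[of _ ?c], rule exI[of _ "L * ?m"]) (use 1 2 3 in auto)
    qed
  qed
  from this[of "n + 1"] obtain c where
    "\<forall>i<n + 1. \<forall>y. sat (y ## i ## e) G \<longrightarrow> (\<exists>q. c = q * ((i + 1) * d + 1) + y)"
    unfolding M_def by (elim impE[OF _ order_refl] exE conjE) (rule that)
  then have c: "ent c d i y" if "i \<le> n" "sat (y ## i ## e) G" for i y
    using that lt unfolding ent_def by simp
  have "ent c d i y \<longleftrightarrow> sat (y ## i ## e) G" if "i \<le> n" for i y
  proof
    assume y: "ent c d i y"
    obtain z where z: "sat (z ## i ## e) G" using G \<open>i \<le> n\<close> by blast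
    from ent_unique[OF y c[OF \<open>i \<le> n\<close> z]] z show "sat (y ## i ## e) G" by simp
  qed (use c \<open>i \<le> n\<close> in blast)
  then show ?thesis by blast
qed

section \<open>Derivations inside a model\<close>

definition dr :: "(('a :: pa \<Rightarrow> bool) \<Rightarrow> 'a \<Rightarrow> bool) \<Rightarrow> 'a \<Rightarrow> bool" where
  "dr S y \<longleftrightarrow> (\<exists>c d n. ent c d n y \<and> (\<forall>i\<le>n. \<exists>y. ent c d i y \<and> S (\<lambda>q. \<exists>j<i. ent c d j q) y))"

text \<open>Besides being monotone, a step uses at most two premises. Closure under \<open>S\<close>
  then amounts to coding the concatenation of two sequences.\<close>

definition step_op :: "(('a :: pa \<Rightarrow> bool) \<Rightarrow> 'a \<Rightarrow> bool) \<Rightarrow> bool" where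
  "step_op S \<longleftrightarrow> (\<forall>P Q y. (\<forall>x. P x \<longrightarrow> Q x) \<longrightarrow> S P y \<longrightarrow> S Q y) \<and>
    (\<forall>P y. S P y \<longrightarrow> S (\<lambda>_. False) y \<or> (\<exists>q1 q2. P q1 \<and> P q2 \<and> S (\<lambda>q. q = q1 \<or> q = q2) y))"

lemma step_mono: "step_op S \<Longrightarrow> S P y \<Longrightarrow> (\<And>x. P x \<Longrightarrow> Q x) \<Longrightarrow> S Q y"
  unfolding step_op_def by blast

lemma dr_intro0:
  assumes S: "step_op S" and y: "S (\<lambda>_. False) y"
  shows "dr S y"
proof -
  have "\<exists>c d. \<forall>i\<le>0. \<forall>z. ent c d i z \<longleftrightarrow> sat (z ## i ## (\<lambda>_. y)) (Var 0 \<^bold>= Var 2)"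
    by (rule beta_lemma) auto
  then obtain c d where c: "\<And>z. ent c d 0 z \<longleftrightarrow> z = y" by auto
  then show ?thesis unfolding dr_def using step_mono[OF S y] by (intro exI[of _ c] exI[of _ d] exI[of _ 0]) auto
qed

text \<open>The two sequences are laid end to end, followed by \<open>y\<close>. The joint entry
  function is definable from the codes of both, so the beta function codes it too.\<close>

lemma dr_intro2:
  fixes y :: "'a :: pa"
  assumes S: "step_op S" and "dr S q1" "dr S q2" and y: "S (\<lambda>q. q = q1 \<or> q = q2) y"
  shows "dr S y"
proof -
  obtain c1 d1 n1 where 1: "ent c1 d1 n1 q1"
    "\<And>i. i \<le> n1 \<Longrightarrow> \<exists>y. ent c1 d1 i y \<and> S (\<lambda>q. \<exists>j<i. ent c1 d1 j q) y"
    using assms(2) unfolding dr_def by blast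
  obtain c2 d2 n2 where 2: "ent c2 d2 n2 q2"
    "\<And>i. i \<le> n2 \<Longrightarrow> \<exists>y. ent c2 d2 i y \<and> S (\<lambda>q. \<exists>j<i. ent c2 d2 j q) y"
    using assms(3) unfolding dr_def by blast
  \<comment> \<open>\<open>n1\<close> and \<open>n2\<close> are last indices, not lengths: the
    second sequence starts at \<open>n1 + 1\<close>, and \<open>y\<close> stands at
    \<open>n1 + 1 + (n2 + 1)\<close>.\<close>
  define N where "N = n1 + 1 + (n2 + 1)"
  define e where "e = n1 ## n2 ## c1 ## d1 ## c2 ## d2 ## y ## (\<lambda>_. N)"
  let ?G = "Var 1 \<^bold>\<le> Var 2 \<^bold>\<and> beta (Var 4) (Var 5) (Var 1) (Var 0) \<^bold>\<or>
    Exi (Var 0 \<^bold>\<le> Var 4 \<^bold>\<and> Var 2 \<^bold>= Add (Scc (Var 3)) (Var 0) \<^bold>\<and> beta (Var 7) (Var 8) (Var 0) (Var 1)) \<^bold>\<or>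
    Var 1 \<^bold>= Var 9 \<^bold>\<and> Var 0 \<^bold>= Var 8"
  define G where "G = (\<lambda>z i. (i \<le> n1 \<and> ent c1 d1 i z) \<or>
    (\<exists>k. k \<le> n2 \<and> i = n1 + 1 + k \<and> ent c2 d2 k z) \<or> (i = N \<and> z = y))"
  have G: "sat (z ## i ## e) ?G = G z i" for z i
    by (simp add: e_def G_def)
  have split: "i \<le> n1 \<or> (\<exists>k\<le>n2. i = n1 + 1 + k) \<or> i = N" if "i \<le> N" for i
  proof (cases "i \<le> n1")
    case False
    then have "n1 + 1 \<le> i" by simp
    then obtain k where k: "i = n1 + 1 + k" by (auto simp: le_iff_add)
    then have "k \<le> n2 + 1" using that unfolding N_def by simp
    then have "k \<le> n2 \<or> k = n2 + 1" by (metis le_less pa_less_Suc)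
    then show ?thesis using k N_def by auto
  qed simp
  have lo: "\<not> (n1 + 1 + k \<le> n1)" for k
  proof -
    have "n1 < n1 + 1" by simp
    also have "n1 + 1 \<le> n1 + 1 + k" by simp
    finally show ?thesis by simp
  qed
  have N1: "\<not> N \<le> n1" unfolding N_def by (rule lo)
  have N2: "N \<noteq> n1 + 1 + k" if "k \<le> n2" for k
    using that unfolding N_def by auto
  have u1: "G z i \<longleftrightarrow> ent c1 d1 i z" if "i \<le> n1" for z i
    using that lo N1 by (auto simp: G_def)
  have u2: "G z (n1 + 1 + k) \<longleftrightarrow> ent c2 d2 k z" if "k \<le> n2" for z k
    using that lo[of k] N2[OF that] by (auto simp: G_def)
  have u3: "G z N \<longleftrightarrow> z = y" for z
    using N1 N2 by (auto simp: G_def)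
  have "\<exists>c d. \<forall>i\<le>N. \<forall>z. ent c d i z \<longleftrightarrow> sat (z ## i ## e) ?G"
  proof (rule beta_lemma)
    fix i assume "i \<le> N"
    then show "\<exists>!z. sat (z ## i ## e) ?G"
      unfolding G using split[OF \<open>i \<le> N\<close>]
    proof (elim disjE exE conjE)
      assume i: "i \<le> n1"
      then obtain z where "ent c1 d1 i z" using 1(2) by blast
      then show "\<exists>!z. G z i" unfolding u1[OF i] using ent_unique by blast
    next
      fix k assume k: "k \<le> n2" "i = n1 + 1 + k"
      then obtain z where "ent c2 d2 k z" using 2(2) by blast
      then show "\<exists>!z. G z i" unfolding k(2) u2[OF k(1)] using ent_unique by blast
    qed (simp_all add: u3)
  qed
  then obtain c d where "\<forall>i\<le>N. \<forall>z. ent c d i z \<longleftrightarrow> G z i" unfolding G by blast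
  then have c: "ent c d i z \<longleftrightarrow> G z i" if "i \<le> N" for i z using that by blast
  have le1: "i \<le> N" if "i \<le> n1" for i
    using that unfolding N_def by (simp add: add.assoc add_increasing2)
  have le2: "n1 + 1 + k \<le> N" if "k \<le> n2" for k
    using that unfolding N_def by (simp add: less_imp_le)
  have lt: "n1 < N" "n1 + 1 + n2 < N"
    using N1 unfolding N_def by (simp_all add: not_le)
  have "\<exists>z. ent c d i z \<and> S (\<lambda>q. \<exists>j<i. ent c d j q) z" if i: "i \<le> N" for i
    using split[OF i]
  proof (elim disjE exE conjE)
    assume i1: "i \<le> n1"
    then obtain z where z: "ent c1 d1 i z" "S (\<lambda>q. \<exists>j<i. ent c1 d1 j q) z" using 1(2) by blast
    have "S (\<lambda>q. \<exists>j<i. ent c d j q) z"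
    proof (rule step_mono[OF S z(2)])
      fix x assume "\<exists>j<i. ent c1 d1 j x"
      then obtain j where j: "j < i" "ent c1 d1 j x" by blast
      then have "j \<le> n1" using i1 by (meson less_imp_le order_trans)
      then show "\<exists>j<i. ent c d j x" using j c[OF le1] u1 by blast
    qed
    then show ?thesis using z c[OF le1] u1 i1 by blast
  next
    fix k assume k: "k \<le> n2" "i = n1 + 1 + k"
    then obtain z where z: "ent c2 d2 k z" "S (\<lambda>q. \<exists>j<k. ent c2 d2 j q) z" using 2(2) by blast
    have "S (\<lambda>q. \<exists>j<i. ent c d j q) z"
    proof (rule step_mono[OF S z(2)])
      fix x assume "\<exists>j<k. ent c2 d2 j x"
      then obtain j where j: "j < k" "ent c2 d2 j x" by blast
      then have "j \<le> n2" using k(1) by (meson less_imp_le order_trans)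
      then have "ent c d (n1 + 1 + j) x" "n1 + 1 + j < i" using j c[OF le2] u2 k(2) by auto
      then show "\<exists>j<i. ent c d j x" by blast
    qed
    then show ?thesis using z c[OF le2] u2 k by blast
  next
    assume iN: "i = N"
    have "S (\<lambda>q. \<exists>j<i. ent c d j q) y"
    proof (rule step_mono[OF S y])
      fix x assume "x = q1 \<or> x = q2"
      then show "\<exists>j<i. ent c d j x"
        using c[OF le1[OF order_refl]] c[OF le2[OF order_refl]] u1[OF order_refl] u2[OF order_refl] 1(1) 2(1) lt iN
        by blast
    qed
    then show ?thesis using c[OF i] u3 iN by blast
  qed
  moreover have "ent c d N y" using c u3 by blast
  ultimately show ?thesis unfolding dr_def by blast
qed

lemma dr_prefix:
  assumes "\<forall>i\<le>n. \<exists>y. ent c d i y \<and> S (\<lambda>q. \<exists>j<i. ent c d j q) y" "ent c d j q" "j \<le> n"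
  shows "dr S q"
  unfolding dr_def
  by (rule exI[of _ c], rule exI[of _ d], rule exI[of _ j])
    (use assms in \<open>auto dest: order_trans\<close>)

text \<open>Apart from induction, \<open>Deriv\<close> is used only through this fixed point
  property, from which the coding sequences have disappeared.\<close>

lemma dr_unfold:
  assumes S: "step_op S" shows "dr S y \<longleftrightarrow> S (dr S) y"
proof
  assume "dr S y"
  then obtain c d n where n: "ent c d n y" "\<forall>i\<le>n. \<exists>y. ent c d i y \<and> S (\<lambda>q. \<exists>j<i. ent c d j q) y"
    unfolding dr_def by blast
  then obtain z where "ent c d n z" and z: "S (\<lambda>q. \<exists>j<n. ent c d j q) z" by blast
  then have "z = y" using n(1) ent_unique by blast
  show "S (dr S) y"
    by (rule step_mono[OF S z[unfolded \<open>z = y\<close>]]) (use dr_prefix[OF n(2)] less_imp_le in blast)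
next
  assume "S (dr S) y"
  then consider "S (\<lambda>_. False) y" | q1 q2 where "dr S q1" "dr S q2" "S (\<lambda>q. q = q1 \<or> q = q2) y"
    using S unfolding step_op_def by blast
  then show "dr S y" using dr_intro0[OF S] dr_intro2[OF S] by cases blast+
qed

text \<open>Induction along the coding sequence. The induction principle for the indices is left
  open as \<open>ind\<close>: in an arbitrary model it holds for definable predicates, in the
  standard model for all.\<close>

lemma dr_induct_gen:
  assumes S: "step_op S"
    and ind: "\<And>c d n i. (\<And>i. (\<And>j. j < i \<Longrightarrow> j \<le> n \<longrightarrow> (\<forall>y. ent c d j y \<longrightarrow> P y)) \<Longrightarrow>
       i \<le> n \<longrightarrow> (\<forall>y. ent c d i y \<longrightarrow> P y)) \<Longrightarrow> i \<le> n \<longrightarrow> (\<forall>y. ent c d i y \<longrightarrow> P y)"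
    and step: "\<And>y. S (\<lambda>q. dr S q \<and> P q) y \<Longrightarrow> P y"
    and y: "dr S y"
  shows "P y"
proof -
  from y obtain c d n where n: "ent c d n y" "\<forall>i\<le>n. \<exists>y. ent c d i y \<and> S (\<lambda>q. \<exists>j<i. ent c d j q) y"
    unfolding dr_def by blast
  have "n \<le> n \<longrightarrow> (\<forall>y. ent c d n y \<longrightarrow> P y)"
  proof (rule ind, intro impI allI)
    fix i z assume IH: "\<And>j. j < i \<Longrightarrow> j \<le> n \<longrightarrow> (\<forall>y. ent c d j y \<longrightarrow> P y)"
      and i: "i \<le> n" and z: "ent c d i z"
    from n(2) i obtain z' where z': "ent c d i z'" "S (\<lambda>q. \<exists>j<i. ent c d j q) z'" by blast
    then have [simp]: "z' = z" using z ent_unique by blast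
    have "S (\<lambda>q. dr S q \<and> P q) z"
    proof (rule step_mono[OF S z'(2)[simplified]])
      fix x assume "\<exists>j<i. ent c d j x"
      then obtain j where j: "j < i" "ent c d j x" by blast
      then have "j \<le> n" using i by (meson less_imp_le order_trans)
      then show "dr S x \<and> P x" using dr_prefix[OF n(2) j(2)] IH j by blast
    qed
    then show "P z" by (rule step)
  qed
  then show ?thesis using n(1) by simp
qed

lemma dr_induct:
  assumes S: "step_op S" and P: "dfb P"
    and step: "\<And>y. S (\<lambda>q. dr S q \<and> P q) y \<Longrightarrow> P y"
    and y: "dr S y"
  shows "P y"
proof (rule dr_induct_gen[OF S _ step y])
  fix c d n i
  assume st: "\<And>i. (\<And>j. j < i \<Longrightarrow> j \<le> n \<longrightarrow> (\<forall>y. ent c d j y \<longrightarrow> P y)) \<Longrightarrow> i \<le> n \<longrightarrow> (\<forall>y. ent c d i y \<longrightarrow> P y)"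
  obtain A e where A: "\<And>x. P x = sat (x ## e) A" using P unfolding dfb_def by blast
  show "i \<le> n \<longrightarrow> (\<forall>y. ent c d i y \<longrightarrow> P y)"
  proof (rule dfb_strong[of "\<lambda>i. i \<le> n \<longrightarrow> (\<forall>y. ent c d i y \<longrightarrow> P y)", OF _ st])
    show "dfb (\<lambda>i. i \<le> n \<longrightarrow> (\<forall>y. ent c d i y \<longrightarrow> P y))"
      by (rule dfbI[of _ "n ## d ## c ## e" "Var 0 \<^bold>\<le> Var 1 \<^bold>\<longrightarrow> Uni (beta (Var 4) (Var 3) (Var 1) (Var 0) \<^bold>\<longrightarrow>
          lift_fm 1 (lift_fm 1 (lift_fm 1 (lift_fm 1 A))))"]) (simp add: A)
  qed
qed

lemma dr_induct_nat:
  fixes P :: "nat \<Rightarrow> bool"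
  assumes "step_op S" "\<And>y. S (\<lambda>q. dr S q \<and> P q) y \<Longrightarrow> P y" "dr S y"
  shows "P y"
  by (rule dr_induct_gen[OF assms(1) _ assms(2,3)]) (rule less_induct, blast)

section \<open>Semantic counterparts of the arithmetized syntax\<close>

primrec pval :: "(nat \<Rightarrow> 'a :: pa) \<Rightarrow> pat \<Rightarrow> 'a" where
  "pval e (At t) = val e t"
| "pval e (p \<triangleright> q) = pr (pval e p) (pval e q)"

lemma sat_matches [simp]: "sat e (matches n p y) \<longleftrightarrow> val e y = pval (\<lambda>i. e (i + n)) p"
  by (induction p arbitrary: n e y) (auto simp: numeral_2_eq_2)

lemma sat_Cur [simp]: "sat e (Cur m p) \<longleftrightarrow> e m = pval e p"
  by (simp add: Cur_def)

lemma sat_Prev [simp]: "sat e (Prev m p) \<longleftrightarrow> (\<exists>j<e (m + 1). ent (e (m + 4)) (e (m + 3)) j (pval e p))"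
  by (simp add: Prev_def numeral_eq_Suc)

lemma sat_disjs [simp]: "sat e (disjs As) \<longleftrightarrow> (\<exists>A\<in>set As. sat e A)"
  by (induction As) (auto simp: disjs_def)

definition sat_step :: "fm \<Rightarrow> (('a :: pa \<Rightarrow> bool) \<Rightarrow> 'a \<Rightarrow> bool) \<Rightarrow> bool" where
  "sat_step A S \<longleftrightarrow> (\<forall>e y i n d c. sat (y ## i ## n ## d ## c ## e) A = S (\<lambda>q. \<exists>j<i. ent c d j q) y)"

lemma sat_Deriv: "sat_step A S \<Longrightarrow> sat e (Deriv A p) \<longleftrightarrow> dr S (pval e p)"
  by (simp add: Deriv_def dr_def sat_step_def numeral_eq_Suc)

lemma step_op_const: "step_op (\<lambda>P y. R y)"
  unfolding step_op_def by blast

lemma step_opI: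
  assumes "\<And>P Q y. (\<And>x. P x \<Longrightarrow> Q x) \<Longrightarrow> S P y \<Longrightarrow> S Q y"
    and "\<And>P y. S P y \<Longrightarrow> S (\<lambda>_. False) y \<or> (\<exists>q1 q2. P q1 \<and> P q2 \<and> S (\<lambda>q. q = q1 \<or> q = q2) y)"
  shows "step_op S"
  unfolding step_op_def
proof (intro conjI allI impI)
  fix P Q y assume "\<forall>x. P x \<longrightarrow> Q x" "S P y"
  then show "S Q y" using assms(1)[of P Q y] by simp
qed (rule assms(2))

lemma step_op_fin:
  "step_op S \<Longrightarrow> S P y \<Longrightarrow> S (\<lambda>_. False) y \<or> (\<exists>q1 q2. P q1 \<and> P q2 \<and> S (\<lambda>q. q = q1 \<or> q = q2) y)"
  unfolding step_op_def by simp

lemma step_op_disj: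
  assumes S: "step_op S" and T: "step_op T" shows "step_op (\<lambda>P y. S P y \<or> T P y)"
proof (rule step_opI)
  fix P Q y assume h: "\<And>x. P x \<Longrightarrow> Q x" and "S P y \<or> T P y"
  then show "S Q y \<or> T Q y" using step_mono[OF S _ h] step_mono[OF T _ h] by (elim disjE) simp_all
next
  fix P y assume "S P y \<or> T P y"
  then show "(S (\<lambda>_. False) y \<or> T (\<lambda>_. False) y) \<or>
      (\<exists>q1 q2. P q1 \<and> P q2 \<and> (S (\<lambda>q. q = q1 \<or> q = q2) y \<or> T (\<lambda>q. q = q1 \<or> q = q2) y))"
    using step_op_fin[OF S, of P y] step_op_fin[OF T, of P y] by (elim disjE) auto
qed

lemma step_op_ex:
  assumes S: "\<And>x. step_op (S x)" shows "step_op (\<lambda>P y. \<exists>x. S x P y)"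
proof (rule step_opI)
  fix P Q y assume h: "\<And>x. P x \<Longrightarrow> Q x" and "\<exists>x. S x P y"
  then show "\<exists>x. S x Q y" using step_mono[OF S _ h] by (elim exE) (rule exI)
next
  fix P y assume "\<exists>x. S x P y"
  then obtain x where "S x P y" ..
  from step_op_fin[OF S this] show "(\<exists>x. S x (\<lambda>_. False) y) \<or>
      (\<exists>q1 q2. P q1 \<and> P q2 \<and> (\<exists>x. S x (\<lambda>q. q = q1 \<or> q = q2) y))"
    by (elim disjE exE conjE) auto
qed

lemma step_op_1: "step_op (\<lambda>P y. R y \<and> P a)"
  unfolding step_op_def by auto

lemma step_op_2: "step_op (\<lambda>P y. R y \<and> P a \<and> P b)"
  unfolding step_op_def by auto

lemma step_op_1': "step_op (\<lambda>P y. R y \<and> Q y \<and> P a)"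
  unfolding step_op_def by auto

lemma step_op_bex: "(\<And>x. step_op (S x)) \<Longrightarrow> step_op (\<lambda>P y. \<exists>x\<in>A. S x P y)"
proof -
  assume S: "\<And>x. step_op (S x)"
  have "step_op (\<lambda>P y. x \<in> A \<and> S x P y)" for x
    by (rule step_opI) (use step_mono[OF S] step_op_fin[OF S] in \<open>auto\<close>)
  from step_op_ex[OF this] show ?thesis unfolding Bex_def .
qed

lemmas step_op_rules = step_op_const step_op_1 step_op_2 step_op_1' step_op_disj step_op_bex step_op_ex

text \<open>The existential quantifiers stand in the order of those of \<open>tm_step\<close>, the
  one for index 0 innermost, so that the two agree after simplification. The later operators follow
  the same convention.\<close>

definition tm_op :: "('a :: pa \<Rightarrow> bool) \<Rightarrow> 'a \<Rightarrow> bool" where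
  "tm_op P y \<longleftrightarrow> (\<exists>i k. y = pr k (pr 0 i) \<and> i < k) \<or> (\<exists>k. y = pr k (pr 1 0)) \<or>
    (\<exists>s k. y = pr k (pr 2 s) \<and> P (pr k s)) \<or>
    (\<exists>t s k. y = pr k (pr 3 (pr s t)) \<and> P (pr k s) \<and> P (pr k t)) \<or>
    (\<exists>t s k. y = pr k (pr 4 (pr s t)) \<and> P (pr k s) \<and> P (pr k t))"

definition tmf :: "'a :: pa \<Rightarrow> 'a \<Rightarrow> bool" where "tmf k x \<longleftrightarrow> dr tm_op (pr k x)"

lemma tm_op: "step_op tm_op"
  unfolding tm_op_def by (rule step_op_rules)+

lemma sat_tm_step: "sat_step tm_step tm_op"
  unfolding sat_step_def tm_step_def tm_op_def by (simp add: numeral_nat disj_assoc)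

lemma sat_TmF [simp]: "sat e (TmF k x) \<longleftrightarrow> tmf (val e k) (val e x)"
  by (simp add: TmF_def sat_Deriv[OF sat_tm_step] tmf_def)

definition fm_op :: "('a :: pa \<Rightarrow> bool) \<Rightarrow> 'a \<Rightarrow> bool" where
  "fm_op P y \<longleftrightarrow> (\<exists>t s k. y = pr k (pr 5 (pr s t)) \<and> tmf k s \<and> tmf k t) \<or> (\<exists>k. y = pr k (pr 6 0)) \<or>
    (\<exists>g\<in>{7, 8, 9}. \<exists>t s k. y = pr k (pr g (pr s t)) \<and> P (pr k s) \<and> P (pr k t)) \<or>
    (\<exists>g\<in>{10, 11}. \<exists>s k. y = pr k (pr g s) \<and> P (pr (k + 1) s))"

definition fmf :: "'a :: pa \<Rightarrow> 'a \<Rightarrow> bool" where "fmf k x \<longleftrightarrow> dr fm_op (pr k x)"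

lemma fm_op: "step_op fm_op"
  unfolding fm_op_def by (rule step_op_rules)+

lemma sat_fm_step: "sat_step fm_step fm_op"
  unfolding sat_step_def fm_step_def fm_op_def by (simp add: numeral_nat disj_assoc)

lemma sat_FmF [simp]: "sat e (FmF k x) \<longleftrightarrow> fmf (val e k) (val e x)"
  by (simp add: FmF_def sat_Deriv[OF sat_fm_step] fmf_def)

lemma sat_IsSent [simp]: "sat e (IsSent x) \<longleftrightarrow> fmf 0 (val e x)"
  by (simp add: IsSent_def)

definition istm :: "'a :: pa \<Rightarrow> bool" where "istm x \<longleftrightarrow> (\<exists>k. tmf k x)"
definition isfm :: "'a :: pa \<Rightarrow> bool" where "isfm x \<longleftrightarrow> (\<exists>k. fmf k x)"

lemma sat_IsTm [simp]: "sat e (IsTm x) \<longleftrightarrow> istm (val e x)"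
  by (simp add: IsTm_def istm_def)

lemma sat_IsFm [simp]: "sat e (IsFm x) \<longleftrightarrow> isfm (val e x)"
  by (simp add: IsFm_def isfm_def)

definition lift_op :: "('a :: pa \<Rightarrow> bool) \<Rightarrow> 'a \<Rightarrow> bool" where
  "lift_op P y \<longleftrightarrow> (\<exists>i k. y = pr k (pr (pr 0 i) (pr 0 i)) \<and> i < k) \<or>
    (\<exists>i k. y = pr k (pr (pr 0 i) (pr 0 (i + 1))) \<and> k \<le> i) \<or>
    (\<exists>k. y = pr k (pr (pr 1 0) (pr 1 0))) \<or> (\<exists>k. y = pr k (pr (pr 6 0) (pr 6 0))) \<or>
    (\<exists>b a k. y = pr k (pr (pr 2 a) (pr 2 b)) \<and> P (pr k (pr a b))) \<or>
    (\<exists>g\<in>{3, 4, 5, 7, 8, 9}. \<exists>b' a' b a k. y = pr k (pr (pr g (pr a b)) (pr g (pr a' b'))) \<and>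
      P (pr k (pr a a')) \<and> P (pr k (pr b b'))) \<or>
    (\<exists>g\<in>{10, 11}. \<exists>b a k. y = pr k (pr (pr g a) (pr g b)) \<and> P (pr (k + 1) (pr a b)))"

definition liftf :: "'a :: pa \<Rightarrow> 'a \<Rightarrow> 'a \<Rightarrow> bool" where "liftf k x y \<longleftrightarrow> dr lift_op (pr k (pr x y))"

lemma lift_op: "step_op lift_op"
  unfolding lift_op_def by (rule step_op_rules)+

lemma sat_lift_step: "sat_step lift_step lift_op"
  unfolding sat_step_def lift_step_def lift_op_def by (simp add: numeral_nat disj_assoc)

lemma sat_LiftF [simp]: "sat e (LiftF k x y) \<longleftrightarrow> liftf (val e k) (val e x) (val e y)"
  by (simp add: LiftF_def sat_Deriv[OF sat_lift_step] liftf_def)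

definition sub_op :: "('a :: pa \<Rightarrow> bool) \<Rightarrow> 'a \<Rightarrow> bool" where
  "sub_op P y \<longleftrightarrow> (\<exists>i t k. y = pr k (pr t (pr (pr 0 i) (pr 0 i))) \<and> i < k) \<or>
    (\<exists>t k. y = pr k (pr t (pr (pr 0 k) t))) \<or>
    (\<exists>i t k. y = pr k (pr t (pr (pr 0 (i + 1)) (pr 0 i))) \<and> k \<le> i) \<or>
    (\<exists>t k. y = pr k (pr t (pr (pr 1 0) (pr 1 0)))) \<or> (\<exists>t k. y = pr k (pr t (pr (pr 6 0) (pr 6 0)))) \<or>
    (\<exists>b a t k. y = pr k (pr t (pr (pr 2 a) (pr 2 b))) \<and> P (pr k (pr t (pr a b)))) \<or>
    (\<exists>g\<in>{3, 4, 5, 7, 8, 9}. \<exists>b' a' b a t k. y = pr k (pr t (pr (pr g (pr a b)) (pr g (pr a' b')))) \<and>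
      P (pr k (pr t (pr a a'))) \<and> P (pr k (pr t (pr b b')))) \<or>
    (\<exists>g\<in>{10, 11}. \<exists>t' b a t k. y = pr k (pr t (pr (pr g a) (pr g b))) \<and> liftf 0 t t' \<and>
      P (pr (k + 1) (pr t' (pr a b))))"

definition subf :: "'a :: pa \<Rightarrow> 'a \<Rightarrow> 'a \<Rightarrow> 'a \<Rightarrow> bool" where
  "subf k t x y \<longleftrightarrow> dr sub_op (pr k (pr t (pr x y)))"

lemma sub_op: "step_op sub_op"
  unfolding sub_op_def by (rule step_op_rules)+

lemma sat_sub_step: "sat_step sub_step sub_op"
  unfolding sat_step_def sub_step_def sub_op_def by (simp add: numeral_nat disj_assoc)

lemma sat_SubF [simp]: "sat e (SubF k t x y) \<longleftrightarrow> subf (val e k) (val e t) (val e x) (val e y)"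
  by (simp add: SubF_def sat_Deriv[OF sat_sub_step] subf_def)

definition clos_op :: "('a :: pa \<Rightarrow> bool) \<Rightarrow> 'a \<Rightarrow> bool" where
  "clos_op P y \<longleftrightarrow> (\<exists>x. y = pr x x) \<or> (\<exists>b a. y = pr a (pr 10 b) \<and> P (pr a b))"

definition closf :: "'a :: pa \<Rightarrow> 'a \<Rightarrow> bool" where "closf x y \<longleftrightarrow> dr clos_op (pr x y)"

lemma clos_op: "step_op clos_op"
  unfolding clos_op_def by (rule step_op_rules)+

lemma sat_closure_step: "sat_step closure_step clos_op"
  unfolding sat_step_def closure_step_def clos_op_def by (simp add: numeral_nat disj_assoc)

lemma sat_ClosureF [simp]: "sat e (ClosureF x y) \<longleftrightarrow> closf (val e x) (val e y)"
  by (simp add: ClosureF_def sat_Deriv[OF sat_closure_step] closf_def)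

abbreviation (input) iconj :: "'a :: pa \<Rightarrow> 'a \<Rightarrow> 'a" where "iconj a b \<equiv> pr 7 (pr a b)"
abbreviation (input) idisj :: "'a :: pa \<Rightarrow> 'a \<Rightarrow> 'a" where "idisj a b \<equiv> pr 8 (pr a b)"
abbreviation (input) iimp :: "'a :: pa \<Rightarrow> 'a \<Rightarrow> 'a" where "iimp a b \<equiv> pr 9 (pr a b)"

definition logax :: "'a :: pa \<Rightarrow> bool" where
  "logax x \<longleftrightarrow> (\<exists>c b a. isfm a \<and> isfm b \<and> isfm c \<and>
      (x = iimp a (iimp b a) \<or> x = iimp (iimp a (iimp b c)) (iimp (iimp a b) (iimp a c)) \<or>
       x = iimp a (iimp b (iconj a b)) \<or> x = iimp (iconj a b) a \<or> x = iimp (iconj a b) b \<or>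
       x = iimp a (idisj a b) \<or> x = iimp b (idisj a b) \<or>
       x = iimp (iimp a c) (iimp (iimp b c) (iimp (idisj a b) c)) \<or> x = iimp (pr 6 0) a)) \<or>
    (\<exists>c b a. isfm a \<and> istm b \<and> subf 0 b a c \<and> (x = iimp (pr 10 a) c \<or> x = iimp c (pr 11 a))) \<or>
    (\<exists>c b a. isfm a \<and> isfm b \<and> liftf 0 a c \<and>
      (x = iimp (pr 10 (iimp c b)) (iimp a (pr 10 b)) \<or> x = iimp (pr 10 (iimp b c)) (iimp (pr 11 b) a))) \<or>
    (\<exists>a. istm a \<and> x = pr 5 (pr a a)) \<or>
    (\<exists>e d c b a. isfm a \<and> istm b \<and> istm c \<and> subf 0 b a d \<and> subf 0 c a e \<and>
      x = iimp (pr 5 (pr b c)) (iimp d e))"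

lemma sat_LogAxF [simp]: "sat e LogAxF \<longleftrightarrow> logax (e 0)"
  unfolding LogAxF_def logax_def by (simp add: numeral_nat disj_assoc)

definition haax :: "'a :: pa \<Rightarrow> bool" where
  "haax x \<longleftrightarrow> (\<exists>A\<in>set basic_axioms. x = of_nat \<ulcorner>A\<urcorner>) \<or>
    fmf 0 x \<and> (\<exists>e d c b a. isfm a \<and> subf 0 (pr 1 0) a b \<and> liftf 1 a c \<and> subf 0 (pr 2 (pr 0 0)) c d \<and>
      e = iimp (iconj b (pr 10 (iimp a d))) (pr 10 a) \<and> closf e x)"

lemma sat_HaAxF [simp]: "sat e HaAxF \<longleftrightarrow> haax (e 0)"
  unfolding HaAxF_def haax_def by (simp add: numeral_nat of_nat_prod_encode)

definition prov_op :: "('a :: pa \<Rightarrow> bool) \<Rightarrow> ('a \<Rightarrow> bool) \<Rightarrow> 'a \<Rightarrow> bool" where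
  "prov_op A P y \<longleftrightarrow> logax y \<or> (fmf 0 y \<and> A y) \<or> (\<exists>a b. y = b \<and> P a \<and> P (iimp a b)) \<or>
    (\<exists>a. y = pr 10 a \<and> P a)"

definition bx :: "('a :: pa \<Rightarrow> bool) \<Rightarrow> 'a \<Rightarrow> bool" where "bx A x \<longleftrightarrow> dr (prov_op A) x"

lemma prov_op: "step_op (prov_op A)"
  unfolding prov_op_def by (rule step_op_rules)+

definition ext :: "fm \<Rightarrow> 'a :: pa \<Rightarrow> bool" where "ext \<alpha> x \<longleftrightarrow> sat (\<lambda>_. x) \<alpha>"

lemma sat_prov_step:
  assumes "closed_fm 1 \<alpha>" shows "sat_step (prov_step \<alpha>) (prov_op (ext \<alpha>))"
proof -
  have "sat (y ## e) \<alpha> = ext \<alpha> y" for y :: 'a and e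
    unfolding ext_def by (rule sat_closed[OF assms]) simp
  then show ?thesis unfolding sat_step_def prov_step_def prov_op_def
    by (simp add: numeral_nat disj_assoc)
qed

lemma sat_Box [simp]: "closed_fm 1 \<alpha> \<Longrightarrow> sat e (Box \<alpha> x) \<longleftrightarrow> bx (ext \<alpha>) (val e x)"
  by (simp add: Box_def sat_Deriv[OF sat_prov_step] bx_def)

section \<open>Coded syntax\<close>

lemma tmf_iff: "tmf k x \<longleftrightarrow> (\<exists>i<k. x = pr 0 i) \<or> x = pr 1 0 \<or> (\<exists>s. x = pr 2 s \<and> tmf k s) \<or>
    (\<exists>s t. x = pr 3 (pr s t) \<and> tmf k s \<and> tmf k t) \<or> (\<exists>s t. x = pr 4 (pr s t) \<and> tmf k s \<and> tmf k t)"
  unfolding tmf_def by (subst dr_unfold[OF tm_op]) (auto simp: tm_op_def)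

lemma fmf_iff: "fmf k x \<longleftrightarrow> (\<exists>s t. x = pr 5 (pr s t) \<and> tmf k s \<and> tmf k t) \<or> x = pr 6 0 \<or>
    (\<exists>g\<in>{7, 8, 9}. \<exists>s t. x = pr g (pr s t) \<and> fmf k s \<and> fmf k t) \<or>
    (\<exists>g\<in>{10, 11}. \<exists>s. x = pr g s \<and> fmf (k + 1) s)"
  unfolding fmf_def by (subst dr_unfold[OF fm_op]) (simp add: fm_op_def, blast)

lemma tmf_simps [simp]:
  "tmf k (pr 0 i) \<longleftrightarrow> i < k" "tmf k (pr 1 0)" "tmf k (pr 2 s) \<longleftrightarrow> tmf k s"
  "tmf k (pr 3 (pr s t)) \<longleftrightarrow> tmf k s \<and> tmf k t" "tmf k (pr 4 (pr s t)) \<longleftrightarrow> tmf k s \<and> tmf k t"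
  "\<not> tmf k (pr 5 x)" "\<not> tmf k (pr 6 x)" "\<not> tmf k (pr 7 x)" "\<not> tmf k (pr 8 x)" "\<not> tmf k (pr 9 x)"
  "\<not> tmf k (pr 10 x)" "\<not> tmf k (pr 11 x)"
  by (subst tmf_iff, simp)+

lemma fmf_simps [simp]:
  "fmf k (pr 5 (pr s t)) \<longleftrightarrow> tmf k s \<and> tmf k t" "fmf k (pr 6 0)"
  "fmf k (pr 7 (pr s t)) \<longleftrightarrow> fmf k s \<and> fmf k t" "fmf k (pr 8 (pr s t)) \<longleftrightarrow> fmf k s \<and> fmf k t"
  "fmf k (pr 9 (pr s t)) \<longleftrightarrow> fmf k s \<and> fmf k t"
  "fmf k (pr 10 a) \<longleftrightarrow> fmf (k + 1) a" "fmf k (pr 11 a) \<longleftrightarrow> fmf (k + 1) a"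
  "\<not> fmf k (pr 0 x)" "\<not> fmf k (pr 1 x)" "\<not> fmf k (pr 2 x)" "\<not> fmf k (pr 3 x)" "\<not> fmf k (pr 4 x)"
  by (subst fmf_iff, simp)+

lemma liftf_unfold: "liftf k x y \<longleftrightarrow> lift_op (\<lambda>z. dr lift_op z) (pr k (pr x y))"
  unfolding liftf_def by (subst dr_unfold[OF lift_op]) simp

lemma liftf_intros:
  "i < k \<Longrightarrow> liftf k (pr 0 i) (pr 0 i)"
  "k \<le> i \<Longrightarrow> liftf k (pr 0 i) (pr 0 (i + 1))"
  "liftf k (pr 1 0) (pr 1 0)" "liftf k (pr 6 0) (pr 6 0)"
  "liftf k a b \<Longrightarrow> liftf k (pr 2 a) (pr 2 b)"
  "g \<in> {3, 4, 5, 7, 8, 9} \<Longrightarrow> liftf k a a' \<Longrightarrow> liftf k b b' \<Longrightarrow> liftf k (pr g (pr a b)) (pr g (pr a' b'))"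
  "g \<in> {10, 11} \<Longrightarrow> liftf (k + 1) a b \<Longrightarrow> liftf k (pr g a) (pr g b)"
  by (subst liftf_unfold, simp add: lift_op_def liftf_def; blast)+

lemma subf_unfold: "subf k t x y \<longleftrightarrow> sub_op (\<lambda>z. dr sub_op z) (pr k (pr t (pr x y)))"
  unfolding subf_def by (subst dr_unfold[OF sub_op]) simp

lemma subf_intros:
  "i < k \<Longrightarrow> subf k t (pr 0 i) (pr 0 i)"
  "subf k t (pr 0 k) t"
  "k \<le> i \<Longrightarrow> subf k t (pr 0 (i + 1)) (pr 0 i)"
  "subf k t (pr 1 0) (pr 1 0)" "subf k t (pr 6 0) (pr 6 0)"
  "subf k t a b \<Longrightarrow> subf k t (pr 2 a) (pr 2 b)"
  "g \<in> {3, 4, 5, 7, 8, 9} \<Longrightarrow> subf k t a a' \<Longrightarrow> subf k t b b' \<Longrightarrow> subf k t (pr g (pr a b)) (pr g (pr a' b'))"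
  "g \<in> {10, 11} \<Longrightarrow> liftf 0 t t' \<Longrightarrow> subf (k + 1) t' a b \<Longrightarrow> subf k t (pr g a) (pr g b)"
  by (subst subf_unfold, simp add: sub_op_def subf_def; blast)+

lemma closf_intros: "closf x x" "closf x y \<Longrightarrow> closf x (pr 10 y)"
  unfolding closf_def by (subst dr_unfold[OF clos_op], simp add: clos_op_def)+

text \<open>Codes of actual terms and formulas as elements of a model, to be told apart from
  arbitrary elements that satisfy \<open>istm\<close> or \<open>isfm\<close>.\<close>

definition gt :: "tm \<Rightarrow> 'a :: pa" where "gt t = of_nat (code_tm t)"
definition gf :: "fm \<Rightarrow> 'a :: pa" where "gf A = of_nat \<ulcorner>A\<urcorner>"

lemma gt_simps [simp]:
  "gt (Var i) = pr 0 (of_nat i)" "gt Zero = pr 1 0" "gt (Scc s) = pr 2 (gt s)"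
  "gt (Add s t) = pr 3 (pr (gt s) (gt t))" "gt (Mul s t) = pr 4 (pr (gt s) (gt t))"
  by (simp_all add: gt_def of_nat_prod_encode)

lemma gf_simps [simp]:
  "gf (s \<^bold>= t) = pr 5 (pr (gt s) (gt t))" "gf Fls = pr 6 0"
  "gf (A \<^bold>\<and> B) = pr 7 (pr (gf A) (gf B))" "gf (A \<^bold>\<or> B) = pr 8 (pr (gf A) (gf B))"
  "gf (A \<^bold>\<longrightarrow> B) = pr 9 (pr (gf A) (gf B))" "gf (Uni A) = pr 10 (gf A)" "gf (Exi A) = pr 11 (gf A)"
  by (simp_all add: gf_def gt_def of_nat_prod_encode)

lemma tmf_gt: "closed_tm k t \<Longrightarrow> tmf (of_nat k) (gt t)"
  by (induction t) auto

lemma fmf_gf: "closed_fm k A \<Longrightarrow> fmf (of_nat k) (gf A)"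
proof (induction A arbitrary: k)
  case (Uni A) from Uni.IH[of "Suc k"] Uni.prems show ?case by (simp add: add.commute)
next
  case (Exi A) from Exi.IH[of "Suc k"] Exi.prems show ?case by (simp add: add.commute)
qed (auto simp: tmf_gt)

lemma fmf0_gf: "closed_fm 0 A \<Longrightarrow> fmf 0 (gf A)"
  using fmf_gf[of 0] by simp

lemma istm_gt: "istm (gt t)"
  unfolding istm_def using closed_tm_ex tmf_gt by blast

lemma isfm_gf: "isfm (gf A)"
  unfolding isfm_def using closed_fm_ex fmf_gf by blast

lemma liftf_gt: "liftf (of_nat k) (gt t) (gt (lift_tm k t))"
proof (induction t)
  case (Var i)
  show ?case
  proof (cases "i < k")
    case True then show ?thesis by (simp add: liftf_intros)
  next
    case False then show ?thesis using liftf_intros(2)[of "of_nat k" "of_nat i"] by (simp add: add.commute)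
  qed
qed (simp_all add: liftf_intros)

lemma liftf_gf: "liftf (of_nat k) (gf A) (gf (lift_fm k A))"
proof (induction A arbitrary: k)
  case (Uni A) from Uni.IH[of "Suc k"] show ?case by (simp add: add.commute liftf_intros)
next
  case (Exi A) from Exi.IH[of "Suc k"] show ?case by (simp add: add.commute liftf_intros)
qed (simp_all add: liftf_intros liftf_gt)

lemma subf_gt: "subf (of_nat k) (gt u) (gt t) (gt (sub_tm k u t))"
proof (induction t)
  case (Var i)
  consider "i < k" | "i = k" | j where "i = Suc j" "k \<le> j"
    by (metis Suc_leI less_imp_Suc_add linorder_neqE_nat le_add1)
  then show ?case
  proof cases
    case 3 then show ?thesis using subf_intros(3)[of "of_nat k" "of_nat j"] by (simp add: add.commute)
  qed (simp_all add: subf_intros)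
qed (simp_all add: subf_intros)

lemma subf_gf: "subf (of_nat k) (gt u) (gf A) (gf (sub_fm k u A))"
proof (induction A arbitrary: k u)
  case (Uni A)
  from Uni.IH[of "Suc k" "lift_tm 0 u"] liftf_gt[of 0 u] show ?case
    using subf_intros(8)[of 10 "gt u" "gt (lift_tm 0 u)" "of_nat k"] by (simp add: add.commute)
next
  case (Exi A)
  from Exi.IH[of "Suc k" "lift_tm 0 u"] liftf_gt[of 0 u] show ?case
    using subf_intros(8)[of 11 "gt u" "gt (lift_tm 0 u)" "of_nat k"] by (simp add: add.commute)
qed (simp_all add: subf_intros subf_gt)

lemma logax_prop:
  "isfm a \<Longrightarrow> isfm b \<Longrightarrow> isfm c \<Longrightarrow>
    x = iimp a (iimp b a) \<or> x = iimp (iimp a (iimp b c)) (iimp (iimp a b) (iimp a c)) \<or>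
    x = iimp a (iimp b (iconj a b)) \<or> x = iimp (iconj a b) a \<or> x = iimp (iconj a b) b \<or>
    x = iimp a (idisj a b) \<or> x = iimp b (idisj a b) \<or>
    x = iimp (iimp a c) (iimp (iimp b c) (iimp (idisj a b) c)) \<or> x = iimp (pr 6 0) a \<Longrightarrow> logax x"
  unfolding logax_def by (rule disjI1, rule exI[of _ c], rule exI[of _ b], rule exI[of _ a]) (intro conjI)

lemma logax_inst:
  "isfm a \<Longrightarrow> istm b \<Longrightarrow> subf 0 b a c \<Longrightarrow> x = iimp (pr 10 a) c \<or> x = iimp c (pr 11 a) \<Longrightarrow> logax x"
  unfolding logax_def
  by (rule disjI2, rule disjI1, rule exI[of _ c], rule exI[of _ b], rule exI[of _ a]) (intro conjI)

lemma logax_quant: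
  "isfm a \<Longrightarrow> isfm b \<Longrightarrow> liftf 0 a c \<Longrightarrow>
    x = iimp (pr 10 (iimp c b)) (iimp a (pr 10 b)) \<or> x = iimp (pr 10 (iimp b c)) (iimp (pr 11 b) a) \<Longrightarrow> logax x"
  unfolding logax_def
  by (rule disjI2, rule disjI2, rule disjI1, rule exI[of _ c], rule exI[of _ b], rule exI[of _ a]) (intro conjI)

lemma logax_refl: "istm a \<Longrightarrow> logax (pr 5 (pr a a))"
  unfolding logax_def by (rule disjI2, rule disjI2, rule disjI2, rule disjI1, rule exI[of _ a]) simp

lemma logax_subst:
  "isfm a \<Longrightarrow> istm b \<Longrightarrow> istm c \<Longrightarrow> subf 0 b a d \<Longrightarrow> subf 0 c a e \<Longrightarrow>
    logax (iimp (pr 5 (pr b c)) (iimp d e))"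
  unfolding logax_def by (rule disjI2, rule disjI2, rule disjI2, rule disjI2,
    rule exI[of _ e], rule exI[of _ d], rule exI[of _ c], rule exI[of _ b], rule exI[of _ a]) simp

lemma logax_gf: "log_ax A \<Longrightarrow> logax (gf A :: 'a :: pa)"
proof (induction rule: log_ax.induct)
  case (2 A B C) show ?case unfolding gf_simps by (rule logax_prop[OF isfm_gf[of A] isfm_gf[of B] isfm_gf[of C]]) simp
next
  case (8 A C B) show ?case unfolding gf_simps by (rule logax_prop[OF isfm_gf[of A] isfm_gf[of B] isfm_gf[of C]]) simp
next
  case (9 A) show ?case unfolding gf_simps by (rule logax_prop[OF isfm_gf[of A] isfm_gf[of A] isfm_gf[of A]]) simp
next
  case (10 A t)
  show ?case unfolding gf_simps by (rule logax_inst[OF isfm_gf istm_gt subf_gf[of 0 t A, simplified]]) simp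
next
  case (11 t A)
  show ?case unfolding gf_simps by (rule logax_inst[OF isfm_gf istm_gt subf_gf[of 0 t A, simplified]]) simp
next
  case (12 A B)
  show ?case unfolding gf_simps by (rule logax_quant[OF isfm_gf isfm_gf[of B] liftf_gf[of 0 A, simplified]]) simp
next
  case (13 B A)
  show ?case unfolding gf_simps by (rule logax_quant[OF isfm_gf isfm_gf[of B] liftf_gf[of 0 A, simplified]]) simp
next
  case (14 t) show ?case unfolding gf_simps by (rule logax_refl[OF istm_gt])
next
  case (15 s t A)
  show ?case unfolding gf_simps
    by (rule logax_subst[OF isfm_gf istm_gt istm_gt subf_gf[of 0 s A, simplified] subf_gf[of 0 t A, simplified]])
next
  case (1 A B) show ?case unfolding gf_simps by (rule logax_prop[OF isfm_gf[of A] isfm_gf[of B] isfm_gf[of A]]) simp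
next
  case (3 A B) show ?case unfolding gf_simps by (rule logax_prop[OF isfm_gf[of A] isfm_gf[of B] isfm_gf[of A]]) simp
next
  case (4 A B) show ?case unfolding gf_simps by (rule logax_prop[OF isfm_gf[of A] isfm_gf[of B] isfm_gf[of A]]) simp
next
  case (5 A B) show ?case unfolding gf_simps by (rule logax_prop[OF isfm_gf[of A] isfm_gf[of B] isfm_gf[of A]]) simp
next
  case (6 A B) show ?case unfolding gf_simps by (rule logax_prop[OF isfm_gf[of A] isfm_gf[of B] isfm_gf[of A]]) simp
next
  case (7 B A) show ?case unfolding gf_simps by (rule logax_prop[OF isfm_gf[of A] isfm_gf[of B] isfm_gf[of A]]) simp
qed

lemma haax_gf: "A \<in> HA \<Longrightarrow> haax (gf A :: 'a :: pa)"
proof -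
  have clos: "closf (gf B) (gf ((Uni ^^ n) B))" for n B by (induction n) (auto intro: closf_intros)
  assume A: "A \<in> HA"
  show ?thesis
  proof (cases "A \<in> set basic_axioms")
    case True then show ?thesis unfolding haax_def gf_def by blast
  next
    case False
    then obtain n B where B: "A = (Uni ^^ n) (ind_ax B)" using A by (auto simp: HA_def)
    show ?thesis
      unfolding haax_def
    proof (rule disjI2, intro conjI exI)
      show "fmf 0 (gf A)" by (rule fmf0_gf[OF HA_closed[OF A]])
      show "isfm (gf B)" by (rule isfm_gf)
      show "subf 0 (pr 1 0) (gf B) (gf (sub_fm 0 Zero B))" using subf_gf[of 0 Zero B] by simp
      show "liftf 1 (gf B) (gf (lift_fm 1 B))" using liftf_gf[of 1 B] by simp
      show "subf 0 (pr 2 (pr 0 0)) (gf (lift_fm 1 B)) (gf (sub_fm 0 (Scc (Var 0)) (lift_fm 1 B)))"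
        using subf_gf[of 0 "Scc (Var 0)"] by simp
      show "gf (ind_ax B) = iimp (iconj (gf (sub_fm 0 Zero B)) (pr 10 (iimp (gf B)
         (gf (sub_fm 0 (Scc (Var 0)) (lift_fm 1 B)))))) (pr 10 (gf B))" by (simp add: ind_ax_def)
      show "closf (gf (ind_ax B)) (gf A)" unfolding B by (rule clos)
    qed
  qed
qed

section \<open>Provability inside a model\<close>

lemma bx_unfold: "bx A x \<longleftrightarrow> prov_op A (bx A) x"
  unfolding bx_def by (subst dr_unfold[OF prov_op]) simp

lemma bx_log: "logax x \<Longrightarrow> bx A x"
  by (subst bx_unfold) (simp add: prov_op_def)

lemma bx_ax: "fmf 0 x \<Longrightarrow> A x \<Longrightarrow> bx A x"
  by (subst bx_unfold) (simp add: prov_op_def)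

lemma bx_mp: "bx A (iimp x y) \<Longrightarrow> bx A x \<Longrightarrow> bx A y"
  by (subst bx_unfold) (auto simp: prov_op_def)

lemma bx_gen: "bx A x \<Longrightarrow> bx A (pr 10 x)"
  by (subst bx_unfold) (auto simp: prov_op_def)

lemma bx_HA:
  assumes A: "\<And>x. haax x \<Longrightarrow> A x" and B: "HA \<^bold>\<turnstile> B"
  shows "bx A (gf B)"
  using B
proof (induction rule: prv.induct)
  case (logic B) then show ?case by (intro bx_log logax_gf)
next
  case (axiom B) then show ?case by (intro bx_ax A haax_gf fmf0_gf HA_closed)
next
  case (mp B C) then show ?case by (auto intro: bx_mp)
next
  case (gen B) then show ?case by (auto intro: bx_gen)
qed

lemma dfb_bx: "closed_fm 1 \<beta> \<Longrightarrow> dfb (bx (ext \<beta>))"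
  by (rule dfbI[of _ "\<lambda>_. 0" "Box \<beta> (Var 0)"]) simp

text \<open>The induction is for provability from \<beta>, so only \<beta> has to be given by a
  formula; \<open>A\<close> may be any set of elements.\<close>

lemma bx_cut:
  assumes b: "closed_fm 1 \<beta>" and A: "\<And>u. fmf 0 u \<Longrightarrow> A u \<Longrightarrow> bx (ext \<beta>) u" and x: "bx A x"
  shows "bx (ext \<beta>) x"
  by (rule dr_induct[OF prov_op dfb_bx[OF b] _ x[unfolded bx_def]])
    (auto simp: prov_op_def intro: bx_log A bx_mp bx_gen)

section \<open>Free indices of possibly nonstandard terms and formulas\<close>

lemma tmf_mono: "tmf k x \<Longrightarrow> k \<le> l \<Longrightarrow> tmf l x"
proof -
  let ?P = "\<lambda>z. \<forall>k x. z = pr k x \<longrightarrow> (\<forall>l. k \<le> l \<longrightarrow> tmf l x)"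
  have "?P z" if "dr tm_op z" for z :: 'a
  proof (rule dr_induct[OF tm_op, of ?P, OF _ _ that])
    show "dfb ?P"
      by (rule dfbI[of _ "\<lambda>_. 0" "Uni (Uni (pairing (Var 1) (Var 0) (Var 2) \<^bold>\<longrightarrow>
        Uni (Var 2 \<^bold>\<le> Var 0 \<^bold>\<longrightarrow> TmF (Var 0) (Var 1))))"]) (simp add: numeral_nat)
  qed (auto simp: tm_op_def)
  then show "tmf k x \<Longrightarrow> k \<le> l \<Longrightarrow> tmf l x" by (auto simp: tmf_def)
qed

lemma fmf_mono: "fmf k x \<Longrightarrow> k \<le> l \<Longrightarrow> fmf l x"
proof -
  let ?P = "\<lambda>z. \<forall>k x. z = pr k x \<longrightarrow> (\<forall>l. k \<le> l \<longrightarrow> fmf l x)"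
  have "?P z" if "dr fm_op z" for z :: 'a
  proof (rule dr_induct[OF fm_op, of ?P, OF _ _ that])
    show "dfb ?P"
      by (rule dfbI[of _ "\<lambda>_. 0" "Uni (Uni (pairing (Var 1) (Var 0) (Var 2) \<^bold>\<longrightarrow>
        Uni (Var 2 \<^bold>\<le> Var 0 \<^bold>\<longrightarrow> FmF (Var 0) (Var 1))))"]) (simp add: numeral_nat)
  qed (auto simp: fm_op_def intro: tmf_mono)
  then show "fmf k x \<Longrightarrow> k \<le> l \<Longrightarrow> fmf l x" by (auto simp: fmf_def)
qed

text \<open>What is derived is the code of a tuple, so the induction predicate quantifies over all
  components with that code. The bound rises by one since lifting may raise the largest
  index.\<close>

lemma liftf_closed:
  assumes "liftf k x y"
  shows "(tmf j x \<longrightarrow> tmf (j + 1) y) \<and> (fmf j x \<longrightarrow> fmf (j + 1) y)"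
proof -
  let ?P = "\<lambda>z. \<forall>k x y. z = pr k (pr x y) \<longrightarrow> (\<forall>j. (tmf j x \<longrightarrow> tmf (j + 1) y) \<and> (fmf j x \<longrightarrow> fmf (j + 1) y))"
  have "?P z" if "dr lift_op z" for z :: 'a
  proof (rule dr_induct[OF lift_op, of ?P, OF _ _ that])
    show "dfb ?P"
      by (rule dfbI[of _ "\<lambda>_. 0" "Uni (Uni (Uni (matches 0 (V 2 \<triangleright> V 1 \<triangleright> V 0) (Var 3) \<^bold>\<longrightarrow>
        Uni ((TmF (Var 0) (Var 2) \<^bold>\<longrightarrow> TmF (Scc (Var 0)) (Var 1)) \<^bold>\<and>
             (FmF (Var 0) (Var 2) \<^bold>\<longrightarrow> FmF (Scc (Var 0)) (Var 1))))))"]) (simp add: numeral_nat)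
  qed (auto simp: lift_op_def less_imp_le)
  then show ?thesis using assms by (auto simp: liftf_def)
qed

lemma subf_closed:
  assumes "subf k t x y" "k \<le> j" "tmf j t"
  shows "(tmf (j + 1) x \<longrightarrow> tmf j y) \<and> (fmf (j + 1) x \<longrightarrow> fmf j y)"
proof -
  let ?P = "\<lambda>z. \<forall>k t x y. z = pr k (pr t (pr x y)) \<longrightarrow> (\<forall>j. k \<le> j \<longrightarrow> tmf j t \<longrightarrow>
     (tmf (j + 1) x \<longrightarrow> tmf j y) \<and> (fmf (j + 1) x \<longrightarrow> fmf j y))"
  have "?P z" if "dr sub_op z" for z :: 'a
  proof (rule dr_induct[OF sub_op, of ?P, OF _ _ that])
    show "dfb ?P"
      by (rule dfbI[of _ "\<lambda>_. 0" "Uni (Uni (Uni (Uni (matches 0 (V 3 \<triangleright> V 2 \<triangleright> V 1 \<triangleright> V 0) (Var 4) \<^bold>\<longrightarrow>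
        Uni (Var 4 \<^bold>\<le> Var 0 \<^bold>\<longrightarrow> TmF (Var 0) (Var 3) \<^bold>\<longrightarrow>
             (TmF (Scc (Var 0)) (Var 2) \<^bold>\<longrightarrow> TmF (Var 0) (Var 1)) \<^bold>\<and>
             (FmF (Scc (Var 0)) (Var 2) \<^bold>\<longrightarrow> FmF (Var 0) (Var 1)))))))"]) (simp add: numeral_nat)
  qed (auto simp: sub_op_def less_imp_le dest: liftf_closed)
  then show ?thesis using assms by (auto simp: subf_def)
qed

lemma ex_fmf_conj: "(\<exists>k. fmf k a \<and> fmf k b) \<longleftrightarrow> isfm a \<and> isfm b"
  unfolding isfm_def using fmf_mono[of _ a] fmf_mono[of _ b] by (metis linear)

lemma ex_tmf_conj: "(\<exists>k. tmf k a \<and> tmf k b) \<longleftrightarrow> istm a \<and> istm b"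
  unfolding istm_def using tmf_mono[of _ a] tmf_mono[of _ b] by (metis linear)

lemma ex_fmf_Suc: "(\<exists>k. fmf (k + 1) a) \<longleftrightarrow> isfm a"
  unfolding isfm_def using fmf_mono[of _ a] by (metis less_imp_le pa_Suc_le order_refl)

lemma isfm_simps [simp]:
  "isfm (pr 7 (pr a b)) \<longleftrightarrow> isfm a \<and> isfm b" "isfm (pr 8 (pr a b)) \<longleftrightarrow> isfm a \<and> isfm b"
  "isfm (pr 9 (pr a b)) \<longleftrightarrow> isfm a \<and> isfm b" "isfm (pr 10 a) \<longleftrightarrow> isfm a" "isfm (pr 11 a) \<longleftrightarrow> isfm a"
  "isfm (pr 5 (pr a b)) \<longleftrightarrow> istm a \<and> istm b" "isfm (pr 6 0)"
  by (simp_all add: isfm_def[of "pr _ _"] ex_fmf_conj ex_tmf_conj ex_fmf_Suc)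

lemma isfm_subf: assumes "subf 0 t x y" "istm t" "isfm x" shows "isfm y"
proof -
  obtain k l where k: "tmf k t" "fmf l x" using assms by (auto simp: istm_def isfm_def)
  have "tmf (max k l) t" "fmf (max k l + 1) x"
    using k by (auto intro: tmf_mono fmf_mono[OF k(2)] simp: less_imp_le le_max_iff_disj)
  then show ?thesis using subf_closed[OF assms(1) zero_le] by (auto simp: isfm_def)
qed

lemma isfm_liftf: "liftf k x y \<Longrightarrow> isfm x \<Longrightarrow> isfm y"
  unfolding isfm_def using liftf_closed by blast

lemma logax_isfm: "logax x \<Longrightarrow> isfm x"
  unfolding logax_def by (elim disjE exE conjE) (auto dest: isfm_subf isfm_liftf)

text \<open>Logical axioms ask for codes of formulas, so a proof can be extended by an axiom about
  its conclusion only once the conclusion is known to be a formula, for nonstandard proofs as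
  well.\<close>

lemma bx_isfm: "bx A x \<Longrightarrow> isfm x"
proof -
  have "isfm x" if "dr (prov_op A) x"
  proof (rule dr_induct[OF prov_op _ _ that])
    show "dfb (isfm :: 'a \<Rightarrow> bool)" by (rule dfbI[of _ "\<lambda>_. 0" "IsFm (Var 0)"]) simp
    fix y assume "prov_op A (\<lambda>q. dr (prov_op A) q \<and> isfm q) y"
    then consider "logax y" | "fmf 0 y" | a where "isfm (iimp a y)" | a where "y = pr 10 a" "isfm a"
      unfolding prov_op_def by blast
    then show "isfm y" by cases (simp_all add: logax_isfm, auto simp: isfm_def)
  qed
  then show "bx A x \<Longrightarrow> isfm x" by (simp add: bx_def)
qed

lemma bx_K: "bx A x \<Longrightarrow> isfm y \<Longrightarrow> bx A (iimp y x)"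
  by (rule bx_mp[OF bx_log[OF logax_prop[of x y x]]]) (auto dest: bx_isfm)

text \<open>The deduction theorem for proofs inside a model. That \<open>s\<close> is closed enters
  as \<open>liftf 0 s s\<close>: lifting does not change it, so the quantifier axiom moves it out of
  a generalization.\<close>

lemma bx_deduction:
  assumes b: "closed_fm 1 \<beta>" and s: "isfm s" "liftf 0 s s"
    and A: "\<And>u. fmf 0 u \<Longrightarrow> A u \<Longrightarrow> bx (ext \<beta>) (iimp s u)" and x: "bx A x"
  shows "bx (ext \<beta>) (iimp s x)"
proof (rule dr_induct[OF prov_op _ _ x[unfolded bx_def]])
  show "dfb (\<lambda>x. bx (ext \<beta>) (iimp s x))"
    by (rule dfbI[of _ "\<lambda>_. s" "Exi (matches 0 (pImpl (V 2) (V 1)) (Var 0) \<^bold>\<and> Box \<beta> (Var 0))"])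
      (simp add: b[simplified] numeral_nat)
  fix y assume "prov_op A (\<lambda>q. dr (prov_op A) q \<and> bx (ext \<beta>) (iimp s q)) y"
  then consider "logax y" | "fmf 0 y" "A y" | a where "bx A (iimp a y)" "bx A a"
      "bx (ext \<beta>) (iimp s a)" "bx (ext \<beta>) (iimp s (iimp a y))"
    | a where "y = pr 10 a" "bx A a" "bx (ext \<beta>) (iimp s a)"
    unfolding prov_op_def bx_def[of A] by blast
  then show "bx (ext \<beta>) (iimp s y)"
  proof cases
    case 1 then show ?thesis using s by (intro bx_K bx_log)
  next
    case 2 then show ?thesis by (rule A)
  next
    case (3 a)
    have "isfm a" "isfm y" using bx_isfm[OF 3(1)] by simp_all
    then have "logax (iimp (iimp s (iimp a y)) (iimp (iimp s a) (iimp s y)))"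
      using s(1) by (intro logax_prop[of s a y]) simp_all
    from bx_mp[OF bx_mp[OF bx_log[OF this] 3(4)] 3(3)] show ?thesis .
  next
    case (4 a)
    have "isfm a" using bx_isfm[OF 4(2)] .
    then have "logax (iimp (pr 10 (iimp s a)) (iimp s (pr 10 a)))"
      using s by (intro logax_quant[of s a s]) simp_all
    from bx_mp[OF bx_log[OF this] bx_gen[OF 4(3)]] show ?thesis using 4(1) by simp
  qed
qed

section \<open>Numerals and formulas with parameters inside a model\<close>

text \<open>The numeral function as a \<Sigma>-formula. It serves twice: nonstandard parameters are
  named by their numerals, and the diagonalization needs the code of the numeral of a code.\<close>

definition num_step :: fm where
  "num_step = disjs [Cur 0 (At Zero \<triangleright> pZero),
    ExN 2 (Cur 2 (At (Scc (Var 0)) \<triangleright> pScc (V 1)) \<^bold>\<and> Prev 2 (V 0 \<triangleright> V 1))]"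

definition NumF :: "tm \<Rightarrow> tm \<Rightarrow> fm" where
  "NumF x z = Deriv num_step (At x \<triangleright> At z)"

definition num_op :: "('a :: pa \<Rightarrow> bool) \<Rightarrow> 'a \<Rightarrow> bool" where
  "num_op P y \<longleftrightarrow> y = pr 0 (pr 1 0) \<or> (\<exists>z x. y = pr (x + 1) (pr 2 z) \<and> P (pr x z))"

lemma num_op: "step_op num_op"
  unfolding num_op_def by (rule step_op_rules)+

lemma sat_num_step: "sat_step num_step num_op"
  unfolding sat_step_def num_step_def num_op_def by (simp add: numeral_nat disj_assoc)

lemma numf_iff: "dr num_op (pr x z) \<longleftrightarrow> x = 0 \<and> z = pr 1 0 \<or> (\<exists>y w. x = y + 1 \<and> z = pr 2 w \<and> dr num_op (pr y w))"
  by (subst dr_unfold[OF num_op]) (auto simp: num_op_def)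

definition numc :: "'a :: pa \<Rightarrow> 'a" where
  "numc x = (THE z. dr num_op (pr x z))"

lemma numf_ex1: "\<exists>!z. dr num_op (pr x (z :: 'a :: pa))"
proof (rule dfb_induct[of "\<lambda>x. \<exists>!z. dr num_op (pr x z)"])
  show "dfb (\<lambda>x :: 'a. \<exists>!z. dr num_op (pr x z))"
    by (rule dfbI[of _ "\<lambda>_. 0" "Exi (NumF (Var 1) (Var 0) \<^bold>\<and> Uni (NumF (Var 2) (Var 0) \<^bold>\<longrightarrow> Var 0 \<^bold>= Var 1))"])
      (simp add: NumF_def sat_Deriv[OF sat_num_step] Ex1_def numeral_nat)
  show "\<exists>!z :: 'a. dr num_op (pr 0 z)"
    by (subst numf_iff) (use pa_Suc_ne in metis)
  fix x :: 'a assume h: "\<exists>!z. dr num_op (pr x z)"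
  have "dr num_op (pr (x + 1) z) \<longleftrightarrow> (\<exists>w. z = pr 2 w \<and> dr num_op (pr x w))" for z
    by (subst numf_iff) (use pa_Suc_ne[of x] in auto)
  then show "\<exists>!z. dr num_op (pr (x + 1) z)" using h by auto
qed

lemma numc_iff: "dr num_op (pr x z) \<longleftrightarrow> z = numc x"
  unfolding numc_def using numf_ex1[of x] by (metis (mono_tags, lifting) the_equality)

lemma sat_NumF [simp]: "sat e (NumF x z) \<longleftrightarrow> val e z = numc (val e x)"
  by (simp add: NumF_def sat_Deriv[OF sat_num_step] numc_iff)

lemma numc_0 [simp]: "numc 0 = pr 1 0"
proof -
  have "dr num_op (pr 0 (pr 1 0 :: 'a))" by (subst numf_iff) simp
  then show ?thesis by (simp only: numc_iff)
qed

lemma numc_Suc [simp]: "numc (x + 1) = pr 2 (numc x)"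
  using numf_iff[of "x + 1" "pr 2 (numc x)"] by (auto simp: numc_iff)

lemma numc_of_nat: "numc (of_nat n) = gt (num n)"
proof (induction n)
  case (Suc n) then show ?case using numc_Suc[of "of_nat n :: 'a"] by (simp add: add.commute)
qed simp

lemma tmf_numc: "tmf k (numc x)"
proof (rule dfb_induct[of "\<lambda>x. tmf k (numc x)"])
  show "dfb (\<lambda>x. tmf k (numc x))"
    by (rule dfbI[of _ "\<lambda>_. k" "Exi (NumF (Var 1) (Var 0) \<^bold>\<and> TmF (Var 2) (Var 0))"]) simp
qed auto

lemma istm_numc: "istm (numc x)"
  unfolding istm_def using tmf_numc[of 0 x] by blast

lemma liftf_numc: "liftf k (numc x) (numc x)"
proof (rule dfb_induct[of "\<lambda>x. liftf k (numc x) (numc x)"])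
  show "dfb (\<lambda>x. liftf k (numc x) (numc x))"
    by (rule dfbI[of _ "\<lambda>_. k" "Exi (NumF (Var 1) (Var 0) \<^bold>\<and> LiftF (Var 2) (Var 0) (Var 0))"]) simp
qed (auto intro: liftf_intros)

lemma subf_numc: "subf k t (numc x) (numc x)"
proof (rule dfb_induct[of "\<lambda>x. subf k t (numc x) (numc x)"])
  show "dfb (\<lambda>x. subf k t (numc x) (numc x))"
    by (rule dfbI[of _ "k ## (\<lambda>_. t)" "Exi (NumF (Var 1) (Var 0) \<^bold>\<and> SubF (Var 2) (Var 3) (Var 0) (Var 0))"]) simp
qed (auto intro: subf_intros)

text \<open>The code of a formula in which the free indices from \<open>k\<close> on are replaced by the numerals of
  the elements of an environment.\<close>

primrec et :: "nat \<Rightarrow> (nat \<Rightarrow> 'a :: pa) \<Rightarrow> tm \<Rightarrow> 'a" where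
  "et k e (Var i) = (if i < k then pr 0 (of_nat i) else numc (e (i - k)))"
| "et k e Zero = pr 1 0"
| "et k e (Scc s) = pr 2 (et k e s)"
| "et k e (Add s t) = pr 3 (pr (et k e s) (et k e t))"
| "et k e (Mul s t) = pr 4 (pr (et k e s) (et k e t))"

primrec ef :: "nat \<Rightarrow> (nat \<Rightarrow> 'a :: pa) \<Rightarrow> fm \<Rightarrow> 'a" where
  "ef k e (s \<^bold>= t) = pr 5 (pr (et k e s) (et k e t))"
| "ef k e Fls = pr 6 0"
| "ef k e (A \<^bold>\<and> B) = pr 7 (pr (ef k e A) (ef k e B))"
| "ef k e (A \<^bold>\<or> B) = pr 8 (pr (ef k e A) (ef k e B))"
| "ef k e (A \<^bold>\<longrightarrow> B) = pr 9 (pr (ef k e A) (ef k e B))"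
| "ef k e (Uni A) = pr 10 (ef (Suc k) e A)"
| "ef k e (Exi A) = pr 11 (ef (Suc k) e A)"

lemma et_closed: "closed_tm k t \<Longrightarrow> et k e t = gt t"
  by (induction t) auto

lemma ef_closed: "closed_fm k A \<Longrightarrow> ef k e A = gf A"
  by (induction A arbitrary: k) (auto simp: et_closed)

lemma ef_sentence: "closed_fm 0 A \<Longrightarrow> ef k e A = gf A"
  using closed_fm_mono ef_closed by blast

definition renk :: "nat \<Rightarrow> (nat \<Rightarrow> nat) \<Rightarrow> nat \<Rightarrow> nat" where
  "renk k \<rho> i = (if i < k then i else \<rho> (i - k) + k)"

lemma et_ren: "et k e (tsubst (\<lambda>i. Var (renk k \<rho> i)) t) = et k (\<lambda>i. e (\<rho> i)) t"
  by (induction t) (auto simp: renk_def)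

text \<open>Indices below \<open>k\<close> are the bound ones and stay fixed, so a renaming affects
  the environment only. Lifting is the case where \<open>Suc\<close> is the renaming.\<close>

lemma ef_ren: "ef k e (fsubst (\<lambda>i. Var (renk k \<rho> i)) A) = ef k (\<lambda>i. e (\<rho> i)) A"
proof (induction A arbitrary: k)
  have *: "up (\<lambda>i. Var (renk k \<rho> i)) = (\<lambda>i. Var (renk (Suc k) \<rho> i))" for k
    by (rule ext) (auto simp: renk_def up_def split: nat.split)
  { case (Uni A) then show ?case by (simp add: *) }
  { case (Exi A) then show ?case by (simp add: *) }
qed (auto simp: et_ren)

lemma ef_lift: "ef k (x ## e) (lift_fm k A) = ef k e A"
proof -
  have "(\<lambda>i. Var (renk k Suc i)) = (\<lambda>i. Var (if i < k then i else Suc i))"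
    by (rule ext) (auto simp: renk_def)
  then show ?thesis using ef_ren[of k "x ## e" Suc A] by (simp add: lift_fm_fsubst)
qed

lemma ef_lift0 [simp]: "ef 0 (x ## e) (lift_fm 0 A) = ef 0 e A"
  "ef (Suc 0) (x ## e) (lift_fm (Suc 0) A) = ef (Suc 0) e A"
  by (rule ef_lift)+

lemma et_lift0 [simp]: "et 0 (x ## e) (lift_tm 0 t) = et 0 e t"
  by (induction t) auto

lemma tmf_et: "tmf (of_nat k) (et k e t)"
  by (induction t) (auto simp: tmf_numc)

lemma fmf_ef: "fmf (of_nat k) (ef k e A)"
proof (induction A arbitrary: k)
  case (Uni A) from Uni.IH[of "Suc k"] show ?case by (simp add: add.commute)
next
  case (Exi A) from Exi.IH[of "Suc k"] show ?case by (simp add: add.commute)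
qed (auto simp: tmf_et)

lemma isfm_ef: "isfm (ef k e A)"
  unfolding isfm_def using fmf_ef by blast

lemma subf_et: "subf (of_nat k) (numc a) (et (Suc k) e t) (et k (a ## e) t)"
proof (induction t)
  case (Var i)
  consider "i < k" | "i = k" | j where "i = Suc (j + k)"
    by (metis add.commute less_imp_Suc_add linorder_neqE_nat)
  then show ?case by cases (auto intro: subf_intros subf_numc)
qed (simp_all add: subf_intros)

text \<open>Instantiation by the numeral of an element that may be nonstandard. The substituted term
  does not change under binders because a numeral is closed.\<close>

lemma subf_ef: "subf (of_nat k) (numc a) (ef (Suc k) e A) (ef k (a ## e) A)"
proof (induction A arbitrary: k)
  case (Uni A)
  from subf_intros(8)[of 10 "numc a" "numc a" "of_nat k"] Uni.IH[of "Suc k"] show ?case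
    by (simp add: liftf_numc add.commute)
next
  case (Exi A)
  from subf_intros(8)[of 11 "numc a" "numc a" "of_nat k"] Exi.IH[of "Suc k"] show ?case
    by (simp add: liftf_numc add.commute)
qed (simp_all add: subf_intros subf_et)

lemma bx_inst:
  assumes "bx A (ef 0 e (Uni B))" shows "bx A (ef 0 (a ## e) B)"
proof -
  have "logax (iimp (pr 10 (ef (Suc 0) e B)) (ef 0 (a ## e) B))"
    by (rule logax_inst[of "ef (Suc 0) e B" "numc a" "ef 0 (a ## e) B"])
      (use isfm_ef istm_numc subf_ef[of 0 a e B] in auto)
  from bx_mp[OF bx_log[OF this]] assms show ?thesis by simp
qed

text \<open>The theorem is first closed by quantifiers, as a sentence proved inside the model, and
  then instantiated by one numeral after the other.\<close>

lemma bx_env: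
  assumes A: "\<And>x. haax x \<Longrightarrow> A x" and B: "HA \<^bold>\<turnstile> B"
  shows "bx A (ef 0 e B)"
proof -
  have inst: "bx A (ef 0 (\<lambda>i. e (i + n)) ((Uni ^^ n) B)) \<Longrightarrow> bx A (ef 0 e B)" for n and e :: "nat \<Rightarrow> 'a" and B
  proof (induction n arbitrary: e B)
    case (Suc n)
    have "bx A (ef 0 (\<lambda>i. e (Suc i)) (Uni B))"
      by (rule Suc.IH) (use Suc.prems in \<open>simp only: funpow_Suc_right o_apply add_Suc_right\<close>)
    from bx_inst[OF this, of "e 0"] have "bx A (ef 0 (e 0 ## (\<lambda>i. e (Suc i))) B)" .
    moreover have "e 0 ## (\<lambda>i. e (Suc i)) = e" by (rule ext) (simp add: scons_def split: nat.split)
    ultimately show ?case by simp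
  qed simp
  obtain n where "closed_fm n B" using closed_fm_ex by blast
  then have c: "closed_fm 0 ((Uni ^^ n) B)" using closed_fm_closure[of 0 n B] by simp
  have "HA \<^bold>\<turnstile> (Uni ^^ n) B" by (induction n) (auto intro: prv.gen B)
  then have "bx A (gf ((Uni ^^ n) B))" by (rule bx_HA[rotated]) (rule A)
  then have "bx A (ef 0 (\<lambda>i. e (i + n)) ((Uni ^^ n) B))" by (simp add: ef_closed[OF c])
  then show ?thesis by (rule inst)
qed

text \<open>Natural deduction with free variables in HA becomes a way of combining proofs about
  numerals of nonstandard elements. All proofs inside a model are composed like this below when
  parameters are involved.\<close>

lemma bx_nd:
  assumes A: "\<And>x. haax x \<Longrightarrow> A x" and "\<Gamma> \<tturnstile> B" "\<And>C. C \<in> set \<Gamma> \<Longrightarrow> bx A (ef 0 e C)"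
  shows "bx A (ef 0 e B)"
  using assms(2,3)
proof (induction \<Gamma> arbitrary: B)
  case Nil then show ?case by (intro bx_env[OF A]) (simp_all add: nd_Nil)
next
  case (Cons C \<Gamma>)
  have "bx A (ef 0 e (C \<^bold>\<longrightarrow> B))" by (rule Cons.IH) (use Cons.prems in \<open>auto simp: nd_Cons\<close>)
  then show ?case using Cons.prems(2)[of C] by (auto intro: bx_mp)
qed

section \<open>Closedness and complexity of the arithmetized syntax\<close>

lemma closed_tm_lift [simp]: "closed_tm (Suc k) (lift_tm 0 t) = closed_tm k t"
  by (induction t) auto

lemma closed_tm_shift: "closed_tm k t \<Longrightarrow> k + n \<le> l \<Longrightarrow> closed_tm l ((lift_tm 0 ^^ n) t)"
proof (induction n arbitrary: l)
  case 0 then show ?case by (auto intro: closed_tm_mono)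
next
  case (Suc n)
  then show ?case by (cases l) auto
qed

lemma closed_num [simp]: "closed_tm k (num n)"
  by (induction n) auto

lemma closed_lt [simp]: "closed_fm k (s \<^bold>< t) \<longleftrightarrow> closed_tm k s \<and> closed_tm k t"
  by (simp add: lt_def)

lemma closed_le [simp]: "closed_fm k (s \<^bold>\<le> t) \<longleftrightarrow> closed_tm k s \<and> closed_tm k t"
  by (simp add: le_def)

lemma closed_disjs [simp]: "closed_fm k (disjs As) \<longleftrightarrow> (\<forall>A\<in>set As. closed_fm k A)"
  by (induction As) (auto simp: disjs_def)

lemma closed_ExN [simp]: "closed_fm k (ExN n A) \<longleftrightarrow> closed_fm (k + n) A"
  by (induction n arbitrary: k) auto

primrec closed_pat :: "nat \<Rightarrow> pat \<Rightarrow> bool" where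
  "closed_pat k (At t) \<longleftrightarrow> closed_tm k t"
| "closed_pat k (p \<triangleright> q) \<longleftrightarrow> closed_pat k p \<and> closed_pat k q"

lemma closed_pairing [simp]:
  "closed_fm k (pairing x y z) \<longleftrightarrow> closed_tm k x \<and> closed_tm k y \<and> closed_tm k z"
  by (auto simp: pairing_def)

lemma closed_matches: "closed_pat j p \<Longrightarrow> j + n \<le> k \<Longrightarrow> closed_tm k y \<Longrightarrow> closed_fm k (matches n p y)"
proof (induction p arbitrary: n k y)
  case (At t) then show ?case by (auto intro: closed_tm_shift)
next
  case (Pr p q)
  then show ?case
    using Pr.IH(1)[of "n + 2" "k + 2" "Var 1"] Pr.IH(2)[of "n + 2" "k + 2" "Var 0"]
      closed_tm_shift[of k y 2 "k + 2"]
    by simp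
qed

lemma closed_Cur [simp]: "closed_pat k p \<Longrightarrow> m < k \<Longrightarrow> closed_fm k (Cur m p)"
  unfolding Cur_def by (rule closed_matches) auto

lemma closed_beta [simp]: "closed_tm k c \<Longrightarrow> closed_tm k d \<Longrightarrow> closed_tm k i \<Longrightarrow> closed_tm k y \<Longrightarrow> closed_fm k (beta c d i y)"
  by (simp add: beta_def)

lemma closed_Prev [simp]: "closed_pat k p \<Longrightarrow> m + 4 < k \<Longrightarrow> closed_fm k (Prev m p)"
  unfolding Prev_def using closed_matches[of k p 2 "k + 2" "Var 0"] by simp

lemma closed_Deriv [simp]: "closed_fm 5 A \<Longrightarrow> closed_pat k p \<Longrightarrow> closed_fm k (Deriv A p)"
  unfolding Deriv_def
  using closed_matches[of k p 4 "k + 4" "Var 0"] closed_fm_mono[of 5 A "k + 5"]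
  by (simp add: numeral_nat)

lemma closed_TmF [simp]: "closed_tm k x \<Longrightarrow> closed_tm k y \<Longrightarrow> closed_fm k (TmF x y)"
  by (simp add: TmF_def tm_step_def)

lemma closed_FmF [simp]: "closed_tm k x \<Longrightarrow> closed_tm k y \<Longrightarrow> closed_fm k (FmF x y)"
  by (simp add: FmF_def fm_step_def)

lemma closed_IsTm [simp]: "closed_tm k x \<Longrightarrow> closed_fm k (IsTm x)"
  by (simp add: IsTm_def)

lemma closed_IsFm [simp]: "closed_tm k x \<Longrightarrow> closed_fm k (IsFm x)"
  by (simp add: IsFm_def)

lemma closed_IsSent [simp]: "closed_tm k x \<Longrightarrow> closed_fm k (IsSent x)"
  by (simp add: IsSent_def)

lemma closed_LiftF [simp]: "closed_tm k t \<Longrightarrow> closed_tm k x \<Longrightarrow> closed_tm k y \<Longrightarrow> closed_fm k (LiftF t x y)"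
  by (simp add: LiftF_def lift_step_def)

lemma closed_SubF [simp]:
  "closed_tm k i \<Longrightarrow> closed_tm k t \<Longrightarrow> closed_tm k x \<Longrightarrow> closed_tm k y \<Longrightarrow> closed_fm k (SubF i t x y)"
  by (simp add: SubF_def sub_step_def)

lemma closed_ClosureF [simp]: "closed_tm k x \<Longrightarrow> closed_tm k y \<Longrightarrow> closed_fm k (ClosureF x y)"
  by (simp add: ClosureF_def closure_step_def)

lemma closed_NumF [simp]: "closed_tm k x \<Longrightarrow> closed_tm k y \<Longrightarrow> closed_fm k (NumF x y)"
  by (simp add: NumF_def num_step_def)

lemma closed_LogAxF: "closed_fm 1 LogAxF"
  by (simp add: LogAxF_def)

lemma closed_HaAxF: "closed_fm 1 HaAxF"
proof -
  have "closed_fm 6 (matches 0 (pImpl (pConj (V 1) (pUni (pImpl (V 0) (V 3)))) (pUni (V 0))) (Var 4))"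
    by (rule closed_matches[of 6]) auto
  then show ?thesis by (simp add: HaAxF_def)
qed

lemma closed_Box: "closed_fm 1 \<alpha> \<Longrightarrow> closed_tm k x \<Longrightarrow> closed_fm k (Box \<alpha> x)"
  using closed_fm_mono[OF closed_LogAxF, of 5] closed_fm_mono[of 1 \<alpha> 5]
  by (simp add: Box_def prov_step_def)

lemma Sig_Eql [intro, simp]: "Sig (s \<^bold>= t)"
  by (intro Sig_delta0 delta0.intros)

lemma Sig_Fls [intro, simp]: "Sig Fls"
  by (intro Sig_delta0 delta0.intros)

lemma Sig_lt [intro, simp]: "Sig (s \<^bold>< t)"
  by (intro Sig_delta0 delta0.intros)

lemma Sig_le [intro, simp]: "Sig (s \<^bold>\<le> t)"
  unfolding le_def by (intro Sig_Exi Sig_Eql)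

lemmas [intro, simp] = Sig_Conj Sig_Disj Sig_Exi

lemma Sig_disjs [intro, simp]: "(\<And>A. A \<in> set As \<Longrightarrow> Sig A) \<Longrightarrow> Sig (disjs As)"
  by (induction As) (auto simp: disjs_def)

lemma Sig_ExN [intro, simp]: "Sig A \<Longrightarrow> Sig (ExN n A)"
  by (induction n) auto

lemma Sig_matches [intro, simp]: "Sig (matches n p y)"
  by (induction p arbitrary: n y) (auto simp: pairing_def)

lemma Sig_Cur [intro, simp]: "Sig (Cur m p)"
  by (simp add: Cur_def)

lemma Sig_beta [intro, simp]: "Sig (beta c d i y)"
  by (simp add: beta_def)

lemma Sig_Prev [intro, simp]: "Sig (Prev m p)"
  by (simp add: Prev_def)

lemma Sig_Deriv [intro, simp]: "Sig A \<Longrightarrow> Sig (Deriv A p)"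
  unfolding Deriv_def using Sig_Uni[of _ "Var 0"] by simp

lemma Sig_TmF [intro, simp]: "Sig (TmF k x)"
  unfolding TmF_def tm_step_def by (intro Sig_Deriv Sig_disjs) auto

lemma Sig_FmF [intro, simp]: "Sig (FmF k x)"
  unfolding FmF_def fm_step_def by (intro Sig_Deriv Sig_disjs) auto

lemma Sig_IsTm [intro, simp]: "Sig (IsTm x)"
  by (simp add: IsTm_def)

lemma Sig_IsFm [intro, simp]: "Sig (IsFm x)"
  by (simp add: IsFm_def)

lemma Sig_IsSent [intro, simp]: "Sig (IsSent x)"
  by (simp add: IsSent_def)

lemma Sig_LiftF [intro, simp]: "Sig (LiftF k x y)"
  unfolding LiftF_def lift_step_def by (intro Sig_Deriv Sig_disjs) auto

lemma Sig_SubF [intro, simp]: "Sig (SubF k t x y)"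
  unfolding SubF_def sub_step_def by (intro Sig_Deriv Sig_disjs) auto

lemma Sig_ClosureF [intro, simp]: "Sig (ClosureF x y)"
  unfolding ClosureF_def closure_step_def by (intro Sig_Deriv Sig_disjs) auto

lemma Sig_NumF [intro, simp]: "Sig (NumF x y)"
  unfolding NumF_def num_step_def by (intro Sig_Deriv Sig_disjs) auto

lemma Sig_LogAxF [intro, simp]: "Sig LogAxF"
  unfolding LogAxF_def by (auto intro!: Sig_ExN Sig_Conj Sig_disjs simp del: funpow.simps)

lemma Sig_HaAxF [intro, simp]: "Sig HaAxF"
  unfolding HaAxF_def
  by (intro Sig_Disj Sig_Conj Sig_disjs Sig_ExN Sig_matches Sig_IsFm Sig_SubF Sig_LiftF Sig_ClosureF Sig_IsSent) auto

lemma Sig_Box [intro, simp]: "Sig \<alpha> \<Longrightarrow> Sig (Box \<alpha> x)"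
  unfolding Box_def prov_step_def by (intro Sig_Deriv Sig_disjs) auto

section \<open>Provable \<open>\<Sigma>\<^sub>1\<close>-completeness inside a model\<close>

lemma ext_HaAxF: "ext HaAxF = haax"
  by (rule ext) (simp add: ext_def)

abbreviation pv :: "(nat \<Rightarrow> 'a :: pa) \<Rightarrow> fm \<Rightarrow> bool" where
  "pv e B \<equiv> bx haax (ef 0 e B)"

lemma sat_Box_HaAxF: "sat e (Box HaAxF x) \<longleftrightarrow> bx haax (val e x)"
  by (simp add: closed_HaAxF[simplified] ext_HaAxF)

lemma pv_nd: "\<Gamma> \<tturnstile> B \<Longrightarrow> (\<And>C. C \<in> set \<Gamma> \<Longrightarrow> pv e C) \<Longrightarrow> pv e B"
  by (rule bx_nd[of haax])

lemma pv_nd0: "[] \<tturnstile> B \<Longrightarrow> pv e B"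
  by (rule pv_nd) auto

lemma pv_nd1: "[C] \<tturnstile> B \<Longrightarrow> pv e C \<Longrightarrow> pv e B"
  by (rule pv_nd[of "[C]"]) auto

lemma pv_nd2: "[C, D] \<tturnstile> B \<Longrightarrow> pv e C \<Longrightarrow> pv e D \<Longrightarrow> pv e B"
  by (rule pv_nd[of "[C, D]"]) auto

lemma pv_nd3: "[C, D, E] \<tturnstile> B \<Longrightarrow> pv e C \<Longrightarrow> pv e D \<Longrightarrow> pv e E \<Longrightarrow> pv e B"
  by (rule pv_nd[of "[C, D, E]"]) auto

lemma pv_refl: "e i = e j \<Longrightarrow> pv e (Var i \<^bold>= Var j)"
  by (simp add: bx_log logax_refl istm_numc)

text \<open>The number \<open>b\<close> may be nonstandard, so the proofs come from an induction in
  the model. Its predicate is definable because the code of the equation is a pattern in the three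
  numerals.\<close>

lemma pv_add: "pv (b ## a ## (a + b) ## e) (Add (Var 1) (Var 0) \<^bold>= Var 2)"
proof (rule dfb_induct[of "\<lambda>b. pv (b ## a ## (a + b) ## e) (Add (Var 1) (Var 0) \<^bold>= Var 2)"])
  show "dfb (\<lambda>b. pv (b ## a ## (a + b) ## e) (Add (Var 1) (Var 0) \<^bold>= Var 2))"
    by (rule dfbI[of _ "\<lambda>_. a" "Exi (Exi (Exi (NumF (Var 3) (Var 0) \<^bold>\<and> NumF (Var 4) (Var 1) \<^bold>\<and>
        NumF (Add (Var 4) (Var 3)) (Var 2) \<^bold>\<and>
        Exi (matches 0 (pEql (tag2 3 (V 2) (V 1)) (V 3)) (Var 0) \<^bold>\<and> Box HaAxF (Var 0)))))"])
      (simp add: numeral_nat closed_HaAxF[simplified] ext_HaAxF)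
  have "pv (0 ## a ## a ## e) (Add (Var 1) Zero \<^bold>= Var 1)" by (rule pv_nd0[OF nd_Add_Zero])
  then show "pv (0 ## a ## (a + 0) ## e) (Add (Var 1) (Var 0) \<^bold>= Var 2)" by simp
  fix b assume h: "pv (b ## a ## (a + b) ## e) (Add (Var 1) (Var 0) \<^bold>= Var 2)"
  have "pv (b ## a ## (a + b) ## e) (Add (Var 1) (Scc (Var 0)) \<^bold>= Scc (Var 2))"
    by (rule pv_nd1[OF nd_trans[OF nd_Add_Scc nd_Scc_cong[OF nd_self]] h])
  then show "pv ((b + 1) ## a ## (a + (b + 1)) ## e) (Add (Var 1) (Var 0) \<^bold>= Var 2)"
    using numc_Suc[of "a + b"] by (simp add: add.assoc)
qed

lemma pv_mul: "pv (b ## a ## (a * b) ## e) (Mul (Var 1) (Var 0) \<^bold>= Var 2)"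
proof (rule dfb_induct[of "\<lambda>b. pv (b ## a ## (a * b) ## e) (Mul (Var 1) (Var 0) \<^bold>= Var 2)"])
  show "dfb (\<lambda>b. pv (b ## a ## (a * b) ## e) (Mul (Var 1) (Var 0) \<^bold>= Var 2))"
    by (rule dfbI[of _ "\<lambda>_. a" "Exi (Exi (Exi (NumF (Var 3) (Var 0) \<^bold>\<and> NumF (Var 4) (Var 1) \<^bold>\<and>
        NumF (Mul (Var 4) (Var 3)) (Var 2) \<^bold>\<and>
        Exi (matches 0 (pEql (tag2 4 (V 2) (V 1)) (V 3)) (Var 0) \<^bold>\<and> Box HaAxF (Var 0)))))"])
      (simp add: numeral_nat closed_HaAxF[simplified] ext_HaAxF)
  have "pv (0 ## a ## a ## e) (Mul (Var 1) Zero \<^bold>= Zero)" by (rule pv_nd0[OF nd_Mul_Zero])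
  then show "pv (0 ## a ## (a * 0) ## e) (Mul (Var 1) (Var 0) \<^bold>= Var 2)" by simp
  fix b assume h: "pv (b ## a ## (a * b) ## e) (Mul (Var 1) (Var 0) \<^bold>= Var 2)"
  let ?e = "a ## (a * b) ## (a * b + a) ## b ## e"
  have 1: "pv ?e (Mul (Var 0) (Var 3) \<^bold>= Var 1)" using h by (simp add: numeral_nat)
  have 2: "pv ?e (Add (Var 1) (Var 0) \<^bold>= Var 2)" using pv_add[of a "a * b"] by (simp add: numeral_nat)
  have "[Mul (Var 0) (Var 3) \<^bold>= Var 1, Add (Var 1) (Var 0) \<^bold>= Var 2] \<tturnstile> Mul (Var 0) (Scc (Var 3)) \<^bold>= Var 2"
    by (rule nd_trans[OF nd_Mul_Scc nd_trans[OF nd_Add_cong[OF nd_self nd_refl]]], rule nd_asm) simp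
  from pv_nd2[OF this 1 2] show "pv ((b + 1) ## a ## (a * (b + 1)) ## e) (Mul (Var 1) (Var 0) \<^bold>= Var 2)"
    by (simp add: numeral_nat pa_mult_Suc del: distrib_left)
qed

text \<open>Every term is provably equal to the numeral of its value, so atoms need to be decided
  between numerals only.\<close>

lemma pv_val: "pv (val e t ## e) (lift_tm 0 t \<^bold>= Var 0)"
proof (induction t)
  case (Var i) show ?case by (simp add: bx_log logax_refl istm_numc)
next
  case Zero show ?case by (simp add: bx_log logax_refl istm_def)
next
  case (Scc t)
  from pv_nd1[OF nd_Scc_cong[OF nd_self] Scc.IH] show ?case by simp
next
  case (Add s t)
  let ?e = "val e t ## val e s ## (val e s + val e t) ## e" and ?l = "\<lambda>t. lift_tm 0 (lift_tm 0 (lift_tm 0 t))"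
  have "[?l s \<^bold>= Var 1, ?l t \<^bold>= Var 0, Add (Var 1) (Var 0) \<^bold>= Var 2] \<tturnstile> Add (?l s) (?l t) \<^bold>= Var 2"
    by (rule nd_trans[OF nd_Add_cong[of _ _ "Var 1" _ "Var 0"]]; rule nd_asm; simp)
  then have "pv ?e (Add (?l s) (?l t) \<^bold>= Var 2)"
    by (rule pv_nd3) (use Add.IH pv_add in \<open>simp_all add: numeral_nat\<close>)
  then show ?case by (simp add: numeral_nat)
next
  case (Mul s t)
  let ?e = "val e t ## val e s ## (val e s * val e t) ## e" and ?l = "\<lambda>t. lift_tm 0 (lift_tm 0 (lift_tm 0 t))"
  have "[?l s \<^bold>= Var 1, ?l t \<^bold>= Var 0, Mul (Var 1) (Var 0) \<^bold>= Var 2] \<tturnstile> Mul (?l s) (?l t) \<^bold>= Var 2"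
    by (rule nd_trans[OF nd_Mul_cong[of _ _ "Var 1" _ "Var 0"]]; rule nd_asm; simp)
  then have "pv ?e (Mul (?l s) (?l t) \<^bold>= Var 2)"
    by (rule pv_nd3) (use Mul.IH pv_mul in \<open>simp_all add: numeral_nat\<close>)
  then show ?case by (simp add: numeral_nat)
qed

lemma pv_less_neq: "a < b \<Longrightarrow> pv (a ## b ## e) (Neg (Var 0 \<^bold>= Var 1))"
proof -
  assume "a < b"
  then obtain c where c: "b = c + a + 1" by (auto simp: pa_less)
  let ?e = "a ## b ## c ## e"
  have 1: "pv ?e (Scc (Add (Var 2) (Var 0)) \<^bold>= Var 1)"
  proof -
    have "pv (a ## c ## (c + a) ## e) (Scc (Add (Var 1) (Var 0)) \<^bold>= Scc (Var 2))"
      by (rule pv_nd1[OF nd_Scc_cong[OF nd_self] pv_add])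
    then show ?thesis unfolding c by (simp add: numeral_nat)
  qed
  have "[Scc (Add (Var 2) (Var 0)) \<^bold>= Var 1] \<tturnstile> Neg (Var 0 \<^bold>= Var 1)"
  proof (rule nd_impI)
    let ?G = "(Var 0 \<^bold>= Var 1) # [Scc (Add (Var 2) (Var 0)) \<^bold>= Var 1]"
    have "?G \<tturnstile> Scc (Add (Var 2) (Var 0)) \<^bold>= Var 0"
      by (rule nd_trans[OF nd_asm nd_sym[OF nd_self]]) simp
    then show "?G \<tturnstile> Fls" by (rule nd_lt_irrefl)
  qed
  from pv_nd1[OF this 1] show ?thesis by simp
qed

lemma pv_neq: "a \<noteq> b \<Longrightarrow> pv (a ## b ## e) (Neg (Var 0 \<^bold>= Var 1))"
proof (cases "a < b")
  case False
  assume "a \<noteq> b"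
  then have "b < a" using False by simp
  from pv_less_neq[OF this] have "pv (a ## b ## e) (Neg (Var 1 \<^bold>= Var 0))" by simp
  moreover have "[Neg (Var 1 \<^bold>= Var 0)] \<tturnstile> Neg (Var 0 \<^bold>= Var 1)"
    by (rule nd_impI, rule nd_mp[OF nd_asm nd_sym[OF nd_self]]) simp
  ultimately show ?thesis by (rule pv_nd1[rotated])
qed (rule pv_less_neq)

lemma pv_eql:
  "(val e s = val e t \<longrightarrow> pv e (s \<^bold>= t)) \<and> (val e s \<noteq> val e t \<longrightarrow> pv e (Neg (s \<^bold>= t)))"
proof -
  let ?e = "val e s ## val e t ## e" and ?l = "\<lambda>t. lift_tm 0 (lift_tm 0 t)"
  have s: "pv ?e (?l s \<^bold>= Var 0)" and t: "pv ?e (?l t \<^bold>= Var 1)"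
    using pv_val[of e s] pv_val[of e t] by simp_all
  have 1: "[?l s \<^bold>= Var 0, ?l t \<^bold>= Var 1, Var 0 \<^bold>= Var 1] \<tturnstile> ?l s \<^bold>= ?l t" (is "?G \<tturnstile> _")
    by (rule nd_trans[of _ _ "Var 0"], rule nd_asm, simp,
        rule nd_trans[of _ _ "Var 1", OF nd_asm nd_sym[OF nd_asm]]) simp_all
  have 2: "[?l s \<^bold>= Var 0, ?l t \<^bold>= Var 1, Neg (Var 0 \<^bold>= Var 1)] \<tturnstile> Neg (?l s \<^bold>= ?l t)" (is "?H \<tturnstile> _")
  proof (rule nd_impI, rule nd_mp[OF nd_asm])
    show "Neg (Var 0 \<^bold>= Var 1) \<in> set ((?l s \<^bold>= ?l t) # ?H)" by simp
    show "(?l s \<^bold>= ?l t) # ?H \<tturnstile> Var 0 \<^bold>= Var 1"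
      by (rule nd_trans[of _ _ "?l s", OF nd_sym[OF nd_asm] nd_trans[OF nd_self nd_asm]]) simp_all
  qed
  show ?thesis
  proof (intro conjI impI)
    assume "val e s = val e t"
    then have "pv ?e (Var 0 \<^bold>= Var 1)" by (intro pv_refl) simp
    from pv_nd3[OF 1 s t this] show "pv e (s \<^bold>= t)" by simp
  next
    assume "val e s \<noteq> val e t"
    from pv_nd3[OF 2 s t pv_neq[OF this]] show "pv e (Neg (s \<^bold>= t))" by simp
  qed
qed

lemma pv_lt:
  "(val e s < val e t \<longrightarrow> pv e (s \<^bold>< t)) \<and> (\<not> val e s < val e t \<longrightarrow> pv e (Neg (s \<^bold>< t)))"
proof (intro conjI impI)
  assume "val e s < val e t"
  then obtain c where c: "c + val e s + 1 = val e t" by (auto simp: pa_less)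
  have "pv (c ## e) (Scc (Add (Var 0) (lift_tm 0 s)) \<^bold>= lift_tm 0 t)"
    using pv_eql[of "c ## e"] c by (simp del: ef.simps)
  from pv_nd1[OF nd_ltI[OF nd_self] this] have "pv (c ## e) (lift_fm 0 (s \<^bold>< t))"
    by (simp only: lift_lt)
  then show "pv e (s \<^bold>< t)" by (simp only: ef_lift0)
next
  assume "\<not> val e s < val e t"
  then obtain c where c: "c + val e t = val e s" by (auto simp: not_less pa_le)
  have "pv (c ## e) (Add (Var 0) (lift_tm 0 t) \<^bold>= lift_tm 0 s)"
    using pv_eql[of "c ## e"] c by (simp del: ef.simps)
  from pv_nd1[OF nd_le_not_lt[OF nd_self] this] have "pv (c ## e) (lift_fm 0 (Neg (s \<^bold>< t)))"
    by (simp only: lift_lt lift_fm.simps)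
  then show "pv e (Neg (s \<^bold>< t))" by (simp only: ef_lift0)
qed

text \<open>This makes induction over a parameter in the code of a formula available.\<close>

definition deff :: "(nat \<Rightarrow> 'a) \<Rightarrow> ('a \<Rightarrow> 'a :: pa) \<Rightarrow> bool" where
  "deff e f \<longleftrightarrow> (\<exists>A. \<forall>x z. sat (z ## x ## e) A \<longleftrightarrow> z = f x)"

lemma deff_of_nat: "deff e (\<lambda>_. of_nat n)"
  unfolding deff_def by (rule exI[of _ "Var 0 \<^bold>= num n"]) simp

lemma deff_numc: "deff e (\<lambda>x. numc ((x ## e) i))"
  unfolding deff_def by (rule exI[of _ "NumF (Var (Suc i)) (Var 0)"]) simp

lemma deff_pr: assumes "deff e f" "deff e g" shows "deff e (\<lambda>x. pr (f x) (g x))"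
proof -
  obtain A B where A: "\<And>x z. sat (z ## x ## e) A \<longleftrightarrow> z = f x" and B: "\<And>x z. sat (z ## x ## e) B \<longleftrightarrow> z = g x"
    using assms unfolding deff_def by metis
  show ?thesis
    unfolding deff_def
    by (rule exI[of _ "Exi (Exi (lift_fm 1 (lift_fm 1 A) \<^bold>\<and> lift_fm 0 (lift_fm 1 B) \<^bold>\<and> pairing (Var 0) (Var 1) (Var 2)))"])
      (simp add: A B numeral_nat)
qed

lemma deff_et: "deff e (\<lambda>x. et k (x ## e) t)"
proof (induction t)
  case (Var i)
  show ?case
    by (cases "i < k") (use deff_pr[OF deff_of_nat[of e 0] deff_of_nat[of e i]] deff_numc in simp_all)
next
  case Zero show ?case using deff_pr[OF deff_of_nat[of e 1] deff_of_nat[of e 0]] by simp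
next
  case (Scc t) from deff_pr[OF deff_of_nat[of e 2] Scc.IH] show ?case by simp
next
  case (Add s t) from deff_pr[OF deff_of_nat[of e 3] deff_pr[OF Add.IH]] show ?case by simp
next
  case (Mul s t) from deff_pr[OF deff_of_nat[of e 4] deff_pr[OF Mul.IH]] show ?case by simp
qed

lemma deff_ef: "deff e (\<lambda>x. ef k (x ## e) A)"
proof (induction A arbitrary: k)
  case (Eql s t) from deff_pr[OF deff_of_nat[of e 5] deff_pr[OF deff_et deff_et]] show ?case by simp
next
  case Fls from deff_pr[OF deff_of_nat[of e 6] deff_of_nat[of e 0]] show ?case by simp
next
  case (Conj A B) from deff_pr[OF deff_of_nat[of e 7] deff_pr[OF Conj.IH]] show ?case by simp
next
  case (Disj A B) from deff_pr[OF deff_of_nat[of e 8] deff_pr[OF Disj.IH]] show ?case by simp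
next
  case (Impl A B) from deff_pr[OF deff_of_nat[of e 9] deff_pr[OF Impl.IH]] show ?case by simp
next
  case (Uni A) from deff_pr[OF deff_of_nat[of e 10] Uni.IH] show ?case by simp
next
  case (Exi A) from deff_pr[OF deff_of_nat[of e 11] Exi.IH] show ?case by simp
qed

lemma dfb_pv: "dfb (\<lambda>x. pv (x ## e) A)"
proof -
  obtain B where B: "\<And>x z. sat (z ## x ## e) B \<longleftrightarrow> z = ef 0 (x ## e) A"
    using deff_ef[of e 0 A] unfolding deff_def by metis
  show ?thesis
    by (rule dfbI[of _ e "Exi (B \<^bold>\<and> Box HaAxF (Var 0))"]) (simp add: B sat_Box_HaAxF)
qed

text \<open>With a nonstandard bound the proofs of the instances cannot be joined one by one from
  outside; they are joined by an induction on the bound in the model.\<close>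

lemma pv_bounded:
  assumes "\<And>b. b < val e t \<Longrightarrow> pv (b ## e) A"
  shows "pv e (Uni (Var 0 \<^bold>< lift_tm 0 t \<^bold>\<longrightarrow> A))"
proof -
  let ?B = "Uni (Var 0 \<^bold>< Var 1 \<^bold>\<longrightarrow> lift_fm 1 A)"
  have "k \<le> val e t \<longrightarrow> pv (k ## e) ?B" for k
  proof (rule dfb_induct[of "\<lambda>k. k \<le> val e t \<longrightarrow> pv (k ## e) ?B"])
    obtain C f where C: "\<And>k. pv (k ## e) ?B = sat (k ## f) C" using dfb_pv unfolding dfb_def by metis
    show "dfb (\<lambda>k. k \<le> val e t \<longrightarrow> pv (k ## e) ?B)"
      by (rule dfbI[of _ "val e t ## f" "Var 0 \<^bold>\<le> Var 1 \<^bold>\<longrightarrow> lift_fm 1 C"]) (simp add: C[unfolded One_nat_def] del: ef.simps)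
    have "[] \<tturnstile> Uni (Var 0 \<^bold>< Zero \<^bold>\<longrightarrow> A)"
      by (intro nd_allI nd_impI) (rule nd_lt_Zero[OF nd_self])
    from pv_nd0[OF this, of e] show "0 \<le> val e t \<longrightarrow> pv (0 ## e) ?B" by (simp add: lt_def)
    fix k assume h: "k \<le> val e t \<longrightarrow> pv (k ## e) ?B"
    show "k + 1 \<le> val e t \<longrightarrow> pv ((k + 1) ## e) ?B"
    proof
      assume "k + 1 \<le> val e t"
      then have k: "k < val e t" by simp
      have "[?B, A] \<tturnstile> Uni (Var 0 \<^bold>< Scc (Var 1) \<^bold>\<longrightarrow> lift_fm 1 A)"
        by (rule nd_bounded_step[OF nd_self nd_asm]) simp
      from pv_nd2[OF this _ assms[OF k]] h k have "pv (k ## e) (Uni (Var 0 \<^bold>< Scc (Var 1) \<^bold>\<longrightarrow> lift_fm 1 A))"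
        by (simp only: less_imp_le simp_thms)
      then show "pv ((k + 1) ## e) ?B" by (simp add: lt_def)
    qed
  qed
  then have B: "pv (val e t ## e) ?B" by blast
  \<comment> \<open>Back from the numeral of the value to the term \<open>t\<close>, by their
    provable equation.\<close>
  have "[lift_tm 0 t \<^bold>= Var 0, ?B] \<tturnstile> lift_fm 0 (Uni (Var 0 \<^bold>< lift_tm 0 t \<^bold>\<longrightarrow> A))" (is "?G \<tturnstile> _")
  proof -
    have 1: "?G \<tturnstile> Var 0 \<^bold>= lift_tm 0 t" by (rule nd_sym[OF nd_self])
    have 2: "?G \<tturnstile> ?B" by (rule nd_asm) simp
    show ?thesis using nd_subst[OF 1, of "Uni (Var 0 \<^bold>< Var 1 \<^bold>\<longrightarrow> lift_fm 1 (lift_fm 1 A))"] 2 by simp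
  qed
  from pv_nd2[OF this pv_val B] show ?thesis by (simp only: ef_lift0)
qed

text \<open>Truth and falsity are treated together because bounded formulas contain
  implications.\<close>

lemma pv_delta0: "delta0 A \<Longrightarrow> (sat e A \<longrightarrow> pv e A) \<and> (\<not> sat e A \<longrightarrow> pv e (Neg A))"
proof (induction arbitrary: e rule: delta0.induct)
  case (1 s t) then show ?case using pv_eql by (simp del: ef.simps)
next
  case (2 s t) then show ?case using pv_lt by (simp del: ef.simps)
next
  case 3 have "pv e Tru" by (rule pv_nd0[OF nd_Tru])
  then show ?case by (simp del: ef.simps)
next
  case (4 A B)
  have 1: "[A, B] \<tturnstile> A \<^bold>\<and> B" by (intro nd_conjI nd_asm) auto
  have 2: "[Neg A] \<tturnstile> Neg (A \<^bold>\<and> B)" "[Neg B] \<tturnstile> Neg (A \<^bold>\<and> B)"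
    by (rule nd_impI, rule nd_mp[OF nd_asm nd_conj1[OF nd_self]], simp)
      (rule nd_impI, rule nd_mp[OF nd_asm nd_conj2[OF nd_self]], simp)
  show ?case using 4(3,4)[of e] pv_nd2[OF 1] pv_nd1[OF 2(1)] pv_nd1[OF 2(2)] by (auto simp del: ef.simps)
next
  case (5 A B)
  have 1: "[A] \<tturnstile> A \<^bold>\<or> B" "[B] \<tturnstile> A \<^bold>\<or> B" by (rule nd_disj1[OF nd_self], rule nd_disj2[OF nd_self])
  have 2: "[Neg A, Neg B] \<tturnstile> Neg (A \<^bold>\<or> B)"
    by (rule nd_impI, rule nd_disjE[OF nd_self]) (rule nd_mp[OF nd_asm nd_self], simp)+
  show ?case using 5(3,4)[of e] pv_nd1[OF 1(1)] pv_nd1[OF 1(2)] pv_nd2[OF 2] by (auto simp del: ef.simps)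
next
  case (6 A B)
  have 1: "[B] \<tturnstile> A \<^bold>\<longrightarrow> B" by (rule nd_impI, rule nd_asm) simp
  have 2: "[Neg A] \<tturnstile> A \<^bold>\<longrightarrow> B" by (rule nd_impI, rule nd_FlsE, rule nd_mp[OF nd_asm nd_self]) simp
  have 3: "[A, Neg B] \<tturnstile> Neg (A \<^bold>\<longrightarrow> B)"
    by (rule nd_impI, rule nd_mp[OF nd_asm[of "Neg B"]], simp, rule nd_mp[OF nd_self nd_asm], simp)
  show ?case using 6(3,4)[of e] pv_nd1[OF 1] pv_nd1[OF 2] pv_nd2[OF 3] by (auto simp del: ef.simps)
next
  case (7 A t)
  have "pv e (Neg (Uni (Var 0 \<^bold>< lift_tm 0 t \<^bold>\<longrightarrow> A)))" if b: "b < val e t" "\<not> sat (b ## e) A" for b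
  proof -
    have "[Var 0 \<^bold>< lift_tm 0 t, Neg A] \<tturnstile> lift_fm 0 (Neg (Uni (Var 0 \<^bold>< lift_tm 0 t \<^bold>\<longrightarrow> A)))" (is "?G \<tturnstile> _")
    proof (simp only: lift_fm.simps(5) lift_fm.simps(2), rule nd_impI)
      let ?U = "lift_fm 0 (Uni (Var 0 \<^bold>< lift_tm 0 t \<^bold>\<longrightarrow> A))"
      have "?U # ?G \<tturnstile> Var 0 \<^bold>< lift_tm 0 t \<^bold>\<longrightarrow> A" by (rule nd_all_self[OF nd_self])
      from nd_mp[OF this nd_asm] have "?U # ?G \<tturnstile> A" by simp
      then show "?U # ?G \<tturnstile> Fls" by (rule nd_mp[OF nd_asm, rotated]) simp
    qed
    moreover have "pv (b ## e) (Var 0 \<^bold>< lift_tm 0 t)" using pv_lt[of "b ## e"] b(1) by (simp del: ef.simps)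
    moreover have "pv (b ## e) (Neg A)" using 7(2) b(2) by blast
    ultimately have "pv (b ## e) (lift_fm 0 (Neg (Uni (Var 0 \<^bold>< lift_tm 0 t \<^bold>\<longrightarrow> A))))" by (rule pv_nd2)
    then show ?thesis by (simp only: ef_lift0)
  qed
  moreover have "pv e (Uni (Var 0 \<^bold>< lift_tm 0 t \<^bold>\<longrightarrow> A))" if "\<forall>b<val e t. sat (b ## e) A"
    by (rule pv_bounded) (use that 7(2) in blast)
  ultimately show ?case by (auto simp del: ef.simps)
next
  case (8 A t)
  have "pv e (Exi (Var 0 \<^bold>< lift_tm 0 t \<^bold>\<and> A))" if b: "b < val e t" "sat (b ## e) A" for b
  proof -
    have "[Var 0 \<^bold>< lift_tm 0 t, A] \<tturnstile> lift_fm 0 (Exi (Var 0 \<^bold>< lift_tm 0 t \<^bold>\<and> A))"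
      by (rule nd_ex_self, intro nd_conjI nd_asm) auto
    moreover have "pv (b ## e) (Var 0 \<^bold>< lift_tm 0 t)" using pv_lt[of "b ## e"] b(1) by (simp del: ef.simps)
    moreover have "pv (b ## e) A" using 8(2) b(2) by blast
    ultimately have "pv (b ## e) (lift_fm 0 (Exi (Var 0 \<^bold>< lift_tm 0 t \<^bold>\<and> A)))" by (rule pv_nd2)
    then show ?thesis by (simp only: ef_lift0)
  qed
  moreover have "pv e (Neg (Exi (Var 0 \<^bold>< lift_tm 0 t \<^bold>\<and> A)))" if "\<forall>b<val e t. \<not> sat (b ## e) A"
  proof -
    have 1: "pv e (Uni (Var 0 \<^bold>< lift_tm 0 t \<^bold>\<longrightarrow> Neg A))"
      by (rule pv_bounded) (use that 8(2) in blast)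
    have "[Uni (Var 0 \<^bold>< lift_tm 0 t \<^bold>\<longrightarrow> Neg A)] \<tturnstile> Neg (Exi (Var 0 \<^bold>< lift_tm 0 t \<^bold>\<and> A))" (is "[?U] \<tturnstile> _")
    proof (rule nd_impI, rule nd_exE[OF nd_self])
      let ?G = "(Var 0 \<^bold>< lift_tm 0 t \<^bold>\<and> A) # map (lift_fm 0) [Exi (Var 0 \<^bold>< lift_tm 0 t \<^bold>\<and> A), ?U]"
      have "?G \<tturnstile> Var 0 \<^bold>< lift_tm 0 t \<^bold>\<longrightarrow> Neg A" by (rule nd_all_self, rule nd_asm) simp
      from nd_mp[OF nd_mp[OF this nd_conj1[OF nd_self]] nd_conj2[OF nd_self]]
      show "?G \<tturnstile> lift_fm 0 Fls" by simp
    qed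
    from pv_nd1[OF this 1] show ?thesis .
  qed
  ultimately show ?case by (auto simp del: ef.simps)
qed

theorem pv_Sig: "Sig A \<Longrightarrow> sat e A \<Longrightarrow> pv e A"
proof (induction arbitrary: e rule: Sig.induct)
  case (Sig_delta0 A) then show ?case using pv_delta0 by blast
next
  case (Sig_Conj A B)
  have "[A, B] \<tturnstile> A \<^bold>\<and> B" by (intro nd_conjI nd_asm) auto
  then show ?case by (rule pv_nd2) (use Sig_Conj in auto)
next
  case (Sig_Disj A B)
  then consider "pv e A" | "pv e B" by auto
  then show ?case
    by cases (rule pv_nd1[OF nd_disj1[OF nd_self]], assumption, rule pv_nd1[OF nd_disj2[OF nd_self]], assumption)
next
  case (Sig_Exi A)
  then obtain x where "sat (x ## e) A" by auto
  from pv_nd1[OF nd_ex_self[OF nd_self] Sig_Exi.IH[OF this]] show ?case by (simp only: ef_lift0)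
next
  case (Sig_Uni A t)
  let ?U = "Uni (Var 0 \<^bold>< lift_tm 0 (Scc t) \<^bold>\<longrightarrow> A)"
  have 1: "pv e ?U"
    by (rule pv_bounded, rule Sig_Uni.IH) (use Sig_Uni.prems in simp)
  have "[?U] \<tturnstile> Uni (Var 0 \<^bold>\<le> lift_tm 0 t \<^bold>\<longrightarrow> A)"
  proof (rule nd_allI, rule nd_impI)
    let ?G = "(Var 0 \<^bold>\<le> lift_tm 0 t) # map (lift_fm 0) [?U]"
    have "?G \<tturnstile> Var 0 \<^bold>< lift_tm 0 (Scc t) \<^bold>\<longrightarrow> A" by (rule nd_all_self, rule nd_asm) simp
    then show "?G \<tturnstile> A" by (rule nd_mp) (use nd_le_lt[OF nd_self] in simp)
  qed
  from pv_nd1[OF this 1] show ?case .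
qed

section \<open>Soundness of RC1 in models\<close>

declare code.simps [simp del] code_tm.simps [simp del]

lemma of_nat_code [simp]: "of_nat \<ulcorner>A\<urcorner> = gf A"
  by (simp add: gf_def)

lemma HA_sound: "HA \<^bold>\<turnstile> A \<Longrightarrow> sat (e :: nat \<Rightarrow> 'a :: pa) A"
proof (induction arbitrary: e rule: prv.induct)
  case (logic A)
  then show ?case by (induction arbitrary: e rule: log_ax.induct) auto
next
  case (axiom A)
  show ?case
  proof (cases "A \<in> set basic_axioms")
    case True
    then show ?thesis
      by (auto simp: basic_axioms_def pa_Suc_ne pa_mult_Suc add.assoc)
  next
    case False
    then obtain n B where B: "A = (Uni ^^ n) (ind_ax B)" using axiom by (auto simp: HA_def)
    have "sat e (ind_ax B)" for e :: "nat \<Rightarrow> 'a"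
      unfolding ind_ax_def using pa_induct[of e B] by auto
    then have "sat e ((Uni ^^ n) (ind_ax B))" for e :: "nat \<Rightarrow> 'a" by (induction n arbitrary: e) auto
    then show ?thesis unfolding B .
  qed
next
  case (mp A B) then show ?case by simp
next
  case (gen A) then show ?case by simp
qed

section \<open>Substitution into provability formulas and monotonicity of \<open>Box\<close>\<close>

lemma tsubst_up_lift: "tsubst (up \<sigma>) (lift_tm 0 t) = lift_tm 0 (tsubst \<sigma> t)"
  by (simp add: tsubst_lift0 lift0_tsubst)

lemma tsubst_up_shift: "tsubst ((up ^^ n) \<sigma>) ((lift_tm 0 ^^ n) t) = (lift_tm 0 ^^ n) (tsubst \<sigma> t)"
  by (induction n) (auto simp: tsubst_up_lift)

primrec psubst :: "(nat \<Rightarrow> tm) \<Rightarrow> pat \<Rightarrow> pat" where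
  "psubst \<sigma> (At t) = At (tsubst \<sigma> t)"
| "psubst \<sigma> (p \<triangleright> q) = psubst \<sigma> p \<triangleright> psubst \<sigma> q"

lemma fsubst_matches: "fsubst ((up ^^ n) \<sigma>) (matches n p y) = matches n (psubst \<sigma> p) (tsubst ((up ^^ n) \<sigma>) y)"
proof (induction p arbitrary: n y)
  case (Pr p q)
  from Pr.IH(1)[of "Suc (Suc n)" "Var 1"] Pr.IH(2)[of "Suc (Suc n)" "Var 0"]
  show ?case by (simp add: numeral_nat pairing_def tsubst_up_lift)
qed (simp add: tsubst_up_shift)

text \<open>All free indices of the step formula are bound by the five quantifiers around it in
  \<open>Deriv\<close>, so the substitution reaches the pattern only.\<close>

lemma fsubst_Deriv:
  assumes "closed_fm 5 A" shows "fsubst \<sigma> (Deriv A p) = Deriv A (psubst \<sigma> p)"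
proof -
  have 1: "fsubst (up (up (up (up (up \<sigma>))))) A = A"
  proof -
    have "fsubst (up (up (up (up (up \<sigma>))))) A = fsubst Var A"
      by (rule fsubst_closed[OF assms]) (auto simp: numeral_nat less_Suc_eq)
    then show ?thesis by simp
  qed
  have 2: "fsubst (up (up (up (up \<sigma>)))) (matches 4 p (Var 0)) = matches 4 (psubst \<sigma> p) (Var 0)"
    using fsubst_matches[of 4 \<sigma> p "Var 0"] by (simp add: numeral_nat)
  show ?thesis
    using 1 2 by (simp add: Deriv_def numeral_nat beta_def lt_def le_def)
qed

lemma closed_fm_step: "closed_fm 5 fm_step"
  by (simp add: fm_step_def)

lemma closed_prov_step: "closed_fm 1 \<alpha> \<Longrightarrow> closed_fm 5 (prov_step \<alpha>)"
  using closed_fm_mono[OF closed_LogAxF, of 5] closed_fm_mono[of 1 \<alpha> 5] by (simp add: prov_step_def)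

lemma sub_Box: "closed_fm 1 \<alpha> \<Longrightarrow> sub_fm 0 u (Box \<alpha> t) = Box \<alpha> (sub_tm 0 u t)"
  by (simp add: sub_fm_0 sub_tm_0 Box_def fsubst_Deriv[OF closed_prov_step])

lemma sub_IsSent: "sub_fm 0 u (IsSent t) = IsSent (sub_tm 0 u t)"
  by (simp add: sub_fm_0 sub_tm_0 IsSent_def FmF_def fsubst_Deriv[OF closed_fm_step])

lemma nd_Exi_mono: "HA \<^bold>\<turnstile> A \<^bold>\<longrightarrow> B \<Longrightarrow> HA \<^bold>\<turnstile> Exi A \<^bold>\<longrightarrow> Exi B"
  unfolding nd_Nil[symmetric]
  by (rule nd_impI, rule nd_exE[OF nd_self], rule nd_ex_self, rule nd_mp[OF nd_thm nd_self]) (simp add: nd_Nil)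

lemma nd_Conj_mono: "HA \<^bold>\<turnstile> A \<^bold>\<longrightarrow> B \<Longrightarrow> HA \<^bold>\<turnstile> C \<^bold>\<and> A \<^bold>\<longrightarrow> C \<^bold>\<and> B"
  unfolding nd_Nil[symmetric]
  by (rule nd_impI, rule nd_conjI[OF nd_conj1[OF nd_self]], rule nd_mp[OF nd_thm nd_conj2[OF nd_self]])
    (simp add: nd_Nil)

lemma nd_Disj_mono: "HA \<^bold>\<turnstile> A \<^bold>\<longrightarrow> B \<Longrightarrow> HA \<^bold>\<turnstile> C \<^bold>\<longrightarrow> D \<Longrightarrow> HA \<^bold>\<turnstile> A \<^bold>\<or> C \<^bold>\<longrightarrow> B \<^bold>\<or> D"
  unfolding nd_Nil[symmetric]
proof (rule nd_impI, rule nd_disjE[OF nd_self])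
  assume "[] \<tturnstile> A \<^bold>\<longrightarrow> B" "[] \<tturnstile> C \<^bold>\<longrightarrow> D"
  then have ab: "HA \<^bold>\<turnstile> A \<^bold>\<longrightarrow> B" and cd: "HA \<^bold>\<turnstile> C \<^bold>\<longrightarrow> D" by (simp_all add: nd_Nil)
  show "[A, A \<^bold>\<or> C] \<tturnstile> B \<^bold>\<or> D" by (rule nd_disj1, rule nd_mp[OF nd_thm[OF ab] nd_self])
  show "[C, A \<^bold>\<or> C] \<tturnstile> B \<^bold>\<or> D" by (rule nd_disj2, rule nd_mp[OF nd_thm[OF cd] nd_self])
qed

lemma nd_Uni_mono: "HA \<^bold>\<turnstile> A \<^bold>\<longrightarrow> B \<Longrightarrow> HA \<^bold>\<turnstile> Uni (C \<^bold>\<longrightarrow> A) \<^bold>\<longrightarrow> Uni (C \<^bold>\<longrightarrow> B)"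
  unfolding nd_Nil[symmetric]
proof (rule nd_impI, rule nd_allI, rule nd_impI)
  assume "[] \<tturnstile> A \<^bold>\<longrightarrow> B"
  then have ab: "HA \<^bold>\<turnstile> A \<^bold>\<longrightarrow> B" by (simp add: nd_Nil)
  let ?G = "C # map (lift_fm 0) [Uni (C \<^bold>\<longrightarrow> A)]"
  have "?G \<tturnstile> C \<^bold>\<longrightarrow> A" by (rule nd_all_self, rule nd_asm) simp
  from nd_mp[OF nd_thm[OF ab] nd_mp[OF this nd_self]] show "?G \<tturnstile> B" .
qed

lemma HA_imp_refl: "HA \<^bold>\<turnstile> A \<^bold>\<longrightarrow> A"
  unfolding nd_Nil[symmetric] by (rule nd_impI[OF nd_self])

lemma HA_imp_trans: "HA \<^bold>\<turnstile> A \<^bold>\<longrightarrow> B \<Longrightarrow> HA \<^bold>\<turnstile> B \<^bold>\<longrightarrow> C \<Longrightarrow> HA \<^bold>\<turnstile> A \<^bold>\<longrightarrow> C"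
  unfolding nd_Nil[symmetric] by (rule nd_impI, rule nd_mp[OF nd_weaken1 nd_mp[OF nd_weaken1 nd_self]])

text \<open>Derived in HA, since the axiomatization occurs positively in \<open>Box\<close>, and not
  by way of models: it is applied to the given \<eta>, which is not assumed to be a
  \<Sigma>-formula.\<close>

lemma Box_mono: "HA \<^bold>\<turnstile> \<alpha> \<^bold>\<longrightarrow> \<beta> \<Longrightarrow> HA \<^bold>\<turnstile> Box \<alpha> x \<^bold>\<longrightarrow> Box \<beta> x"
  unfolding Box_def Deriv_def prov_step_def disjs_def
  by (simp add: numeral_nat) (intro nd_Exi_mono nd_Conj_mono nd_Uni_mono nd_Disj_mono HA_imp_refl)

text \<open>The axiomatization \<open>\<eta>\<close> need not be a \<open>\<Sigma>\<^sub>1\<close>-formula, but \<open>HaAxF\<close> is.\<close>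

primrec realS :: "(nat \<Rightarrow> fm) \<Rightarrow> fm \<Rightarrow> spf \<Rightarrow> fm" where
  "realS r \<tau> STop = HaAxF"
| "realS r \<tau> (SVar p) = (r p \<^bold>\<or> HaAxF)"
| "realS r \<tau> (SAnd \<phi> \<psi>) = (realS r \<tau> \<phi> \<^bold>\<or> realS r \<tau> \<psi>)"
| "realS r \<tau> (SDia \<phi>) = (HaAxF \<^bold>\<or> (Var 0 \<^bold>= num \<ulcorner>Dia (realize r \<tau> \<phi>) Tru\<urcorner>))"

abbreviation bot :: fm where "bot \<equiv> Neg Tru"
abbreviation nbot :: tm where "nbot \<equiv> num \<ulcorner>bot\<urcorner>"

text \<open>The sentence quoted in the \<open>SDia\<close> case is the same on both sides; only the
  description of the axioms of HA differs. So propositional reasoning suffices.\<close>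

lemma realS_iff:
  assumes "standard_axiomatization_HA \<eta>"
  shows "HA \<^bold>\<turnstile> realS r \<eta> \<phi> \<^bold>\<longrightarrow> realize r \<eta> \<phi>" "HA \<^bold>\<turnstile> realize r \<eta> \<phi> \<^bold>\<longrightarrow> realS r \<eta> \<phi>"
proof -
  have "HA \<^bold>\<turnstile> Uni (Iff \<eta> HaAxF)" using assms by (simp add: standard_axiomatization_HA_def)
  from HA_closure[of 1, simplified, OF this] have "[] \<tturnstile> Iff \<eta> HaAxF" by (simp add: nd_Nil)
  then have 1: "HA \<^bold>\<turnstile> \<eta> \<^bold>\<longrightarrow> HaAxF" and 2: "HA \<^bold>\<turnstile> HaAxF \<^bold>\<longrightarrow> \<eta>"
    unfolding nd_Nil[symmetric] by (rule nd_conj1, rule nd_conj2)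
  show "HA \<^bold>\<turnstile> realS r \<eta> \<phi> \<^bold>\<longrightarrow> realize r \<eta> \<phi>"
    by (induction \<phi>) (auto intro!: nd_Disj_mono HA_imp_refl 2)
  show "HA \<^bold>\<turnstile> realize r \<eta> \<phi> \<^bold>\<longrightarrow> realS r \<eta> \<phi>"
    by (induction \<phi>) (auto intro!: nd_Disj_mono HA_imp_refl 1)
qed

lemma sigma1_Sig: "sigma1 A \<Longrightarrow> Sig A"
  by (induction rule: sigma1.induct) (auto intro: Sig_delta0)

locale realization =
  fixes r :: "nat \<Rightarrow> fm" and \<eta> :: fm
  assumes std: "standard_axiomatization_HA \<eta>" and inf: "infinitary_realization r"
begin

abbreviation "re \<equiv> realize r \<eta>"
abbreviation "rs \<equiv> realS r \<eta>"
abbreviation "D \<phi> \<equiv> Dia (re \<phi>) Tru"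

lemma closed_re: "closed_fm 1 (re \<phi>)"
  using std inf by (induction \<phi>) (auto simp: standard_axiomatization_HA_def infinitary_realization_def)

lemma closed_rs: "closed_fm 1 (rs \<phi>)"
  using inf closed_HaAxF by (induction \<phi>) (auto simp: infinitary_realization_def)

lemma Sig_rs: "Sig (rs \<phi>)"
  using inf by (induction \<phi>) (auto simp: infinitary_realization_def intro: sigma1_Sig)

lemma closed_D: "closed_fm 0 (D \<phi>)"
  unfolding Dia_def using closed_Box[OF closed_re] by simp

lemma ext_re: "ext (re \<phi>) = ext (rs \<phi>)"
proof
  fix x :: 'a
  show "ext (re \<phi>) x = ext (rs \<phi>) x"
    using HA_sound[OF realS_iff(1)[OF std, of r \<phi>], of "\<lambda>_. x"]
      HA_sound[OF realS_iff(2)[OF std, of r \<phi>], of "\<lambda>_. x"]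
    by (auto simp: ext_def)
qed

lemma ext_rs [simp]: "ext (rs STop) = haax" "ext (rs (SVar p)) x \<longleftrightarrow> ext (r p) x \<or> haax x"
  "ext (rs (SAnd \<phi> \<psi>)) x \<longleftrightarrow> ext (rs \<phi>) x \<or> ext (rs \<psi>) x"
  "ext (rs (SDia \<phi>)) x \<longleftrightarrow> haax x \<or> x = gf (D \<phi>)"
  by (simp_all add: ext_def fun_eq_iff)

declare realS.simps [simp del]

lemma haax_rs: "haax x \<Longrightarrow> ext (rs \<phi>) x"
  by (induction \<phi>) auto

lemma bx_rs_mono: "bx haax x \<Longrightarrow> bx (ext (rs \<phi>)) x"
  by (rule bx_cut[OF closed_rs]) (auto intro: bx_ax haax_rs)

lemma bx_rs_HA: "HA \<^bold>\<turnstile> A \<Longrightarrow> bx (ext (rs \<phi>)) (gf A)"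
  by (rule bx_HA) (auto intro: haax_rs)

definition holds :: "spf \<Rightarrow> spf \<Rightarrow> bool" where
  "holds \<phi> \<psi> \<longleftrightarrow> HA \<^bold>\<turnstile> Uni (IsSent (Var 0) \<^bold>\<longrightarrow> Box (re \<psi>) (Var 0) \<^bold>\<longrightarrow> Box (re \<phi>) (Var 0))"

lemma holds_bx: "holds \<phi> \<psi> \<Longrightarrow> fmf 0 (u :: 'a :: pa) \<Longrightarrow> bx (ext (rs \<psi>)) u \<Longrightarrow> bx (ext (rs \<phi>)) u"
  unfolding holds_def using HA_sound[of _ "\<lambda>_ :: nat. u"]
  by (fastforce simp: closed_re[simplified] ext_re)

text \<open>Brings the inclusion into the form of an implication between \<Sigma>-formulas, to which
  transfer applies.\<close>

lemma holds_iff: "holds \<phi> \<psi> \<longleftrightarrow> HA \<^bold>\<turnstile> IsSent (Var 0) \<^bold>\<and> Box (rs \<psi>) (Var 0) \<^bold>\<longrightarrow> Box (rs \<phi>) (Var 0)"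
proof
  let ?S = "IsSent (Var 0)"
  note m1 = Box_mono[OF realS_iff(1)[OF std], of r _ "Var 0"] and m2 = Box_mono[OF realS_iff(2)[OF std], of r _ "Var 0"]
  {
    assume "holds \<phi> \<psi>"
    then have "HA \<^bold>\<turnstile> Uni (?S \<^bold>\<longrightarrow> Box (re \<psi>) (Var 0) \<^bold>\<longrightarrow> Box (re \<phi>) (Var 0))" by (simp add: holds_def)
    from HA_closure[of 1, simplified, OF this]
    have h: "HA \<^bold>\<turnstile> ?S \<^bold>\<longrightarrow> Box (re \<psi>) (Var 0) \<^bold>\<longrightarrow> Box (re \<phi>) (Var 0)" .
    have "[?S \<^bold>\<and> Box (rs \<psi>) (Var 0)] \<tturnstile> Box (rs \<phi>) (Var 0)"
      by (rule nd_mp[OF nd_thm[OF m2] nd_mp[OF nd_mp[OF nd_thm[OF h] nd_conj1[OF nd_self]]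
            nd_mp[OF nd_thm[OF m1] nd_conj2[OF nd_self]]]])
    then show "HA \<^bold>\<turnstile> ?S \<^bold>\<and> Box (rs \<psi>) (Var 0) \<^bold>\<longrightarrow> Box (rs \<phi>) (Var 0)" by (simp add: nd_Cons nd_Nil)
  }
  {
    assume h: "HA \<^bold>\<turnstile> ?S \<^bold>\<and> Box (rs \<psi>) (Var 0) \<^bold>\<longrightarrow> Box (rs \<phi>) (Var 0)"
    have "[Box (re \<psi>) (Var 0), ?S] \<tturnstile> Box (re \<phi>) (Var 0)"
      by (rule nd_mp[OF nd_thm[OF m1] nd_mp[OF nd_thm[OF h] nd_conjI[OF nd_weaken1[OF nd_self]
            nd_mp[OF nd_thm[OF m2] nd_self]]]])
    then show "holds \<phi> \<psi>" unfolding holds_def by (simp add: nd_Cons nd_Nil prv.gen)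
  }
qed

lemma holds_trans: "holds \<phi> \<psi> \<Longrightarrow> holds \<psi> \<chi> \<Longrightarrow> holds \<phi> \<chi>"
proof -
  assume "holds \<phi> \<psi>" "holds \<psi> \<chi>"
  then have 1: "HA \<^bold>\<turnstile> IsSent (Var 0) \<^bold>\<and> Box (rs \<psi>) (Var 0) \<^bold>\<longrightarrow> Box (rs \<phi>) (Var 0)"
    and 2: "HA \<^bold>\<turnstile> IsSent (Var 0) \<^bold>\<and> Box (rs \<chi>) (Var 0) \<^bold>\<longrightarrow> Box (rs \<psi>) (Var 0)" by (simp_all add: holds_iff)
  have "[IsSent (Var 0) \<^bold>\<and> Box (rs \<chi>) (Var 0)] \<tturnstile> Box (rs \<phi>) (Var 0)"
    by (rule nd_mp[OF nd_thm[OF 1] nd_conjI[OF nd_conj1[OF nd_self] nd_mp[OF nd_thm[OF 2] nd_self]]])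
  then show ?thesis by (simp add: holds_iff nd_Cons nd_Nil)
qed

text \<open>It is essential that the inclusion is proved in HA and not just true in the model: it is
  used within the model's own proofs, at the sentence \<open>bot\<close> to which \<open>D\<close>
  refers.\<close>

lemma bx_nec:
  assumes "holds \<phi> \<psi>"
  shows "bx (ext (rs (SDia \<phi>))) (gf (D \<psi>) :: 'a :: pa)"
proof -
  have "HA \<^bold>\<turnstile> sub_fm 0 nbot (IsSent (Var 0) \<^bold>\<longrightarrow> Box (re \<psi>) (Var 0) \<^bold>\<longrightarrow> Box (re \<phi>) (Var 0))"
    using assms unfolding holds_def by (rule HA_inst)
  then have h: "HA \<^bold>\<turnstile> IsSent nbot \<^bold>\<longrightarrow> Box (re \<psi>) nbot \<^bold>\<longrightarrow> Box (re \<phi>) nbot"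
    by (simp add: sub_Box[OF closed_re] sub_IsSent)
  have "[IsSent nbot] \<tturnstile> D \<phi> \<^bold>\<longrightarrow> D \<psi>"
    unfolding Dia_def
    by (rule nd_impI, rule nd_impI, rule nd_mp[OF nd_weaken1[OF nd_self]],
        rule nd_mp[OF nd_mp[OF nd_thm[OF h] nd_asm] nd_self]) simp
  moreover have "pv (\<lambda>_ :: nat. 0 :: 'a) (IsSent nbot)"
    using fmf0_gf[of bot] by (intro pv_Sig) auto
  ultimately have "bx haax (ef 0 (\<lambda>_. 0) (D \<phi> \<^bold>\<longrightarrow> D \<psi>) :: 'a)" by (rule pv_nd1)
  then have "bx haax (iimp (gf (D \<phi>)) (gf (D \<psi>)) :: 'a)" by (simp add: ef_sentence closed_D)
  then show ?thesis by (rule bx_mp[OF bx_rs_mono bx_ax]) (simp_all add: fmf0_gf closed_D)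
qed

text \<open>That an inconsistency proof exists is a true \<Sigma>-sentence, hence provable inside
  the model, where it contradicts the axiom \<open>D \<chi>\<close>. For this the realization must
  have \<Sigma>-formulas as values.\<close>

lemma bx_four_key:
  assumes "bx (ext (rs \<chi>)) (gf bot :: 'a :: pa)"
  shows "bx (ext (rs (SDia \<chi>))) (gf bot :: 'a)"
proof -
  let ?e = "\<lambda>_ :: nat. 0 :: 'a"
  have "pv ?e (Box (rs \<chi>) nbot)"
    using assms by (intro pv_Sig Sig_Box Sig_rs) (simp add: closed_rs[simplified])
  moreover have "[Box (rs \<chi>) nbot] \<tturnstile> Box (re \<chi>) nbot"
    by (simp add: nd_Cons nd_Nil Box_mono[OF realS_iff(1)[OF std]])
  ultimately have "pv ?e (Box (re \<chi>) nbot)" by (rule pv_nd1[rotated])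
  then have 1: "bx (ext (rs (SDia \<chi>))) (gf (Box (re \<chi>) nbot) :: 'a)"
    by (intro bx_rs_mono) (simp only: ef_sentence[OF closed_Box[OF closed_re closed_num]])
  have 2: "bx (ext (rs (SDia \<chi>))) (gf (D \<chi>) :: 'a)"
    by (rule bx_ax) (simp_all add: fmf0_gf closed_D)
  have "bx (ext (rs (SDia \<chi>))) (gf (Fls \<^bold>\<longrightarrow> bot) :: 'a)"
    by (rule bx_rs_HA, rule prv.logic, rule log_ax.intros(9))
  moreover have "bx (ext (rs (SDia \<chi>))) (gf Fls :: 'a)"
    using bx_mp[OF 2[unfolded Dia_def gf_simps] 1] by simp
  ultimately show ?thesis using bx_mp by auto
qed

lemma bx_four:
  assumes "HA \<^bold>\<turnstile> Box (rs \<chi>) nbot \<^bold>\<longrightarrow> Box (rs (SDia \<chi>)) nbot"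
  shows "bx (ext (rs (SDia (SDia \<chi>)))) (gf (D \<chi>) :: 'a :: pa)"
proof -
  have h: "HA \<^bold>\<turnstile> Box (re \<chi>) nbot \<^bold>\<longrightarrow> Box (re (SDia \<chi>)) nbot"
    by (rule HA_imp_trans[OF Box_mono[OF realS_iff(2)[OF std]] HA_imp_trans[OF assms Box_mono[OF realS_iff(1)[OF std]]]])
  have "[] \<tturnstile> D (SDia \<chi>) \<^bold>\<longrightarrow> D \<chi>"
    unfolding Dia_def
    by (rule nd_impI, rule nd_impI, rule nd_mp[OF nd_weaken1[OF nd_self]], rule nd_mp[OF nd_thm[OF h] nd_self])
  then have "bx (ext (rs (SDia (SDia \<chi>)))) (gf (D (SDia \<chi>) \<^bold>\<longrightarrow> D \<chi>) :: 'a)"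
    by (intro bx_rs_HA) (simp add: nd_Nil)
  then show ?thesis unfolding gf_simps by (rule bx_mp[OF _ bx_ax[OF fmf0_gf[OF closed_D]]]) simp
qed

text \<open>The rules of the calculus with their premises already established in HA. Reflexivity and
  transitivity are absent, being immediate in HA; for the others the inclusion is checked in models
  and transferred before it serves as a premise.\<close>

inductive sound_step :: "spf \<Rightarrow> spf \<Rightarrow> bool" where
  "sound_step \<phi> STop"
| "sound_step (SAnd \<phi> \<psi>) \<phi>"
| "sound_step (SAnd \<phi> \<psi>) \<psi>"
| "holds \<phi> \<psi> \<Longrightarrow> holds \<phi> \<chi> \<Longrightarrow> sound_step \<phi> (SAnd \<psi> \<chi>)"
| "holds \<phi> \<psi> \<Longrightarrow> sound_step (SDia \<phi>) (SDia \<psi>)"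
| "HA \<^bold>\<turnstile> Box (rs \<chi>) nbot \<^bold>\<longrightarrow> Box (rs (SDia \<chi>)) nbot \<Longrightarrow> sound_step (SDia (SDia \<chi>)) (SDia \<chi>)"

lemma sound_step_bx:
  assumes "sound_step \<phi> \<psi>" "bx (ext (rs \<psi>)) (u :: 'a :: pa)" shows "bx (ext (rs \<phi>)) u"
  using assms
proof (induction rule: sound_step.induct)
  case (1 \<phi>) then show ?case using bx_rs_mono by simp
next
  case (2 \<phi> \<psi>) show ?case by (rule bx_cut[OF closed_rs _ 2]) (auto intro: bx_ax)
next
  case (3 \<phi> \<psi>) show ?case by (rule bx_cut[OF closed_rs _ 3]) (auto intro: bx_ax)
next
  case (4 \<phi> \<psi> \<chi>)
  show ?case by (rule bx_cut[OF closed_rs _ 4(3)]) (auto intro: holds_bx[OF 4(1)] holds_bx[OF 4(2)] bx_ax)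
next
  case (5 \<phi> \<psi>)
  show ?case
    by (rule bx_cut[OF closed_rs _ 5(2)]) (auto intro: bx_nec[OF 5(1), simplified] bx_rs_mono bx_ax)
next
  case (6 \<chi>)
  show ?case
    by (rule bx_cut[OF closed_rs _ 6(2)]) (auto intro: bx_four[OF 6(1), simplified] bx_rs_mono bx_ax)
qed

end

section \<open>Reflection in the standard model\<close>

lemma code_tm_inj: "code_tm s = code_tm t \<Longrightarrow> s = t"
proof (induction s arbitrary: t)
  case (Var i) then show ?case by (cases t) (auto simp: code_tm.simps)
next
  case Zero then show ?case by (cases t) (auto simp: code_tm.simps)
next
  case (Scc s) then show ?case by (cases t) (auto simp: code_tm.simps)
next
  case (Add s s') then show ?case by (cases t) (auto simp: code_tm.simps)
next
  case (Mul s s') then show ?case by (cases t) (auto simp: code_tm.simps)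
qed

lemma code_inj: "\<ulcorner>A\<urcorner> = \<ulcorner>B\<urcorner> \<Longrightarrow> A = B"
proof (induction A arbitrary: B)
  case (Eql s t) then show ?case by (cases B) (auto simp: code.simps dest: code_tm_inj)
next
  case Fls then show ?case by (cases B) (auto simp: code.simps)
next
  case (Conj A A') then show ?case by (cases B) (auto simp: code.simps)
next
  case (Disj A A') then show ?case by (cases B) (auto simp: code.simps)
next
  case (Impl A A') then show ?case by (cases B) (auto simp: code.simps)
next
  case (Uni A) then show ?case by (cases B) (auto simp: code.simps)
next
  case (Exi A) then show ?case by (cases B) (auto simp: code.simps)
qed

lemma gf_inj: "gf A = (gf B :: nat) \<Longrightarrow> A = B"
  by (rule code_inj) (simp add: gf_def del: of_nat_code)

lemma liftf_iff:
  "liftf k (pr 0 i) y \<longleftrightarrow> (i < k \<and> y = pr 0 i) \<or> (k \<le> i \<and> y = pr 0 (i + 1))"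
  "liftf k (pr 1 0) y \<longleftrightarrow> y = pr 1 0" "liftf k (pr 6 0) y \<longleftrightarrow> y = pr 6 0"
  "liftf k (pr 2 a) y \<longleftrightarrow> (\<exists>b. y = pr 2 b \<and> liftf k a b)"
  "g \<in> {3, 4, 5, 7, 8, 9} \<Longrightarrow> liftf k (pr g (pr a b)) y \<longleftrightarrow> (\<exists>b' a'. y = pr g (pr a' b') \<and> liftf k a a' \<and> liftf k b b')"
  "g \<in> {10, 11} \<Longrightarrow> liftf k (pr g a) y \<longleftrightarrow> (\<exists>b. y = pr g b \<and> liftf (k + 1) a b)"
proof -
  show "liftf k (pr 0 i) y \<longleftrightarrow> (i < k \<and> y = pr 0 i) \<or> (k \<le> i \<and> y = pr 0 (i + 1))"
    "liftf k (pr 1 0) y \<longleftrightarrow> y = pr 1 0" "liftf k (pr 6 0) y \<longleftrightarrow> y = pr 6 0"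
    "liftf k (pr 2 a) y \<longleftrightarrow> (\<exists>b. y = pr 2 b \<and> liftf k a b)"
    by (subst liftf_unfold; simp add: lift_op_def liftf_def; blast)+
  show "g \<in> {3, 4, 5, 7, 8, 9} \<Longrightarrow> liftf k (pr g (pr a b)) y \<longleftrightarrow> (\<exists>b' a'. y = pr g (pr a' b') \<and> liftf k a a' \<and> liftf k b b')"
    by (elim insertE emptyE; hypsubst; subst liftf_unfold; simp add: lift_op_def liftf_def)
  show "g \<in> {10, 11} \<Longrightarrow> liftf k (pr g a) y \<longleftrightarrow> (\<exists>b. y = pr g b \<and> liftf (k + 1) a b)"
    by (elim insertE emptyE; hypsubst; subst liftf_unfold; simp add: lift_op_def liftf_def)
qed

lemma subf_iff:
  "subf k t (pr 1 0) y \<longleftrightarrow> y = pr 1 0" "subf k t (pr 6 0) y \<longleftrightarrow> y = pr 6 0"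
  "subf k t (pr 2 a) y \<longleftrightarrow> (\<exists>b. y = pr 2 b \<and> subf k t a b)"
  "g \<in> {3, 4, 5, 7, 8, 9} \<Longrightarrow> subf k t (pr g (pr a b)) y \<longleftrightarrow> (\<exists>b' a'. y = pr g (pr a' b') \<and> subf k t a a' \<and> subf k t b b')"
  "g \<in> {10, 11} \<Longrightarrow> subf k t (pr g a) y \<longleftrightarrow> (\<exists>t' b. y = pr g b \<and> liftf 0 t t' \<and> subf (k + 1) t' a b)"
proof -
  show "subf k t (pr 1 0) y \<longleftrightarrow> y = pr 1 0" "subf k t (pr 6 0) y \<longleftrightarrow> y = pr 6 0"
    "subf k t (pr 2 a) y \<longleftrightarrow> (\<exists>b. y = pr 2 b \<and> subf k t a b)"
    by (subst subf_unfold; simp add: sub_op_def subf_def; blast)+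
  show "g \<in> {3, 4, 5, 7, 8, 9} \<Longrightarrow> subf k t (pr g (pr a b)) y \<longleftrightarrow> (\<exists>b' a'. y = pr g (pr a' b') \<and> subf k t a a' \<and> subf k t b b')"
    by (elim insertE emptyE; hypsubst; subst subf_unfold; simp add: sub_op_def subf_def)
  show "g \<in> {10, 11} \<Longrightarrow> subf k t (pr g a) y \<longleftrightarrow> (\<exists>t' b. y = pr g b \<and> liftf 0 t t' \<and> subf (k + 1) t' a b)"
    by (elim insertE emptyE; hypsubst; subst subf_unfold; simp add: sub_op_def subf_def)
qed

lemma subf_Var_iff: "subf k t (pr 0 i) y \<longleftrightarrow> (i < k \<and> y = pr 0 i) \<or> (i = k \<and> y = t) \<or> (\<exists>j. i = j + 1 \<and> k \<le> j \<and> y = pr 0 j)"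
  by (subst subf_unfold; simp add: sub_op_def; blast)

lemma liftf_gt_unique: "liftf (of_nat k) (gt t) y \<Longrightarrow> y = gt (lift_tm k t)"
proof (induction t arbitrary: y)
  case (Var i) then show ?case by (auto simp: liftf_iff add.commute)
qed (auto simp: liftf_iff)

lemma liftf_gf_unique: "liftf (of_nat k) (gf A) y \<Longrightarrow> y = gf (lift_fm k A)"
proof (induction A arbitrary: k y)
  case (Uni A)
  then obtain b where "y = pr 10 b" "liftf (of_nat (Suc k)) (gf A) b" by (auto simp: liftf_iff add.commute)
  then show ?case using Uni.IH by auto
next
  case (Exi A)
  then obtain b where "y = pr 11 b" "liftf (of_nat (Suc k)) (gf A) b" by (auto simp: liftf_iff add.commute)
  then show ?case using Exi.IH by auto
qed (auto simp: liftf_iff dest: liftf_gt_unique)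

lemma subf_gt_unique: "subf k (gt u) (gt t) y \<Longrightarrow> y = gt (sub_tm k u t)" for k :: nat
proof (induction t arbitrary: y)
  case (Var i) then show ?case by (auto simp: subf_Var_iff)
next
  case Zero then show ?case by (simp only: gt_simps subf_iff(1) sub_tm.simps)
qed (auto simp: subf_iff)

lemma subf_gf_unique: "subf k (gt u) (gf A) y \<Longrightarrow> y = gf (sub_fm k u A)" for k :: nat
proof (induction A arbitrary: k u y)
  case (Uni A)
  then obtain t b where "y = pr 10 b" "liftf 0 (gt u) t" "subf (Suc k) t (gf A) b" by (auto simp: subf_iff)
  then show ?case using Uni.IH[of "Suc k" "lift_tm 0 u" b] liftf_gt_unique[of 0 u t] by auto
next
  case (Exi A)
  then obtain t b where "y = pr 11 b" "liftf 0 (gt u) t" "subf (Suc k) t (gf A) b" by (auto simp: subf_iff)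
  then show ?case using Exi.IH[of "Suc k" "lift_tm 0 u" b] liftf_gt_unique[of 0 u t] by auto
qed (auto simp: subf_iff dest: subf_gt_unique)

text \<open>\<open>dr_induct_nat\<close> accepts the predicate of being the code of an actual term,
  for which no defining formula has to be given.\<close>

lemma tmf_nat: "tmf k x \<Longrightarrow> \<exists>t. closed_tm k t \<and> x = gt t" for k x :: nat
proof -
  let ?P = "\<lambda>z. \<forall>k x. z = pr k x \<longrightarrow> (\<exists>t. closed_tm k t \<and> x = (gt t :: nat))"
  have "?P z" if "dr tm_op z" for z
  proof (rule dr_induct_nat[OF tm_op, of ?P, OF _ that])
    fix y :: nat assume "tm_op (\<lambda>q. dr tm_op q \<and> ?P q) y"
    then show "?P y"
      unfolding tm_op_def
    proof (elim disjE exE conjE)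
      fix i k assume "y = pr k (pr 0 i)" "i < k"
      then show ?thesis by (auto intro!: exI[of _ "Var i"])
    next
      fix k assume "y = pr k (pr 1 0)"
      then show ?thesis by (auto intro!: exI[of _ Zero])
    next
      fix s k assume "y = pr k (pr 2 s)" "?P (pr k s)"
      then obtain t where "closed_tm k t" "s = gt t" by auto
      then show ?thesis using \<open>y = _\<close> by (auto intro!: exI[of _ "Scc t"])
    next
      fix t s k assume "y = pr k (pr 3 (pr s t))" "?P (pr k s)" "?P (pr k t)"
      then obtain s' t' where "closed_tm k s'" "s = gt s'" "closed_tm k t'" "t = gt t'" by auto
      then show ?thesis using \<open>y = _\<close> by (auto intro!: exI[of _ "Add s' t'"])
    next
      fix t s k assume "y = pr k (pr 4 (pr s t))" "?P (pr k s)" "?P (pr k t)"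
      then obtain s' t' where "closed_tm k s'" "s = gt s'" "closed_tm k t'" "t = gt t'" by auto
      then show ?thesis using \<open>y = _\<close> by (auto intro!: exI[of _ "Mul s' t'"])
    qed
  qed
  then show "tmf k x \<Longrightarrow> ?thesis" by (auto simp: tmf_def)
qed

lemma fmf_nat: "fmf k x \<Longrightarrow> \<exists>A. closed_fm k A \<and> x = gf A" for k x :: nat
proof -
  let ?P = "\<lambda>z. \<forall>k x. z = pr k x \<longrightarrow> (\<exists>A. closed_fm k A \<and> x = (gf A :: nat))"
  have "?P z" if "dr fm_op z" for z
  proof (rule dr_induct_nat[OF fm_op, of ?P, OF _ that])
    fix y :: nat assume "fm_op (\<lambda>q. dr fm_op q \<and> ?P q) y"
    then show "?P y"
      unfolding fm_op_def
    proof (elim disjE exE conjE bexE)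
      fix t s k assume "y = pr k (pr 5 (pr s t))" "tmf k s" "tmf k t"
      moreover from this obtain s' t' where "closed_tm k s'" "s = gt s'" "closed_tm k t'" "t = gt t'"
        using tmf_nat by blast
      ultimately show ?thesis by (auto intro!: exI[of _ "s' \<^bold>= t'"])
    next
      fix k assume "y = pr k (pr 6 0)"
      then show ?thesis by (auto intro!: exI[of _ Fls])
    next
      fix g t s k assume g: "g \<in> {7, 8, 9 :: nat}" and y: "y = pr k (pr g (pr s t))" "?P (pr k s)" "?P (pr k t)"
      then obtain A B where AB: "closed_fm k A" "s = gf A" "closed_fm k B" "t = gf B" by auto
      then have "\<exists>C. closed_fm k C \<and> pr g (pr s t) = gf C"
        using g exI[of "\<lambda>C. closed_fm k C \<and> pr 7 (pr s t) = gf C" "A \<^bold>\<and> B"]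
          exI[of "\<lambda>C. closed_fm k C \<and> pr 8 (pr s t) = gf C" "A \<^bold>\<or> B"]
          exI[of "\<lambda>C. closed_fm k C \<and> pr 9 (pr s t) = gf C" "A \<^bold>\<longrightarrow> B"] by auto
      then show ?thesis using y by simp
    next
      fix g s k assume g: "g \<in> {10, 11 :: nat}" and y: "y = pr k (pr g s)" "?P (pr (k + 1) s)"
      then obtain A where AB: "closed_fm (Suc k) A" "s = gf A" by auto
      then have "\<exists>C. closed_fm k C \<and> pr g s = gf C"
        using g exI[of "\<lambda>C. closed_fm k C \<and> pr 10 s = gf C" "Uni A"]
          exI[of "\<lambda>C. closed_fm k C \<and> pr 11 s = gf C" "Exi A"] by auto
      then show ?thesis using y by simp
    qed
  qed
  then show "fmf k x \<Longrightarrow> ?thesis" by (auto simp: fmf_def)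
qed

lemma isfm_nat: "isfm x \<Longrightarrow> \<exists>A. x = gf A" for x :: nat
  using fmf_nat by (auto simp: isfm_def)

lemma istm_nat: "istm x \<Longrightarrow> \<exists>t. x = gt t" for x :: nat
  using tmf_nat by (auto simp: istm_def)

lemma logax_nat: "logax x \<Longrightarrow> \<exists>A. log_ax A \<and> x = gf A" for x :: nat
proof -
  assume "logax x"
  then show ?thesis
    unfolding logax_def
  proof (elim exE conjE disjE, goal_cases)
    case (1 c b a)
    then obtain A B where "a = gf A" "b = gf B" using isfm_nat by metis
    then show ?thesis using 1 by (intro exI[of _ "A \<^bold>\<longrightarrow> B \<^bold>\<longrightarrow> A"]) (auto intro: log_ax.intros)
  next
    case (2 c b a)
    then obtain A B C where "a = gf A" "b = gf B" "c = gf C" using isfm_nat by metis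
    then show ?thesis using 2
      by (intro exI[of _ "(A \<^bold>\<longrightarrow> B \<^bold>\<longrightarrow> C) \<^bold>\<longrightarrow> (A \<^bold>\<longrightarrow> B) \<^bold>\<longrightarrow> A \<^bold>\<longrightarrow> C"]) (auto intro: log_ax.intros)
  next
    case (3 c b a)
    then obtain A B where "a = gf A" "b = gf B" using isfm_nat by metis
    then show ?thesis using 3 by (intro exI[of _ "A \<^bold>\<longrightarrow> B \<^bold>\<longrightarrow> A \<^bold>\<and> B"]) (auto intro: log_ax.intros)
  next
    case (4 c b a)
    then obtain A B where "a = gf A" "b = gf B" using isfm_nat by metis
    then show ?thesis using 4 by (intro exI[of _ "A \<^bold>\<and> B \<^bold>\<longrightarrow> A"]) (auto intro: log_ax.intros)
  next
    case (5 c b a)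
    then obtain A B where "a = gf A" "b = gf B" using isfm_nat by metis
    then show ?thesis using 5 by (intro exI[of _ "A \<^bold>\<and> B \<^bold>\<longrightarrow> B"]) (auto intro: log_ax.intros)
  next
    case (6 c b a)
    then obtain A B where "a = gf A" "b = gf B" using isfm_nat by metis
    then show ?thesis using 6 by (intro exI[of _ "A \<^bold>\<longrightarrow> A \<^bold>\<or> B"]) (auto intro: log_ax.intros)
  next
    case (7 c b a)
    then obtain A B where "a = gf A" "b = gf B" using isfm_nat by metis
    then show ?thesis using 7 by (intro exI[of _ "B \<^bold>\<longrightarrow> A \<^bold>\<or> B"]) (auto intro: log_ax.intros)
  next
    case (8 c b a)
    then obtain A B C where "a = gf A" "b = gf B" "c = gf C" using isfm_nat by metis
    then show ?thesis using 8
      by (intro exI[of _ "(A \<^bold>\<longrightarrow> C) \<^bold>\<longrightarrow> (B \<^bold>\<longrightarrow> C) \<^bold>\<longrightarrow> A \<^bold>\<or> B \<^bold>\<longrightarrow> C"]) (auto intro: log_ax.intros)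
  next
    case (9 c b a)
    then obtain A where "a = gf A" using isfm_nat by metis
    then show ?thesis using 9 by (intro exI[of _ "Fls \<^bold>\<longrightarrow> A"]) (auto intro: log_ax.intros)
  next
    case (10 c b a)
    then obtain A t where A: "a = gf A" "b = gt t" using isfm_nat istm_nat by metis
    with 10 have "c = gf (sub_fm 0 t A)" using subf_gf_unique by blast
    then show ?thesis using 10 A by (intro exI[of _ "Uni A \<^bold>\<longrightarrow> sub_fm 0 t A"]) (auto intro: log_ax.intros)
  next
    case (11 c b a)
    then obtain A t where A: "a = gf A" "b = gt t" using isfm_nat istm_nat by metis
    with 11 have "c = gf (sub_fm 0 t A)" using subf_gf_unique by blast
    then show ?thesis using 11 A by (intro exI[of _ "sub_fm 0 t A \<^bold>\<longrightarrow> Exi A"]) (auto intro: log_ax.intros)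
  next
    case (12 c b a)
    then obtain A B where A: "a = gf A" "b = gf B" using isfm_nat by metis
    with 12 have "c = gf (lift_fm 0 A)" using liftf_gf_unique[of 0] by simp
    then show ?thesis using 12 A
      by (intro exI[of _ "Uni (lift_fm 0 A \<^bold>\<longrightarrow> B) \<^bold>\<longrightarrow> A \<^bold>\<longrightarrow> Uni B"]) (auto intro: log_ax.intros)
  next
    case (13 c b a)
    then obtain A B where A: "a = gf A" "b = gf B" using isfm_nat by metis
    with 13 have "c = gf (lift_fm 0 A)" using liftf_gf_unique[of 0] by simp
    then show ?thesis using 13 A
      by (intro exI[of _ "Uni (B \<^bold>\<longrightarrow> lift_fm 0 A) \<^bold>\<longrightarrow> Exi B \<^bold>\<longrightarrow> A"]) (auto intro: log_ax.intros)
  next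
    case (14 a)
    then obtain t where "a = gt t" using istm_nat by metis
    then show ?thesis using 14 by (intro exI[of _ "t \<^bold>= t"]) (auto intro: log_ax.intros)
  next
    case (15 e d c b a)
    then obtain A s t where A: "a = gf A" "b = gt s" "c = gt t" using isfm_nat istm_nat by metis
    with 15 have "d = gf (sub_fm 0 s A)" "e = gf (sub_fm 0 t A)" using subf_gf_unique by blast+
    then show ?thesis using 15 A
      by (intro exI[of _ "s \<^bold>= t \<^bold>\<longrightarrow> sub_fm 0 s A \<^bold>\<longrightarrow> sub_fm 0 t A"]) (auto intro: log_ax.intros)
  qed
qed

lemma closf_nat: "closf (gf A) x \<Longrightarrow> \<exists>n. x = (gf ((Uni ^^ n) A) :: nat)"
proof -
  let ?P = "\<lambda>z. \<forall>x. z = pr (gf A) x \<longrightarrow> (\<exists>n. x = (gf ((Uni ^^ n) A) :: nat))"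
  have "?P z" if "dr clos_op z" for z
  proof (rule dr_induct_nat[OF clos_op, of ?P, OF _ that])
    fix y :: nat assume "clos_op (\<lambda>q. dr clos_op q \<and> ?P q) y"
    then show "?P y"
      unfolding clos_op_def
    proof (elim disjE exE conjE)
      fix x assume "y = pr x x"
      then show ?thesis by (auto intro!: exI[of _ 0])
    next
      fix b a assume y: "y = pr a (pr 10 b)" "?P (pr a b)"
      show ?thesis
      proof (intro allI impI)
        fix x assume "y = pr (gf A) x"
        then obtain n where "b = gf ((Uni ^^ n) A)" "x = pr 10 b" using y by auto
        then show "\<exists>n. x = gf ((Uni ^^ n) A)" by (intro exI[of _ "Suc n"]) simp
      qed
    qed
  qed
  then show "closf (gf A) x \<Longrightarrow> ?thesis" by (auto simp: closf_def)
qed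

lemma haax_nat: "haax x \<Longrightarrow> \<exists>A\<in>HA. x = gf A" for x :: nat
  unfolding haax_def
proof (elim disjE conjE exE bexE)
  fix A assume "A \<in> set basic_axioms" "x = of_nat \<ulcorner>A\<urcorner>"
  then show ?thesis by (auto simp: HA_def gf_def simp del: of_nat_code)
next
  fix e d c b a
  assume h: "fmf 0 x" "isfm a" "subf 0 (pr 1 0) a b" "liftf 1 a c" "subf 0 (pr 2 (pr 0 0)) c d"
    "e = iimp (iconj b (pr 10 (iimp a d))) (pr 10 a)" "closf e x"
  obtain A where A: "a = gf A" using isfm_nat h by blast
  have b: "b = gf (sub_fm 0 Zero A)" using subf_gf_unique[of 0 Zero A b] h A by simp
  have c: "c = gf (lift_fm 1 A)" using liftf_gf_unique[of 1 A c] h A by simp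
  have d: "d = gf (sub_fm 0 (Scc (Var 0)) (lift_fm 1 A))"
    using subf_gf_unique[of 0 "Scc (Var 0)" _ d] h c by simp
  have "e = gf (ind_ax A)" using h A b c d by (simp add: ind_ax_def)
  then obtain n where n: "x = gf ((Uni ^^ n) (ind_ax A))" using h closf_nat by blast
  \<comment> \<open>\<open>x\<close> codes a sentence and also a closure of an induction axiom.
    Injectivity of the coding identifies the two, so the closure is a sentence as \<open>HA\<close>
    demands.\<close>
  obtain B where B: "closed_fm 0 B" "x = gf B" using fmf_nat h(1) by blast
  then have "B = (Uni ^^ n) (ind_ax A)" using n by (intro gf_inj) simp
  then show ?thesis using B by (auto simp: HA_def)
qed

text \<open>Over the natural numbers the coded sequences are finite in fact, so their steps can be
  replayed as steps of \<open>prv\<close>.\<close>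

theorem bx_nat: "bx haax (gf A :: nat) \<Longrightarrow> HA \<^bold>\<turnstile> A"
proof -
  have "\<exists>A. x = gf A \<and> HA \<^bold>\<turnstile> A" if "dr (prov_op haax) x" for x :: nat
  proof (rule dr_induct_nat[OF prov_op _ that])
    fix y :: nat assume "prov_op haax (\<lambda>q. dr (prov_op haax) q \<and> (\<exists>A. q = gf A \<and> HA \<^bold>\<turnstile> A)) y"
    then show "\<exists>A. y = gf A \<and> HA \<^bold>\<turnstile> A"
      unfolding prov_op_def
    proof (elim disjE exE conjE)
      assume "logax y" then show ?thesis using logax_nat prv.logic by blast
    next
      assume "haax y" then show ?thesis using haax_nat prv.axiom by blast
    next
      fix a b A C assume h: "y = b" "a = gf A" "HA \<^bold>\<turnstile> A" "iimp a b = gf C" "HA \<^bold>\<turnstile> C"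
      then obtain A' B where "C = (A' \<^bold>\<longrightarrow> B)" "gf A' = a" "gf B = b" by (cases C) auto
      then show ?thesis using h gf_inj prv.mp by metis
    next
      fix a A assume "y = pr 10 a" "a = gf A" "HA \<^bold>\<turnstile> A"
      then show ?thesis by (intro exI[of _ "Uni A"]) (auto intro: prv.gen)
    qed
  qed
  then show "bx haax (gf A :: nat) \<Longrightarrow> HA \<^bold>\<turnstile> A" using gf_inj unfolding bx_def by metis
qed

section \<open>Bounding the quantifiers of \<open>\<Sigma>\<close>-formulas\<close>

text \<open>Index \<open>k\<close>, beyond the free indices of the formula, becomes a common bound
  on all witnesses; it rises by one under each binder. Universal quantifiers bounded by \<le> are
  rewritten with < to fit \<open>delta0\<close>, and \<open>SOME\<close> recovers their bound from
  the syntax.\<close>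

fun bnd :: "nat \<Rightarrow> fm \<Rightarrow> fm" where
  "bnd k (A \<^bold>\<and> B) = (if delta0 (A \<^bold>\<and> B) then A \<^bold>\<and> B else bnd k A \<^bold>\<and> bnd k B)"
| "bnd k (A \<^bold>\<or> B) = (if delta0 (A \<^bold>\<or> B) then A \<^bold>\<or> B else bnd k A \<^bold>\<or> bnd k B)"
| "bnd k (Exi A) = (if delta0 (Exi A) then Exi A else Exi (Var 0 \<^bold>< Var (Suc k) \<^bold>\<and> bnd (Suc k) A))"
| "bnd k (Uni (X \<^bold>\<longrightarrow> A)) = (if delta0 (Uni (X \<^bold>\<longrightarrow> A)) then Uni (X \<^bold>\<longrightarrow> A)
     else Uni (Var 0 \<^bold>< lift_tm 0 (Scc (SOME t. X = (Var 0 \<^bold>\<le> lift_tm 0 t))) \<^bold>\<longrightarrow> bnd (Suc k) A))"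
| "bnd k A = A"

lemma bnd_delta0: "delta0 A \<Longrightarrow> bnd k A = A"
  by (cases "(k, A)" rule: bnd.cases) auto

lemma scons_upd: "(y ## e)(Suc k := w) = y ## e(k := w)"
  by (rule ext) (auto simp: scons_def split: nat.split)

text \<open>The bounded universal quantifier is the critical case: the witnesses for all
  \<open>y\<close> up to \<open>T\<close> get a common bound, by induction on how far one has come,
  with \<open>max\<close> and monotonicity.\<close>

lemma collection:
  fixes T :: "'a :: pa"
  assumes mono: "\<And>y w w'. sat ((y ## e)(Suc k := w)) B \<Longrightarrow> w \<le> w' \<Longrightarrow> sat ((y ## e)(Suc k := w')) B"
    and ex: "\<And>y. y \<le> T \<Longrightarrow> \<exists>w. sat ((y ## e)(Suc k := w)) B"
  shows "\<exists>w. \<forall>y\<le>T. sat ((y ## e)(Suc k := w)) B"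
proof -
  let ?P = "\<lambda>j. j \<le> T \<longrightarrow> (\<exists>w. \<forall>y\<le>j. sat ((y ## e)(Suc k := w)) B)"
  have "?P j" for j
  proof (rule dfb_induct[of ?P])
    \<comment> \<open>In the environment \<open>y ## w ## j ## T ## e\<close> the bound sits at
      index 1, whereas \<open>B\<close> expects it at \<open>Suc k\<close>; the remaining indices
      skip \<open>w\<close>, \<open>j\<close> and \<open>T\<close>.\<close>
    define \<rho> where "\<rho> i = (if i = 0 then 0 else if i = Suc k then 1 else i + 3)" for i :: nat
    have "sat (y ## w ## j ## T ## e) (fsubst (\<lambda>i. Var (\<rho> i)) B) = sat ((y ## e)(Suc k := w)) B" for y w j
      unfolding sat_fsubst
      by (rule arg_cong[where f = "\<lambda>e. sat e B"]) (auto simp: \<rho>_def scons_def numeral_nat split: nat.split)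
    then show "dfb ?P"
      by (intro dfbI[of _ "T ## e" "Var 0 \<^bold>\<le> Var 1 \<^bold>\<longrightarrow> Exi (Uni (Var 0 \<^bold>\<le> Var 2 \<^bold>\<longrightarrow> fsubst (\<lambda>i. Var (\<rho> i)) B))"])
        (simp add: numeral_nat)
    show "?P 0" using ex[of 0] by auto
    fix j assume "?P j"
    show "?P (j + 1)"
    proof
      assume j: "j + 1 \<le> T"
      then obtain w where w: "\<forall>y\<le>j. sat ((y ## e)(Suc k := w)) B" using \<open>?P j\<close> by (auto dest: less_imp_le)
      obtain w' where w': "sat (((j + 1) ## e)(Suc k := w')) B" using ex[OF j] by blast
      have "sat ((y ## e)(Suc k := max w w')) B" if y: "y \<le> j + 1" for y
      proof (cases "y \<le> j")
        case True then show ?thesis using w mono max.cobounded1 by blast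
      next
        case False
        then have "y = j + 1" using y by (metis le_less pa_less_Suc)
        then show ?thesis using w' mono max.cobounded2 by blast
      qed
      then show "\<exists>w. \<forall>y\<le>j + 1. sat ((y ## e)(Suc k := w)) B" by blast
    qed
  qed
  then show ?thesis by blast
qed

lemma bnd_syntax: "Sig A \<Longrightarrow> closed_fm k A \<Longrightarrow> delta0 (bnd k A) \<and> closed_fm (Suc k) (bnd k A)"
proof (induction arbitrary: k rule: Sig.induct)
  case (Sig_delta0 A)
  then show ?case using bnd_delta0 closed_fm_mono[of k A "Suc k"] by simp
next
  case (Sig_Conj A B)
  then show ?case using closed_fm_mono[of k _ "Suc k"] by (auto intro: delta0.intros)
next
  case (Sig_Disj A B)
  then show ?case using closed_fm_mono[of k _ "Suc k"] by (auto intro: delta0.intros)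
next
  case (Sig_Exi A)
  then show ?case using closed_fm_mono[of "Suc k" A "Suc (Suc k)"] delta0.intros(8)[of "bnd (Suc k) A" "Var k"]
    by auto
next
  case (Sig_Uni A t)
  let ?X = "Var 0 \<^bold>\<le> lift_tm 0 t"
  define t' where "t' = (SOME t'. ?X = (Var 0 \<^bold>\<le> lift_tm 0 t'))"
  have t': "?X = (Var 0 \<^bold>\<le> lift_tm 0 t')" unfolding t'_def by (rule someI[of _ t]) simp
  then have "closed_tm k t'" using Sig_Uni.prems by (metis closed_fm.simps(5,6) closed_le closed_tm_lift)
  then have c: "closed_tm (Suc k) t'" by (rule closed_tm_mono) simp
  have IH: "delta0 (bnd (Suc k) A)" "closed_fm (Suc (Suc k)) (bnd (Suc k) A)"
    using Sig_Uni.IH[of "Suc k"] Sig_Uni.prems by auto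
  show ?case
  proof (cases "delta0 (Uni (?X \<^bold>\<longrightarrow> A))")
    case True
    then show ?thesis using closed_fm_mono[OF Sig_Uni.prems, of "Suc k"] by simp
  next
    case False
    then show ?thesis using IH c delta0.intros(7)[OF IH(1), of "Scc t'"] by (simp add: t'_def[symmetric])
  qed
qed

lemma bnd_sat_delta0:
  assumes "delta0 A" "closed_fm k A"
  shows "(\<forall>(e :: nat \<Rightarrow> 'a :: pa) w w'. sat (e(k := w)) (bnd k A) \<longrightarrow> w \<le> w' \<longrightarrow> sat (e(k := w')) (bnd k A)) \<and>
    (\<forall>e :: nat \<Rightarrow> 'a. sat e A \<longleftrightarrow> (\<exists>w. sat (e(k := w)) (bnd k A)))"
proof -
  have "sat (e(k := w)) A = sat e A" for e :: "nat \<Rightarrow> 'a" and w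
    by (rule sat_closed[OF assms(2)]) auto
  then show ?thesis unfolding bnd_delta0[OF assms(1)] by (simp only:) blast
qed

text \<open>Monotonicity in the bound is proved along with the equivalence because conjunctions and
  bounded quantifiers have to reconcile different bounds.\<close>

lemma bnd_sat:
  "Sig A \<Longrightarrow> closed_fm k A \<Longrightarrow>
    (\<forall>(e :: nat \<Rightarrow> 'a :: pa) w w'. sat (e(k := w)) (bnd k A) \<longrightarrow> w \<le> w' \<longrightarrow> sat (e(k := w')) (bnd k A)) \<and>
    (\<forall>e :: nat \<Rightarrow> 'a. sat e A \<longleftrightarrow> (\<exists>w. sat (e(k := w)) (bnd k A)))"
proof (induction arbitrary: k rule: Sig.induct)
  case (Sig_delta0 A)
  show ?case by (rule bnd_sat_delta0) fact+
next
  case (Sig_Conj A B)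
  show ?case
  proof (cases "delta0 (A \<^bold>\<and> B)")
    case True
    then show ?thesis by (rule bnd_sat_delta0) fact
  next
    case False
    have c: "closed_fm k A" "closed_fm k B" using Sig_Conj.prems by auto
    note A = Sig_Conj.IH(1)[OF c(1)] and B = Sig_Conj.IH(2)[OF c(2)]
    have s: "sat (e(k := w)) (bnd k (A \<^bold>\<and> B)) \<longleftrightarrow> sat (e(k := w)) (bnd k A) \<and> sat (e(k := w)) (bnd k B)"
      for e :: "nat \<Rightarrow> 'a" and w using False by simp
    have "\<exists>w. sat (e(k := w)) (bnd k A) \<and> sat (e(k := w)) (bnd k B)"
      if "sat (e(k := w)) (bnd k A)" "sat (e(k := w')) (bnd k B)" for e :: "nat \<Rightarrow> 'a" and w w'
      using that A[THEN conjunct1, rule_format, of e w "max w w'"] B[THEN conjunct1, rule_format, of e w' "max w w'"]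
      by auto
    note ex = this
    show ?thesis
    proof (intro conjI allI impI)
      fix e :: "nat \<Rightarrow> 'a" and w w' assume "sat (e(k := w)) (bnd k (A \<^bold>\<and> B))" "w \<le> w'"
      then show "sat (e(k := w')) (bnd k (A \<^bold>\<and> B))" unfolding s using A B by blast
    next
      fix e :: "nat \<Rightarrow> 'a"
      show "sat e (A \<^bold>\<and> B) \<longleftrightarrow> (\<exists>w. sat (e(k := w)) (bnd k (A \<^bold>\<and> B)))"
        unfolding s sat.simps(3) A[THEN conjunct2, rule_format] B[THEN conjunct2, rule_format]
        using ex[of e] by blast
    qed
  qed
next
  case (Sig_Disj A B)
  show ?case
  proof (cases "delta0 (A \<^bold>\<or> B)")
    case True
    then show ?thesis by (rule bnd_sat_delta0) fact
  next
    case False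
    have c: "closed_fm k A" "closed_fm k B" using Sig_Disj.prems by auto
    note A = Sig_Disj.IH(1)[OF c(1)] and B = Sig_Disj.IH(2)[OF c(2)]
    have s: "sat (e(k := w)) (bnd k (A \<^bold>\<or> B)) \<longleftrightarrow> sat (e(k := w)) (bnd k A) \<or> sat (e(k := w)) (bnd k B)"
      for e :: "nat \<Rightarrow> 'a" and w using False by simp
    show ?thesis
    proof (intro conjI allI impI)
      fix e :: "nat \<Rightarrow> 'a" and w w' assume "sat (e(k := w)) (bnd k (A \<^bold>\<or> B))" "w \<le> w'"
      then show "sat (e(k := w')) (bnd k (A \<^bold>\<or> B))" unfolding s using A B by blast
    next
      fix e :: "nat \<Rightarrow> 'a"
      show "sat e (A \<^bold>\<or> B) \<longleftrightarrow> (\<exists>w. sat (e(k := w)) (bnd k (A \<^bold>\<or> B)))"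
        unfolding s sat.simps(4) A[THEN conjunct2, rule_format] B[THEN conjunct2, rule_format] by blast
    qed
  qed
next
  case (Sig_Exi A)
  show ?case
  proof (cases "delta0 (Exi A)")
    case True
    then show ?thesis by (rule bnd_sat_delta0) fact
  next
    case False
    have c: "closed_fm (Suc k) A" using Sig_Exi.prems by auto
    note A = Sig_Exi.IH[OF c]
    have s: "sat (e(k := w)) (bnd k (Exi A)) \<longleftrightarrow> (\<exists>y<w. sat ((y ## e)(Suc k := w)) (bnd (Suc k) A))"
      for e :: "nat \<Rightarrow> 'a" and w using False by (simp add: scons_upd)
    have "\<exists>w. \<exists>y<w. sat ((y ## e)(Suc k := w)) (bnd (Suc k) A)"
      if "sat ((y ## e)(Suc k := w)) (bnd (Suc k) A)" for e :: "nat \<Rightarrow> 'a" and y w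
    proof -
      have "y < max (y + 1) w" by (simp add: less_max_iff_disj)
      moreover have "sat ((y ## e)(Suc k := max (y + 1) w)) (bnd (Suc k) A)"
        using A[THEN conjunct1, rule_format, OF that max.cobounded2] .
      ultimately show ?thesis by blast
    qed
    then have 2: "sat e (Exi A) \<longleftrightarrow> (\<exists>w. \<exists>y<w. sat ((y ## e)(Suc k := w)) (bnd (Suc k) A))" for e :: "nat \<Rightarrow> 'a"
      unfolding sat.simps(7) A[THEN conjunct2, rule_format] by blast
    have 1: "\<exists>y<w'. sat ((y ## e)(Suc k := w')) (bnd (Suc k) A)"
      if "y < w" "sat ((y ## e)(Suc k := w)) (bnd (Suc k) A)" "w \<le> w'" for e :: "nat \<Rightarrow> 'a" and y w w'
      using A[THEN conjunct1, rule_format, OF that(2,3)] less_le_trans[OF that(1,3)] by blast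
    show ?thesis
    proof (intro conjI allI impI)
      fix e :: "nat \<Rightarrow> 'a" and w w' assume "sat (e(k := w)) (bnd k (Exi A))" "w \<le> w'"
      then show "sat (e(k := w')) (bnd k (Exi A))" unfolding s using 1 by blast
    qed (simp only: s 2)
  qed
next
  case (Sig_Uni A t)
  let ?X = "Var 0 \<^bold>\<le> lift_tm 0 t"
  show ?case
  proof (cases "delta0 (Uni (?X \<^bold>\<longrightarrow> A))")
    case True
    then show ?thesis by (rule bnd_sat_delta0) fact
  next
    case False
    define t' where "t' = (SOME t'. ?X = (Var 0 \<^bold>\<le> lift_tm 0 t'))"
    have t': "?X = (Var 0 \<^bold>\<le> lift_tm 0 t')" unfolding t'_def by (rule someI[of _ t]) simp
    then have ct: "closed_tm k t'" using Sig_Uni.prems by (metis closed_fm.simps(5,6) closed_le closed_tm_lift)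
    have v: "val (e(k := w)) t' = val e t'" for e :: "nat \<Rightarrow> 'a" and w
      by (rule val_closed[OF ct]) simp
    have c: "closed_fm (Suc k) A" using Sig_Uni.prems by auto
    note A = Sig_Uni.IH[OF c]
    have s: "sat (e(k := w)) (bnd k (Uni (?X \<^bold>\<longrightarrow> A))) \<longleftrightarrow>
        (\<forall>y\<le>val e t'. sat ((y ## e)(Suc k := w)) (bnd (Suc k) A))" for e :: "nat \<Rightarrow> 'a" and w
      using False by (simp add: scons_upd t'_def[symmetric] v)
    have u: "sat e (Uni (?X \<^bold>\<longrightarrow> A)) \<longleftrightarrow> (\<forall>y\<le>val e t'. sat (y ## e) A)" for e :: "nat \<Rightarrow> 'a"
      unfolding t' by simp
    have "\<exists>w. \<forall>y\<le>val e t'. sat ((y ## e)(Suc k := w)) (bnd (Suc k) A)"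
      if "\<forall>y\<le>val e t'. sat (y ## e) A" for e :: "nat \<Rightarrow> 'a"
    proof (rule collection)
      show "sat ((y ## e)(Suc k := w')) (bnd (Suc k) A)"
        if "sat ((y ## e)(Suc k := w)) (bnd (Suc k) A)" "w \<le> w'" for y w w'
        using A[THEN conjunct1, rule_format, OF that] .
      show "\<exists>w. sat ((y ## e)(Suc k := w)) (bnd (Suc k) A)" if "y \<le> val e t'" for y
        using A[THEN conjunct2, rule_format, of "y ## e"] \<open>\<forall>y\<le>val e t'. sat (y ## e) A\<close> that by blast
    qed
    note col = this
    show ?thesis
    proof (intro conjI allI impI)
      fix e :: "nat \<Rightarrow> 'a" and w w'
      assume "sat (e(k := w)) (bnd k (Uni (?X \<^bold>\<longrightarrow> A)))" "w \<le> w'"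
      then show "sat (e(k := w')) (bnd k (Uni (?X \<^bold>\<longrightarrow> A)))" unfolding s using A by blast
    next
      fix e :: "nat \<Rightarrow> 'a"
      show "sat e (Uni (?X \<^bold>\<longrightarrow> A)) \<longleftrightarrow> (\<exists>w. sat (e(k := w)) (bnd k (Uni (?X \<^bold>\<longrightarrow> A))))"
        unfolding s u using col[of e] A[THEN conjunct2, rule_format] by blast
    qed
  qed
qed

section \<open>Kripke semantics of RC1\<close>

instance spf :: countable by countable_datatype

primrec dias :: "spf \<Rightarrow> spf list" where
  "dias STop = []"
| "dias (SVar p) = []"
| "dias (SAnd \<phi> \<psi>) = dias \<phi> @ dias \<psi>"
| "dias (SDia \<phi>) = [\<phi>]"

primrec vrs :: "spf \<Rightarrow> nat set" where
  "vrs STop = {}"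
| "vrs (SVar p) = {p}"
| "vrs (SAnd \<phi> \<psi>) = vrs \<phi> \<union> vrs \<psi>"
| "vrs (SDia \<phi>) = {}"

text \<open>The transitive closure answers to the axiom \<open>four\<close>. Each single step leads
  to a smaller formula, so unravelling from a world gives a finite tree.\<close>

definition acc :: "spf \<Rightarrow> spf \<Rightarrow> bool" where
  "acc = (\<lambda>\<chi> \<xi>. \<xi> \<in> set (dias \<chi>))\<^sup>+\<^sup>+"

text \<open>Formulas are read as the worlds of the Kripke model whose accessibility relation is \<open>acc\<close>.\<close>

primrec sem :: "spf \<Rightarrow> spf \<Rightarrow> bool" where
  "sem \<chi> STop \<longleftrightarrow> True"
| "sem \<chi> (SVar p) \<longleftrightarrow> p \<in> vrs \<chi>"
| "sem \<chi> (SAnd \<phi> \<psi>) \<longleftrightarrow> sem \<chi> \<phi> \<and> sem \<chi> \<psi>"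
| "sem \<chi> (SDia \<phi>) \<longleftrightarrow> (\<exists>\<xi>. acc \<chi> \<xi> \<and> sem \<xi> \<phi>)"

lemma rc1_vrs: "p \<in> vrs \<chi> \<Longrightarrow> \<chi> \<turnstile>\<^sub>R\<^sub>C\<^sub>1 SVar p"
  by (induction \<chi>) (auto intro: rc1.intros)

lemma rc1_dias: "\<xi> \<in> set (dias \<chi>) \<Longrightarrow> \<chi> \<turnstile>\<^sub>R\<^sub>C\<^sub>1 SDia \<xi>"
  by (induction \<chi>) (auto intro: rc1.intros)

lemma rc1_acc: "acc \<chi> \<xi> \<Longrightarrow> \<chi> \<turnstile>\<^sub>R\<^sub>C\<^sub>1 SDia \<xi>"
  unfolding acc_def
proof (induction rule: tranclp_induct)
  case (base \<xi>) then show ?case by (rule rc1_dias)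
next
  case (step \<xi> \<zeta>)
  then show ?case by (meson rc1_dias rc1.nec rc1.four rc1.trans)
qed

lemma sem_rc1: "sem \<chi> \<phi> \<Longrightarrow> \<chi> \<turnstile>\<^sub>R\<^sub>C\<^sub>1 \<phi>"
proof (induction \<phi> arbitrary: \<chi>)
  case (SDia \<phi>)
  then show ?case by (auto intro: rc1.trans rc1_acc rc1.nec)
qed (auto intro: rc1.intros rc1_vrs)

text \<open>As a world, a formula matters only through its top-level variables and diamonds. This
  carries truth from a conjunct, read as a world, to the conjunction.\<close>

lemma sem_mono: "vrs \<chi> \<subseteq> vrs \<chi>' \<Longrightarrow> set (dias \<chi>) \<subseteq> set (dias \<chi>') \<Longrightarrow> sem \<chi> \<phi> \<Longrightarrow> sem \<chi>' \<phi>"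
proof (induction \<phi>)
  case (SDia \<phi>)
  then obtain \<xi> where x: "acc \<chi> \<xi>" "sem \<xi> \<phi>" by auto
  from x(1) SDia.prems(2) have "acc \<chi>' \<xi>"
    unfolding acc_def by (metis (no_types, lifting) subsetD tranclp.simps tranclpD tranclp_into_tranclp2 rtranclpD)
  then show ?case using x(2) by auto
qed auto

lemma sem_refl: "sem \<phi> \<phi>"
proof (induction \<phi>)
  case (SAnd \<phi> \<psi>)
  then show ?case using sem_mono[of \<phi> "SAnd \<phi> \<psi>" \<phi>] sem_mono[of \<psi> "SAnd \<phi> \<psi>" \<psi>] by auto
next
  case (SDia \<phi>)
  then show ?case by (auto simp: acc_def intro!: exI[of _ \<phi>])
qed auto

section \<open>The self-referential sentences\<close>

lemma size_dias: "\<psi> \<in> set (dias \<chi>) \<Longrightarrow> size \<psi> < size \<chi>"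
  by (induction \<chi>) auto

text \<open>A node is a path of worlds, its end first.\<close>

function tree :: "spf list \<Rightarrow> spf \<Rightarrow> spf list list" where
  "tree p \<chi> = (\<chi> # p) # concat (map (tree (\<chi> # p)) (dias \<chi>))"
  by pat_completeness auto
termination by (relation "measure (\<lambda>(p, \<chi>). size \<chi>)") (auto dest: size_dias)

declare tree.simps [simp del]

text \<open>Since paths have their end first, the nonempty suffixes are the nodes passed on the way
  from the root.\<close>

primrec sufs :: "'a list \<Rightarrow> 'a list list" where
  "sufs [] = []"
| "sufs (a # x) = (a # x) # sufs x"

definition conjs :: "fm list \<Rightarrow> fm" where
  "conjs As = foldr Conj As Tru"

lemma sat_conjs [simp]: "sat e (conjs As) \<longleftrightarrow> (\<forall>A\<in>set As. sat e A)"
  by (induction As) (auto simp: conjs_def)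

lemma closed_conjs [simp]: "closed_fm k (conjs As) \<longleftrightarrow> (\<forall>A\<in>set As. closed_fm k A)"
  by (induction As) (auto simp: conjs_def)

lemma Sig_conjs: "(\<And>A. A \<in> set As \<Longrightarrow> Sig A) \<Longrightarrow> Sig (conjs As)"
proof (induction As)
  case Nil
  show ?case unfolding conjs_def by (simp, intro Sig_delta0 delta0.intros)
qed (auto simp: conjs_def)

text \<open>A bounded proof predicate: index 1 bounds all witnesses for the provability of index 0.
  Having a proof up to a bound is thus decidable in HA, and it is monotone in the bound.\<close>

definition W :: fm where "W = bnd 1 (Box HaAxF (Var 0))"

lemma W: "delta0 W" "closed_fm 2 W"
  unfolding W_def using bnd_syntax[of "Box HaAxF (Var 0)" 1] closed_Box[OF closed_HaAxF, of 1 "Var 0"]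
  by (auto simp: numeral_2_eq_2)

definition wt :: "'a :: pa \<Rightarrow> 'a \<Rightarrow> bool" where "wt v w \<longleftrightarrow> sat (v ## w ## (\<lambda>_. 0)) W"

lemma sat_W [simp]: "sat (v ## w ## e) W \<longleftrightarrow> wt v w"
  unfolding wt_def by (rule sat_closed[OF W(2)]) (auto simp: less_2_cases_iff)

lemma wt_upd: "sat ((v ## e)(1 := w)) W \<longleftrightarrow> wt v w"
  unfolding wt_def by (rule sat_closed[OF W(2)]) (auto simp: less_2_cases_iff)

lemma bx_wt: "bx haax v \<longleftrightarrow> (\<exists>w. wt v w)"
proof -
  have "sat (v ## (\<lambda>_. 0)) (Box HaAxF (Var 0)) \<longleftrightarrow> (\<exists>w. sat ((v ## (\<lambda>_. 0))(1 := w)) W)"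
    unfolding W_def
    using bnd_sat[of "Box HaAxF (Var 0)" 1, where 'a = 'a] closed_Box[OF closed_HaAxF, of 1 "Var 0"] by auto
  then show ?thesis unfolding wt_upd sat_Box_HaAxF by simp
qed

lemma wt_mono: "wt v w \<Longrightarrow> w \<le> w' \<Longrightarrow> wt v (w' :: 'a :: pa)"
proof -
  have "\<forall>(e :: nat \<Rightarrow> 'a) w w'. sat (e(1 := w)) W \<longrightarrow> w \<le> w' \<longrightarrow> sat (e(1 := w')) W"
    unfolding W_def
    using bnd_sat[of "Box HaAxF (Var 0)" 1, where 'a = 'a] closed_Box[OF closed_HaAxF, of 1 "Var 0"] by auto
  then show "wt v w \<Longrightarrow> w \<le> w' \<Longrightarrow> wt v w'" using wt_upd by metis
qed

section \<open>The tree of nodes and the process on it\<close>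

locale frame =
  fixes \<phi> :: spf
begin

definition nodes :: "spf list list" where "nodes = tree [] \<phi>"
text \<open>Duplicates are removed so that the precedence among siblings is strict.\<close>

definition kids :: "spf list \<Rightarrow> spf list list" where "kids x = map (\<lambda>\<psi>. \<psi> # x) (remdups (dias (hd x)))"
definition sibs :: "spf list \<Rightarrow> spf list list" where "sibs x = (if tl x = [] then [[\<phi>]] else kids (tl x))"

lemma distinct_sibs: "distinct (sibs x)"
  by (simp add: sibs_def kids_def distinct_map inj_on_def)

lemma nodes_root: "[\<phi>] \<in> set nodes"
  unfolding nodes_def by (subst tree.simps) simp

lemma nodes_kid: "x \<in> set nodes \<Longrightarrow> y \<in> set (kids x) \<Longrightarrow> y \<in> set nodes"
proof -
  have "x \<in> set (tree p \<chi>) \<Longrightarrow> \<psi> \<in> set (dias (hd x)) \<Longrightarrow> \<psi> # x \<in> set (tree p \<chi>)" for p \<chi> \<psi>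
  proof (induction p \<chi> rule: tree.induct)
    case (1 p \<chi>)
    from 1(2) consider "x = \<chi> # p" | \<xi> where "\<xi> \<in> set (dias \<chi>)" "x \<in> set (tree (\<chi> # p) \<xi>)"
      by (auto simp: tree.simps[of p])
    then show ?case
    proof cases
      case a: 1
      then have "\<psi> # x \<in> set (tree (\<chi> # p) \<psi>)" by (subst tree.simps) simp
      then show ?thesis using a 1(3) by (subst tree.simps) auto
    next
      case (2 \<xi>)
      then show ?thesis using 1(1)[OF 2(1) 2(2) 1(3)] by (subst tree.simps) auto
    qed
  qed
  then show "x \<in> set nodes \<Longrightarrow> y \<in> set (kids x) \<Longrightarrow> y \<in> set nodes"
    by (auto simp: nodes_def kids_def)
qed

lemma nodes_cases:
  assumes "x \<in> set nodes"
  obtains "x = [\<phi>]" | y where "y \<in> set nodes" "x \<in> set (kids y)" "x = hd x # y"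
proof -
  have "x \<in> set (tree p \<chi>) \<Longrightarrow> x = \<chi> # p \<or> (\<exists>y\<in>set (tree p \<chi>). \<exists>\<psi>\<in>set (dias (hd y)). x = \<psi> # y)" for p \<chi>
  proof (induction p \<chi> rule: tree.induct)
    case (1 p \<chi>)
    from 1(2) consider "x = \<chi> # p" | \<xi> where "\<xi> \<in> set (dias \<chi>)" "x \<in> set (tree (\<chi> # p) \<xi>)"
      by (auto simp: tree.simps[of p])
    then show ?case
    proof cases
      case (2 \<xi>)
      from 1(1)[OF 2] show ?thesis
      proof
        assume "x = \<xi> # \<chi> # p"
        then show ?thesis using 2(1) by (auto simp: tree.simps[of p] intro!: bexI[of _ "\<chi> # p"])
      next
        assume "\<exists>y\<in>set (tree (\<chi> # p) \<xi>). \<exists>\<psi>\<in>set (dias (hd y)). x = \<psi> # y"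
        then show ?thesis using 2(1) by (auto simp: tree.simps[of p])
      qed
    qed simp
  qed
  from this[of "[]" \<phi>] assms show ?thesis
    using that by (fastforce simp: nodes_def kids_def)
qed

lemma nodes_nonempty: "x \<in> set nodes \<Longrightarrow> x \<noteq> []"
  by (erule nodes_cases) auto

lemma sibs_kid: "y \<in> set nodes \<Longrightarrow> x \<in> set (kids y) \<Longrightarrow> sibs x = kids y"
  using nodes_nonempty[of y] by (auto simp: sibs_def kids_def)

definition idn :: "spf list \<Rightarrow> nat" where "idn x = to_nat x"

text \<open>This pattern and the next two compute the codes of \<open>EE\<close>,
  \<open>Esen x\<close> and \<open>NS x\<close> from the two codes held in indices 0 and 1. In this
  way \<open>winF\<close> refers to sentences that are only later built from it.\<close>

definition EEp :: pat where "EEp = pExi (pConj (pEql (pVar Zero) (V 0)) (V 1))"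
definition Ep :: "spf list \<Rightarrow> pat" where
  "Ep x = pExi (pConj (pEql (pVar Zero) (At (num (code_tm (num (idn x)))))) EEp)"
definition NSp :: "spf list \<Rightarrow> pat" where
  "NSp x = pImpl (pConj (Ep x) (pImpl (foldr (\<lambda>p q. pDisj p q) (map Ep (kids x)) pFls) pFls)) pFls"

definition before :: "spf list \<Rightarrow> spf list list" where "before x = takeWhile (\<lambda>y. y \<noteq> x) (sibs x)"
definition after :: "spf list \<Rightarrow> spf list list" where "after x = tl (dropWhile (\<lambda>y. y \<noteq> x) (sibs x))"

text \<open>A Rosser comparison: at the bound \<open>w\<close>, which is index \<open>0\<close>, the negated sentence of \<open>x\<close> is the
  first one with a proof, where earlier siblings have precedence.\<close>

definition winF :: "spf list \<Rightarrow> fm" where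
  "winF x = Exi (Exi (matches 2 (NSp x) (Var 0) \<^bold>\<and> W) \<^bold>\<and>
     conjs (map (\<lambda>y. Exi (matches 2 (NSp y) (Var 0) \<^bold>\<and> Neg W)) (before x)) \<^bold>\<and>
     conjs (map (\<lambda>y. Var 0 \<^bold>= Zero \<^bold>\<or> Exi (Scc (Var 0) \<^bold>= Var 1 \<^bold>\<and> Exi (matches 3 (NSp y) (Var 0) \<^bold>\<and> Neg W))) (after x)))"

text \<open>The free indices \<open>0, 1, 2\<close> of \<open>Theta\<close> stand for the code of the numeral of the code of \<open>Psi\<close>,
  for the code of \<open>Psi\<close>, and for the number of a node.  The code of \<open>EE\<close> can be written as a pattern
  in the first two of them, which makes \<open>EE\<close> speak about itself.\<close>

definition Theta :: fm where
  "Theta = disjs (map (\<lambda>x. Var 2 \<^bold>= num (idn x) \<^bold>\<and> conjs (map winF (sufs x))) nodes)"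
definition Psi :: fm where "Psi = Exi (NumF (Var 1) (Var 0) \<^bold>\<and> Theta)"
definition EE :: fm where "EE = Exi (Var 0 \<^bold>= num \<ulcorner>Psi\<urcorner> \<^bold>\<and> Psi)"
text \<open>That the process enters \<open>x\<close>. Next, \<open>sg x\<close> says that it enters
  \<open>x\<close> but no child, that is, stops there, and \<open>NS x\<close> is the negation,
  whose proofs drive the process.\<close>

definition Esen :: "spf list \<Rightarrow> fm" where "Esen x = Exi (Var 0 \<^bold>= num (idn x) \<^bold>\<and> EE)"
definition sg :: "spf list \<Rightarrow> fm" where "sg x = (Esen x \<^bold>\<and> Neg (disjs (map Esen (kids x))))"
definition NS :: "spf list \<Rightarrow> fm" where "NS x = Neg (sg x)"

lemma closed_NSp: "closed_pat 2 (NSp x)"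
proof -
  have E: "closed_pat 2 (Ep y)" for y by (simp add: Ep_def EEp_def)
  have "closed_pat 2 (foldr (\<lambda>p q. pDisj p q) (map Ep ys) pFls)" for ys
    by (induction ys) (auto simp: E)
  then show ?thesis by (simp add: NSp_def E)
qed

lemma closed_winF: "closed_fm 3 (winF x)"
proof -
  have W': "closed_fm k W" if "2 \<le> k" for k using W(2) that by (rule closed_fm_mono)
  have m: "closed_fm 5 (matches 2 (NSp y) (Var 0))" "closed_fm 6 (matches 3 (NSp y) (Var 0))" for y
    by (rule closed_matches[OF closed_NSp]; simp)+
  show ?thesis unfolding winF_def using m W' by (simp add: numeral_nat)
qed

lemma closed_EE: "closed_fm 1 EE"
  unfolding EE_def Psi_def Theta_def using closed_winF by (auto simp: numeral_nat)

lemma closed_Esen: "closed_fm 0 (Esen x)"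
  unfolding Esen_def using closed_EE by simp

lemma closed_sg: "closed_fm 0 (sg x)"
  by (simp add: sg_def closed_Esen)

lemma Sig_winF: "Sig (winF x)"
proof -
  have "Sig (Neg W)" "Sig W" using W(1) by (auto intro: Sig_delta0 delta0.intros)
  then show ?thesis unfolding winF_def by (intro Sig_Exi Sig_Conj Sig_conjs Sig_matches) auto
qed

lemma Sig_Esen: "Sig (Esen x)"
  unfolding Esen_def EE_def Psi_def Theta_def
  by (auto intro!: Sig_Exi Sig_Conj Sig_disjs Sig_conjs Sig_NumF Sig_winF)

lemma numc_gf: "numc (gf A) = gt (num \<ulcorner>A\<urcorner>)"
  using numc_of_nat[of "\<ulcorner>A\<urcorner>"] by simp

lemma pval_Ep: "pval (gt (num \<ulcorner>Psi\<urcorner>) ## gf Psi ## e) (Ep x) = gf (Esen x)"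
  by (simp add: Ep_def EEp_def Esen_def EE_def gt_def[symmetric])

text \<open>The fixed point property: at the two codes supplied by \<open>EE\<close>, the pattern
  used in \<open>winF\<close> evaluates to the code of the sentence built from
  \<open>winF\<close>.\<close>

lemma pval_NSp: "pval (gt (num \<ulcorner>Psi\<urcorner>) ## gf Psi ## e) (NSp x) = gf (NS x)"
proof -
  have "pval (gt (num \<ulcorner>Psi\<urcorner>) ## gf Psi ## e) (foldr (\<lambda>p q. pDisj p q) (map Ep ys) pFls) = gf (disjs (map Esen ys))" for ys
    by (induction ys) (auto simp: pval_Ep disjs_def)
  then show ?thesis by (simp add: NSp_def NS_def sg_def pval_Ep)
qed

text \<open>Ties at a bound \<open>w\<close> go to the earlier sibling: earlier ones must lack a
  proof up to \<open>w\<close>, later ones up to \<open>w - 1\<close>, hence the exception for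
  \<open>w = 0\<close>.\<close>

definition win :: "'a :: pa itself \<Rightarrow> spf list \<Rightarrow> bool" where
  "win _ x \<longleftrightarrow> (\<exists>w :: 'a. wt (gf (NS x)) w \<and> (\<forall>y\<in>set (before x). \<not> wt (gf (NS y)) w) \<and>
     (\<forall>y\<in>set (after x). w = 0 \<or> (\<exists>p. p + 1 = w \<and> \<not> wt (gf (NS y)) p)))"

lemma sat_winF: "sat (gt (num \<ulcorner>Psi\<urcorner>) ## gf Psi ## (e :: nat \<Rightarrow> 'a :: pa)) (winF x) \<longleftrightarrow> win TYPE('a) x"
  unfolding winF_def win_def by (simp add: pval_NSp numeral_nat)

definition ent_node :: "'a :: pa itself \<Rightarrow> spf list \<Rightarrow> bool" where
  "ent_node t x \<longleftrightarrow> (\<forall>y\<in>set (sufs x). win t y)"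

lemma sat_Psi: "sat (s ## e) Psi \<longleftrightarrow> sat (numc s ## s ## e) Theta"
  by (simp add: Psi_def)

lemma sat_EE: "sat e EE \<longleftrightarrow> sat (gt (num \<ulcorner>Psi\<urcorner>) ## gf Psi ## e) Theta"
  by (simp add: EE_def sat_Psi numc_gf)

lemma sat_Esen: "x \<in> set nodes \<Longrightarrow> sat (e :: nat \<Rightarrow> 'a :: pa) (Esen x) \<longleftrightarrow> ent_node TYPE('a) x"
proof -
  assume x: "x \<in> set nodes"
  have "sat e (Esen x) \<longleftrightarrow> (\<exists>y\<in>set nodes. (of_nat (idn x) :: 'a) = of_nat (idn y) \<and> ent_node TYPE('a) y)"
    unfolding Esen_def Theta_def ent_node_def
    by (simp add: sat_EE Theta_def numeral_nat sat_winF)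
  then show ?thesis using x by (auto simp: idn_def)
qed

lemma ent_root: "ent_node t [\<phi>] \<longleftrightarrow> win t [\<phi>]"
  by (simp add: ent_node_def)

lemma ent_kid: "y \<in> set nodes \<Longrightarrow> x \<in> set (kids y) \<Longrightarrow> ent_node t x \<longleftrightarrow> ent_node t y \<and> win t x"
  by (auto simp: ent_node_def kids_def)

lemma ent_win: "x \<in> set nodes \<Longrightarrow> ent_node t x \<Longrightarrow> win t x"
  using ent_root ent_kid nodes_cases by metis

lemma win_bx: "win TYPE('a) x \<Longrightarrow> bx haax (gf (NS x) :: 'a :: pa)"
  unfolding win_def bx_wt by blast

lemma sibs_split: "x \<in> set (sibs y) \<Longrightarrow> sibs x = sibs y \<Longrightarrow> sibs y = before x @ x # after x"
proof -
  have "x \<in> set L \<Longrightarrow> L = takeWhile (\<lambda>y. y \<noteq> x) L @ x # tl (dropWhile (\<lambda>y. y \<noteq> x) L)" for L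
    by (induction L) auto
  then show "x \<in> set (sibs y) \<Longrightarrow> sibs x = sibs y \<Longrightarrow> sibs y = before x @ x # after x"
    unfolding before_def after_def by metis
qed

lemma win_unique:
  assumes "win TYPE('a :: pa) x" "win TYPE('a) y" "x \<in> set (sibs x)" "y \<in> set (sibs x)" "sibs y = sibs x"
  shows "x = y"
proof (rule ccontr)
  assume "x \<noteq> y"
  \<comment> \<open>Let \<open>x\<close> precede \<open>y\<close>, with winning bounds
    \<open>w\<close> and \<open>v\<close>. The sentence of \<open>x\<close> has no proof up to
    \<open>v\<close>, so \<open>v < w\<close>; that of \<open>y\<close> has none up to
    \<open>w - 1\<close>, against its proof up to \<open>v\<close>.\<close>
  have *: False if h: "x \<noteq> y" "win TYPE('a) x" "win TYPE('a) y" "x \<in> set (before y)" "y \<in> set (after x)" for x y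
  proof -
    obtain w :: 'a where w: "wt (gf (NS x)) w" "w = 0 \<or> (\<exists>p. p + 1 = w \<and> \<not> wt (gf (NS y)) p)"
      using h unfolding win_def by blast
    obtain v :: 'a where v: "wt (gf (NS y)) v" "\<not> wt (gf (NS x)) v"
      using h unfolding win_def by blast
    have "v < w" using v(2) w(1) wt_mono by (meson not_less)
    then obtain p where p: "p + 1 = w" "\<not> wt (gf (NS y)) p" using w(2) by auto
    then have "v \<le> p" using \<open>v < w\<close> pa_less_Suc by metis
    then show False using p v wt_mono by blast
  qed
  have 1: "sibs x = before x @ x # after x" "sibs x = before y @ y # after y"
    using sibs_split[of x x] sibs_split[of y x] assms by auto
  have "y \<in> set (before x) \<or> y \<in> set (after x)" using 1(1) assms(4) \<open>x \<noteq> y\<close> by auto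
  moreover have "y \<in> set (before x) \<Longrightarrow> x \<in> set (after y)"
  proof -
    assume "y \<in> set (before x)"
    then obtain as bs where "before x = as @ y # bs" by (meson split_list)
    then have "sibs x = as @ y # (bs @ x # after x)" using 1(1) by simp
    then have "as @ y # (bs @ x # after x) = before y @ y # after y" "y \<notin> set as \<union> set (bs @ x # after x)"
      using 1(2) distinct_sibs[of x] by auto
    then have "after y = bs @ x # after x"
      by (simp only: append_Cons_eq_iff Un_iff de_Morgan_disj simp_thms)
    then show ?thesis by simp
  qed
  moreover have "y \<in> set (after x) \<Longrightarrow> x \<in> set (before y)"
  proof -
    assume "y \<in> set (after x)"
    then obtain as bs where "after x = as @ y # bs" by (meson split_list)
    then have "sibs x = (before x @ x # as) @ y # bs" using 1(1) by simp
    then have "(before x @ x # as) @ y # bs = before y @ y # after y" "y \<notin> set (before x @ x # as) \<union> set bs"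
      using 1(2) distinct_sibs[of x] by auto
    then have "before y = before x @ x # as"
      by (simp only: append_Cons_eq_iff Un_iff de_Morgan_disj simp_thms)
    then show ?thesis by simp
  qed
  ultimately show False using *[of x y] *[of y x] assms \<open>x \<noteq> y\<close> by blast
qed

text \<open>Take the least bound at which some sibling has a proof, which exists by definability;
  the first sibling with a proof at that bound wins.\<close>

lemma win_exists:
  assumes "x \<in> set L" "\<And>y. y \<in> set L \<Longrightarrow> sibs y = L" "bx haax (gf (NS x) :: 'a :: pa)"
  shows "\<exists>y\<in>set L. win TYPE('a) y"
proof -
  define P where "P = (\<lambda>w :: 'a. \<exists>y\<in>set L. wt (gf (NS y)) w)"
  have "dfb P"
    by (rule dfbI[of _ "\<lambda>_. 0" "disjs (map (\<lambda>y. Exi (Var 0 \<^bold>= num \<ulcorner>NS y\<urcorner> \<^bold>\<and> W)) L)"]) (simp add: P_def)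
  moreover obtain w :: 'a where "wt (gf (NS x)) w" using assms(3) bx_wt by blast
  ultimately obtain m where m: "P m" "\<forall>k<m. \<not> P k" using dfb_least[of P w] assms(1) unfolding P_def by blast
  define D where "D = dropWhile (\<lambda>y. \<not> wt (gf (NS y)) m) L"
  have "D \<noteq> []" using m(1) unfolding D_def P_def by (auto simp: dropWhile_eq_Nil_conv)
  define y where "y = hd D"
  have y: "wt (gf (NS y)) m" using \<open>D \<noteq> []\<close> using hd_dropWhile[of "\<lambda>y. \<not> wt (gf (NS y)) m" L] unfolding y_def D_def by blast
  have L: "L = takeWhile (\<lambda>y. \<not> wt (gf (NS y)) m) L @ y # tl D"
    using \<open>D \<noteq> []\<close> unfolding y_def by (simp add: D_def)
  then have yL: "y \<in> set L" by (metis in_set_conv_decomp)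
  have b: "\<not> wt (gf (NS z)) m" if "z \<in> set (before y)" for z
  proof -
    have "before y = takeWhile (\<lambda>z. z \<noteq> y) L" unfolding before_def using assms(2)[OF yL] by simp
    also have "\<dots> = takeWhile (\<lambda>z. z \<noteq> y) (takeWhile (\<lambda>y. \<not> wt (gf (NS y)) m) L @ y # tl D)" using L by simp
    also have "\<dots> = takeWhile (\<lambda>y. \<not> wt (gf (NS y)) m) L"
      using y by (subst takeWhile_append2) (auto dest: set_takeWhileD)
    finally show ?thesis using that by (auto dest: set_takeWhileD)
  qed
  have a: "m = 0 \<or> (\<exists>p. p + 1 = m \<and> \<not> wt (gf (NS z)) p)" if "z \<in> set (after y)" for z
  proof (cases m rule: pa_cases)
    case (2 p)
    have "z \<in> set L" using that assms(2)[OF yL] unfolding after_def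
      by (metis list.sel(2) list.set_sel(2) set_dropWhileD)
    moreover have "p < m" unfolding 2 by simp
    ultimately show ?thesis using m(2) 2 unfolding P_def by blast
  qed simp
  have "win TYPE('a) y" unfolding win_def using y a b by blast
  then show ?thesis using yL by blast
qed

end

section \<open>The realization refuting an underivable sequent\<close>

lemma nd_disjsI: "A \<in> set As \<Longrightarrow> \<Gamma> \<tturnstile> A \<Longrightarrow> \<Gamma> \<tturnstile> disjs As"
  by (induction As) (auto simp: disjs_def intro: nd_disj1 nd_disj2)

lemma nd_disjsE: "\<Gamma> \<tturnstile> disjs As \<Longrightarrow> (\<And>A. A \<in> set As \<Longrightarrow> A # \<Gamma> \<tturnstile> C) \<Longrightarrow> \<Gamma> \<tturnstile> C"
proof (induction As arbitrary: \<Gamma>)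
  case Nil then show ?case by (simp add: disjs_def nd_FlsE)
next
  case (Cons A As)
  show ?case
  proof (rule nd_disjE)
    show "\<Gamma> \<tturnstile> A \<^bold>\<or> disjs As" using Cons.prems(1) by (simp add: disjs_def)
    show "A # \<Gamma> \<tturnstile> C" using Cons.prems(2) by simp
    show "disjs As # \<Gamma> \<tturnstile> C"
    proof (rule Cons.IH[OF nd_self])
      fix B assume "B \<in> set As"
      then have "B # \<Gamma> \<tturnstile> C" using Cons.prems(2) by simp
      then show "B # disjs As # \<Gamma> \<tturnstile> C" by (rule nd_weaken) auto
    qed
  qed
qed

lemma bx_gf_nd: "\<Gamma> \<tturnstile> B \<Longrightarrow> (\<And>C. C \<in> set \<Gamma> \<Longrightarrow> bx haax (gf C :: 'a :: pa)) \<Longrightarrow> bx haax (gf B :: 'a)"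
proof (induction \<Gamma> arbitrary: B)
  case Nil then show ?case by (intro bx_HA) (simp_all add: nd_Nil)
next
  case (Cons C \<Gamma>)
  have "bx haax (gf (C \<^bold>\<longrightarrow> B) :: 'a)"
  proof (rule Cons.IH)
    show "\<Gamma> \<tturnstile> C \<^bold>\<longrightarrow> B" using Cons.prems(1) by (rule nd_impI)
    show "bx haax (gf E :: 'a)" if "E \<in> set \<Gamma>" for E by (rule Cons.prems(2)) (simp add: that)
  qed
  then have "bx haax (iimp (gf C) (gf B) :: 'a)" by simp
  then show ?case by (rule bx_mp) (rule Cons.prems(2), simp)
qed

lemma bx_gf_Sig: "Sig A \<Longrightarrow> closed_fm 0 A \<Longrightarrow> sat (e :: nat \<Rightarrow> 'a :: pa) A \<Longrightarrow> bx haax (gf A :: 'a)"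
  using pv_Sig[of A e] by (simp add: ef_sentence)

lemma bx_comp:
  assumes "bx A (iimp a b)" "bx A (iimp b c)" shows "bx A (iimp a c)"
proof -
  have f: "isfm a" "isfm b" "isfm c" using bx_isfm[OF assms(1)] bx_isfm[OF assms(2)] by auto
  have k: "bx A (iimp a (iimp b c))" by (rule bx_K[OF assms(2) f(1)])
  have "logax (iimp (iimp a (iimp b c)) (iimp (iimp a b) (iimp a c)))"
    using f by (intro logax_prop[of a b c]) auto
  from bx_mp[OF bx_mp[OF bx_log[OF this] k] assms(1)] show ?thesis .
qed

locale refutation = frame +
  fixes \<eta> :: fm
  assumes std: "standard_axiomatization_HA \<eta>"
begin

definition Ap :: "nat \<Rightarrow> fm" where "Ap p = disjs (map sg (filter (\<lambda>x. p \<in> vrs (hd x)) nodes))"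
definition rp :: "nat \<Rightarrow> fm" where "rp p = (Var 0 \<^bold>= num \<ulcorner>Ap p\<urcorner>)"

lemma infinitary_rp: "infinitary_realization rp"
  by (auto simp: infinitary_realization_def rp_def intro: sigma1.intros delta0.intros)

sublocale realization rp \<eta>
  by standard (rule std, rule infinitary_rp)

text \<open>A realization consists of HA and finitely many sentences; their conjunction is
  \<open>star \<chi>\<close>. It replaces a theory by a sentence that can be decided in HA from
  \<open>sg x\<close>.\<close>

primrec star :: "spf \<Rightarrow> fm" where
  "star STop = Tru"
| "star (SVar p) = Ap p"
| "star (SAnd \<chi> \<psi>) = (star \<chi> \<^bold>\<and> star \<psi>)"
| "star (SDia \<chi>) = D \<chi>"

lemma closed_Ap: "closed_fm 0 (Ap p)"
  by (auto simp: Ap_def closed_sg)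

lemma closed_star: "closed_fm 0 (star \<chi>)"
  by (induction \<chi>) (auto simp: closed_Ap closed_D)

lemma ext_rp [simp]: "ext (rp p) x \<longleftrightarrow> x = gf (Ap p)"
  by (simp add: ext_def rp_def)

lemma star_axioms: "ext (rs \<chi>) u \<Longrightarrow> fmf 0 u \<Longrightarrow> bx haax (iimp (gf (star \<chi>)) u)"
proof (induction \<chi>)
  case STop then show ?case by (intro bx_K bx_ax isfm_gf) simp_all
next
  case (SVar p)
  then consider "u = gf (Ap p)" | "haax u" by auto
  then show ?case
  proof cases
    case 1
    have "bx haax (gf (Ap p \<^bold>\<longrightarrow> Ap p) :: 'a)" by (rule bx_HA[OF _ HA_imp_refl])
    then show ?thesis using 1 by simp
  next
    case 2 then show ?thesis using SVar by (intro bx_K bx_ax isfm_gf)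
  qed
next
  case (SAnd \<chi> \<psi>)
  have 1: "bx haax (gf (star \<chi> \<^bold>\<and> star \<psi> \<^bold>\<longrightarrow> star \<chi>) :: 'a)" "bx haax (gf (star \<chi> \<^bold>\<and> star \<psi> \<^bold>\<longrightarrow> star \<psi>) :: 'a)"
    by (rule bx_HA, assumption, rule prv.logic, rule log_ax.intros)+
  from SAnd.prems(1) consider "ext (rs \<chi>) u" | "ext (rs \<psi>) u" by auto
  then show ?case
  proof cases
    case 1 then show ?thesis using bx_comp[OF \<open>bx haax (gf (star \<chi> \<^bold>\<and> star \<psi> \<^bold>\<longrightarrow> star \<chi>))\<close>[unfolded gf_simps]] SAnd by simp
  next
    case 2 then show ?thesis using bx_comp[OF \<open>bx haax (gf (star \<chi> \<^bold>\<and> star \<psi> \<^bold>\<longrightarrow> star \<psi>))\<close>[unfolded gf_simps]] SAnd by simp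
  qed
next
  case (SDia \<chi>)
  then consider "u = gf (D \<chi>)" | "haax u" by auto
  then show ?case
  proof cases
    case 1
    have "bx haax (gf (D \<chi> \<^bold>\<longrightarrow> D \<chi>) :: 'a)" by (rule bx_HA[OF _ HA_imp_refl])
    then show ?thesis using 1 by simp
  next
    case 2 then show ?thesis using SDia by (intro bx_K bx_ax isfm_gf)
  qed
qed

lemma star_self: "bx (ext (rs \<chi>)) (gf (star \<chi>))"
proof (induction \<chi>)
  case STop show ?case by (rule bx_rs_HA) (simp add: nd_Tru flip: nd_Nil)
next
  case (SVar p) show ?case by (rule bx_ax) (simp_all add: fmf0_gf closed_Ap)
next
  case (SAnd \<chi> \<psi>)
  have 1: "bx (ext (rs (SAnd \<chi> \<psi>))) (gf (star \<chi>) :: 'a)"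
    by (rule bx_cut[OF closed_rs _ SAnd.IH(1)]) (auto intro: bx_ax)
  have 2: "bx (ext (rs (SAnd \<chi> \<psi>))) (gf (star \<psi>) :: 'a)"
    by (rule bx_cut[OF closed_rs _ SAnd.IH(2)]) (auto intro: bx_ax)
  have "bx (ext (rs (SAnd \<chi> \<psi>))) (gf (star \<chi> \<^bold>\<longrightarrow> star \<psi> \<^bold>\<longrightarrow> star \<chi> \<^bold>\<and> star \<psi>) :: 'a)"
    by (rule bx_rs_HA, rule prv.logic, rule log_ax.intros)
  from bx_mp[OF bx_mp[OF this[unfolded gf_simps] 1] 2] show ?case unfolding star.simps gf_simps .
next
  case (SDia \<chi>) show ?case by (rule bx_ax) (simp_all add: fmf0_gf closed_D)
qed

text \<open>By the deduction theorem inside the model, inconsistency of a realized formula is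
  provability of the negation of its \<open>star\<close>.\<close>

lemma star_iff: "bx (ext (rs \<chi>)) u \<longleftrightarrow> bx haax (iimp (gf (star \<chi>)) u)"
proof
  have "liftf 0 (gf (star \<chi>)) (gf (star \<chi>) :: 'a)"
    using liftf_gf[of 0 "star \<chi>"] by (simp add: lift_fm_sentence closed_star)
  then show "bx (ext (rs \<chi>)) u \<Longrightarrow> bx haax (iimp (gf (star \<chi>)) u)"
    using bx_deduction[OF closed_HaAxF isfm_gf, of "star \<chi>" "ext (rs \<chi>)" u] star_axioms
    unfolding ext_HaAxF by blast
  show "bx haax (iimp (gf (star \<chi>)) u) \<Longrightarrow> bx (ext (rs \<chi>)) u"
    by (rule bx_mp[OF bx_rs_mono star_self])
qed

lemma sat_Esens: "set ys \<subseteq> set nodes \<Longrightarrow>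
    sat (e :: nat \<Rightarrow> 'a :: pa) (disjs (map Esen ys)) \<longleftrightarrow> (\<exists>y\<in>set ys. ent_node TYPE('a) y)"
  by (simp del: sat_Esen) (meson sat_Esen subsetD)

lemma kids_nodes: "x \<in> set nodes \<Longrightarrow> set (kids x) \<subseteq> set nodes"
  using nodes_kid by auto

text \<open>A proof of \<open>NS y\<close> need not lead to \<open>y\<close> itself, since a sibling
  may win the comparison; but some child is entered.\<close>

lemma ent_kids:
  assumes "x \<in> set nodes" "y \<in> set (kids x)" "ent_node TYPE('a :: pa) x" "bx haax (gf (NS y) :: 'a)"
  shows "\<exists>z\<in>set (kids x). ent_node TYPE('a) z"
proof -
  obtain z where "z \<in> set (kids x)" "win TYPE('a) z"
    using win_exists[OF assms(2) sibs_kid[OF assms(1)] assms(4)] by blast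
  then show ?thesis using ent_kid[OF assms(1), of _ "TYPE('a)"] assms(3) by blast
qed

text \<open>Inconsistency of the realization of \<open>a\<close> yields a proof of
  \<open>NS y\<close>: if \<open>y\<close> forces \<open>star a\<close>, because the latter is
  refuted; if \<open>y\<close> forces consistency, because \<Sigma>-completeness inside the model
  proves the opposite. The second alternative lets the result propagate from child to
  parent.\<close>

lemma key_P:
  assumes x: "x \<in> set nodes" "y \<in> set (kids x)"
    and y: "HA \<^bold>\<turnstile> sg y \<^bold>\<longrightarrow> star a \<or> HA \<^bold>\<turnstile> sg y \<^bold>\<longrightarrow> Neg (Box (rs a) nbot)"
  shows "sat (e :: nat \<Rightarrow> 'a :: pa) (Esen x \<^bold>\<and> Box (rs a) nbot) \<longrightarrow> sat e (disjs (map Esen (kids x)))"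
proof
  assume "sat e (Esen x \<^bold>\<and> Box (rs a) nbot)"
  then have ent: "ent_node TYPE('a) x" and b: "sat e (Box (rs a) nbot)" by (simp_all add: sat_Esen x)
  have "bx haax (gf (NS y) :: 'a)"
    using y
  proof
    assume s: "HA \<^bold>\<turnstile> sg y \<^bold>\<longrightarrow> star a"
    have "bx haax (gf (star a \<^bold>\<longrightarrow> bot) :: 'a)"
      using b star_iff[of a "gf bot :: 'a"] by (simp add: closed_rs[simplified])
    moreover have "[star a \<^bold>\<longrightarrow> bot] \<tturnstile> NS y"
      unfolding NS_def
      by (rule nd_impI, rule nd_mp[OF nd_mp[OF nd_asm nd_mp[OF nd_thm[OF s] nd_self]] nd_Tru]) simp
    ultimately show ?thesis by - (rule bx_gf_nd, assumption, simp)
  next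
    assume s: "HA \<^bold>\<turnstile> sg y \<^bold>\<longrightarrow> Neg (Box (rs a) nbot)"
    have "bx haax (gf (Box (rs a) nbot) :: 'a)"
      by (rule bx_gf_Sig[OF Sig_Box[OF Sig_rs] closed_Box[OF closed_rs closed_num] b])
    moreover have "[Box (rs a) nbot] \<tturnstile> NS y"
      unfolding NS_def by (rule nd_impI, rule nd_mp[OF nd_mp[OF nd_thm[OF s] nd_self] nd_asm]) simp
    ultimately show ?thesis by - (rule bx_gf_nd, assumption, simp)
  qed
  from ent_kids[OF x ent this] show "sat e (disjs (map Esen (kids x)))"
    by (simp add: sat_Esens kids_nodes x del: sat_disjs)
qed

text \<open>Entering \<open>x\<close> takes a proof of \<open>NS x\<close>, and
  \<open>Esen x\<close> is provable inside the model by \<Sigma>-completeness. Together they refute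
  \<open>star a\<close>, under which no child could be entered and the process would stop at
  \<open>x\<close>.\<close>

lemma key_N:
  assumes x: "x \<in> set nodes" and a: "\<And>y. y \<in> set (kids x) \<Longrightarrow> HA \<^bold>\<turnstile> Esen y \<^bold>\<longrightarrow> Neg (star a)"
  shows "sat (e :: nat \<Rightarrow> 'a :: pa) (Esen x) \<longrightarrow> sat e (Box (rs a) nbot)"
proof
  assume e: "sat e (Esen x)"
  then have "win TYPE('a) x" using ent_win[OF x] sat_Esen[OF x] by blast
  then have 1: "bx haax (gf (NS x) :: 'a)" by (rule win_bx)
  have 2: "bx haax (gf (Esen x) :: 'a)" by (rule bx_gf_Sig[OF Sig_Esen closed_Esen e])
  have "[NS x, Esen x] \<tturnstile> star a \<^bold>\<longrightarrow> bot" (is "?G \<tturnstile> _")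
  proof (rule nd_impI, rule nd_FlsE, rule nd_mp[of _ "sg x"])
    show "star a # ?G \<tturnstile> sg x \<^bold>\<longrightarrow> Fls" by (rule nd_asm) (simp add: NS_def)
    show "star a # ?G \<tturnstile> sg x"
      unfolding sg_def
    proof (rule nd_conjI, rule nd_asm, simp, rule nd_impI, rule nd_disjsE[OF nd_self])
      fix B assume "B \<in> set (map Esen (kids x))"
      then obtain y where y: "y \<in> set (kids x)" "B = Esen y" by auto
      let ?H = "B # disjs (map Esen (kids x)) # star a # ?G"
      have "?H \<tturnstile> Neg (star a)" using nd_mp[OF nd_thm[OF a[OF y(1)]] nd_self] y(2) by simp
      then show "?H \<tturnstile> Fls" by (rule nd_mp) (rule nd_asm, simp)
    qed
  qed
  then have "bx haax (gf (star a \<^bold>\<longrightarrow> bot) :: 'a)" by (rule bx_gf_nd) (use 1 2 in auto)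
  then show "sat e (Box (rs a) nbot)"
    using star_iff[of a "gf bot :: 'a"] by (simp add: closed_rs[simplified])
qed

text \<open>At most one node is entered on each level: the parents agree by induction, and among
  siblings the winner is unique.\<close>

lemma ent_same_length:
  "x \<in> set nodes \<Longrightarrow> y \<in> set nodes \<Longrightarrow> ent_node TYPE('a :: pa) x \<Longrightarrow> ent_node TYPE('a) y \<Longrightarrow>
    length x = length y \<Longrightarrow> x = y"
proof (induction x arbitrary: y)
  case Nil then show ?case by simp
next
  case (Cons c x)
  show ?case
  proof (rule nodes_cases[OF Cons.prems(1)])
    assume "c # x = [\<phi>]"
    then have "length y = 1" using Cons.prems(5) by simp
    then have "y = [\<phi>]" using Cons.prems(2) nodes_nonempty
      by (elim nodes_cases[of y]) (auto simp: kids_def)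
    then show ?thesis using \<open>c # x = [\<phi>]\<close> by simp
  next
    fix x' assume x': "x' \<in> set nodes" "c # x \<in> set (kids x')" "c # x = hd (c # x) # x'"
    then have [simp]: "x' = x" by simp
    show ?thesis
    proof (rule nodes_cases[OF Cons.prems(2)])
      assume "y = [\<phi>]"
      then have "x = []" using Cons.prems(5) by simp
      then show ?thesis using x'(1) nodes_nonempty by auto
    next
      fix y' assume y': "y' \<in> set nodes" "y \<in> set (kids y')" "y = hd y # y'"
      have "ent_node TYPE('a) x" "win TYPE('a) (c # x)" "ent_node TYPE('a) y'" "win TYPE('a) y"
        using ent_kid[OF x'(1,2), of "TYPE('a)"] ent_kid[OF y'(1,2), of "TYPE('a)"] Cons.prems by simp_all
      moreover have "length x = length y'" using Cons.prems(5) y'(3) by (metis Suc_inject length_Cons)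
      ultimately have "x = y'" using Cons.IH[of y'] x'(1) y'(1) by simp
      moreover have "sibs (c # x) = kids x'" "sibs y = kids y'"
        by (rule sibs_kid[OF x'(1,2)], rule sibs_kid[OF y'(1,2)])
      ultimately show ?thesis
        using win_unique[OF \<open>win TYPE('a) (c # x)\<close> \<open>win TYPE('a) y\<close>] x'(2) y'(2) by simp
    qed
  qed
qed

lemma ent_prefix:
  "y \<in> set nodes \<Longrightarrow> ent_node TYPE('a :: pa) y \<Longrightarrow> 1 \<le> n \<Longrightarrow> n < length y \<Longrightarrow>
    \<exists>z\<in>set nodes. ent_node TYPE('a) z \<and> length z = n \<and> (\<exists>c\<in>set (kids z). ent_node TYPE('a) c)"
proof (induction y)
  case (Cons c y)
  show ?case
  proof (rule nodes_cases[OF Cons.prems(1)])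
    assume "c # y = [\<phi>]" then show ?thesis using Cons.prems by simp
  next
    fix y' assume y': "y' \<in> set nodes" "c # y \<in> set (kids y')" "c # y = hd (c # y) # y'"
    then have "ent_node TYPE('a) y" using ent_kid[OF y'(1,2), of "TYPE('a)"] Cons.prems by simp
    show ?thesis
    proof (cases "n = length y")
      case True
      then show ?thesis using y' \<open>ent_node TYPE('a) y\<close> Cons.prems(2) by auto
    next
      case False
      then show ?thesis using Cons.IH y' \<open>ent_node TYPE('a) y\<close> Cons.prems by simp
    qed
  qed
qed simp

text \<open>The longer path has an entered prefix of the length of \<open>x\<close>, which must be
  \<open>x\<close>; the next node on that path is an entered child.\<close>

lemma ent_shorter:
  assumes "x \<in> set nodes" "y \<in> set nodes" "ent_node TYPE('a :: pa) x" "ent_node TYPE('a) y"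
    "length x < length y"
  shows "\<exists>z\<in>set (kids x). ent_node TYPE('a) z"
proof -
  have "1 \<le> length x" using nodes_nonempty[OF assms(1)] by (cases x) auto
  from ent_prefix[OF assms(2,4) this assms(5)] ent_same_length[OF assms(1) _ assms(3)] show ?thesis by metis
qed

text \<open>Expresses without negations that the process cannot stop at two nodes, so that both
  sides are \<Sigma>-formulas.\<close>

lemma key_D:
  assumes "x \<in> set nodes" "y \<in> set nodes" "x \<noteq> y"
  shows "sat (e :: nat \<Rightarrow> 'a :: pa) (Esen x \<^bold>\<and> Esen y) \<longrightarrow>
    sat e (disjs (map Esen (kids x)) \<^bold>\<or> disjs (map Esen (kids y)))"
proof
  assume "sat e (Esen x \<^bold>\<and> Esen y)"
  then have e: "ent_node TYPE('a) x" "ent_node TYPE('a) y" using assms by (simp_all add: sat_Esen)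
  then have "length x \<noteq> length y" using ent_same_length[OF assms(1,2)] assms(3) by blast
  then have "(\<exists>z\<in>set (kids x). ent_node TYPE('a) z) \<or> (\<exists>z\<in>set (kids y). ent_node TYPE('a) z)"
    using ent_shorter[OF assms(1,2) e] ent_shorter[OF assms(2,1) e(2,1)] by (meson linorder_neqE_nat)
  then show "sat e (disjs (map Esen (kids x)) \<^bold>\<or> disjs (map Esen (kids y)))"
    by (simp add: sat_Esens kids_nodes assms del: sat_disjs)
qed

end

section \<open>Transfer from models to HA\<close>

text \<open>All implications to be transferred from models to HA are collected in one predicate, because
  the model below is a type and so cannot depend on the implication to be refuted.\<close>

inductive needed :: "fm \<Rightarrow> fm \<Rightarrow> bool" where
  sound: "realization r \<eta> \<Longrightarrow> realization.sound_step r \<eta> \<phi> \<psi> \<Longrightarrow>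
    needed (IsSent (Var 0) \<^bold>\<and> Box (realS r \<eta> \<psi>) (Var 0)) (Box (realS r \<eta> \<phi>) (Var 0))"
| four: "realization r \<eta> \<Longrightarrow> needed (Box (realS r \<eta> \<chi>) nbot) (Box (realS r \<eta> (SDia \<chi>)) nbot)"
| key_P: "refutation \<eta> \<Longrightarrow> x \<in> set (frame.nodes \<phi>) \<Longrightarrow> y \<in> set (frame.kids x) \<Longrightarrow>
    HA \<^bold>\<turnstile> frame.sg \<phi> y \<^bold>\<longrightarrow> refutation.star \<phi> \<eta> a \<or>
      HA \<^bold>\<turnstile> frame.sg \<phi> y \<^bold>\<longrightarrow> Neg (Box (realS (refutation.rp \<phi>) \<eta> a) nbot) \<Longrightarrow>
    needed (frame.Esen \<phi> x \<^bold>\<and> Box (realS (refutation.rp \<phi>) \<eta> a) nbot) (disjs (map (frame.Esen \<phi>) (frame.kids x)))"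
| key_N: "refutation \<eta> \<Longrightarrow> x \<in> set (frame.nodes \<phi>) \<Longrightarrow>
    (\<And>y. y \<in> set (frame.kids x) \<Longrightarrow> HA \<^bold>\<turnstile> frame.Esen \<phi> y \<^bold>\<longrightarrow> Neg (refutation.star \<phi> \<eta> a)) \<Longrightarrow>
    needed (frame.Esen \<phi> x) (Box (realS (refutation.rp \<phi>) \<eta> a) nbot)"
| key_D: "x \<in> set (frame.nodes \<phi>) \<Longrightarrow> y \<in> set (frame.nodes \<phi>) \<Longrightarrow> x \<noteq> y \<Longrightarrow> refutation \<eta> \<Longrightarrow>
    needed (frame.Esen \<phi> x \<^bold>\<and> frame.Esen \<phi> y)
      (disjs (map (frame.Esen \<phi>) (frame.kids x)) \<^bold>\<or> disjs (map (frame.Esen \<phi>) (frame.kids y)))"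

lemma needed_Sig: "needed A B \<Longrightarrow> Sig A \<and> Sig B"
proof (induction rule: needed.induct)
  case (sound r \<eta> \<phi> \<psi>)
  then show ?case using realization.Sig_rs by (intro conjI Sig_Conj Sig_Box Sig_IsSent) blast+
next
  case (four r \<eta> \<chi>)
  then show ?case using realization.Sig_rs by (intro conjI Sig_Box) blast+
next
  case (key_P \<eta> x \<phi> y a)
  interpret refutation \<phi> \<eta> by (rule key_P)
  show ?case by (intro conjI Sig_Conj Sig_Box Sig_disjs Sig_rs) (auto simp: Sig_Esen)
next
  case (key_N \<eta> x \<phi> a)
  interpret refutation \<phi> \<eta> by (rule key_N)
  show ?case by (intro conjI Sig_Box Sig_rs Sig_Esen)
next
  case (key_D x \<phi> y \<eta>)
  interpret refutation \<phi> \<eta> by (rule key_D)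
  show ?case by (intro conjI Sig_Conj Sig_Disj Sig_disjs) (auto simp: Sig_Esen)
qed

lemma needed_sat: "needed A B \<Longrightarrow> sat (e :: nat \<Rightarrow> 'a :: pa) A \<Longrightarrow> sat e B"
proof (induction rule: needed.induct)
  case (sound r \<eta> \<phi> \<psi>)
  interpret realization r \<eta> by (rule sound)
  show ?case using sound_step_bx[OF sound(2), of "e 0"] sound(3) by (simp add: closed_rs[simplified])
next
  case (four r \<eta> \<chi>)
  interpret realization r \<eta> by (rule four)
  show ?case using bx_four_key[of \<chi>, where 'a = 'a] four(2) by (simp add: closed_rs[simplified])
next
  case (key_P \<eta> x \<phi> y a)
  note h = key_P
  interpret refutation \<phi> \<eta> by (rule h)
  show ?case by (rule HOL.mp[OF key_P]) (use h in auto)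
next
  case (key_N \<eta> x \<phi> a)
  note h = key_N
  interpret refutation \<phi> \<eta> by (rule h)
  show ?case by (rule HOL.mp[OF key_N]) (use h in auto)
next
  case (key_D x \<phi> y \<eta>)
  note h = key_D
  interpret refutation \<phi> \<eta> by (rule h)
  show ?case by (rule HOL.mp[OF key_D]) (use h in auto)
qed

section \<open>The term model of a possible counterexample\<close>

lemma henkin_log_ax:
  assumes "henkin \<Delta>" "log_ax A" shows "A \<in> \<Delta>"
  using assms(2,1) by (induction rule: log_ax.induct) (auto simp: henkin_def)

text \<open>All substitution instances are carried along because a Henkin set reads
  \<open>Uni\<close> through its instances.\<close>

lemma henkin_HA:
  assumes h: "henkin \<Delta>" shows "HA \<^bold>\<turnstile> A \<Longrightarrow> fsubst \<sigma> A \<in> \<Delta>"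
proof (induction arbitrary: \<sigma> rule: prv.induct)
  case (logic A) then show ?case using henkin_log_ax[OF h] log_ax_fsubst by blast
next
  case (axiom A)
  then show ?case using h by (auto simp: fsubst_sentence HA_closed henkin_def)
next
  case (mp A B) then show ?case using h by (auto simp: henkin_def)
next
  case (gen A) then show ?case using h by (auto simp: henkin_def sub_fm_fsubst_up)
qed

text \<open>A counterexample to the transfer, if there is one, is chosen before the model type is
  defined. The argument by contradiction in \<open>needed_HA\<close> then turns to this
  pair.\<close>

definition gpair :: "fm \<times> fm" where
  "gpair = (SOME p. needed (fst p) (snd p) \<and> \<not> HA \<^bold>\<turnstile> fst p \<^bold>\<longrightarrow> snd p)"

definition gset :: "fm set" where
  "gset = (SOME \<Delta>. henkin \<Delta> \<and> ((\<exists>A B. needed A B \<and> \<not> HA \<^bold>\<turnstile> A \<^bold>\<longrightarrow> B) \<longrightarrow> fst gpair \<in> \<Delta> \<and> snd gpair \<notin> \<Delta>))"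

lemma gpair: "needed A B \<Longrightarrow> \<not> HA \<^bold>\<turnstile> A \<^bold>\<longrightarrow> B \<Longrightarrow>
    needed (fst gpair) (snd gpair) \<and> \<not> HA \<^bold>\<turnstile> fst gpair \<^bold>\<longrightarrow> snd gpair"
  unfolding gpair_def by (rule someI[of _ "(A, B)"]) simp

lemma gset: "henkin gset \<and>
    ((\<exists>A B. needed A B \<and> \<not> HA \<^bold>\<turnstile> A \<^bold>\<longrightarrow> B) \<longrightarrow> fst gpair \<in> gset \<and> snd gpair \<notin> gset)"
  unfolding gset_def
proof (rule someI_ex)
  show "\<exists>\<Delta>. henkin \<Delta> \<and> ((\<exists>A B. needed A B \<and> \<not> HA \<^bold>\<turnstile> A \<^bold>\<longrightarrow> B) \<longrightarrow> fst gpair \<in> \<Delta> \<and> snd gpair \<notin> \<Delta>)"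
  proof (cases "\<exists>A B. needed A B \<and> \<not> HA \<^bold>\<turnstile> A \<^bold>\<longrightarrow> B")
    case True
    then have g: "needed (fst gpair) (snd gpair)" "\<not> HA \<^bold>\<turnstile> fst gpair \<^bold>\<longrightarrow> snd gpair"
      using gpair by blast+
    then have "Sig (fst gpair)" "Sig (snd gpair)" using needed_Sig by blast+
    from henkin_exists[OF this g(2)] show ?thesis by blast
  next
    case False
    \<comment> \<open>Without a counterexample any Henkin set will do; the type has to be defined in
      either case.\<close>
    have "\<not> HA \<^bold>\<turnstile> Tru \<^bold>\<longrightarrow> Fls" using HA_sound[of "Tru \<^bold>\<longrightarrow> Fls" "\<lambda>_. 0 :: nat"] by auto
    moreover have "Sig Fls" "Sig Tru" by (auto intro: Sig_delta0 delta0.intros)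
    ultimately show ?thesis using henkin_exists[of Tru Fls] False by blast
  qed
qed

lemma gset_conn [simp]:
  shows "Fls \<notin> gset"
    and "(A \<^bold>\<and> B) \<in> gset \<longleftrightarrow> A \<in> gset \<and> B \<in> gset"
    and "(A \<^bold>\<or> B) \<in> gset \<longleftrightarrow> A \<in> gset \<or> B \<in> gset"
    and "(A \<^bold>\<longrightarrow> B) \<in> gset \<longleftrightarrow> (A \<in> gset \<longrightarrow> B \<in> gset)"
    and "Uni A \<in> gset \<longleftrightarrow> (\<forall>t. sub_fm 0 t A \<in> gset)"
    and "Exi A \<in> gset \<longleftrightarrow> (\<exists>t. sub_fm 0 t A \<in> gset)"
    and "(t \<^bold>= t) \<in> gset"
  using gset[THEN conjunct1] by (simp_all only: henkin_def not_False_eq_True simp_thms)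

lemma gset_subst: "(s \<^bold>= t) \<in> gset \<Longrightarrow> sub_fm 0 s A \<in> gset \<Longrightarrow> sub_fm 0 t A \<in> gset"
  using gset unfolding henkin_def by blast

lemma gset_sym: "(s \<^bold>= t) \<in> gset \<Longrightarrow> (t \<^bold>= s) \<in> gset"
  using gset_subst[of s t "Var 0 \<^bold>= lift_tm 0 s"] by simp

lemma gset_trans: "(s \<^bold>= t) \<in> gset \<Longrightarrow> (t \<^bold>= u) \<in> gset \<Longrightarrow> (s \<^bold>= u) \<in> gset"
  using gset_subst[of t u "lift_tm 0 s \<^bold>= Var 0"] by simp

lemma gset_Add: "(s \<^bold>= t) \<in> gset \<Longrightarrow> (u \<^bold>= v) \<in> gset \<Longrightarrow> (Add s u \<^bold>= Add t v) \<in> gset"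
  using gset_subst[of s t "Add (lift_tm 0 s) (lift_tm 0 u) \<^bold>= Add (Var 0) (lift_tm 0 u)"]
    gset_subst[of u v "Add (lift_tm 0 s) (lift_tm 0 u) \<^bold>= Add (lift_tm 0 t) (Var 0)"] by simp

lemma gset_Mul: "(s \<^bold>= t) \<in> gset \<Longrightarrow> (u \<^bold>= v) \<in> gset \<Longrightarrow> (Mul s u \<^bold>= Mul t v) \<in> gset"
  using gset_subst[of s t "Mul (lift_tm 0 s) (lift_tm 0 u) \<^bold>= Mul (Var 0) (lift_tm 0 u)"]
    gset_subst[of u v "Mul (lift_tm 0 s) (lift_tm 0 u) \<^bold>= Mul (lift_tm 0 t) (Var 0)"] by simp

text \<open>Models read \<open>Scc\<close> as adding 1, for which the language has no symbol; the
  class of \<open>Scc Zero\<close> plays its part.\<close>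

lemma gset_Scc: "(Add t (Scc Zero) \<^bold>= Scc t) \<in> gset"
proof -
  have "[] \<tturnstile> Add t (Scc Zero) \<^bold>= Scc t"
    by (rule nd_trans[OF nd_Add_Scc nd_Scc_cong[OF nd_Add_Zero]])
  then show ?thesis using henkin_HA[of gset _ Var] gset by (simp add: nd_Nil)
qed

quotient_type gm = tm / "\<lambda>s t. (s \<^bold>= t) \<in> gset"
  by (intro equivpI reflpI sympI transpI) (auto intro: gset_sym gset_trans)

instantiation gm :: pa_ops
begin

definition zero_gm :: gm where "zero_gm = abs_gm Zero"
definition one_gm :: gm where "one_gm = abs_gm (Scc Zero)"
definition plus_gm :: "gm \<Rightarrow> gm \<Rightarrow> gm" where "plus_gm x y = abs_gm (Add (rep_gm x) (rep_gm y))"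
definition times_gm :: "gm \<Rightarrow> gm \<Rightarrow> gm" where "times_gm x y = abs_gm (Mul (rep_gm x) (rep_gm y))"
definition less_gm :: "gm \<Rightarrow> gm \<Rightarrow> bool" where "less_gm x y \<longleftrightarrow> (\<exists>z. z + x + 1 = y)"
definition less_eq_gm :: "gm \<Rightarrow> gm \<Rightarrow> bool" where "less_eq_gm x y \<longleftrightarrow> (\<exists>z. z + x = y)"
definition minus_gm :: "gm \<Rightarrow> gm \<Rightarrow> gm" where "minus_gm x y = (if y \<le> x then THE z. z + y = x else 0)"

instance ..

end

lemma abs_gm_eq: "abs_gm s = abs_gm t \<longleftrightarrow> (s \<^bold>= t) \<in> gset"
  using Quotient3_rel[OF Quotient3_gm, of s t] by simp

lemma rep_abs_gm: "(rep_gm (abs_gm s) \<^bold>= s) \<in> gset"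
  using abs_gm_eq Quotient3_abs_rep[OF Quotient3_gm] by blast

lemma abs_gm_ops: "abs_gm s + abs_gm t = abs_gm (Add s t)" "abs_gm s * abs_gm t = abs_gm (Mul s t)"
  unfolding plus_gm_def times_gm_def abs_gm_eq by (intro gset_Add gset_Mul rep_abs_gm)+

lemma val_gm: "val (\<lambda>i. abs_gm (\<sigma> i)) t = abs_gm (tsubst \<sigma> t)"
proof (induction t)
  case (Scc t)
  have "abs_gm (tsubst \<sigma> t) + 1 = abs_gm (Scc (tsubst \<sigma> t))"
    by (simp add: one_gm_def abs_gm_ops abs_gm_eq gset_Scc)
  then show ?case using Scc by simp
qed (simp_all add: zero_gm_def abs_gm_ops)

text \<open>The truth lemma of the Henkin construction. Quantifiers over the quotient become
  quantifiers over representing terms, which \<open>gset\<close> handles as a Henkin set.\<close>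

lemma sat_gm: "sat (\<lambda>i. abs_gm (\<sigma> i)) A \<longleftrightarrow> fsubst \<sigma> A \<in> gset"
proof (induction A arbitrary: \<sigma>)
  have *: "abs_gm t ## (\<lambda>i. abs_gm (\<sigma> i)) = (\<lambda>i. abs_gm (case_nat t \<sigma> i))" for t \<sigma>
    by (rule ext) (simp add: scons_def split: nat.split)
  have all: "(\<forall>x. P x) \<longleftrightarrow> (\<forall>t. P (abs_gm t))" and ex: "(\<exists>x. P x) \<longleftrightarrow> (\<exists>t. P (abs_gm t))" for P
    by (metis Quotient3_abs_rep Quotient3_gm)+
  { case (Eql s t) then show ?case by (simp add: val_gm abs_gm_eq) }
  { case (Uni A) then show ?case by (simp add: all * sub_fm_fsubst_up) }
  { case (Exi A) then show ?case by (simp add: ex * sub_fm_fsubst_up) }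
qed auto

lemma sat_gm_HA: "HA \<^bold>\<turnstile> A \<Longrightarrow> sat (e :: nat \<Rightarrow> gm) A"
proof -
  have e: "e = (\<lambda>i. abs_gm (rep_gm (e i)))"
    by (rule ext) (metis Quotient3_abs_rep Quotient3_gm)
  show "HA \<^bold>\<turnstile> A \<Longrightarrow> ?thesis"
    by (subst e) (use henkin_HA gset in \<open>simp add: sat_gm\<close>)
qed

instance gm :: pa
proof
  fix x y :: gm and e :: "nat \<Rightarrow> gm" and A
  have ax: "A \<in> set basic_axioms \<Longrightarrow> sat (\<lambda>_. 0 :: gm) A" for A
    by (intro sat_gm_HA prv.axiom) (simp add: HA_def)
  note ax = ax[unfolded basic_axioms_def, simplified]
  show "x + 1 \<noteq> 0" using ax[of "Uni (Neg (Scc (Var 0) \<^bold>= Zero))"] by simp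
  show "x + 1 = y + 1 \<Longrightarrow> x = y"
    using ax[of "Uni (Uni (Scc (Var 1) \<^bold>= Scc (Var 0) \<^bold>\<longrightarrow> Var 1 \<^bold>= Var 0))"] by simp
  show "x + 0 = x" using ax[of "Uni (Add (Var 0) Zero \<^bold>= Var 0)"] by simp
  show "x + (y + 1) = x + y + 1"
    using ax[of "Uni (Uni (Add (Var 1) (Scc (Var 0)) \<^bold>= Scc (Add (Var 1) (Var 0))))"] by simp
  show "x * 0 = 0" using ax[of "Uni (Mul (Var 0) Zero \<^bold>= Zero)"] by simp
  show "x * (y + 1) = x * y + x"
    using ax[of "Uni (Uni (Mul (Var 1) (Scc (Var 0)) \<^bold>= Add (Mul (Var 1) (Var 0)) (Var 1)))"] by simp
  have "val (\<lambda>i. abs_gm (Var i)) (Scc Zero) = 1" unfolding val_gm by (simp add: one_gm_def)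
  then show "0 + 1 = (1 :: gm)" by simp
  show "(x < y) = (\<exists>z. z + x + 1 = y)" by (rule less_gm_def)
  show "(x \<le> y) = (\<exists>z. z + x = y)" by (rule less_eq_gm_def)
  show "x - y = (if y \<le> x then THE z. z + y = x else 0)" by (rule minus_gm_def)
  assume "sat (0 ## e) A" "\<And>x. sat (x ## e) A \<Longrightarrow> sat ((x + 1) ## e) A"
  \<comment> \<open>Each value of the environment is represented by a term, so the open instances of
    induction hold with arbitrary parameters.\<close>
  moreover have "sat e (ind_ax A)" by (rule sat_gm_HA[OF HA_ind_ax])
  ultimately show "sat (x ## e) A" by (simp add: ind_ax_def)
qed

theorem needed_HA: "needed A B \<Longrightarrow> HA \<^bold>\<turnstile> A \<^bold>\<longrightarrow> B"
proof (rule ccontr)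
  assume "needed A B" "\<not> HA \<^bold>\<turnstile> A \<^bold>\<longrightarrow> B"
  then have g: "needed (fst gpair) (snd gpair)" "fst gpair \<in> gset" "snd gpair \<notin> gset"
    using gpair gset by blast+
  show False
    using needed_sat[OF g(1), of "\<lambda>i. abs_gm (Var i)"] g(2,3) unfolding sat_gm fsubst_Var by blast
qed

section \<open>Soundness and completeness\<close>

context realization
begin

lemma holds_sound_step: "sound_step \<phi> \<psi> \<Longrightarrow> holds \<phi> \<psi>"
  unfolding holds_iff by (rule needed_HA[OF needed.sound[OF realization_axioms]])

lemma holds_rc1: "\<phi> \<turnstile>\<^sub>R\<^sub>C\<^sub>1 \<psi> \<Longrightarrow> holds \<phi> \<psi>"
proof (induction rule: rc1.induct)
  case (refl \<phi>) show ?case unfolding holds_iff by (rule prv.logic, rule log_ax.intros)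
next
  case (trans \<phi> \<psi> \<chi>) then show ?case by (blast intro: holds_trans)
next
  case (four \<phi>)
  \<comment> \<open>Two transfers in a row: first the implication between inconsistency statements,
    then the inclusion that is obtained with its help.\<close>
  show ?case by (intro holds_sound_step sound_step.intros needed_HA needed.four realization_axioms)
qed (blast intro: holds_sound_step sound_step.intros)+

end

section \<open>Completeness\<close>

context refutation
begin

definition kid :: "spf list \<Rightarrow> spf list \<Rightarrow> bool" where "kid x y \<longleftrightarrow> y \<in> set (kids x)"

lemma kid_nodes: "kid\<^sup>*\<^sup>* x y \<Longrightarrow> x \<in> set nodes \<Longrightarrow> y \<in> set nodes"
  by (induction rule: rtranclp_induct) (auto simp: kid_def intro: nodes_kid)

lemma kid_acc: "kid\<^sup>+\<^sup>+ x y \<Longrightarrow> acc (hd x) (hd y)"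
proof (induction rule: tranclp_induct)
  case (base y) then show ?case by (auto simp: kid_def kids_def acc_def)
next
  case (step y z)
  then have "hd z \<in> set (dias (hd y))" by (auto simp: kid_def kids_def)
  then show ?case using step.IH unfolding acc_def by (rule tranclp.trancl_into_trancl[rotated])
qed

lemma acc_kid: "acc (hd x) \<xi> \<Longrightarrow> \<exists>y. kid\<^sup>+\<^sup>+ x y \<and> hd y = \<xi>"
  unfolding acc_def
proof (induction rule: tranclp_induct)
  case (base \<xi>)
  then have "kid x (\<xi> # x)" by (simp add: kid_def kids_def)
  then show ?case by force
next
  case (step \<xi> \<zeta>)
  then obtain y where y: "kid\<^sup>+\<^sup>+ x y" "hd y = \<xi>" by blast
  then have "kid y (\<zeta> # y)" using step(2) by (simp add: kid_def kids_def)
  then have "kid\<^sup>+\<^sup>+ x (\<zeta> # y)" by (rule tranclp.trancl_into_trancl[OF y(1)])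
  then show ?case by force
qed

lemma sg_kid:
  assumes "x \<in> set nodes" "kid x y"
    "HA \<^bold>\<turnstile> sg y \<^bold>\<longrightarrow> star a \<or> HA \<^bold>\<turnstile> sg y \<^bold>\<longrightarrow> Neg (Box (rs a) nbot)"
  shows "HA \<^bold>\<turnstile> sg x \<^bold>\<longrightarrow> Neg (Box (rs a) nbot)"
proof -
  have h: "HA \<^bold>\<turnstile> Esen x \<^bold>\<and> Box (rs a) nbot \<^bold>\<longrightarrow> disjs (map Esen (kids x))"
    by (rule needed_HA[OF needed.key_P[OF refutation_axioms assms(1) assms(2)[unfolded kid_def] assms(3)]])
  have s: "[Box (rs a) nbot, sg x] \<tturnstile> sg x" by (rule nd_asm) simp
  have "[Box (rs a) nbot, sg x] \<tturnstile> Fls"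
    by (rule nd_mp[OF nd_conj2[OF s[unfolded sg_def], folded sg_def]
          nd_mp[OF nd_thm[OF h] nd_conjI[OF nd_conj1[OF s[unfolded sg_def], folded sg_def] nd_self]]])
  then show ?thesis by (simp add: nd_Cons nd_Nil)
qed

text \<open>The parent of \<open>y\<close> is handled through \<open>star a\<close>, every node
  further up through the consistency statement already proved for its child.\<close>

lemma sg_descendant:
  assumes "kid\<^sup>+\<^sup>+ x y" "x \<in> set nodes" "HA \<^bold>\<turnstile> sg y \<^bold>\<longrightarrow> star a"
  shows "HA \<^bold>\<turnstile> sg x \<^bold>\<longrightarrow> Neg (Box (rs a) nbot)"
  using assms
proof (induction rule: converse_tranclp_induct)
  case (base x) then show ?case using sg_kid by blast
next
  case (step x z)
  then have "z \<in> set nodes" using nodes_kid by (auto simp: kid_def)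
  then show ?case using step sg_kid by blast
qed

text \<open>Replaces the case distinction over where the process stops. As the conclusion is
  negative, it is enough that \<open>A\<close> excludes the entry of every child; then the process
  stops at \<open>x\<close>, which is excluded as well.\<close>

lemma Esen_Neg:
  assumes "\<And>y. kid\<^sup>*\<^sup>* x y \<Longrightarrow> HA \<^bold>\<turnstile> sg y \<^bold>\<longrightarrow> Neg A"
  shows "HA \<^bold>\<turnstile> Esen x \<^bold>\<longrightarrow> Neg A"
  using assms
proof (induction "size (hd x)" arbitrary: x rule: less_induct)
  case less
  have IH: "HA \<^bold>\<turnstile> Esen y \<^bold>\<longrightarrow> Neg A" if "y \<in> set (kids x)" for y
  proof (rule less.hyps)
    show "size (hd y) < size (hd x)" using that by (auto simp: kids_def size_dias)
    fix z assume "kid\<^sup>*\<^sup>* y z"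
    then have "kid\<^sup>*\<^sup>* x z" using that by (auto simp: kid_def intro: converse_rtranclp_into_rtranclp)
    then show "HA \<^bold>\<turnstile> sg z \<^bold>\<longrightarrow> Neg A" by (rule less.prems)
  qed
  have "[A, Esen x] \<tturnstile> sg x"
    unfolding sg_def
  proof (rule nd_conjI, rule nd_asm, simp, rule nd_impI, rule nd_disjsE[OF nd_self])
    fix B assume "B \<in> set (map Esen (kids x))"
    then obtain y where y: "y \<in> set (kids x)" "B = Esen y" by auto
    let ?H = "B # disjs (map Esen (kids x)) # [A, Esen x]"
    have "?H \<tturnstile> Neg A" using nd_mp[OF nd_thm[OF IH[OF y(1)]] nd_self] y(2) by simp
    then show "?H \<tturnstile> Fls" by (rule nd_mp) (rule nd_asm, simp)
  qed
  from nd_mp[OF nd_mp[OF nd_thm[OF less.prems[OF rtranclp.rtrancl_refl]] this] nd_self]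
  show ?case by (simp add: nd_Cons nd_Nil)
qed

lemma sg_exclusive:
  assumes "x \<in> set nodes" "y \<in> set nodes" "x \<noteq> y" shows "[sg y, sg x] \<tturnstile> Fls"
proof -
  have h: "HA \<^bold>\<turnstile> Esen x \<^bold>\<and> Esen y \<^bold>\<longrightarrow> disjs (map Esen (kids x)) \<^bold>\<or> disjs (map Esen (kids y))"
    by (rule needed_HA[OF needed.key_D[OF assms refutation_axioms]])
  have s: "\<Gamma> \<tturnstile> Esen z" "\<Gamma> \<tturnstile> Neg (disjs (map Esen (kids z)))" if "sg z \<in> set \<Gamma>" for z \<Gamma>
    using nd_asm[OF that] unfolding sg_def by (rule nd_conj1, rule nd_conj2)
  show ?thesis
  proof (rule nd_disjE)
    show "[sg y, sg x] \<tturnstile> disjs (map Esen (kids x)) \<^bold>\<or> disjs (map Esen (kids y))"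
      by (rule nd_mp[OF nd_thm[OF h] nd_conjI[OF s(1) s(1)]]) simp_all
    show "[disjs (map Esen (kids x)), sg y, sg x] \<tturnstile> Fls"
      by (rule nd_mp[OF s(2) nd_self]) simp
    show "[disjs (map Esen (kids y)), sg y, sg x] \<tturnstile> Fls"
      by (rule nd_mp[OF s(2) nd_self]) simp
  qed
qed

text \<open>The counterpart of Solovay's truth lemma. For \<open>SDia\<close> a descendant that
  satisfies the formula gives consistency; if there is none, entering the node already proves
  inconsistency.\<close>

lemma sg_star: "x \<in> set nodes \<Longrightarrow>
    (sem (hd x) \<chi> \<longrightarrow> HA \<^bold>\<turnstile> sg x \<^bold>\<longrightarrow> star \<chi>) \<and> (\<not> sem (hd x) \<chi> \<longrightarrow> HA \<^bold>\<turnstile> sg x \<^bold>\<longrightarrow> Neg (star \<chi>))"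
proof (induction \<chi> arbitrary: x)
  case STop
  have "[sg x] \<tturnstile> Tru" by (rule nd_Tru)
  then show ?case by (simp add: nd_Cons nd_Nil)
next
  case (SVar p)
  show ?case
  proof (intro conjI impI)
    assume "sem (hd x) (SVar p)"
    then have "[sg x] \<tturnstile> Ap p"
      unfolding Ap_def by (intro nd_disjsI[OF _ nd_self]) (use SVar in auto)
    then show "HA \<^bold>\<turnstile> sg x \<^bold>\<longrightarrow> star (SVar p)" by (simp add: nd_Cons nd_Nil)
  next
    assume s: "\<not> sem (hd x) (SVar p)"
    have "[Ap p, sg x] \<tturnstile> Fls"
    proof (rule nd_disjsE)
      show "[Ap p, sg x] \<tturnstile> disjs (map sg (filter (\<lambda>x. p \<in> vrs (hd x)) nodes))"
        using nd_self unfolding Ap_def .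
    next
      fix B assume "B \<in> set (map sg (filter (\<lambda>x. p \<in> vrs (hd x)) nodes))"
      then obtain y where y: "B = sg y" "y \<in> set nodes" "p \<in> vrs (hd y)" by auto
      then have "[B, sg x] \<tturnstile> Fls" using sg_exclusive[OF SVar y(2)] s by auto
      then show "[B, Ap p, sg x] \<tturnstile> Fls" by (rule nd_weaken) auto
    qed
    then show "HA \<^bold>\<turnstile> sg x \<^bold>\<longrightarrow> Neg (star (SVar p))" by (simp add: nd_Cons nd_Nil)
  qed
next
  case (SAnd \<chi> \<psi>)
  show ?case
  proof (intro conjI impI)
    assume "sem (hd x) (SAnd \<chi> \<psi>)"
    then have "HA \<^bold>\<turnstile> sg x \<^bold>\<longrightarrow> star \<chi>" "HA \<^bold>\<turnstile> sg x \<^bold>\<longrightarrow> star \<psi>" using SAnd by auto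
    then have "[sg x] \<tturnstile> star \<chi> \<^bold>\<and> star \<psi>" by (intro nd_conjI) (simp_all add: nd_Cons nd_Nil)
    then show "HA \<^bold>\<turnstile> sg x \<^bold>\<longrightarrow> star (SAnd \<chi> \<psi>)" by (simp add: nd_Cons nd_Nil)
  next
    assume "\<not> sem (hd x) (SAnd \<chi> \<psi>)"
    then consider "HA \<^bold>\<turnstile> sg x \<^bold>\<longrightarrow> Neg (star \<chi>)" | "HA \<^bold>\<turnstile> sg x \<^bold>\<longrightarrow> Neg (star \<psi>)"
      using SAnd by auto
    then have "[star \<chi> \<^bold>\<and> star \<psi>, sg x] \<tturnstile> Fls" (is "?G \<tturnstile> _")
    proof cases
      case 1
      have "?G \<tturnstile> sg x" by (rule nd_asm) simp
      from nd_mp[OF nd_mp[OF nd_thm[OF 1] this] nd_conj1[OF nd_self]] show ?thesis .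
    next
      case 2
      have "?G \<tturnstile> sg x" by (rule nd_asm) simp
      from nd_mp[OF nd_mp[OF nd_thm[OF 2] this] nd_conj2[OF nd_self]] show ?thesis .
    qed
    then show "HA \<^bold>\<turnstile> sg x \<^bold>\<longrightarrow> Neg (star (SAnd \<chi> \<psi>))" by (simp add: nd_Cons nd_Nil)
  qed
next
  case (SDia \<chi>)
  show ?case
  proof (intro conjI impI)
    assume "sem (hd x) (SDia \<chi>)"
    then obtain y where y: "kid\<^sup>+\<^sup>+ x y" "sem (hd y) \<chi>" using acc_kid by force
    then have "y \<in> set nodes" using kid_nodes SDia(2) tranclp_into_rtranclp by metis
    then have "HA \<^bold>\<turnstile> sg y \<^bold>\<longrightarrow> star \<chi>" using SDia(1) y(2) by blast
    then have 1: "HA \<^bold>\<turnstile> sg x \<^bold>\<longrightarrow> Neg (Box (rs \<chi>) nbot)" by (rule sg_descendant[OF y(1) SDia(2)])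
    have "[Box (re \<chi>) nbot, sg x] \<tturnstile> Fls" (is "?G \<tturnstile> _")
    proof (rule nd_mp)
      have "?G \<tturnstile> sg x" by (rule nd_asm) simp
      then show "?G \<tturnstile> Neg (Box (rs \<chi>) nbot)" by (rule nd_mp[OF nd_thm[OF 1]])
      show "?G \<tturnstile> Box (rs \<chi>) nbot" by (rule nd_mp[OF nd_thm[OF Box_mono[OF realS_iff(2)[OF std]]] nd_self])
    qed
    then show "HA \<^bold>\<turnstile> sg x \<^bold>\<longrightarrow> star (SDia \<chi>)" by (simp add: Dia_def nd_Cons nd_Nil)
  next
    assume n: "\<not> sem (hd x) (SDia \<chi>)"
    \<comment> \<open>\<open>key_N\<close> asks about entering a child, the induction hypothesis
      about stopping at nodes; \<open>Esen_Neg\<close> connects the two.\<close>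
    have a: "HA \<^bold>\<turnstile> Esen y \<^bold>\<longrightarrow> Neg (star \<chi>)" if y: "y \<in> set (kids x)" for y
    proof (rule Esen_Neg)
      fix z assume z: "kid\<^sup>*\<^sup>* y z"
      have "kid\<^sup>+\<^sup>+ x z" using y z by (auto simp: kid_def intro: rtranclp_into_tranclp2)
      then have "\<not> sem (hd z) \<chi>" using n kid_acc by auto
      moreover have "z \<in> set nodes" using kid_nodes[OF z] nodes_kid[OF SDia(2) y] by blast
      ultimately show "HA \<^bold>\<turnstile> sg z \<^bold>\<longrightarrow> Neg (star \<chi>)" using SDia(1) by blast
    qed
    have h: "HA \<^bold>\<turnstile> Esen x \<^bold>\<longrightarrow> Box (rs \<chi>) nbot"
      by (rule needed_HA[OF needed.key_N[OF refutation_axioms SDia(2) a]])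
    have "[D \<chi>, sg x] \<tturnstile> Fls" (is "?G \<tturnstile> _")
    proof (rule nd_mp)
      show "?G \<tturnstile> Neg (Box (re \<chi>) nbot)" using nd_self unfolding Dia_def .
      have "?G \<tturnstile> sg x" by (rule nd_asm) simp
      then have "?G \<tturnstile> Esen x" unfolding sg_def by (rule nd_conj1)
      then show "?G \<tturnstile> Box (re \<chi>) nbot"
        by (rule nd_mp[OF nd_thm[OF Box_mono[OF realS_iff(1)[OF std]]] nd_mp[OF nd_thm[OF h]]])
    qed
    then show "HA \<^bold>\<turnstile> sg x \<^bold>\<longrightarrow> Neg (star (SDia \<chi>))" by (simp add: nd_Cons nd_Nil)
  qed
qed

text \<open>In the standard model the proof behind an entry is an actual one and its conclusion
  true, so every entered node has an entered child; the size of the formula at the end of the path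
  decreases each time.\<close>

lemma not_ent_nat: "x \<in> set nodes \<Longrightarrow> \<not> ent_node TYPE(nat) x"
proof (induction "size (hd x)" arbitrary: x rule: less_induct)
  case less
  show ?case
  proof
    assume e: "ent_node TYPE(nat) x"
    then have "bx haax (gf (NS x) :: nat)" using win_bx ent_win[OF less.prems] by blast
    then have "HA \<^bold>\<turnstile> NS x" by (rule bx_nat)
    from HA_sound[OF this, of "\<lambda>_. 0 :: nat"] e less.prems
    have "sat (\<lambda>_. 0 :: nat) (disjs (map Esen (kids x)))"
      by (simp add: NS_def sg_def sat_Esen del: sat_disjs)
    then obtain y where y: "y \<in> set (kids x)" "ent_node TYPE(nat) y"
      using sat_Esens[OF kids_nodes[OF less.prems]] by blast
    moreover have "size (hd y) < size (hd x)" using y(1) by (auto simp: kids_def size_dias)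
    ultimately show False using less.hyps nodes_kid[OF less.prems] by blast
  qed
qed

lemma holds_sem:
  assumes "holds \<phi> \<psi>" shows "sem \<phi> \<psi>"
proof (rule ccontr)
  assume n: "\<not> sem \<phi> \<psi>"
  have "bx (ext (rs \<phi>)) (gf (star \<psi>) :: nat)"
    by (rule holds_bx[OF assms fmf0_gf[OF closed_star] star_self])
  then have "bx haax (gf (star \<phi> \<^bold>\<longrightarrow> star \<psi>) :: nat)" by (simp add: star_iff)
  then have h: "HA \<^bold>\<turnstile> star \<phi> \<^bold>\<longrightarrow> star \<psi>" by (rule bx_nat)
  have p: "HA \<^bold>\<turnstile> sg [\<phi>] \<^bold>\<longrightarrow> star \<phi>" and m: "HA \<^bold>\<turnstile> sg [\<phi>] \<^bold>\<longrightarrow> Neg (star \<psi>)"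
    using sg_star[OF nodes_root] n sem_refl[of \<phi>] by auto
  have "[sg [\<phi>]] \<tturnstile> Fls"
    by (rule nd_mp[OF nd_mp[OF nd_thm[OF m] nd_self] nd_mp[OF nd_thm[OF h] nd_mp[OF nd_thm[OF p] nd_self]]])
  then have "HA \<^bold>\<turnstile> NS [\<phi>]" by (simp add: NS_def nd_Cons nd_Nil)
  then have "bx haax (gf (NS [\<phi>]) :: nat)" by (intro bx_HA)
  \<comment> \<open>The root competes with itself only, so a proof of its sentence makes it
    win.\<close>
  then have "win TYPE(nat) [\<phi>]" using win_exists[of "[\<phi>]" "[[\<phi>]]", where 'a = nat] by (simp add: sibs_def)
  then show False using not_ent_nat[OF nodes_root] ent_root by blast
qed

end

theorem theorem6p3:
  fixes \<eta> :: fm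
  assumes "standard_axiomatization_HA \<eta>"
  shows "(\<forall>\<phi> \<psi>. \<phi> \<turnstile>\<^sub>R\<^sub>C\<^sub>1 \<psi> \<longleftrightarrow>
      (\<forall>r. infinitary_realization r \<longrightarrow>
        HA \<^bold>\<turnstile> Uni (IsSent (Var 0) \<^bold>\<longrightarrow>
          Box (realize r \<eta> \<psi>) (Var 0) \<^bold>\<longrightarrow> Box (realize r \<eta> \<phi>) (Var 0))))
    \<and> RL_HA \<eta> = {(\<phi>, \<psi>). \<phi> \<turnstile>\<^sub>R\<^sub>C\<^sub>1 \<psi>}"
proof -
  have "\<phi> \<turnstile>\<^sub>R\<^sub>C\<^sub>1 \<psi> \<longleftrightarrow> (\<forall>r. infinitary_realization r \<longrightarrow> HA \<^bold>\<turnstile> Uni (IsSent (Var 0) \<^bold>\<longrightarrow>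
      Box (realize r \<eta> \<psi>) (Var 0) \<^bold>\<longrightarrow> Box (realize r \<eta> \<phi>) (Var 0)))" (is "_ \<longleftrightarrow> ?R") for \<phi> \<psi>
  proof
    assume p: "\<phi> \<turnstile>\<^sub>R\<^sub>C\<^sub>1 \<psi>"
    show ?R
    proof (intro allI impI)
      fix r assume "infinitary_realization r"
      then interpret realization r \<eta> using assms by unfold_locales
      from holds_rc1[OF p] show "HA \<^bold>\<turnstile> Uni (IsSent (Var 0) \<^bold>\<longrightarrow> Box (re \<psi>) (Var 0) \<^bold>\<longrightarrow> Box (re \<phi>) (Var 0))"
        unfolding holds_def .
    qed
  next
    assume R: ?R
    interpret refutation \<phi> \<eta> using assms by unfold_locales
    have "holds \<phi> \<psi>" unfolding holds_def using R infinitary_rp by blast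
    then show "\<phi> \<turnstile>\<^sub>R\<^sub>C\<^sub>1 \<psi>" by (intro sem_rc1 holds_sem)
  qed
  then show ?thesis by (simp add: RL_HA_def)
qed

end
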